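(* Let $R$ be a commutative domain. Suppose $(R,F)$ and $(R,F')$ are one-dimensional commutative formal group laws over the same ring $R$, with either $\kappa^F=0$ or $a_{11}$ invertible in $R$, where $a_{11}$ is the coefficient of $uv$ in $F(u,v)=u+v+\sum_{i,j\ge1}a_{ij}u^iv^j$. Then $$\mathbf{H}_F\otimes_{R_F[[\Lambda]]_F}R'_F[[\Lambda]]_F\;\cong\;\mathbf{H}_{F'}\otimes_{R_{F'}[[\Lambda]]_{F'}}R'_{F'}[[\Lambda]]_{F'}$$ as algebras, where $R'_F=(R\otimes_{\mathbb{Z}}\mathbb{Q})_F\otimes_{\mathbb{Q}}\mathbb{Q}[x_\gamma^{-1}]$, i.e. $(R\otimes_{\mathbb{Z}}\mathbb{Q})_F$ with $x_\gamma^{-1}$ adjoined (and similarly with $F$ replaced by $F'$).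
   Context: A one-dimensional commutative formal group law (FGL) $(R,F)$ is a commutative ring $R$ and $F\in R[[u,v]]$ with $F(u,0)=F(0,u)=u$, $F(u,v)=F(v,u)$, $F(u,F(v,w))=F(F(u,v),w)$; so $F(u,v)=u+v+\sum_{i,j\ge1}a_{ij}u^iv^j$. One writes $u+_Fv=F(u,v)$, $-_Fu$ for the formal inverse, and $\mu_F(u)=\frac{-_Fu}{-u}$. Formal group algebra: for an abelian group $\Lambda$, $R[[x_\Lambda]]$ is the completion of $R[x_\lambda\mid\lambda\in\Lambda]$ at the kernel of the augmentation $x_\lambda\mapsto 0$; $R[[\Lambda]]_F$ is its quotient by the closure of the ideal generated by $x_0$ and $x_{\lambda_1+\lambda_2}-(x_{\lambda_1}+_Fx_{\lambda_2})$, $\lambda_1,\lambda_2\in\Lambda$. A reduced root system $(\Lambda,\Phi,\varrho)$ is fixed (root datum in the sense of Demazure): a free $\mathbb{Z}$-module $\Lambda$ of finite rank, a finite set of roots $\Phi\subset\Lambda$, and a map $\varrho:\Phi\to\Lambda^\vee=\mathrm{Hom}_{\mathbb{Z}}(\Lambda,\mathbb{Z})$, $\alpha\mapsto\alpha^\vee$, satisfying the usual axioms. $W$ is the Weyl group generated by $s_\alpha(\lambda)=\lambda-\langle\alpha^\vee,\lambda\rangle\alpha$; $\{\alpha_i\}_{i\in I}$ are fixed simple roots, $s_i=s_{\alpha_i}$. $W$ acts on formal group algebras of $\Lambda$ by $w(x_\lambda)=x_{w(\lambda)}$. For $\alpha\in\Phi$, $\kappa^F_\alpha=\frac1{x_\alpha}+\frac1{x_{-\alpha}}$,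 which lies in the formal group algebra; $\kappa^F_i=\kappa^F_{\alpha_i}$. One writes $\kappa^F=0$ if $\kappa^F_\alpha=0$ for all $\alpha\in\Phi$ (equivalently for some $\alpha$), and $\kappa^F\ne0$ otherwise. Let $\Gamma$ be a free abelian group of rank 1 with generator $\gamma$; for a coefficient ring $R$ put $R_F:=R[[\Gamma]]_F$ (so $x_\gamma\in R_F$ and $R_F\cong R[[x_\gamma]]$); $W$ acts trivially on $R_F$. $R_F[[\Lambda]]_F$ and $R'_F[[\Lambda]]_F$ are the formal group algebras of $\Lambda$ with coefficient rings $R_F$ and $R'_F$. $Q'$ is the subring of the fraction field of $R_F[[\Lambda]]_F$ generated by $R_F[[\Lambda]]_F$, $\{x_\lambda^{-1}\mid\lambda\in\Lambda\setminus\{0\}\}$ and $\{(\kappa^F_\alpha)^{-1}\mid\alpha\in\Phi,\ \kappa_\alpha^F\ne0\}$. $Q_W'$ is $R_F[W]\otimes_{R_F}Q'$ with multiplication $(\delta_{w'}\psi')(\delta_w\psi)=\delta_{w'w}w^{-1}(\psi')\psi$ for $w,w'\in W$, $\psi,\psi'\in Q'$, where $\delta_w$ is the element of $R_F[W]$ corresponding to $w$; $\delta_i=\delta_{s_i}$. Put $X_i=\frac1{x_{\alpha_i}}(1-\delta_i)\in Q'_W$, $\Theta_F=\mu_F(x_\gamma)-\mu_F(x_{-\gamma})$, and $$T_i^F=\begin{cases}X_i\frac{\Theta_F}{\kappa^F_i}+\delta_i\mu_F(x_\gamma)&\text{if }\kappa^F\neq0,\\ 2X_ix_\gamma+\delta_i&\text{if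 }\kappa^F=0.\end{cases}$$ $R_F[[\Lambda]]_F^\kappa$ is $R_F[[\Lambda]]_F[(\kappa_\alpha^F)^{-1}\mid\alpha\in\Phi]$ if $\kappa^F\ne0$ and $R_F[[\Lambda]]_F$ if $\kappa^F=0$ (if $a_{11}$ is invertible all $\kappa_\alpha^F$ are already invertible in $R_F[[\Lambda]]_F$, so the two rings agree). The formal affine Hecke algebra $\mathbf{H}_F$ is the $R_F$-subalgebra of $Q_W'$ generated by all $T_i^F$, $i\in I$, and $R_F[[\Lambda]]_F^\kappa$. The tensor product $\mathbf{H}_F\otimes_{R_F[[\Lambda]]_F}R'_F[[\Lambda]]_F$ is the algebra obtained by extending coefficients, i.e. the algebra generated by $R'_F[[\Lambda]]_F$ together with the generators of $\mathbf{H}_F$ inside the corresponding twisted formal group algebra over $R'_F$. All of these objects are defined in the same way for $F'$.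
   Formalization: The condition "κ=0 or a_11 invertible in R" is required of F' as well as of F; with the condition on F alone the claim fails, e.g. R=Q, Λ of rank one, F additive and F' with logarithm x+x^4. *)

theory Defs
  imports "HOL-Algebra.Generated_Rings" "HOL-Algebra.Generated_Groups" "HOL-Algebra.Bij"
    "HOL-Library.Multiset"
begin

section \<open>Power series in arbitrarily many variables\<close>

text \<open>
  The completion of \<open>R[x\<^sub>v | v :: 'v]\<close> at the kernel \<open>I\<close> of the augmentation \<open>x\<^sub>v \<mapsto> 0\<close>. As in
  HOL-Algebra's indexed polynomials, a monomial is a multiset of variables. An element of
  \<open>lim R[x\<^sub>v]/I^n\<close> is a formal sum over \<open>n\<close> of homogeneous polynomials of degree \<open>n\<close>; hence the
  requirement that only finitely many monomials of each degree occur, which matters when there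
  are infinitely many variables.
\<close>

definition pser :: "('r, 'm) ring_scheme \<Rightarrow> ('v multiset \<Rightarrow> 'r) ring" where
  "pser R =
    \<lparr>carrier = {f. (\<forall>m. f m \<in> carrier R) \<and> (\<forall>n. finite {m. size m = n \<and> f m \<noteq> \<zero>\<^bsub>R\<^esub>})},
     monoid.mult = (\<lambda>f g m. \<Oplus>\<^bsub>R\<^esub>k\<in>{k. k \<subseteq># m}. f k \<otimes>\<^bsub>R\<^esub> g (m - k)),
     one = (\<lambda>m. if m = {#} then \<one>\<^bsub>R\<^esub> else \<zero>\<^bsub>R\<^esub>),
     zero = (\<lambda>m. \<zero>\<^bsub>R\<^esub>),
     add = (\<lambda>f g m. f m \<oplus>\<^bsub>R\<^esub> g m)\<rparr>"

definition pser_const :: "('r, 'm) ring_scheme \<Rightarrow> 'r \<Rightarrow> 'v multiset \<Rightarrow> 'r" where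
  "pser_const R a = (\<lambda>m. if m = {#} then a else \<zero>\<^bsub>R\<^esub>)"

definition pser_var :: "('r, 'm) ring_scheme \<Rightarrow> 'v \<Rightarrow> 'v multiset \<Rightarrow> 'r" where
  "pser_var R v = (\<lambda>m. if m = {#v#} then \<one>\<^bsub>R\<^esub> else \<zero>\<^bsub>R\<^esub>)"

text \<open>Closure in the topology of the completion: \<open>g\<close> approximates \<open>f\<close> up to degree \<open>n\<close>.\<close>

definition pser_closure ::
  "('r, 'm) ring_scheme \<Rightarrow> ('v multiset \<Rightarrow> 'r) set \<Rightarrow> ('v multiset \<Rightarrow> 'r) set" where
  "pser_closure R J =
    {f \<in> carrier (pser R). \<forall>n. \<exists>g\<in>J. \<forall>m. size m < n \<longrightarrow> f m = g m}"

text \<open>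
  Substitution into a power series in one variable (given by its coefficients \<open>c k\<close>) and in two
  variables (given by its coefficients \<open>F i j\<close> of \<open>u^i v^j\<close>). These are meaningful only for \<open>f\<close>
  and \<open>g\<close> without constant term: then \<open>f^i g^j\<close> has no monomials of degree below \<open>i + j\<close>, and
  so the sums may be truncated at the degree of the monomial whose coefficient is computed.
\<close>

definition pser_subst1 ::
  "('r, 'm) ring_scheme \<Rightarrow> (nat \<Rightarrow> 'r) \<Rightarrow> ('v multiset \<Rightarrow> 'r) \<Rightarrow> 'v multiset \<Rightarrow> 'r" where
  "pser_subst1 R c f = (\<lambda>m. \<Oplus>\<^bsub>R\<^esub>k\<in>{..size m}. c k \<otimes>\<^bsub>R\<^esub> (f [^]\<^bsub>pser R\<^esub> k) m)"

definition pser_subst2 ::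
  "('r, 'm) ring_scheme \<Rightarrow> (nat \<Rightarrow> nat \<Rightarrow> 'r) \<Rightarrow>
    ('v multiset \<Rightarrow> 'r) \<Rightarrow> ('v multiset \<Rightarrow> 'r) \<Rightarrow> 'v multiset \<Rightarrow> 'r" where
  "pser_subst2 R F f g =
    (\<lambda>m. \<Oplus>\<^bsub>R\<^esub>p\<in>{(i, j). i + j \<le> size m}.
      F (fst p) (snd p) \<otimes>\<^bsub>R\<^esub> (f [^]\<^bsub>pser R\<^esub> fst p \<otimes>\<^bsub>pser R\<^esub> g [^]\<^bsub>pser R\<^esub> snd p) m)"


section \<open>Formal group laws\<close>

definition formal_group_law :: "('r, 'm) ring_scheme \<Rightarrow> (nat \<Rightarrow> nat \<Rightarrow> 'r) \<Rightarrow> bool" where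
  "formal_group_law R F \<longleftrightarrow>
    (\<forall>i j. F i j \<in> carrier R) \<and>
    (let u = pser_var R (0::nat); v = pser_var R 1; w = pser_var R 2; z = \<zero>\<^bsub>pser R\<^esub> in
      pser_subst2 R F u z = u \<and>
      pser_subst2 R F z u = u \<and>
      pser_subst2 R F u v = pser_subst2 R F v u \<and>
      pser_subst2 R F u (pser_subst2 R F v w) = pser_subst2 R F (pser_subst2 R F u v) w)"

definition fgl_inverse :: "('r, 'm) ring_scheme \<Rightarrow> (nat \<Rightarrow> nat \<Rightarrow> 'r) \<Rightarrow> unit multiset \<Rightarrow> 'r" where
  "fgl_inverse R F =
    (THE g. g \<in> carrier (pser R) \<and> g {#} = \<zero>\<^bsub>R\<^esub> \<and>
      pser_subst2 R F (pser_var R ()) g = \<zero>\<^bsub>pser R\<^esub>)"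

text \<open>The coefficients of \<open>\<mu>(u)\<close>, the quotient of the formal inverse of \<open>u\<close> by \<open>-u\<close>.\<close>

definition fgl_mu :: "('r, 'm) ring_scheme \<Rightarrow> (nat \<Rightarrow> nat \<Rightarrow> 'r) \<Rightarrow> nat \<Rightarrow> 'r" where
  "fgl_mu R F k = \<ominus>\<^bsub>R\<^esub> fgl_inverse R F (replicate_mset (Suc k) ())"


section \<open>Formal group algebras\<close>

text \<open>The abelian group is the type \<open>'l\<close>.\<close>

definition fga_ideal ::
  "('r, 'm) ring_scheme \<Rightarrow> (nat \<Rightarrow> nat \<Rightarrow> 'r) \<Rightarrow> ('l::ab_group_add multiset \<Rightarrow> 'r) set" where
  "fga_ideal R F =
    pser_closure R (Idl\<^bsub>pser R\<^esub>
      (insert (pser_var R 0)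
        {pser_var R (l1 + l2) \<ominus>\<^bsub>pser R\<^esub> pser_subst2 R F (pser_var R l1) (pser_var R l2)
          | l1 l2. True}))"

definition fga ::
  "('r, 'm) ring_scheme \<Rightarrow> (nat \<Rightarrow> nat \<Rightarrow> 'r) \<Rightarrow> ('l::ab_group_add multiset \<Rightarrow> 'r) set ring" where
  "fga R F = pser R Quot fga_ideal R F"

definition fga_class ::
  "('r, 'm) ring_scheme \<Rightarrow> (nat \<Rightarrow> nat \<Rightarrow> 'r) \<Rightarrow>
    ('l::ab_group_add multiset \<Rightarrow> 'r) \<Rightarrow> ('l multiset \<Rightarrow> 'r) set" where
  "fga_class R F f = fga_ideal R F +>\<^bsub>pser R\<^esub> f"

definition fga_const ::
  "('r, 'm) ring_scheme \<Rightarrow> (nat \<Rightarrow> nat \<Rightarrow> 'r) \<Rightarrow> 'r \<Rightarrow> ('l::ab_group_add multiset \<Rightarrow> 'r) set" where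
  "fga_const R F a = fga_class R F (pser_const R a)"

definition fga_x ::
  "('r, 'm) ring_scheme \<Rightarrow> (nat \<Rightarrow> nat \<Rightarrow> 'r) \<Rightarrow> 'l::ab_group_add \<Rightarrow> ('l multiset \<Rightarrow> 'r) set" where
  "fga_x R F l = fga_class R F (pser_var R l)"

text \<open>\<open>\<mu>(x\<^sub>l)\<close>\<close>

definition fga_mu ::
  "('r, 'm) ring_scheme \<Rightarrow> (nat \<Rightarrow> nat \<Rightarrow> 'r) \<Rightarrow> 'l::ab_group_add \<Rightarrow> ('l multiset \<Rightarrow> 'r) set" where
  "fga_mu R F l = fga_class R F (pser_subst1 R (fgl_mu R F) (pser_var R l))"

text \<open>
  The action \<open>x\<^sub>l \<mapsto> x\<^bsub>w l\<^esub>\<close> of a group automorphism \<open>w\<close>. On power series it renames the variables;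
  the defining ideal is stable, so that the image of a coset is a coset.
\<close>

definition pser_act :: "('l \<Rightarrow> 'l) \<Rightarrow> ('l multiset \<Rightarrow> 'r) \<Rightarrow> 'l multiset \<Rightarrow> 'r" where
  "pser_act w f = (\<lambda>m. f (image_mset (inv_into UNIV w) m))"

definition fga_act :: "('l \<Rightarrow> 'l) \<Rightarrow> ('l multiset \<Rightarrow> 'r) set \<Rightarrow> ('l multiset \<Rightarrow> 'r) set" where
  "fga_act w X = pser_act w ` X"


section \<open>Rings of fractions\<close>

text \<open>\<open>S\<close> is a multiplicative subset of the commutative ring \<open>A\<close>; fractions are classes of pairs.\<close>

definition frac_rel :: "('a, 'm) ring_scheme \<Rightarrow> 'a set \<Rightarrow> (('a \<times> 'a) \<times> ('a \<times> 'a)) set" where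
  "frac_rel A S =
    {((a, s), (b, t)). a \<in> carrier A \<and> s \<in> S \<and> b \<in> carrier A \<and> t \<in> S \<and>
      (\<exists>u\<in>S. u \<otimes>\<^bsub>A\<^esub> (a \<otimes>\<^bsub>A\<^esub> t) = u \<otimes>\<^bsub>A\<^esub> (b \<otimes>\<^bsub>A\<^esub> s))}"

definition frac_of :: "('a, 'm) ring_scheme \<Rightarrow> 'a set \<Rightarrow> 'a \<Rightarrow> 'a \<Rightarrow> ('a \<times> 'a) set" where
  "frac_of A S a s = frac_rel A S `` {(a, s)}"

definition localization :: "('a, 'm) ring_scheme \<Rightarrow> 'a set \<Rightarrow> ('a \<times> 'a) set ring" where
  "localization A S =
    \<lparr>carrier = (carrier A \<times> S) // frac_rel A S,
     monoid.mult = (\<lambda>X Y. \<Union>(a, s)\<in>X. \<Union>(b, t)\<in>Y. frac_of A S (a \<otimes>\<^bsub>A\<^esub> b) (s \<otimes>\<^bsub>A\<^esub> t)),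
     one = frac_of A S \<one>\<^bsub>A\<^esub> \<one>\<^bsub>A\<^esub>,
     zero = frac_of A S \<zero>\<^bsub>A\<^esub> \<one>\<^bsub>A\<^esub>,
     add = (\<lambda>X Y. \<Union>(a, s)\<in>X. \<Union>(b, t)\<in>Y.
       frac_of A S (a \<otimes>\<^bsub>A\<^esub> t \<oplus>\<^bsub>A\<^esub> b \<otimes>\<^bsub>A\<^esub> s) (s \<otimes>\<^bsub>A\<^esub> t))\<rparr>"

definition loc_emb :: "('a, 'm) ring_scheme \<Rightarrow> 'a set \<Rightarrow> 'a \<Rightarrow> ('a \<times> 'a) set" where
  "loc_emb A S a = frac_of A S a \<one>\<^bsub>A\<^esub>"

definition regular_elements :: "('a, 'm) ring_scheme \<Rightarrow> 'a set" where
  "regular_elements A = {s \<in> carrier A. \<forall>a\<in>carrier A. s \<otimes>\<^bsub>A\<^esub> a = \<zero>\<^bsub>A\<^esub> \<longrightarrow> a = \<zero>\<^bsub>A\<^esub>}"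

text \<open>
  The total ring of fractions: for a domain, its fraction field. It also makes sense for the zero
  ring, which is needed since \<open>R \<otimes> \<rat> = 0\<close> for a domain \<open>R\<close> of positive characteristic.
\<close>

definition tfrac :: "('a, 'm) ring_scheme \<Rightarrow> ('a \<times> 'a) set ring" where
  "tfrac A = localization A (regular_elements A)"

definition tfrac_emb :: "('a, 'm) ring_scheme \<Rightarrow> 'a \<Rightarrow> ('a \<times> 'a) set" where
  "tfrac_emb A = loc_emb A (regular_elements A)"

definition tfrac_map :: "('a, 'm) ring_scheme \<Rightarrow> ('a \<Rightarrow> 'a) \<Rightarrow> ('a \<times> 'a) set \<Rightarrow> ('a \<times> 'a) set" where
  "tfrac_map A h X = (\<Union>(a, s)\<in>X. frac_of A (regular_elements A) (h a) (h s))"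

text \<open>\<open>R \<otimes>\<^sub>\<int> \<rat>\<close>, as the ring of fractions of \<open>R\<close> whose denominators are nonzero integers.\<close>

definition integer_denoms :: "('r, 'm) ring_scheme \<Rightarrow> 'r set" where
  "integer_denoms R = {[k] \<cdot>\<^bsub>R\<^esub> \<one>\<^bsub>R\<^esub> | k :: int. k \<noteq> 0}"

definition rationalization :: "('r, 'm) ring_scheme \<Rightarrow> ('r \<times> 'r) set ring" where
  "rationalization R = localization R (integer_denoms R)"

definition rat_fgl :: "('r, 'm) ring_scheme \<Rightarrow> (nat \<Rightarrow> nat \<Rightarrow> 'r) \<Rightarrow> nat \<Rightarrow> nat \<Rightarrow> ('r \<times> 'r) set" where
  "rat_fgl R F = (\<lambda>i j. loc_emb R (integer_denoms R) (F i j))"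


section \<open>Root data and Weyl groups\<close>

text \<open>
  A free \<open>\<int>\<close>-module \<open>'l\<close> of finite rank (\<open>scale\<close> is its \<open>\<int>\<close>-action) with a reduced root system.
  The axioms \<open>refl_root\<close> and \<open>refl_coroot\<close> say that reflections in roots preserve the set of
  roots, and that their transposes preserve the set of coroots.
\<close>

locale root_datum = Modules.module scale
  for scale :: "int \<Rightarrow> 'l::ab_group_add \<Rightarrow> 'l" +
  fixes \<Phi> :: "'l set" and coroot :: "'l \<Rightarrow> 'l \<Rightarrow> int"
  assumes free: "\<exists>B. finite B \<and> independent B \<and> span B = UNIV"
    and finite_roots: "finite \<Phi>"
    and coroot_hom: "\<And>\<alpha>. \<alpha> \<in> \<Phi> \<Longrightarrow> Modules.module_hom scale (*) (coroot \<alpha>)"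
    and coroot_root: "\<And>\<alpha>. \<alpha> \<in> \<Phi> \<Longrightarrow> coroot \<alpha> \<alpha> = 2"
    and refl_root: "\<And>\<alpha> \<beta>. \<alpha> \<in> \<Phi> \<Longrightarrow> \<beta> \<in> \<Phi> \<Longrightarrow> \<beta> - scale (coroot \<alpha> \<beta>) \<alpha> \<in> \<Phi>"
    and refl_coroot: "\<And>\<alpha> \<beta>. \<alpha> \<in> \<Phi> \<Longrightarrow> \<beta> \<in> \<Phi> \<Longrightarrow>
      \<exists>\<beta>'\<in>\<Phi>. coroot \<beta>' = (\<lambda>l. coroot \<beta> l - coroot \<beta> \<alpha> * coroot \<alpha> l)"
    and reduced: "\<And>\<alpha>. \<alpha> \<in> \<Phi> \<Longrightarrow> scale 2 \<alpha> \<notin> \<Phi>"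

text \<open>\<open>\<Delta>\<close> is a set of simple roots.\<close>

locale based_root_datum = root_datum scale \<Phi> coroot
  for scale :: "int \<Rightarrow> 'l::ab_group_add \<Rightarrow> 'l" and \<Phi> :: "'l set" and coroot :: "'l \<Rightarrow> 'l \<Rightarrow> int" +
  fixes \<Delta> :: "'l set"
  assumes simple_subset: "\<Delta> \<subseteq> \<Phi>"
    and simple_independent: "independent \<Delta>"
    and simple_generate: "\<And>\<beta>. \<beta> \<in> \<Phi> \<Longrightarrow>
      \<exists>c. ((\<forall>\<alpha>\<in>\<Delta>. 0 \<le> c \<alpha>) \<or> (\<forall>\<alpha>\<in>\<Delta>. c \<alpha> \<le> 0)) \<and> \<beta> = (\<Sum>\<alpha>\<in>\<Delta>. scale (c \<alpha>) \<alpha>)"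

definition reflection ::
  "(int \<Rightarrow> 'l::ab_group_add \<Rightarrow> 'l) \<Rightarrow> ('l \<Rightarrow> 'l \<Rightarrow> int) \<Rightarrow> 'l \<Rightarrow> 'l \<Rightarrow> 'l" where
  "reflection scale coroot \<alpha> = (\<lambda>l. l - scale (coroot \<alpha> l) \<alpha>)"

definition weyl_group ::
  "(int \<Rightarrow> 'l::ab_group_add \<Rightarrow> 'l) \<Rightarrow> 'l set \<Rightarrow> ('l \<Rightarrow> 'l \<Rightarrow> int) \<Rightarrow> ('l \<Rightarrow> 'l) set" where
  "weyl_group scale \<Phi> coroot = generate (BijGroup UNIV) (reflection scale coroot ` \<Phi>)"


section \<open>The ring \<open>Q'\<close>\<close>

definition kappa ::
  "('r, 'm) ring_scheme \<Rightarrow> (nat \<Rightarrow> nat \<Rightarrow> 'r) \<Rightarrow> 'l::ab_group_add \<Rightarrow>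
    (('l multiset \<Rightarrow> 'r) set \<times> ('l multiset \<Rightarrow> 'r) set) set" where
  "kappa C F \<alpha> =
    (let Q = tfrac (fga C F); x = (\<lambda>l. tfrac_emb (fga C F) (fga_x C F l))
     in inv\<^bsub>Q\<^esub> x \<alpha> \<oplus>\<^bsub>Q\<^esub> inv\<^bsub>Q\<^esub> x (- \<alpha>))"

definition kappa_zero ::
  "('r, 'm) ring_scheme \<Rightarrow> (nat \<Rightarrow> nat \<Rightarrow> 'r) \<Rightarrow> 'l::ab_group_add set \<Rightarrow> bool" where
  "kappa_zero C F \<Phi> \<longleftrightarrow>
    (\<forall>\<alpha>\<in>\<Phi>. kappa C F \<alpha> = \<zero>\<^bsub>tfrac (fga C F :: ('l multiset \<Rightarrow> 'r) set ring)\<^esub>)"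

definition kappa_inverses ::
  "('r, 'm) ring_scheme \<Rightarrow> (nat \<Rightarrow> nat \<Rightarrow> 'r) \<Rightarrow> 'l::ab_group_add set \<Rightarrow>
    (('l multiset \<Rightarrow> 'r) set \<times> ('l multiset \<Rightarrow> 'r) set) set set" where
  "kappa_inverses C F \<Phi> =
    (let Q = tfrac (fga C F)
     in {y \<in> carrier Q. \<exists>\<alpha>\<in>\<Phi>. kappa C F \<alpha> \<noteq> \<zero>\<^bsub>Q\<^esub> \<and> kappa C F \<alpha> \<otimes>\<^bsub>Q\<^esub> y = \<one>\<^bsub>Q\<^esub>})"

definition Q_prime ::
  "('r, 'm) ring_scheme \<Rightarrow> (nat \<Rightarrow> nat \<Rightarrow> 'r) \<Rightarrow> 'l::ab_group_add set \<Rightarrow>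
    (('l multiset \<Rightarrow> 'r) set \<times> ('l multiset \<Rightarrow> 'r) set) set ring" where
  "Q_prime C F \<Phi> =
    (let A = fga C F; Q = tfrac A
     in Q\<lparr>carrier := generate_ring Q
          (tfrac_emb A ` carrier A \<union>
           {y \<in> carrier Q. \<exists>l. l \<noteq> 0 \<and> tfrac_emb A (fga_x C F l) \<otimes>\<^bsub>Q\<^esub> y = \<one>\<^bsub>Q\<^esub>} \<union>
           kappa_inverses C F \<Phi>)\<rparr>)"

definition fga_kappa ::
  "('r, 'm) ring_scheme \<Rightarrow> (nat \<Rightarrow> nat \<Rightarrow> 'r) \<Rightarrow> 'l::ab_group_add set \<Rightarrow>
    (('l multiset \<Rightarrow> 'r) set \<times> ('l multiset \<Rightarrow> 'r) set) set set" where
  "fga_kappa C F \<Phi> =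
    (let A = fga C F
     in if kappa_zero C F \<Phi> then tfrac_emb A ` carrier A
        else generate_ring (tfrac A) (tfrac_emb A ` carrier A \<union> kappa_inverses C F \<Phi>))"


section \<open>Twisted group algebras\<close>

text \<open>
  \<open>C[W] \<otimes>\<^sub>C P\<close> is the free right \<open>P\<close>-module on the \<open>\<delta>\<^sub>w\<close>: its element \<open>\<Sum>\<^sub>w \<delta>\<^sub>w \<psi>\<^sub>w\<close> is the finitely
  supported function \<open>w \<mapsto> \<psi>\<^sub>w\<close> on \<open>W\<close>, and \<open>(\<delta>\<^bsub>w'\<^esub> \<psi>') (\<delta>\<^sub>w \<psi>) = \<delta>\<^bsub>w'w\<^esub> w\<^sup>-\<^sup>1(\<psi>') \<psi>\<close>.
\<close>

definition twisted_group_ring ::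
  "('p, 'm) ring_scheme \<Rightarrow> ('l \<Rightarrow> 'l) set \<Rightarrow> (('l \<Rightarrow> 'l) \<Rightarrow> 'p \<Rightarrow> 'p) \<Rightarrow> (('l \<Rightarrow> 'l) \<Rightarrow> 'p) ring" where
  "twisted_group_ring P W act =
    \<lparr>carrier = {f \<in> W \<rightarrow>\<^sub>E carrier P. finite {w \<in> W. f w \<noteq> \<zero>\<^bsub>P\<^esub>}},
     monoid.mult = (\<lambda>f g. \<lambda>v\<in>W. \<Oplus>\<^bsub>P\<^esub>w\<in>{w \<in> W. g w \<noteq> \<zero>\<^bsub>P\<^esub>}.
       act (inv_into UNIV w) (f (v \<circ> inv_into UNIV w)) \<otimes>\<^bsub>P\<^esub> g w),
     one = (\<lambda>w\<in>W. if w = id then \<one>\<^bsub>P\<^esub> else \<zero>\<^bsub>P\<^esub>),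
     zero = (\<lambda>w\<in>W. \<zero>\<^bsub>P\<^esub>),
     add = (\<lambda>f g. \<lambda>w\<in>W. f w \<oplus>\<^bsub>P\<^esub> g w)\<rparr>"

text \<open>\<open>\<delta>\<^sub>w \<psi>\<close>\<close>

definition twisted_monom ::
  "('p, 'm) ring_scheme \<Rightarrow> ('l \<Rightarrow> 'l) set \<Rightarrow> ('l \<Rightarrow> 'l) \<Rightarrow> 'p \<Rightarrow> ('l \<Rightarrow> 'l) \<Rightarrow> 'p" where
  "twisted_monom P W w \<psi> = (\<lambda>v\<in>W. if v = w then \<psi> else \<zero>\<^bsub>P\<^esub>)"


section \<open>Formal affine Hecke algebras\<close>

text \<open>
  The rank one free abelian group with generator \<open>\<gamma>\<close> is \<open>int\<close> with \<open>\<gamma> = 1\<close>, so that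
  \<open>K\<^sub>F = K[[\<Gamma>]]\<^sub>F\<close> is the following ring.
\<close>

abbreviation gamma_ring ::
  "('k, 'm) ring_scheme \<Rightarrow> (nat \<Rightarrow> nat \<Rightarrow> 'k) \<Rightarrow> (int multiset \<Rightarrow> 'k) set ring" where
  "gamma_ring K F \<equiv> fga K F"

text \<open>
  In the following constructions \<open>F\<close> is a formal group law over \<open>K\<close>, and \<open>C\<close> is a coefficient
  ring over \<open>K\<^sub>F\<close>, with structure map \<open>j\<close>. For \<open>C = K\<^sub>F\<close> and \<open>j = id\<close> they give \<open>Q'\<^sub>W\<close>, \<open>T\<^sub>\<alpha>\<close> and \<open>H\<^sub>F\<close>
  over \<open>K\<close>; for other \<open>C\<close> they give the extension of coefficients of these to \<open>C\<close>.
\<close>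

definition coeff_fgl ::
  "('k, 'm) ring_scheme \<Rightarrow> (nat \<Rightarrow> nat \<Rightarrow> 'k) \<Rightarrow> ((int multiset \<Rightarrow> 'k) set \<Rightarrow> 'c) \<Rightarrow>
    nat \<Rightarrow> nat \<Rightarrow> 'c" where
  "coeff_fgl K F j = (\<lambda>a b. j (fga_const K F (F a b)))"

definition twisted_fga ::
  "('r, 'm) ring_scheme \<Rightarrow> (nat \<Rightarrow> nat \<Rightarrow> 'r) \<Rightarrow>
    (int \<Rightarrow> 'l::ab_group_add \<Rightarrow> 'l) \<Rightarrow> 'l set \<Rightarrow> ('l \<Rightarrow> 'l \<Rightarrow> int) \<Rightarrow>
    (('l \<Rightarrow> 'l) \<Rightarrow> (('l multiset \<Rightarrow> 'r) set \<times> ('l multiset \<Rightarrow> 'r) set) set) ring" where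
  "twisted_fga C G scale \<Phi> coroot =
    twisted_group_ring (Q_prime C G \<Phi>) (weyl_group scale \<Phi> coroot)
      (\<lambda>w. tfrac_map (fga C G) (fga_act w))"

definition demazure_lusztig ::
  "('k, 'm) ring_scheme \<Rightarrow> (nat \<Rightarrow> nat \<Rightarrow> 'k) \<Rightarrow>
    ('c, 'n) ring_scheme \<Rightarrow> ((int multiset \<Rightarrow> 'k) set \<Rightarrow> 'c) \<Rightarrow>
    (int \<Rightarrow> 'l::ab_group_add \<Rightarrow> 'l) \<Rightarrow> 'l set \<Rightarrow> ('l \<Rightarrow> 'l \<Rightarrow> int) \<Rightarrow> 'l \<Rightarrow>
    ('l \<Rightarrow> 'l) \<Rightarrow> (('l multiset \<Rightarrow> 'c) set \<times> ('l multiset \<Rightarrow> 'c) set) set" where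
  "demazure_lusztig K F C j scale \<Phi> coroot \<alpha> =
    (let
      G = coeff_fgl K F j;
      A = fga C G;
      Q = Q_prime C G \<Phi>;
      W = weyl_group scale \<Phi> coroot;
      QW = twisted_fga C G scale \<Phi> coroot;
      emb = (\<lambda>\<psi>. twisted_monom Q W id \<psi>);
      \<delta> = twisted_monom Q W (reflection scale coroot \<alpha>) \<one>\<^bsub>Q\<^esub>;
      X = emb (inv\<^bsub>Q\<^esub> (tfrac_emb A (fga_x C G \<alpha>))) \<otimes>\<^bsub>QW\<^esub> (\<one>\<^bsub>QW\<^esub> \<ominus>\<^bsub>QW\<^esub> \<delta>);
      coeff = (\<lambda>r. tfrac_emb A (fga_const C G (j r)));
      x\<gamma> = fga_x K F (1::int);
      \<mu> = fga_mu K F (1::int);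
      \<Theta> = fga_mu K F (1::int) \<ominus>\<^bsub>gamma_ring K F\<^esub> fga_mu K F (- 1)
    in
      if kappa_zero C G \<Phi>
      then [(2::nat)] \<cdot>\<^bsub>QW\<^esub> (X \<otimes>\<^bsub>QW\<^esub> emb (coeff x\<gamma>)) \<oplus>\<^bsub>QW\<^esub> \<delta>
      else X \<otimes>\<^bsub>QW\<^esub> emb (coeff \<Theta> \<otimes>\<^bsub>Q\<^esub> inv\<^bsub>Q\<^esub> (kappa C G \<alpha>)) \<oplus>\<^bsub>QW\<^esub> \<delta> \<otimes>\<^bsub>QW\<^esub> emb (coeff \<mu>))"

text \<open>The generated subring contains \<open>C\<close>, so that it is the generated \<open>C\<close>-subalgebra.\<close>

definition affine_hecke ::
  "('k, 'm) ring_scheme \<Rightarrow> (nat \<Rightarrow> nat \<Rightarrow> 'k) \<Rightarrow>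
    ('c, 'n) ring_scheme \<Rightarrow> ((int multiset \<Rightarrow> 'k) set \<Rightarrow> 'c) \<Rightarrow>
    (int \<Rightarrow> 'l::ab_group_add \<Rightarrow> 'l) \<Rightarrow> 'l set \<Rightarrow> ('l \<Rightarrow> 'l \<Rightarrow> int) \<Rightarrow> 'l set \<Rightarrow>
    (('l \<Rightarrow> 'l) \<Rightarrow> (('l multiset \<Rightarrow> 'c) set \<times> ('l multiset \<Rightarrow> 'c) set) set) ring" where
  "affine_hecke K F C j scale \<Phi> coroot \<Delta> =
    (let
      G = coeff_fgl K F j;
      QW = twisted_fga C G scale \<Phi> coroot
    in
      QW\<lparr>carrier := generate_ring QW
        (twisted_monom (Q_prime C G \<Phi>) (weyl_group scale \<Phi> coroot) id ` fga_kappa C G \<Phi> \<union>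
         demazure_lusztig K F C j scale \<Phi> coroot ` \<Delta>)\<rparr>)"

definition affine_hecke_const ::
  "('k, 'm) ring_scheme \<Rightarrow> (nat \<Rightarrow> nat \<Rightarrow> 'k) \<Rightarrow>
    ('c, 'n) ring_scheme \<Rightarrow> ((int multiset \<Rightarrow> 'k) set \<Rightarrow> 'c) \<Rightarrow>
    (int \<Rightarrow> 'l::ab_group_add \<Rightarrow> 'l) \<Rightarrow> 'l set \<Rightarrow> ('l \<Rightarrow> 'l \<Rightarrow> int) \<Rightarrow> 'k \<Rightarrow>
    ('l \<Rightarrow> 'l) \<Rightarrow> (('l multiset \<Rightarrow> 'c) set \<times> ('l multiset \<Rightarrow> 'c) set) set" where
  "affine_hecke_const K F C j scale \<Phi> coroot a =
    (let G = coeff_fgl K F j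
     in twisted_monom (Q_prime C G \<Phi>) (weyl_group scale \<Phi> coroot) id
          (tfrac_emb (fga C G) (fga_const C G (j (fga_const K F a)))))"

text \<open>
  \<open>R'\<^sub>F\<close>, the ring \<open>(R \<otimes> \<rat>)\<^sub>F\<close> with \<open>x\<^sub>\<gamma>\<^sup>-\<^sup>1\<close> adjoined, and the algebra \<open>H\<^sub>F\<close> with coefficients extended
  to it. The distinction whether \<open>\<kappa>\<close> vanishes is made in \<open>R'\<^sub>F[[\<Lambda>]]\<^sub>F\<close>: if \<open>R\<close> has characteristic
  zero, then this ring contains \<open>R\<^sub>F[[\<Lambda>]]\<^sub>F\<close>, and otherwise it is zero, as is the extended algebra.
\<close>

definition gamma_powers :: "('k, 'm) ring_scheme \<Rightarrow> (nat \<Rightarrow> nat \<Rightarrow> 'k) \<Rightarrow> (int multiset \<Rightarrow> 'k) set set"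
  where "gamma_powers K F = {fga_x K F 1 [^]\<^bsub>gamma_ring K F\<^esub> n | n :: nat. True}"

definition R_prime ::
  "('r, 'm) ring_scheme \<Rightarrow> (nat \<Rightarrow> nat \<Rightarrow> 'r) \<Rightarrow>
    ((int multiset \<Rightarrow> ('r \<times> 'r) set) set \<times> (int multiset \<Rightarrow> ('r \<times> 'r) set) set) set ring" where
  "R_prime R F =
    (let K = rationalization R; F\<^sub>K = rat_fgl R F
     in localization (gamma_ring K F\<^sub>K) (gamma_powers K F\<^sub>K))"

definition R_prime_map ::
  "('r, 'm) ring_scheme \<Rightarrow> (nat \<Rightarrow> nat \<Rightarrow> 'r) \<Rightarrow> (int multiset \<Rightarrow> ('r \<times> 'r) set) set \<Rightarrow>
    ((int multiset \<Rightarrow> ('r \<times> 'r) set) set \<times> (int multiset \<Rightarrow> ('r \<times> 'r) set) set) set" where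
  "R_prime_map R F =
    (let K = rationalization R; F\<^sub>K = rat_fgl R F
     in loc_emb (gamma_ring K F\<^sub>K) (gamma_powers K F\<^sub>K))"

definition extended_affine_hecke where
  "extended_affine_hecke R F =
    affine_hecke (rationalization R) (rat_fgl R F) (R_prime R F) (R_prime_map R F)"

definition extended_affine_hecke_const where
  "extended_affine_hecke_const R F =
    affine_hecke_const (rationalization R) (rat_fgl R F) (R_prime R F) (R_prime_map R F)"

end

theory Submission
  imports Defs
begin

text \<open>
  Over \<open>K = R \<otimes> \<rat>\<close> all formal group laws are isomorphic, and over the
  extended coefficients the affine Hecke algebra has a presentation which depends on the formal
  group law only through the elements \<open>x\<^sub>\<lambda>\<close> up to units. These two
  facts give the theorem.

  \<^bold>\<open>The isomorphism of formal group laws.\<close> There are mutually inverse series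
  \<open>h = u + \<dots>\<close> and \<open>h'\<close> over \<open>K\<close> with \<open>h(u
  +\<^bsub>F'\<^esub> v) = h(u) +\<^sub>F h(v)\<close> (\<open>fgl_iso_exists\<close>). A
  homomorphism satisfies \<open>h([2]\<^bsub>F'\<^esub> u) = [2]\<^sub>F h(u)\<close>, where
  \<open>[2]\<close> is the doubling of the formal group, and this equation alone determines the
  coefficients of \<open>h\<close> one degree after the other, since in degree \<open>n\<close>
  the unknown coefficient occurs with the factor \<open>2 - 2\<^sup>n\<close>, which is a unit for
  \<open>n \<ge> 2\<close> (\<open>dilation_exists\<close>, \<open>dilation_unique\<close>). That
  the solution \<open>h\<close> is a homomorphism, and that \<open>h\<close> and \<open>h'\<close>
  are inverse to each other, follows from the uniqueness part of the same argument, since the two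
  sides of the asserted equations satisfy the same equation of this kind.

  \<^bold>\<open>The isomorphism of formal group algebras.\<close> The substitution
  \<open>x\<^sub>\<lambda> \<mapsto> h(x\<^sub>\<lambda>)\<close> induces isomorphisms
  \<open>K\<^sub>F \<rightarrow> K\<^bsub>F'\<^esub>\<close>, then \<open>R'\<^sub>F \<rightarrow>
  R'\<^bsub>F'\<^esub>\<close>, and finally of the formal group algebras of
  \<open>\<Lambda>\<close> over these coefficients (\<open>transport_inverse\<close>,
  \<open>gamma_transport_exists\<close>). The last one commutes with \<open>W\<close> and takes
  \<open>x\<^sub>\<lambda>\<close> to \<open>x\<^sub>\<lambda>\<close> times a unit
  (\<open>transport_x\<close>). Hence it extends to \<open>Q'\<close> and to the twisted group
  algebras.

  \<^bold>\<open>The generators.\<close> This isomorphism does not take \<open>T\<^sub>i\<close>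
  to \<open>T\<^sub>i\<close>. But it takes \<open>X\<^sub>i = x\<^sub>i\<^sup>-\<^sup>1(1 -
  \<delta>\<^sub>i)\<close> to \<open>X\<^sub>i\<close> times a unit of the formal group algebra
  on the left, and over the extended coefficients the Hecke algebra is generated by the formal
  group algebra and the \<open>X\<^sub>i\<close> (\<open>affine_hecke_eq\<close>). To see the
  latter, write \<open>T\<^sub>i = X\<^sub>i \<psi> + \<delta>\<^sub>i \<mu>\<close> with
  \<open>\<psi>\<close> and \<open>\<mu>\<close> fixed by \<open>s\<^sub>i\<close>. Moving the
  coefficients to the left gives \<open>T\<^sub>i = (\<psi> - \<mu> x\<^sub>i) X\<^sub>i +
  \<mu>\<close> (\<open>dem_lusztig\<close>). If \<open>\<psi>\<close> is a unit, then so is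
  \<open>\<psi> - \<mu> x\<^sub>i\<close>, because \<open>x\<^sub>i\<close> is topologically
  nilpotent. If \<open>\<kappa> = 0\<close>, then \<open>\<psi> = 2 x\<^sub>\<gamma>\<close>, a
  unit because \<open>2\<close> and \<open>x\<^sub>\<gamma>\<close> have been inverted. Otherwise
  \<open>a\<^sub>1\<^sub>1\<close> is a unit and \<open>\<psi> = \<Theta> /
  \<kappa>\<^sub>i\<close>. From \<open>\<mu>(u) = 1 - a\<^sub>1\<^sub>1 u + \<dots>\<close> one
  sees that \<open>\<kappa>\<^sub>i\<close> is a unit of the formal group algebra, with constant
  term \<open>-a\<^sub>1\<^sub>1\<close>, and that \<open>\<Theta>\<close> is \<open>-2
  a\<^sub>1\<^sub>1 x\<^sub>\<gamma>\<close> times a series with constant term one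
  (\<open>Theta_factor\<close>).

  \<^bold>\<open>Fractions.\<close> All this takes place in total rings of fractions, so that the
  \<open>x\<^sub>\<lambda>\<close> with \<open>\<lambda> \<noteq> 0\<close> have to be
  non-zero-divisors. This is the content of \<open>fga_x_regular_of_nonzero\<close>: a basis of
  \<open>\<Lambda>\<close> identifies the formal group algebra with power series in the basis
  variables, where \<open>x\<^sub>\<lambda>\<close> has a linear term with integral coefficients,
  not all zero; this suffices if non-zero integers are non-zero-divisors. The same fact shows that
  \<open>\<kappa> = 0\<close> over \<open>R\<close> implies \<open>\<kappa> = 0\<close> over
  \<open>R'\<^sub>F\<close> if \<open>R\<close> has characteristic zero. In positive
  characteristic \<open>K\<close> is the zero ring, and there \<open>a\<^sub>1\<^sub>1\<close> is
  a unit.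
\<close>

section \<open>Finite sums\<close>

lemma (in comm_monoid) finprod_Sigma':
  assumes "finite A" "\<And>a. a \<in> A \<Longrightarrow> finite (B a)"
    "\<And>a b. a \<in> A \<Longrightarrow> b \<in> B a \<Longrightarrow> f a b \<in> carrier G"
  shows "finprod G (\<lambda>a. finprod G (f a) (B a)) A = finprod G (\<lambda>p. f (fst p) (snd p)) (Sigma A B)"
  using assms
proof (induction A rule: finite_induct)
  case empty
  then show ?case by simp
next
  case (insert a A)
  have eq: "Sigma (insert a A) B = Pair a ` B a \<union> Sigma A B" by auto
  have inj: "inj_on (Pair a) (B a)" by (auto simp: inj_on_def)
  have "finprod G (\<lambda>p. f (fst p) (snd p)) (Sigma (insert a A) B) =
      finprod G (\<lambda>p. f (fst p) (snd p)) (Pair a ` B a) \<otimes> finprod G (\<lambda>p. f (fst p) (snd p)) (Sigma A B)"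
    unfolding eq using insert by (intro finprod_Un_disjoint) auto
  also have "finprod G (\<lambda>p. f (fst p) (snd p)) (Pair a ` B a) = finprod G (f a) (B a)"
    using insert inj by (subst finprod_reindex) auto
  finally show ?case using insert by (simp add: Pi_def)
qed

lemma (in comm_monoid) finprod_bij:
  assumes "bij_betw h A B" "\<And>b. b \<in> B \<Longrightarrow> f b \<in> carrier G" "\<And>a. a \<in> A \<Longrightarrow> g a = f (h a)"
  shows "finprod G g A = finprod G f B"
proof -
  have "finprod G f B = finprod G f (h ` A)" using assms(1) by (simp add: bij_betw_def)
  also have "\<dots> = finprod G (\<lambda>a. f (h a)) A"
    using assms by (intro finprod_reindex) (auto simp: bij_betw_def)
  also have "\<dots> = finprod G g A"
    using assms by (intro finprod_cong') (auto simp: bij_betw_def)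
  finally show ?thesis by simp
qed

context abelian_monoid begin
lemmas finsum_Sigma' = add.finprod_Sigma'
lemmas finsum_bij = add.finprod_bij
lemmas finsum_mono_neutral_cong_left = add.finprod_mono_neutral_cong_left
lemmas finsum_zero_eqI = add.finprod_one_eqI
lemma finsum_single:
  assumes "finite A" "i \<in> A" "f i \<in> carrier G" "\<And>j. j \<in> A \<Longrightarrow> j \<noteq> i \<Longrightarrow> f j = \<zero>"
  shows "finsum G f A = f i"
proof -
  have c: "f j \<in> carrier G" if "j \<in> A" for j using assms that by (cases "j = i") auto
  have "finsum G f A = finsum G f {i}"
    using assms c
    by (intro add.finprod_mono_neutral_cong_right) (auto simp: Pi_def)
  also have "\<dots> = f i" using assms by (subst finsum_insert) auto
  finally show ?thesis .
qed
end

lemma hom_finsum: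
  assumes R: "abelian_monoid R" and S: "abelian_monoid S"
    and h: "\<And>x. x \<in> carrier R \<Longrightarrow> h x \<in> carrier S"
      "\<And>x y. x \<in> carrier R \<Longrightarrow> y \<in> carrier R \<Longrightarrow> h (x \<oplus>\<^bsub>R\<^esub> y) = h x \<oplus>\<^bsub>S\<^esub> h y"
      "h \<zero>\<^bsub>R\<^esub> = \<zero>\<^bsub>S\<^esub>"
    and "finite A" and f: "\<And>a. a \<in> A \<Longrightarrow> f a \<in> carrier R"
  shows "h (finsum R f A) = finsum S (\<lambda>a. h (f a)) A"
proof -
  interpret R: abelian_monoid R by fact
  interpret S: abelian_monoid S by fact
  show ?thesis using \<open>finite A\<close> f
  proof (induction A rule: finite_induct)
    case empty then show ?case using h by simp
  next
    case (insert a A)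
    then have "finsum R f A \<in> carrier R" by (intro R.finsum_closed) auto
    with insert show ?case using h
      by (simp add: R.finsum_insert S.finsum_insert Pi_def)
  qed
qed

section \<open>The ring of power series\<close>

lemma finite_submultisets: "finite {k. k \<subseteq># (m :: 'v multiset)}"
proof (induction m)
  case empty then show ?case by simp
next
  case (add x m)
  have "k \<in> {k. k \<subseteq># m} \<union> add_mset x ` {k. k \<subseteq># m}" if "k \<subseteq># add_mset x m" for k
  proof (cases "x \<in># k")
    case True
    then obtain k' where k: "k = add_mset x k'" by (metis multi_member_split)
    then show ?thesis using that by auto
  next
    case False
    then show ?thesis using that by (metis UnI1 mem_Collect_eq diff_single_trivial diff_subset_eq_self insert_subset_eq_iff subset_eq_diff_conv add_mset_remove_trivial union_mset_add_mset_right add_0_right add.right_neutral)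
  qed
  then have "{k. k \<subseteq># add_mset x m} \<subseteq> {k. k \<subseteq># m} \<union> add_mset x ` {k. k \<subseteq># m}" by blast
  then show ?case using add finite_subset by blast
qed

text \<open>
  The index set of the Cauchy product in symmetric form; commutativity and associativity of the
  product then become reindexings.
\<close>

definition splits :: "'v multiset \<Rightarrow> ('v multiset \<times> 'v multiset) set" where
  "splits m = {(a, b). a + b = m}"

lemma splits_bij: "bij_betw (\<lambda>k. (k, m - k)) {k. k \<subseteq># m} (splits m)"
  by (rule bij_betwI[where g = fst]) (auto simp: splits_def subset_mset.add_diff_inverse)

lemma finite_splits [simp]: "finite (splits m)"
  using splits_bij finite_submultisets bij_betw_finite by blast

lemma splits_size: "(a, b) \<in> splits m \<Longrightarrow> size a + size b = size m"
  by (auto simp: splits_def)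

lemma pser_carrier:
  "f \<in> carrier (pser R) \<longleftrightarrow>
    (\<forall>m. f m \<in> carrier R) \<and> (\<forall>n. finite {m. size m = n \<and> f m \<noteq> \<zero>\<^bsub>R\<^esub>})"
  by (simp only: pser_def partial_object.simps mem_Collect_eq)

lemma pser_zero: "\<zero>\<^bsub>pser R\<^esub> = (\<lambda>m. \<zero>\<^bsub>R\<^esub>)" by (simp add: pser_def)
lemma pser_one: "\<one>\<^bsub>pser R\<^esub> = pser_const R \<one>\<^bsub>R\<^esub>" by (simp add: pser_def pser_const_def)
lemma pser_add: "f \<oplus>\<^bsub>pser R\<^esub> g = (\<lambda>m. f m \<oplus>\<^bsub>R\<^esub> g m)" by (simp add: pser_def)

text \<open>
  Sums over all monomials of bounded degree are written as sums over this finite set.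
\<close>

definition psupp :: "('r, 'm) ring_scheme \<Rightarrow> nat \<Rightarrow> ('v multiset \<Rightarrow> 'r) \<Rightarrow> 'v multiset set" where
  "psupp R n f = {m. size m \<le> n \<and> f m \<noteq> \<zero>\<^bsub>R\<^esub>}"

lemma finite_psupp: "f \<in> carrier (pser R) \<Longrightarrow> finite (psupp R n f)"
proof -
  assume "f \<in> carrier (pser R)"
  then have "finite (\<Union>k\<le>n. {m. size m = k \<and> f m \<noteq> \<zero>\<^bsub>R\<^esub>})" by (auto simp: pser_carrier)
  also have "(\<Union>k\<le>n. {m. size m = k \<and> f m \<noteq> \<zero>\<^bsub>R\<^esub>}) = psupp R n f" by (auto simp: psupp_def)
  finally show ?thesis .
qed

lemma pser_carrierI:
  assumes "\<And>m. f m \<in> carrier R" "\<And>n. finite (psupp R n f)"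
  shows "f \<in> carrier (pser R)"
  unfolding pser_carrier
proof (intro conjI allI)
  fix n show "finite {m. size m = n \<and> f m \<noteq> \<zero>\<^bsub>R\<^esub>}"
    by (rule finite_subset[OF _ assms(2)[of n]]) (auto simp: psupp_def)
qed (rule assms)

lemma pser_coeff: "f \<in> carrier (pser R) \<Longrightarrow> f m \<in> carrier R"
  by (simp add: pser_carrier)

context cring begin

lemma pser_mult: 
  assumes "\<And>m. f m \<in> carrier R" "\<And>m. g m \<in> carrier R"
  shows "(f \<otimes>\<^bsub>pser R\<^esub> g) m = (\<Oplus>p\<in>splits m. f (fst p) \<otimes> g (snd p))"
proof -
  have "(f \<otimes>\<^bsub>pser R\<^esub> g) m = (\<Oplus>k\<in>{k. k \<subseteq># m}. f k \<otimes> g (m - k))" by (simp add: pser_def)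
  also have "\<dots> = (\<Oplus>p\<in>splits m. f (fst p) \<otimes> g (snd p))"
    by (rule finsum_bij[OF splits_bij]) (use assms in auto)
  finally show ?thesis .
qed

lemma pser_mult_closed:
  assumes f: "f \<in> carrier (pser R)" and g: "g \<in> carrier (pser R)"
  shows "f \<otimes>\<^bsub>pser R\<^esub> g \<in> carrier (pser R)"
proof (rule pser_carrierI)
  have c: "f m \<in> carrier R" "g m \<in> carrier R" for m using f g by (auto simp: pser_coeff)
  note m = pser_mult[of f g, OF c]
  show "(f \<otimes>\<^bsub>pser R\<^esub> g) m \<in> carrier R" for m unfolding m using c by (auto intro!: finsum_closed)
  fix n
  have "psupp R n (f \<otimes>\<^bsub>pser R\<^esub> g) \<subseteq> (\<lambda>(a, b). a + b) ` (psupp R n f \<times> psupp R n g)"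
  proof
    fix m assume "m \<in> psupp R n (f \<otimes>\<^bsub>pser R\<^esub> g)"
    then have s: "size m \<le> n" and "(\<Oplus>p\<in>splits m. f (fst p) \<otimes> g (snd p)) \<noteq> \<zero>"
      by (auto simp: psupp_def m)
    then have "\<exists>p\<in>splits m. f (fst p) \<otimes> g (snd p) \<noteq> \<zero>"
      using finsum_zero_eqI[of "splits m" "\<lambda>p. f (fst p) \<otimes> g (snd p)"] by blast
    then obtain a b where p: "(a, b) \<in> splits m" "f a \<otimes> g b \<noteq> \<zero>" by auto
    then have "f a \<noteq> \<zero>" "g b \<noteq> \<zero>" using c by auto
    then show "m \<in> (\<lambda>(a, b). a + b) ` (psupp R n f \<times> psupp R n g)"
      using p s by (auto simp: psupp_def splits_def intro!: image_eqI[where x = "(a, b)"])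
  qed
  then show "finite (psupp R n (f \<otimes>\<^bsub>pser R\<^esub> g))"
    using finite_psupp[OF f] finite_psupp[OF g] finite_subset by blast
qed

lemma pser_add_closed:
  assumes f: "f \<in> carrier (pser R)" and g: "g \<in> carrier (pser R)"
  shows "f \<oplus>\<^bsub>pser R\<^esub> g \<in> carrier (pser R)"
proof (rule pser_carrierI)
  fix n
  have "psupp R n (f \<oplus>\<^bsub>pser R\<^esub> g) \<subseteq> psupp R n f \<union> psupp R n g"
    by (auto simp: psupp_def pser_add)
  then show "finite (psupp R n (f \<oplus>\<^bsub>pser R\<^esub> g))"
    using finite_psupp[OF f] finite_psupp[OF g] finite_subset by blast
qed (use f g in \<open>auto simp: pser_add pser_coeff\<close>)

lemma pser_const_closed: "a \<in> carrier R \<Longrightarrow> pser_const R a \<in> carrier (pser R)"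
proof (rule pser_carrierI)
  show "finite (psupp R n (pser_const R a))" for n
    by (rule finite_subset[where B = "{{#}}"]) (auto simp: pser_const_def psupp_def split: if_splits)
qed (simp add: pser_const_def)

lemma pser_var_closed: "pser_var R v \<in> carrier (pser R)"
proof (rule pser_carrierI)
  show "finite (psupp R n (pser_var R v))" for n
    by (rule finite_subset[where B = "{{#v#}}"]) (auto simp: pser_var_def psupp_def split: if_splits)
qed (simp add: pser_var_def)

lemma pser_mult_comm:
  fixes f g :: "'v multiset \<Rightarrow> 'a"
  assumes f: "\<And>m. f m \<in> carrier R" and g: "\<And>m. g m \<in> carrier R"
  shows "f \<otimes>\<^bsub>pser R\<^esub> g = g \<otimes>\<^bsub>pser R\<^esub> f"
proof
  fix m :: "'v multiset"
  have b: "bij_betw (\<lambda>p. (snd p, fst p)) (splits m) (splits m)"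
    by (rule bij_betwI[where g = "\<lambda>p. (snd p, fst p)"]) (auto simp: splits_def add.commute)
  show "(f \<otimes>\<^bsub>pser R\<^esub> g) m = (g \<otimes>\<^bsub>pser R\<^esub> f) m"
    unfolding pser_mult[of f g, OF f g] pser_mult[of g f, OF g f]
    by (rule finsum_bij[OF b]) (use f g in \<open>auto simp: m_comm\<close>)
qed

text \<open>
  Both sides are the sum over all triples of monomials with product \<open>m\<close>.
\<close>

lemma pser_mult_assoc:
  fixes f g h :: "'v multiset \<Rightarrow> 'a"
  assumes f: "\<And>m. f m \<in> carrier R" and g: "\<And>m. g m \<in> carrier R" and h: "\<And>m. h m \<in> carrier R"
  shows "(f \<otimes>\<^bsub>pser R\<^esub> g) \<otimes>\<^bsub>pser R\<^esub> h = f \<otimes>\<^bsub>pser R\<^esub> (g \<otimes>\<^bsub>pser R\<^esub> h)"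
proof
  fix m :: "'v multiset"
  have fg: "(f \<otimes>\<^bsub>pser R\<^esub> g) m \<in> carrier R" for m unfolding pser_mult[of f g, OF f g]
    using f g by (auto intro!: finsum_closed)
  have gh: "(g \<otimes>\<^bsub>pser R\<^esub> h) m \<in> carrier R" for m unfolding pser_mult[of g h, OF g h]
    using g h by (auto intro!: finsum_closed)
  let ?L = "Sigma (splits m) (\<lambda>p. splits (fst p))" and ?R = "Sigma (splits m) (\<lambda>p. splits (snd p))"
  have "((f \<otimes>\<^bsub>pser R\<^esub> g) \<otimes>\<^bsub>pser R\<^esub> h) m =
      (\<Oplus>p\<in>splits m. \<Oplus>q\<in>splits (fst p). f (fst q) \<otimes> g (snd q) \<otimes> h (snd p))"
    unfolding pser_mult[of "f \<otimes>\<^bsub>pser R\<^esub> g" h, OF fg h]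
    by (intro finsum_cong') (use f g h in \<open>auto simp: pser_mult[of f g, OF f g] finsum_ldistr Pi_def intro!: finsum_closed\<close>)
  also have "\<dots> = (\<Oplus>z\<in>?L. f (fst (snd z)) \<otimes> g (snd (snd z)) \<otimes> h (snd (fst z)))"
    by (rule finsum_Sigma') (use f g h in auto)
  also have "\<dots> = (\<Oplus>z\<in>?R. f (fst (fst z)) \<otimes> (g (fst (snd z)) \<otimes> h (snd (snd z))))"
    by (rule finsum_bij[where h = "\<lambda>z. ((fst (snd z), snd (snd z) + snd (fst z)), (snd (snd z), snd (fst z)))"])
      (use f g h in \<open>auto simp: m_assoc splits_def intro!: bij_betwI[where g = "\<lambda>z. ((fst (fst z) + fst (snd z), snd (snd z)), (fst (fst z), fst (snd z)))"]\<close>)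
  also have "\<dots> = (\<Oplus>p\<in>splits m. \<Oplus>q\<in>splits (snd p). f (fst p) \<otimes> (g (fst q) \<otimes> h (snd q)))"
    by (rule finsum_Sigma'[symmetric]) (use f g h in auto)
  also have "\<dots> = (f \<otimes>\<^bsub>pser R\<^esub> (g \<otimes>\<^bsub>pser R\<^esub> h)) m"
    unfolding pser_mult[of f "g \<otimes>\<^bsub>pser R\<^esub> h", OF f gh]
    by (intro finsum_cong') (use f g h in \<open>auto simp: pser_mult[of g h, OF g h] finsum_rdistr Pi_def intro!: finsum_closed\<close>)
  finally show "((f \<otimes>\<^bsub>pser R\<^esub> g) \<otimes>\<^bsub>pser R\<^esub> h) m = (f \<otimes>\<^bsub>pser R\<^esub> (g \<otimes>\<^bsub>pser R\<^esub> h)) m" .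
qed

lemma pser_const_mult:
  fixes g :: "'v multiset \<Rightarrow> 'a"
  assumes a: "a \<in> carrier R" and g: "\<And>m. g m \<in> carrier R"
  shows "pser_const R a \<otimes>\<^bsub>pser R\<^esub> g = (\<lambda>m. a \<otimes> g m)"
proof
  fix m :: "'v multiset"
  let ?F = "\<lambda>p :: 'v multiset \<times> 'v multiset. pser_const R a (fst p) \<otimes> g (snd p)"
  have "finsum R ?F (splits m) = ?F ({#}, m)"
  proof (rule finsum_single)
    show "?F j = \<zero>" if "j \<in> splits m" "j \<noteq> ({#}, m)" for j
      using that g by (auto simp: pser_const_def splits_def)
  qed (use a g finite_splits[of m] in \<open>auto simp: pser_const_def splits_def\<close>)
  moreover have "(pser_const R a \<otimes>\<^bsub>pser R\<^esub> g) m = finsum R ?F (splits m)"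
    using a g by (intro pser_mult) (auto simp: pser_const_def)
  ultimately show "(pser_const R a \<otimes>\<^bsub>pser R\<^esub> g) m = a \<otimes> g m"
    by (simp add: pser_const_def)
qed

lemma pser_cring: "cring (pser R :: ('v multiset \<Rightarrow> 'a) ring)"
proof (rule cringI)
  show "abelian_group (pser R :: ('v multiset \<Rightarrow> 'a) ring)"
  proof (rule abelian_groupI)
    fix f :: "'v multiset \<Rightarrow> 'a" assume f: "f \<in> carrier (pser R)"
    let ?g = "\<lambda>m. \<ominus> f m"
    have "?g \<in> carrier (pser R)"
    proof (rule pser_carrierI)
      show "finite (psupp R n ?g)" for n
        by (rule finite_subset[OF _ finite_psupp[OF f, of n]]) (use pser_coeff[OF f] in \<open>auto simp: psupp_def\<close>)
    qed (use pser_coeff[OF f] in auto)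
    moreover have "?g \<oplus>\<^bsub>pser R\<^esub> f = \<zero>\<^bsub>pser R\<^esub>"
      using pser_coeff[OF f] by (auto simp: pser_add pser_zero l_neg)
    ultimately show "\<exists>y\<in>carrier (pser R). y \<oplus>\<^bsub>pser R\<^esub> f = \<zero>\<^bsub>pser R\<^esub>" by blast
  next
    show "\<zero>\<^bsub>pser R\<^esub> \<in> carrier (pser R :: ('v multiset \<Rightarrow> 'a) ring)" by (rule pser_carrierI) (auto simp: pser_zero psupp_def)
  qed (simp_all add: pser_add_closed, (simp add: pser_add pser_zero a_ac pser_coeff fun_eq_iff)+)
  show "Group.comm_monoid (pser R :: ('v multiset \<Rightarrow> 'a) ring)"
  proof (rule comm_monoidI)
    show "\<one>\<^bsub>pser R\<^esub> \<in> carrier (pser R :: ('v multiset \<Rightarrow> 'a) ring)" by (simp add: pser_one pser_const_closed)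
    show "\<one>\<^bsub>pser R\<^esub> \<otimes>\<^bsub>pser R\<^esub> f = f" if "f \<in> carrier (pser R)" for f :: "'v multiset \<Rightarrow> 'a"
      using pser_coeff[OF that] by (simp add: pser_one pser_const_mult)
    show "f \<otimes>\<^bsub>pser R\<^esub> g \<otimes>\<^bsub>pser R\<^esub> h = f \<otimes>\<^bsub>pser R\<^esub> (g \<otimes>\<^bsub>pser R\<^esub> h)"
      if "f \<in> carrier (pser R)" "g \<in> carrier (pser R)" "h \<in> carrier (pser R)" for f g h :: "'v multiset \<Rightarrow> 'a"
      using pser_coeff that by (intro pser_mult_assoc) auto
    show "f \<otimes>\<^bsub>pser R\<^esub> g = g \<otimes>\<^bsub>pser R\<^esub> f"
      if "f \<in> carrier (pser R)" "g \<in> carrier (pser R)" for f g :: "'v multiset \<Rightarrow> 'a"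
      using pser_coeff that by (intro pser_mult_comm) auto
  qed (auto simp: pser_mult_closed)
  fix f g h :: "'v multiset \<Rightarrow> 'a"
  assume fgh: "f \<in> carrier (pser R)" "g \<in> carrier (pser R)" "h \<in> carrier (pser R)"
  then show "(f \<oplus>\<^bsub>pser R\<^esub> g) \<otimes>\<^bsub>pser R\<^esub> h = f \<otimes>\<^bsub>pser R\<^esub> h \<oplus>\<^bsub>pser R\<^esub> g \<otimes>\<^bsub>pser R\<^esub> h"
    using pser_coeff[of f R] pser_coeff[of g R] pser_coeff[of h R]
    by (auto simp: fun_eq_iff pser_mult pser_add l_distr finsum_addf Pi_def)
qed

end

section \<open>The order filtration\<close>

context cring begin

lemma pser_ring: "ring (pser R :: ('v multiset \<Rightarrow> 'a) ring)"
  using pser_cring cring.axioms(1) by blast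

lemma pser_uminus_apply:
  fixes f :: "'v multiset \<Rightarrow> 'a"
  assumes "f \<in> carrier (pser R)"
  shows "(\<ominus>\<^bsub>pser R\<^esub> f) m = \<ominus> f m"
proof -
  interpret P: cring "pser R :: ('v multiset \<Rightarrow> 'a) ring" by (rule pser_cring)
  have "(\<ominus>\<^bsub>pser R\<^esub> f) m \<oplus> f m = (\<ominus>\<^bsub>pser R\<^esub> f \<oplus>\<^bsub>pser R\<^esub> f) m" by (simp add: pser_add)
  also have "\<dots> = \<zero>" using assms by (simp add: P.l_neg pser_zero)
  finally show ?thesis using assms pser_coeff[OF assms] pser_coeff[of "\<ominus>\<^bsub>pser R\<^esub> f" R]
    by (metis P.a_inv_closed minus_equality)
qed

lemma pser_minus_apply:
  fixes f g :: "'v multiset \<Rightarrow> 'a"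
  assumes "f \<in> carrier (pser R)" "g \<in> carrier (pser R)"
  shows "(f \<ominus>\<^bsub>pser R\<^esub> g) m = f m \<ominus> g m"
  using assms by (simp add: a_minus_def pser_add pser_uminus_apply)

lemma pser_finsum_apply:
  fixes F :: "'x \<Rightarrow> 'v multiset \<Rightarrow> 'a"
  assumes "finite A" "\<And>a. a \<in> A \<Longrightarrow> F a \<in> carrier (pser R)"
  shows "(finsum (pser R) F A) m = (\<Oplus>a\<in>A. F a m)"
proof -
  interpret P: cring "pser R :: ('v multiset \<Rightarrow> 'a) ring" by (rule pser_cring)
  show ?thesis
    using P.abelian_monoid_axioms abelian_monoid_axioms assms
    by (intro hom_finsum[where R = "pser R" and h = "\<lambda>f. f m"]) (auto simp: pser_add pser_zero pser_coeff)
qed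

text \<open>
  The filtration by powers of the augmentation ideal. It defines the topology: \<open>f\<close>
  and \<open>g\<close> are close if \<open>f - g\<close> lies in \<open>pord n\<close> for a large
  \<open>n\<close>.
\<close>

definition pord :: "nat \<Rightarrow> ('v multiset \<Rightarrow> 'a) set" where
  "pord n = {f \<in> carrier (pser R). \<forall>m. size m < n \<longrightarrow> f m = \<zero>}"

lemma pord_carrier: "f \<in> pord n \<Longrightarrow> f \<in> carrier (pser R)" by (simp add: pord_def)
lemma pord_coeff: "f \<in> pord n \<Longrightarrow> size m < n \<Longrightarrow> f m = \<zero>" by (simp add: pord_def)
lemma pord_mono: "f \<in> pord n \<Longrightarrow> k \<le> n \<Longrightarrow> f \<in> pord k" by (simp add: pord_def)
lemma pord_0: "pord 0 = carrier (pser R)" by (simp add: pord_def)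

lemma pord_mult:
  assumes f: "f \<in> pord a" and g: "g \<in> pord b"
  shows "f \<otimes>\<^bsub>pser R\<^esub> g \<in> pord (a + b)"
proof -
  note c = pser_coeff[OF pord_carrier[OF f]] pser_coeff[OF pord_carrier[OF g]]
  have "(f \<otimes>\<^bsub>pser R\<^esub> g) m = \<zero>" if "size m < a + b" for m
    unfolding pser_mult[of f g, OF c]
  proof (rule finsum_zero_eqI)
    fix p assume "p \<in> splits m"
    then have "size (fst p) + size (snd p) < a + b" using splits_size[of "fst p" "snd p"] that by simp
    then have "size (fst p) < a \<or> size (snd p) < b" by linarith
    then show "f (fst p) \<otimes> g (snd p) = \<zero>" using f g c by (auto simp: pord_coeff)
  qed
  then show ?thesis using f g by (auto simp: pord_def pser_mult_closed)
qed

lemma pord_add: "f \<in> pord n \<Longrightarrow> g \<in> pord n \<Longrightarrow> f \<oplus>\<^bsub>pser R\<^esub> g \<in> pord n"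
  by (auto simp: pord_def pser_add_closed) (simp add: pser_add)

lemma pord_uminus: "f \<in> pord n \<Longrightarrow> \<ominus>\<^bsub>pser R\<^esub> f \<in> pord n"
  using pser_uminus_apply[of f] cring.cring_simprules(3)[OF pser_cring, of f] by (auto simp: pord_def)

lemma pord_minus: "f \<in> pord n \<Longrightarrow> g \<in> pord n \<Longrightarrow> f \<ominus>\<^bsub>pser R\<^esub> g \<in> pord n"
  by (simp add: a_minus_def pord_add pord_uminus)

lemma pord_zero: "\<zero>\<^bsub>pser R\<^esub> \<in> pord n"
  using cring.cring_simprules(2)[OF pser_cring] by (auto simp: pord_def) (simp add: pser_zero)

lemma pord_minus_iff:
  fixes f g :: "'v multiset \<Rightarrow> 'a"
  assumes "f \<in> carrier (pser R)" "g \<in> carrier (pser R)"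
  shows "f \<ominus>\<^bsub>pser R\<^esub> g \<in> pord n \<longleftrightarrow> (\<forall>m. size m < n \<longrightarrow> f m = g m)"
proof -
  interpret P: cring "pser R :: ('v multiset \<Rightarrow> 'a) ring" by (rule pser_cring)
  show ?thesis using assms pser_coeff[OF assms(1)] pser_coeff[OF assms(2)]
    by (auto simp: pord_def pser_minus_apply r_right_minus_eq)
qed

lemma pord_mult_right: "f \<in> pord n \<Longrightarrow> g \<in> carrier (pser R) \<Longrightarrow> f \<otimes>\<^bsub>pser R\<^esub> g \<in> pord n"
  using pord_mult[of f n g 0] by (simp add: pord_0)

lemma pord_mult_left: "f \<in> pord n \<Longrightarrow> g \<in> carrier (pser R) \<Longrightarrow> g \<otimes>\<^bsub>pser R\<^esub> f \<in> pord n"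
  using pord_mult[of g 0 f n] by (simp add: pord_0)

lemma pser_eqI:
  fixes f g :: "'v multiset \<Rightarrow> 'a"
  assumes "f \<in> carrier (pser R)" "g \<in> carrier (pser R)" "\<And>n. f \<ominus>\<^bsub>pser R\<^esub> g \<in> pord n"
  shows "f = g"
proof
  fix m show "f m = g m" using assms(3)[of "Suc (size m)"] assms(1,2) by (auto simp: pord_minus_iff)
qed

text \<open>The value of the monomial \<open>k\<close> at the point \<open>s\<close>.\<close>

definition pmon :: "('v \<Rightarrow> 'w multiset \<Rightarrow> 'a) \<Rightarrow> 'v multiset \<Rightarrow> 'w multiset \<Rightarrow> 'a" where
  "pmon s k = finprod (pser R) (\<lambda>v. s v [^]\<^bsub>pser R\<^esub> count k v) (set_mset k)"

lemma pmon_superset: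
  fixes s :: "'v \<Rightarrow> 'w multiset \<Rightarrow> 'a"
  assumes s: "\<And>v. s v \<in> carrier (pser R)" and "finite V" "set_mset k \<subseteq> V"
  shows "pmon s k = finprod (pser R) (\<lambda>v. s v [^]\<^bsub>pser R\<^esub> count k v) V"
proof -
  interpret P: cring "pser R :: ('w multiset \<Rightarrow> 'a) ring" by (rule pser_cring)
  show ?thesis unfolding pmon_def using assms
    by (intro P.finprod_mono_neutral_cong_left) (auto simp: Multiset.not_in_iff)
qed

lemma pmon_closed:
  fixes s :: "'v \<Rightarrow> 'w multiset \<Rightarrow> 'a"
  shows "(\<And>v. s v \<in> carrier (pser R)) \<Longrightarrow> pmon s k \<in> carrier (pser R)"
proof -
  interpret P: cring "pser R :: ('w multiset \<Rightarrow> 'a) ring" by (rule pser_cring)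
  show "(\<And>v. s v \<in> carrier (pser R)) \<Longrightarrow> ?thesis" unfolding pmon_def by (intro P.finprod_closed) auto
qed

lemma pmon_empty:
  fixes s :: "'v \<Rightarrow> 'w multiset \<Rightarrow> 'a"
  shows "pmon s {#} = \<one>\<^bsub>pser R\<^esub>" 
proof -
  interpret P: cring "pser R :: ('w multiset \<Rightarrow> 'a) ring" by (rule pser_cring)
  show ?thesis by (simp add: pmon_def)
qed

lemma pmon_add:
  fixes s :: "'v \<Rightarrow> 'w multiset \<Rightarrow> 'a"
  assumes s: "\<And>v. s v \<in> carrier (pser R)"
  shows "pmon s (k + l) = pmon s k \<otimes>\<^bsub>pser R\<^esub> pmon s l"
proof -
  interpret P: cring "pser R :: ('w multiset \<Rightarrow> 'a) ring" by (rule pser_cring)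
  let ?V = "set_mset (k + l)"
  have "pmon s k = finprod (pser R) (\<lambda>v. s v [^]\<^bsub>pser R\<^esub> count k v) ?V"
    by (rule pmon_superset[OF s]) auto
  moreover have "pmon s l = finprod (pser R) (\<lambda>v. s v [^]\<^bsub>pser R\<^esub> count l v) ?V"
    by (rule pmon_superset[OF s]) auto
  moreover have "pmon s (k + l) = finprod (pser R) (\<lambda>v. s v [^]\<^bsub>pser R\<^esub> count (k + l) v) ?V"
    by (simp add: pmon_def)
  ultimately show ?thesis using s by (simp add: P.finprod_multf Pi_def P.nat_pow_mult[symmetric])
qed

lemma pmon_single:
  fixes s :: "'v \<Rightarrow> 'w multiset \<Rightarrow> 'a"
  shows "s v \<in> carrier (pser R) \<Longrightarrow> pmon s {#v#} = s v"
proof -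
  interpret P: cring "pser R :: ('w multiset \<Rightarrow> 'a) ring" by (rule pser_cring)
  assume "s v \<in> carrier (pser R)"
  then show ?thesis by (simp add: pmon_def)
qed

lemma pmon_add_mset:
  fixes s :: "'v \<Rightarrow> 'w multiset \<Rightarrow> 'a"
  assumes s: "\<And>v. s v \<in> carrier (pser R)"
  shows "pmon s (add_mset v k) = s v \<otimes>\<^bsub>pser R\<^esub> pmon s k"
  using pmon_add[where s = s and k = "{#v#}" and l = k, OF s] pmon_single[of s v] s by simp

lemma pmon_pord:
  fixes s :: "'v \<Rightarrow> 'w multiset \<Rightarrow> 'a"
  assumes s: "\<And>v. s v \<in> pord 1"
  shows "pmon s k \<in> pord (size k)"
proof (induction k)
  case empty
  interpret P: cring "pser R :: ('w multiset \<Rightarrow> 'a) ring" by (rule pser_cring)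
  show ?case by (simp add: pmon_empty pord_0)
next
  case (add v k)
  then show ?case using pord_mult[OF s[of v] add] pmon_add_mset[where s = s, OF pord_carrier[OF s]] by simp
qed

lemma pser_var_mult:
  fixes f :: "'v multiset \<Rightarrow> 'a"
  assumes f: "f \<in> carrier (pser R)"
  shows "(pser_var R v \<otimes>\<^bsub>pser R\<^esub> f) m = (if v \<in># m then f (m - {#v#}) else \<zero>)"
proof -
  let ?F = "\<lambda>p. pser_var R v (fst p) \<otimes> f (snd p)"
  have eq: "(pser_var R v \<otimes>\<^bsub>pser R\<^esub> f) m = finsum R ?F (splits m)"
    using pser_coeff[OF f] pser_coeff[OF pser_var_closed] by (intro pser_mult) auto
  show ?thesis
  proof (cases "v \<in># m")
    case True
    have "finsum R ?F (splits m) = ?F ({#v#}, m - {#v#})"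
    proof (rule finsum_single)
      show "({#v#}, m - {#v#}) \<in> splits m" using True by (simp add: splits_def)
      show "?F j = \<zero>" if "j \<in> splits m" "j \<noteq> ({#v#}, m - {#v#})" for j
        using that pser_coeff[OF f] by (auto simp: splits_def pser_var_def)
    qed (use pser_coeff[OF f] pser_coeff[OF pser_var_closed, of v] in auto)
    then show ?thesis using eq True pser_coeff[OF f] by (simp add: pser_var_def)
  next
    case False
    then have "finsum R ?F (splits m) = \<zero>"
      using pser_coeff[OF f] by (intro finsum_zero_eqI) (auto simp: splits_def pser_var_def)
    then show ?thesis using eq False by simp
  qed
qed

lemma pmon_var:
  assumes g: "\<And>v. s v = pser_var R (g v)"
  shows "pmon s k = (\<lambda>m. if m = image_mset g k then \<one> else \<zero>)"
proof (induction k)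
  case empty
  then show ?case by (simp add: pmon_empty pser_one pser_const_def)
next
  case (add v k)
  have s: "s v \<in> carrier (pser R)" for v by (simp add: g pser_var_closed)
  have "pmon s (add_mset v k) m = (if m = image_mset g (add_mset v k) then \<one> else \<zero>)" for m
    unfolding pmon_add_mset[OF s] g[of v] pser_var_mult[OF pmon_closed[OF s]]
    unfolding add by (auto dest!: multi_member_split)
  then show ?case by blast
qed

lemma pser_one_pord0: "f \<in> pord 1 \<longleftrightarrow> f \<in> carrier (pser R) \<and> f {#} = \<zero>"
  by (auto simp: pord_def)

lemma pser_var_pord: "pser_var R v \<in> pord 1"
  unfolding pser_one_pord0 using pser_var_closed[of v] by (simp add: pser_var_def)

definition ptrunc :: "nat \<Rightarrow> ('v multiset \<Rightarrow> 'a) \<Rightarrow> 'v multiset \<Rightarrow> 'a" where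
  "ptrunc n f = finsum (pser R) (\<lambda>k. pser_const R (f k) \<otimes>\<^bsub>pser R\<^esub> pmon (pser_var R) k) (psupp R n f)"

lemma ptrunc_coeff:
  fixes f :: "'v multiset \<Rightarrow> 'a"
  assumes f: "f \<in> carrier (pser R)" and m: "size m \<le> n"
  shows "ptrunc n f m = f m"
proof -
  note c = pser_coeff[OF f]
  have mon: "pmon (pser_var R) k \<in> carrier (pser R)" for k :: "'v multiset"
    by (rule pmon_closed[OF pser_var_closed])
  let ?F = "\<lambda>k. f k \<otimes> pmon (pser_var R) k m"
  have mon': "pmon (pser_var R) k m = (if m = k then \<one> else \<zero>)" for k
    using fun_cong[OF pmon_var[of "pser_var R" "\<lambda>v. v" k]] by simp
  have "ptrunc n f m = finsum R ?F (psupp R n f)"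
    unfolding ptrunc_def using c mon
    by (subst pser_finsum_apply[OF finite_psupp[OF f]])
      (simp_all add: pser_mult_closed pser_const_closed, simp add: pser_const_mult pser_coeff)
  also have "\<dots> = f m"
  proof (cases "m \<in> psupp R n f")
    case True
    have "finsum R ?F (psupp R n f) = ?F m"
      by (rule finsum_single) (use True c in \<open>auto simp: mon' finite_psupp[OF f]\<close>)
    then show ?thesis using c by (simp add: mon')
  next
    case False
    then have "f m = \<zero>" using m by (auto simp: psupp_def)
    moreover have "finsum R ?F (psupp R n f) = \<zero>"
      using False c by (intro finsum_zero_eqI) (auto simp: mon')
    ultimately show ?thesis by simp
  qed
  finally show ?thesis .
qed

text \<open>
  Polynomials are dense in the power series, since \<open>ptrunc n f\<close> agrees with
  \<open>f\<close> up to degree \<open>n\<close>. Hence a property of the constants and the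
  variables holds for all series if it is preserved by the ring operations and by limits.
\<close>

lemma pser_closed_induct [consumes 1, case_names const var add mult closed]:
  fixes f :: "'v multiset \<Rightarrow> 'a"
  assumes f: "f \<in> carrier (pser R)"
    and const: "\<And>a. a \<in> carrier R \<Longrightarrow> P (pser_const R a)"
    and var: "\<And>v. P (pser_var R v)"
    and add: "\<And>f g. f \<in> carrier (pser R) \<Longrightarrow> g \<in> carrier (pser R) \<Longrightarrow> P f \<Longrightarrow> P g \<Longrightarrow> P (f \<oplus>\<^bsub>pser R\<^esub> g)"
    and mult: "\<And>f g. f \<in> carrier (pser R) \<Longrightarrow> g \<in> carrier (pser R) \<Longrightarrow> P f \<Longrightarrow> P g \<Longrightarrow> P (f \<otimes>\<^bsub>pser R\<^esub> g)"
    and closed: "\<And>f. f \<in> carrier (pser R) \<Longrightarrow>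
      (\<And>n. \<exists>g\<in>carrier (pser R). P g \<and> f \<ominus>\<^bsub>pser R\<^esub> g \<in> pord n) \<Longrightarrow> P f"
  shows "P f"
proof (rule closed[OF f])
  interpret P: cring "pser R :: ('v multiset \<Rightarrow> 'a) ring" by (rule pser_cring)
  fix n
  have mc: "pmon (pser_var R) k \<in> carrier (pser R)" for k :: "'v multiset" by (rule pmon_closed[OF pser_var_closed])
  have m: "P (pmon (pser_var R) k)" for k :: "'v multiset"
  proof (induction k)
    case empty show ?case unfolding pmon_empty pser_one by (rule const) simp
  next
    case (add v k) 
    show ?case unfolding pmon_add_mset[OF pser_var_closed] by (rule mult[OF pser_var_closed mc var add])
  qed
  have "P (finsum (pser R) (\<lambda>k. pser_const R (f k) \<otimes>\<^bsub>pser R\<^esub> pmon (pser_var R) k) A)" if "finite A" for A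
    using that
  proof (induction A rule: finite_induct)
    case empty
    have "P (pser_const R \<zero>)" by (rule const) simp
    moreover have "(pser_const R \<zero> :: 'v multiset \<Rightarrow> 'a) = \<zero>\<^bsub>pser R\<^esub>" by (simp add: pser_const_def pser_zero)
    ultimately show ?case by (simp only: P.finsum_empty)
  next
    case (insert k A)
    have c: "pser_const R (f k) \<otimes>\<^bsub>pser R\<^esub> pmon (pser_var R) k \<in> carrier (pser R)" for k
      by (rule pser_mult_closed[OF pser_const_closed[OF pser_coeff[OF f]] mc])
    have "P (pser_const R (f k) \<otimes>\<^bsub>pser R\<^esub> pmon (pser_var R) k)"
      by (rule mult[OF pser_const_closed[OF pser_coeff[OF f]] mc const[OF pser_coeff[OF f]] m])
    then show ?case using insert c by (simp add: P.finsum_insert Pi_def add P.finsum_closed)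
  qed
  then have "P (ptrunc n f)" unfolding ptrunc_def using finite_psupp[OF f] by blast
  moreover have "ptrunc n f \<in> carrier (pser R)"
    unfolding ptrunc_def using f mc by (intro P.finsum_closed) (auto simp: pser_const_closed pser_coeff)
  ultimately show "\<exists>g\<in>carrier (pser R). P g \<and> f \<ominus>\<^bsub>pser R\<^esub> g \<in> pord n"
    using f ptrunc_coeff[OF f] by (intro bexI[of _ "ptrunc n f"]) (auto simp: pord_minus_iff)
qed

end

section \<open>Substitution\<close>

text \<open>
  These identities split a difference of two values of an expression into differences of its
  arguments, to which estimates of their order can be applied.
\<close>

lemma (in cring) mult_diff_split:
  "a \<in> carrier R \<Longrightarrow> b \<in> carrier R \<Longrightarrow> c \<in> carrier R \<Longrightarrow> d \<in> carrier R \<Longrightarrow>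
    a \<otimes> b \<ominus> c \<otimes> d = (a \<ominus> c) \<otimes> b \<oplus> c \<otimes> (b \<ominus> d)"
  by algebra

lemma (in cring) add_diff_split:
  "a \<in> carrier R \<Longrightarrow> b \<in> carrier R \<Longrightarrow> c \<in> carrier R \<Longrightarrow> d \<in> carrier R \<Longrightarrow>
    (a \<oplus> b) \<ominus> (c \<oplus> d) = (a \<ominus> c) \<oplus> (b \<ominus> d)"
  by algebra

lemma (in cring) diff_diff_split:
  "a \<in> carrier R \<Longrightarrow> b \<in> carrier R \<Longrightarrow> c \<in> carrier R \<Longrightarrow>
    a \<ominus> b = (a \<ominus> c) \<ominus> (b \<ominus> c)"
  by algebra

lemma (in cring) diff_trans:
  "a \<in> carrier R \<Longrightarrow> b \<in> carrier R \<Longrightarrow> c \<in> carrier R \<Longrightarrow>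
    a \<ominus> c = (a \<ominus> b) \<oplus> (b \<ominus> c)"
  by algebra

text \<open>
  Substitution of \<open>s v\<close> for the variables, with a change of coefficients along
  \<open>i\<close>. The sum is truncated at the degree of \<open>m\<close>: the \<open>s v\<close>
  are meant to have no constant term, and then monomials of higher degree do not contribute to the
  coefficient at \<open>m\<close>.
\<close>

definition psub ::
  "('r, 'm) ring_scheme \<Rightarrow> ('s, 'n) ring_scheme \<Rightarrow> ('r \<Rightarrow> 's) \<Rightarrow> ('v \<Rightarrow> 'w multiset \<Rightarrow> 's) \<Rightarrow>
    ('v multiset \<Rightarrow> 'r) \<Rightarrow> 'w multiset \<Rightarrow> 's" where
  "psub R S i s f = (\<lambda>m. \<Oplus>\<^bsub>S\<^esub>k\<in>psupp R (size m) f. i (f k) \<otimes>\<^bsub>S\<^esub> cring.pmon S s k m)"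

text \<open>
  The homomorphisms over \<open>i\<close> that are continuous, in the strong sense that they
  respect the filtration.
\<close>

definition pser_hom_over ::
  "('r, 'm) ring_scheme \<Rightarrow> ('s, 'n) ring_scheme \<Rightarrow> ('r \<Rightarrow> 's) \<Rightarrow>
    (('v multiset \<Rightarrow> 'r) \<Rightarrow> ('w multiset \<Rightarrow> 's)) \<Rightarrow> bool" where
  "pser_hom_over R S i \<phi> \<longleftrightarrow> \<phi> \<in> ring_hom (pser R) (pser S) \<and>
    (\<forall>a\<in>carrier R. \<phi> (pser_const R a) = pser_const S (i a)) \<and>
    (\<forall>n. \<forall>f\<in>cring.pord R n. \<phi> f \<in> cring.pord S n)"

locale coeff_hom = R: cring R + S: cring S
  for R :: "('r, 'm) ring_scheme" (structure) and S :: "('s, 'n) ring_scheme" (structure) +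
  fixes i :: "'r \<Rightarrow> 's"
  assumes i: "i \<in> ring_hom R S"
begin

lemma i_closed: "a \<in> carrier R \<Longrightarrow> i a \<in> carrier S" using i by (rule ring_hom_closed)
lemma i_add: "a \<in> carrier R \<Longrightarrow> b \<in> carrier R \<Longrightarrow> i (a \<oplus>\<^bsub>R\<^esub> b) = i a \<oplus>\<^bsub>S\<^esub> i b" using i by (rule ring_hom_add)
lemma i_mult: "a \<in> carrier R \<Longrightarrow> b \<in> carrier R \<Longrightarrow> i (a \<otimes>\<^bsub>R\<^esub> b) = i a \<otimes>\<^bsub>S\<^esub> i b" using i by (rule ring_hom_mult)
lemma i_one: "i \<one>\<^bsub>R\<^esub> = \<one>\<^bsub>S\<^esub>" using i by (rule ring_hom_one)
lemma i_zero: "i \<zero>\<^bsub>R\<^esub> = \<zero>\<^bsub>S\<^esub>" using i R.ring_axioms S.ring_axioms by (rule ring_hom_zero)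
lemma i_finsum: "finite A \<Longrightarrow> (\<And>a. a \<in> A \<Longrightarrow> f a \<in> carrier R) \<Longrightarrow> 
    i (finsum R f A) = finsum S (\<lambda>a. i (f a)) A"
  by (rule hom_finsum[OF R.abelian_monoid_axioms S.abelian_monoid_axioms]) (auto simp: i_closed i_add i_zero)

context
  fixes s :: "'v \<Rightarrow> 'w multiset \<Rightarrow> 's"
  assumes s: "\<And>v. s v \<in> S.pord 1"
begin

lemma sc: "s v \<in> carrier (pser S)" using s by (rule S.pord_carrier)
lemma mon_closed: "S.pmon s k \<in> carrier (pser S)" by (rule S.pmon_closed[OF sc])
lemma mon_coeff: "S.pmon s k m \<in> carrier S" by (rule pser_coeff[OF mon_closed])
lemma mon_zero: "size m < size k \<Longrightarrow> S.pmon s k m = \<zero>\<^bsub>S\<^esub>"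
  using S.pmon_pord[OF s] by (rule S.pord_coeff)

lemma psub_any:
  assumes f: "f \<in> carrier (pser R)" and Z: "finite Z" "psupp R (size m) f \<subseteq> Z"
  shows "psub R S i s f m = (\<Oplus>\<^bsub>S\<^esub>k\<in>Z. i (f k) \<otimes>\<^bsub>S\<^esub> S.pmon s k m)"
  unfolding psub_def
proof (rule S.finsum_mono_neutral_cong_left[OF Z])
  fix k assume "k \<in> Z - psupp R (size m) f"
  then have "size m < size k \<or> f k = \<zero>\<^bsub>R\<^esub>" by (auto simp: psupp_def)
  then show "i (f k) \<otimes>\<^bsub>S\<^esub> S.pmon s k m = \<zero>\<^bsub>S\<^esub>"
    using mon_coeff pser_coeff[OF f] by (auto simp: mon_zero i_zero i_closed)
qed (use pser_coeff[OF f] mon_coeff in \<open>auto simp: i_closed\<close>)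

lemma psub_coeff: "f \<in> carrier (pser R) \<Longrightarrow> psub R S i s f m \<in> carrier S"
  unfolding psub_def by (intro S.finsum_closed) (auto simp: i_closed mon_coeff pser_coeff)

lemma psub_closed:
  assumes f: "f \<in> carrier (pser R)"
  shows "psub R S i s f \<in> carrier (pser S)"
proof (rule pser_carrierI)
  fix n
  have "psupp S n (psub R S i s f) \<subseteq> (\<Union>k\<in>psupp R n f. psupp S n (S.pmon s k))"
  proof
    fix m assume m: "m \<in> psupp S n (psub R S i s f)"
    then have n: "size m \<le> n" by (simp add: psupp_def)
    have "psub R S i s f m = (\<Oplus>\<^bsub>S\<^esub>k\<in>psupp R n f. i (f k) \<otimes>\<^bsub>S\<^esub> S.pmon s k m)"
      using n by (intro psub_any[OF f finite_psupp[OF f]]) (auto simp: psupp_def)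
    moreover have "psub R S i s f m \<noteq> \<zero>\<^bsub>S\<^esub>" using m by (simp add: psupp_def)
    ultimately obtain k where "k \<in> psupp R n f" "i (f k) \<otimes>\<^bsub>S\<^esub> S.pmon s k m \<noteq> \<zero>\<^bsub>S\<^esub>"
      using S.finsum_zero_eqI[of "psupp R n f" "\<lambda>k. i (f k) \<otimes>\<^bsub>S\<^esub> S.pmon s k m"] by metis
    then have "k \<in> psupp R n f" "m \<in> psupp S n (S.pmon s k)"
      using n i_closed[OF pser_coeff[OF f]] by (auto simp: psupp_def)
    then show "m \<in> (\<Union>k\<in>psupp R n f. psupp S n (S.pmon s k))" by blast
  qed
  then show "finite (psupp S n (psub R S i s f))"
    by (rule finite_subset) (auto intro!: finite_psupp f mon_closed)
qed (rule psub_coeff[OF f])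

lemma psub_add:
  assumes f: "f \<in> carrier (pser R)" and g: "g \<in> carrier (pser R)"
  shows "psub R S i s (f \<oplus>\<^bsub>pser R\<^esub> g) = psub R S i s f \<oplus>\<^bsub>pser S\<^esub> psub R S i s g"
proof
  fix m :: "'w multiset"
  let ?Z = "psupp R (size m) f \<union> psupp R (size m) g"
  have Z: "finite ?Z" using finite_psupp f g by blast
  have sub: "psupp R (size m) (f \<oplus>\<^bsub>pser R\<^esub> g) \<subseteq> ?Z" by (auto simp: psupp_def pser_add)
  note cs = pser_coeff[OF f] pser_coeff[OF g] mon_coeff
  have "psub R S i s (f \<oplus>\<^bsub>pser R\<^esub> g) m =
      (\<Oplus>\<^bsub>S\<^esub>k\<in>?Z. i (f k) \<otimes>\<^bsub>S\<^esub> S.pmon s k m \<oplus>\<^bsub>S\<^esub> i (g k) \<otimes>\<^bsub>S\<^esub> S.pmon s k m)"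
    unfolding psub_any[OF R.pser_add_closed[OF f g] Z sub]
    using cs by (intro S.finsum_cong') (auto simp: pser_add i_closed i_add S.l_distr)
  also have "\<dots> = psub R S i s f m \<oplus>\<^bsub>S\<^esub> psub R S i s g m"
    unfolding psub_any[OF f Z Un_upper1] psub_any[OF g Z Un_upper2]
    using cs by (subst S.finsum_addf) (auto simp: Pi_def i_closed)
  finally show "psub R S i s (f \<oplus>\<^bsub>pser R\<^esub> g) m = (psub R S i s f \<oplus>\<^bsub>pser S\<^esub> psub R S i s g) m"
    by (simp add: pser_add)
qed

lemma psub_pord:
  assumes f: "f \<in> R.pord n"
  shows "psub R S i s f \<in> S.pord n"
proof -
  have "psub R S i s f m = \<zero>\<^bsub>S\<^esub>" if "size m < n" for m
    unfolding psub_def using that R.pord_coeff[OF f] by (intro S.finsum_zero_eqI) (auto simp: psupp_def)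
  then show ?thesis using psub_closed[OF R.pord_carrier[OF f]] by (simp add: S.pord_def)
qed

lemma psub_const:
  assumes a: "a \<in> carrier R"
  shows "psub R S i s (pser_const R a) = pser_const S (i a)"
proof
  fix m :: "'w multiset"
  have "psub R S i s (pser_const R a) m = (\<Oplus>\<^bsub>S\<^esub>k\<in>{{#}}. i (pser_const R a k) \<otimes>\<^bsub>S\<^esub> S.pmon s k m)"
    by (rule psub_any[OF R.pser_const_closed[OF a]]) (auto simp: psupp_def pser_const_def split: if_splits)
  also have "\<dots> = i a \<otimes>\<^bsub>S\<^esub> S.pmon s {#} m"
    using a mon_coeff by (simp add: S.finsum_insert i_closed pser_const_def)
  also have "\<dots> = pser_const S (i a) m"
    using a by (simp add: S.pmon_empty pser_one pser_const_def i_closed)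
  finally show "psub R S i s (pser_const R a) m = pser_const S (i a) m" .
qed

lemma psub_var: "psub R S i s (pser_var R v) = s v"
proof
  fix m :: "'w multiset"
  have "psub R S i s (pser_var R v) m = (\<Oplus>\<^bsub>S\<^esub>k\<in>{{#v#}}. i (pser_var R v k) \<otimes>\<^bsub>S\<^esub> S.pmon s k m)"
    by (rule psub_any[OF R.pser_var_closed]) (auto simp: psupp_def pser_var_def split: if_splits)
  also have "\<dots> = \<one>\<^bsub>S\<^esub> \<otimes>\<^bsub>S\<^esub> S.pmon s {#v#} m"
    using mon_coeff by (simp add: S.finsum_insert i_closed i_one pser_var_def)
  also have "\<dots> = s v m"
    using mon_coeff[of "{#v#}" m] S.pmon_single[of s v, OF sc] by simp
  finally show "psub R S i s (pser_var R v) m = s v m" .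
qed

lemma psub_partial:
  fixes n :: nat
  assumes f: "f \<in> carrier (pser R)"
  defines "P \<equiv> finsum (pser S) (\<lambda>k. pser_const S (i (f k)) \<otimes>\<^bsub>pser S\<^esub> S.pmon s k) (psupp R n f)"
  shows "P \<in> carrier (pser S)" "psub R S i s f \<ominus>\<^bsub>pser S\<^esub> P \<in> S.pord (Suc n)"
proof -
  interpret PS: cring "pser S :: ('w multiset \<Rightarrow> 's) ring" by (rule S.pser_cring)
  have c: "pser_const S (i (f k)) \<otimes>\<^bsub>pser S\<^esub> S.pmon s k \<in> carrier (pser S)" for k
    using pser_coeff[OF f] by (intro S.pser_mult_closed S.pser_const_closed mon_closed) (simp add: i_closed)
  show P: "P \<in> carrier (pser S)" unfolding P_def using c by (intro PS.finsum_closed) auto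
  have "psub R S i s f m = P m" if "size m \<le> n" for m
  proof -
    have "psub R S i s f m = (\<Oplus>\<^bsub>S\<^esub>k\<in>psupp R n f. i (f k) \<otimes>\<^bsub>S\<^esub> S.pmon s k m)"
      using that by (intro psub_any[OF f finite_psupp[OF f]]) (auto simp: psupp_def)
    also have "\<dots> = P m"
      unfolding P_def using c pser_coeff[OF f] mon_coeff
      by (subst S.pser_finsum_apply[OF finite_psupp[OF f]]) (auto simp: S.pser_const_mult i_closed)
    finally show ?thesis .
  qed
  then show "psub R S i s f \<ominus>\<^bsub>pser S\<^esub> P \<in> S.pord (Suc n)"
    using psub_closed[OF f] P by (simp add: S.pord_minus_iff)
qed

text \<open>
  Up to degree \<open>n\<close> both factors are finite sums \<open>\<Sum> i(f\<^sub>k)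
  s\<^sup>k\<close>, for which multiplicativity is the rule \<open>s\<^sup>a s\<^sup>b =
  s\<^sup>a\<^sup>+\<^sup>b\<close> and a rearrangement.
\<close>

lemma psub_mult:
  assumes f: "f \<in> carrier (pser R)" and g: "g \<in> carrier (pser R)"
  shows "psub R S i s (f \<otimes>\<^bsub>pser R\<^esub> g) = psub R S i s f \<otimes>\<^bsub>pser S\<^esub> psub R S i s g"
proof
  fix m :: "'w multiset"
  interpret PS: cring "pser S :: ('w multiset \<Rightarrow> 's) ring" by (rule S.pser_cring)
  let ?n = "size m"
  let ?A = "psupp R ?n f" and ?B = "psupp R ?n g"
  note cf = pser_coeff[OF f] and cg = pser_coeff[OF g]
  note fA = finite_psupp[OF f, of ?n] and fB = finite_psupp[OF g, of ?n]
  let ?t = "\<lambda>h k. pser_const S (i (h k)) \<otimes>\<^bsub>pser S\<^esub> S.pmon s k"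
  have tf: "?t f k \<in> carrier (pser S)" for k
    using cf by (intro S.pser_mult_closed S.pser_const_closed mon_closed) (simp add: i_closed)
  have tg: "?t g k \<in> carrier (pser S)" for k
    using cg by (intro S.pser_mult_closed S.pser_const_closed mon_closed) (simp add: i_closed)
  let ?Pf = "finsum (pser S) (?t f) ?A" and ?Pg = "finsum (pser S) (?t g) ?B"
  let ?T = "\<lambda>a b. i (f a) \<otimes>\<^bsub>S\<^esub> i (g b) \<otimes>\<^bsub>S\<^esub> S.pmon s (a + b) m"
  have Tc: "?T a b \<in> carrier S" for a b using cf cg mon_coeff by (simp add: i_closed)
  have "psub R S i s f \<otimes>\<^bsub>pser S\<^esub> psub R S i s g \<ominus>\<^bsub>pser S\<^esub> ?Pf \<otimes>\<^bsub>pser S\<^esub> ?Pg =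
      (psub R S i s f \<ominus>\<^bsub>pser S\<^esub> ?Pf) \<otimes>\<^bsub>pser S\<^esub> psub R S i s g \<oplus>\<^bsub>pser S\<^esub>
      ?Pf \<otimes>\<^bsub>pser S\<^esub> (psub R S i s g \<ominus>\<^bsub>pser S\<^esub> ?Pg)"
    using psub_closed[OF f] psub_closed[OF g] psub_partial(1)[OF f, of ?n] psub_partial(1)[OF g, of ?n]
    by (rule PS.mult_diff_split)
  also have "\<dots> \<in> S.pord (Suc ?n)"
    using psub_partial[OF f] psub_partial[OF g] psub_closed f g
    by (intro S.pord_add S.pord_mult_right S.pord_mult_left) auto
  finally have "(psub R S i s f \<otimes>\<^bsub>pser S\<^esub> psub R S i s g) m = (?Pf \<otimes>\<^bsub>pser S\<^esub> ?Pg) m"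
    using psub_closed f g psub_partial(1)[OF f] psub_partial(1)[OF g]
    by (subst (asm) S.pord_minus_iff) (auto intro!: S.pser_mult_closed)
  also have "?Pf \<otimes>\<^bsub>pser S\<^esub> ?Pg =
      finsum (pser S) (\<lambda>a. finsum (pser S) (\<lambda>b. ?t f a \<otimes>\<^bsub>pser S\<^esub> ?t g b) ?B) ?A"
    using tf tg fA fB
    by (subst PS.finsum_ldistr) (auto simp: PS.finsum_rdistr Pi_def intro!: PS.finsum_cong' PS.finsum_closed)
  also have "\<dots> = finsum (pser S) (\<lambda>p. ?t f (fst p) \<otimes>\<^bsub>pser S\<^esub> ?t g (snd p)) (?A \<times> ?B)"
    using tf tg fA fB by (intro PS.finsum_Sigma') auto
  also have "\<dots> m = (\<Oplus>\<^bsub>S\<^esub>p\<in>?A \<times> ?B. ?T (fst p) (snd p))"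
  proof -
    have "(?t f a \<otimes>\<^bsub>pser S\<^esub> ?t g b) m = ?T a b" for a b
    proof -
      have "?t f a \<otimes>\<^bsub>pser S\<^esub> ?t g b = pser_const S (i (f a)) \<otimes>\<^bsub>pser S\<^esub>
          (pser_const S (i (g b)) \<otimes>\<^bsub>pser S\<^esub> (S.pmon s a \<otimes>\<^bsub>pser S\<^esub> S.pmon s b))"
        using cf cg by (simp add: PS.m_ac mon_closed S.pser_const_closed i_closed)
      also have "\<dots> = (\<lambda>m. i (f a) \<otimes>\<^bsub>S\<^esub> (i (g b) \<otimes>\<^bsub>S\<^esub> S.pmon s (a + b) m))"
        using cf cg mon_coeff by (simp add: S.pmon_add[OF sc, symmetric] S.pser_const_mult i_closed)
      finally show ?thesis using cf cg mon_coeff by (simp add: S.m_assoc i_closed)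
    qed
    then show ?thesis using tf tg fA fB by (subst S.pser_finsum_apply) auto
  qed
  also have "\<dots> = psub R S i s (f \<otimes>\<^bsub>pser R\<^esub> g) m"
  proof -
    \<comment> \<open>the sum is extended to the products of monomials of \<open>f\<close> and
      \<open>g\<close>, some of which have degree above \<open>n\<close>\<close>
    let ?Z = "(\<lambda>p. fst p + snd p) ` (?A \<times> ?B) \<union> psupp R ?n (f \<otimes>\<^bsub>pser R\<^esub> g)"
    have Z: "finite ?Z" using fA fB finite_psupp[OF R.pser_mult_closed[OF f g]] by blast
    have "psub R S i s (f \<otimes>\<^bsub>pser R\<^esub> g) m =
        (\<Oplus>\<^bsub>S\<^esub>k\<in>?Z. i ((f \<otimes>\<^bsub>pser R\<^esub> g) k) \<otimes>\<^bsub>S\<^esub> S.pmon s k m)"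
      by (rule psub_any[OF R.pser_mult_closed[OF f g] Z]) auto
    also have "\<dots> = (\<Oplus>\<^bsub>S\<^esub>k\<in>?Z. \<Oplus>\<^bsub>S\<^esub>p\<in>splits k. i (f (fst p)) \<otimes>\<^bsub>S\<^esub> i (g (snd p)) \<otimes>\<^bsub>S\<^esub> S.pmon s k m)"
    proof (rule S.finsum_cong')
      fix k
      have "i ((f \<otimes>\<^bsub>pser R\<^esub> g) k) = (\<Oplus>\<^bsub>S\<^esub>p\<in>splits k. i (f (fst p)) \<otimes>\<^bsub>S\<^esub> i (g (snd p)))"
        using cf cg by (simp add: R.pser_mult i_finsum i_mult)
      then show "i ((f \<otimes>\<^bsub>pser R\<^esub> g) k) \<otimes>\<^bsub>S\<^esub> S.pmon s k m =
          (\<Oplus>\<^bsub>S\<^esub>p\<in>splits k. i (f (fst p)) \<otimes>\<^bsub>S\<^esub> i (g (snd p)) \<otimes>\<^bsub>S\<^esub> S.pmon s k m)"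
        using cf cg mon_coeff by (simp add: S.finsum_ldistr Pi_def i_closed)
    qed (use cf cg mon_coeff in \<open>auto intro!: S.finsum_closed simp: i_closed\<close>)
    also have "\<dots> = (\<Oplus>\<^bsub>S\<^esub>z\<in>Sigma ?Z splits.
        i (f (fst (snd z))) \<otimes>\<^bsub>S\<^esub> i (g (snd (snd z))) \<otimes>\<^bsub>S\<^esub> S.pmon s (fst z) m)"
      using Z cf cg mon_coeff by (intro S.finsum_Sigma') (auto simp: i_closed)
    also have "\<dots> = (\<Oplus>\<^bsub>S\<^esub>z\<in>(\<lambda>p. (fst p + snd p, p)) ` (?A \<times> ?B).
        i (f (fst (snd z))) \<otimes>\<^bsub>S\<^esub> i (g (snd (snd z))) \<otimes>\<^bsub>S\<^esub> S.pmon s (fst z) m)"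
    proof (rule S.finsum_mono_neutral_cong_left[symmetric])
      show "finite (Sigma ?Z splits)" using Z by (intro finite_SigmaI) auto
      show "(\<lambda>p. (fst p + snd p, p)) ` (?A \<times> ?B) \<subseteq> Sigma ?Z splits"
        by (force simp: splits_def)
      fix z assume z: "z \<in> Sigma ?Z splits - (\<lambda>p. (fst p + snd p, p)) ` (?A \<times> ?B)"
      obtain k a b where zz: "z = (k, a, b)" by (metis prod.collapse)
      with z have ab: "a + b = k" "(a, b) \<notin> ?A \<times> ?B" by (force simp: splits_def)+
      then have "f a = \<zero>\<^bsub>R\<^esub> \<or> g b = \<zero>\<^bsub>R\<^esub> \<or> size m < size k" by (auto simp: psupp_def)
      then show "i (f (fst (snd z))) \<otimes>\<^bsub>S\<^esub> i (g (snd (snd z))) \<otimes>\<^bsub>S\<^esub> S.pmon s (fst z) m = \<zero>\<^bsub>S\<^esub>"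
        using cf cg mon_coeff by (auto simp: zz i_zero mon_zero i_closed)
    qed (use cf cg mon_coeff in \<open>auto simp: i_closed\<close>)
    also have "\<dots> = (\<Oplus>\<^bsub>S\<^esub>p\<in>?A \<times> ?B. ?T (fst p) (snd p))"
      by (rule S.finsum_bij[symmetric, where h = "\<lambda>p. (fst p + snd p, p)"])
        (use cf cg mon_coeff in \<open>auto simp: i_closed bij_betw_def inj_on_def\<close>)
    finally show ?thesis by simp
  qed
  finally show "psub R S i s (f \<otimes>\<^bsub>pser R\<^esub> g) m = (psub R S i s f \<otimes>\<^bsub>pser S\<^esub> psub R S i s g) m" by simp
qed

lemma psub_hom: "pser_hom_over R S i (psub R S i s)"
  unfolding pser_hom_over_def
proof (intro conjI ballI allI)
  show "psub R S i s \<in> ring_hom (pser R) (pser S)"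
    by (rule ring_hom_memI)
      (auto simp: psub_closed psub_mult psub_add pser_one psub_const i_one)
qed (auto simp: psub_const psub_pord)

end

end

lemma pser_hom_overD:
  assumes "pser_hom_over R S i \<phi>"
  shows "\<phi> \<in> ring_hom (pser R) (pser S)"
    "\<And>a. a \<in> carrier R \<Longrightarrow> \<phi> (pser_const R a) = pser_const S (i a)"
    "\<And>f n. f \<in> cring.pord R n \<Longrightarrow> \<phi> f \<in> cring.pord S n"
    "\<And>f. f \<in> carrier (pser R) \<Longrightarrow> \<phi> f \<in> carrier (pser S)"
    "\<And>f g. f \<in> carrier (pser R) \<Longrightarrow> g \<in> carrier (pser R) \<Longrightarrow> \<phi> (f \<oplus>\<^bsub>pser R\<^esub> g) = \<phi> f \<oplus>\<^bsub>pser S\<^esub> \<phi> g"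
    "\<And>f g. f \<in> carrier (pser R) \<Longrightarrow> g \<in> carrier (pser R) \<Longrightarrow> \<phi> (f \<otimes>\<^bsub>pser R\<^esub> g) = \<phi> f \<otimes>\<^bsub>pser S\<^esub> \<phi> g"
  using assms unfolding pser_hom_over_def ring_hom_def by auto

lemma pser_hom_over_minus:
  assumes R: "cring R" and S: "cring S" and h: "pser_hom_over R S i \<phi>"
    and f: "f \<in> carrier (pser R)" and g: "g \<in> carrier (pser R)"
  shows "\<phi> (f \<ominus>\<^bsub>pser R\<^esub> g) = \<phi> f \<ominus>\<^bsub>pser S\<^esub> \<phi> g"
proof -
  interpret R: cring R by fact
  interpret S: cring S by fact
  interpret H: ring_hom_cring "pser R" "pser S" \<phi>
    using pser_hom_overD(1)[OF h] by (intro ring_hom_cringI R.pser_cring S.pser_cring)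
  show ?thesis using f g by (simp add: a_minus_def)
qed

text \<open>
  Such homomorphisms are determined by their values on constants and variables, by density of the
  polynomials. This replaces all computations with nested substitutions below.
\<close>

lemma pser_hom_over_eq:
  fixes f :: "'v multiset \<Rightarrow> 'r" and \<phi> \<psi> :: "_ \<Rightarrow> 'w multiset \<Rightarrow> 's"
  assumes R: "cring R" and S: "cring S"
    and h: "pser_hom_over R S i \<phi>" "pser_hom_over R S j \<psi>"
    and ij: "\<And>a. a \<in> carrier R \<Longrightarrow> i a = j a"
    and var: "\<And>v. \<phi> (pser_var R v) = \<psi> (pser_var R v)"
    and f: "f \<in> carrier (pser R)"
  shows "\<phi> f = \<psi> f"
proof -
  interpret R: cring R by fact
  interpret S: cring S by fact
  interpret P: cring "pser R :: ('v multiset \<Rightarrow> 'r) ring" by (rule R.pser_cring)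
  interpret PS: cring "pser S :: ('w multiset \<Rightarrow> 's) ring" by (rule S.pser_cring)
  note h1 = pser_hom_overD[OF h(1)] and h2 = pser_hom_overD[OF h(2)]
  show ?thesis using f
  proof (induction f rule: R.pser_closed_induct)
    case (closed f)
    show ?case
    proof (rule S.pser_eqI)
      fix n
      from closed(2)[of n] obtain g where g: "g \<in> carrier (pser R)" "\<phi> g = \<psi> g" "f \<ominus>\<^bsub>pser R\<^esub> g \<in> R.pord n" by blast
      have "\<phi> f \<ominus>\<^bsub>pser S\<^esub> \<psi> f = (\<phi> f \<ominus>\<^bsub>pser S\<^esub> \<phi> g) \<ominus>\<^bsub>pser S\<^esub> (\<psi> f \<ominus>\<^bsub>pser S\<^esub> \<psi> g)"
        unfolding g(2) using closed g h1(4) h2(4) by (intro PS.diff_diff_split) auto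
      also have "\<dots> = \<phi> (f \<ominus>\<^bsub>pser R\<^esub> g) \<ominus>\<^bsub>pser S\<^esub> \<psi> (f \<ominus>\<^bsub>pser R\<^esub> g)"
        using closed g h by (simp add: pser_hom_over_minus[OF R S])
      also have "\<dots> \<in> S.pord n" by (intro S.pord_minus h1(3) h2(3) g)
      finally show "\<phi> f \<ominus>\<^bsub>pser S\<^esub> \<psi> f \<in> S.pord n" .
    qed (use closed h1 h2 in auto)
  qed (use h1 h2 ij var in auto)
qed

lemma pser_hom_over_comp:
  assumes "pser_hom_over R S i \<phi>" "pser_hom_over S T j \<psi>" "i \<in> ring_hom R S"
  shows "pser_hom_over R T (\<lambda>a. j (i a)) (\<lambda>f. \<psi> (\<phi> f))"
proof -
  have "\<psi> \<circ> \<phi> \<in> ring_hom (pser R) (pser T)"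
    using assms ring_hom_trans by (metis pser_hom_overD(1))
  moreover have "i a \<in> carrier S" if "a \<in> carrier R" for a using assms(3) that by (rule ring_hom_closed)
  ultimately show ?thesis using assms(1,2) unfolding pser_hom_over_def by (auto simp: comp_def)
qed

lemma pser_hom_over_id: "pser_hom_over R R (\<lambda>a. a) (\<lambda>f. f)"
  unfolding pser_hom_over_def by (auto simp: ring_hom_def)

lemma id_ring_hom: "(\<lambda>a. a) \<in> ring_hom R R" by (auto simp: ring_hom_def)

lemma (in cring) id_coeff_hom: "coeff_hom R R (\<lambda>a. a)"
  by unfold_locales (rule id_ring_hom)

text \<open>
  The point \<open>(f, g)\<close> at which a series in the variables \<open>0\<close> and
  \<open>1\<close> is evaluated.
\<close>

definition pair_fun :: "'x \<Rightarrow> 'x \<Rightarrow> nat \<Rightarrow> 'x" where "pair_fun f g v = (if v = 0 then f else g)"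

section \<open>Fixed points of contractions\<close>

context cring begin

text \<open>
  Completeness: the coefficients of a sequence whose increments have increasing order become
  stationary.
\<close>

lemma pord_limit:
  fixes a :: "nat \<Rightarrow> 'v multiset \<Rightarrow> 'a"
  assumes a: "\<And>n. a n \<in> carrier (pser R)" and d: "\<And>n. a (Suc n) \<ominus>\<^bsub>pser R\<^esub> a n \<in> pord n"
  shows "\<exists>f\<in>carrier (pser R). \<forall>n. f \<ominus>\<^bsub>pser R\<^esub> a n \<in> pord n"
proof -
  define f where "f = (\<lambda>m. a (Suc (size m)) m)"
  have step: "a (Suc n) m = a n m" if "size m < n" for n m
    using d[of n] that a by (simp add: pord_minus_iff)
  have eq: "a (k + n) m = a n m" if "size m < n" for k n m
    using that by (induction k) (simp_all add: step)
  have fa: "f m = a n m" if "size m < n" for n m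
    using eq[of m "Suc (size m)" "n - Suc (size m)"] that by (simp add: f_def)
  have f: "f \<in> carrier (pser R)"
  proof (rule pser_carrierI)
    fix n
    have "psupp R n f = psupp R n (a (Suc n))" by (auto simp: psupp_def fa[of _ "Suc n"])
    then show "finite (psupp R n f)" using finite_psupp[OF a] by simp
  qed (simp add: f_def pser_coeff[OF a])
  then show ?thesis using a fa by (intro bexI[of _ f]) (auto simp: pord_minus_iff)
qed

text \<open>
  Banach's fixed point theorem for the order filtration; it is the source of inverses of units, of
  the formal inverse, and of the isomorphism of formal group laws.
\<close>

lemma contraction_exists:
  fixes X :: "('v multiset \<Rightarrow> 'a) set"
  assumes X: "X \<subseteq> carrier (pser R)" "x \<in> X" "\<And>f. f \<in> X \<Longrightarrow> T f \<in> X"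
    and closed: "\<And>f. f \<in> carrier (pser R) \<Longrightarrow> \<forall>n. \<exists>g\<in>X. f \<ominus>\<^bsub>pser R\<^esub> g \<in> pord n \<Longrightarrow> f \<in> X"
    and T: "\<And>f g n. f \<in> X \<Longrightarrow> g \<in> X \<Longrightarrow> f \<ominus>\<^bsub>pser R\<^esub> g \<in> pord n \<Longrightarrow> T f \<ominus>\<^bsub>pser R\<^esub> T g \<in> pord (Suc n)"
  shows "\<exists>f\<in>X. T f = f"
proof -
  interpret P: cring "pser R :: ('v multiset \<Rightarrow> 'a) ring" by (rule pser_cring)
  define a where "a n = (T ^^ n) x" for n
  have aX: "a n \<in> X" for n unfolding a_def using X by (induction n) auto
  have aS: "a (Suc n) = T (a n)" for n by (simp add: a_def)
  have ac: "a n \<in> carrier (pser R)" for n using aX X by blast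
  have d: "a (Suc n) \<ominus>\<^bsub>pser R\<^esub> a n \<in> pord n" for n
  proof (induction n)
    case 0
    show ?case using ac by (simp add: pord_0)
  next
    case (Suc n)
    then show ?case using T[OF aX aX, of "Suc n" n n] by (simp add: aS)
  qed
  obtain f where f: "f \<in> carrier (pser R)" "\<And>n. f \<ominus>\<^bsub>pser R\<^esub> a n \<in> pord n"
    using pord_limit[of a, OF ac d] by blast
  have fX: "f \<in> X" using f aX by (intro closed) blast+
  have Tc: "T f \<in> carrier (pser R)" using X fX by blast
  have "T f = f"
  proof (rule pser_eqI[OF Tc f(1)])
    fix n
    have "T f \<ominus>\<^bsub>pser R\<^esub> a (Suc n) \<in> pord (Suc n)" using T[OF fX aX f(2)] by (simp add: aS)
    from pord_minus[OF this f(2)[of "Suc n"]]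
    have "T f \<ominus>\<^bsub>pser R\<^esub> f \<in> pord (Suc n)"
      using P.diff_diff_split[OF Tc f(1) ac] by simp
    then show "T f \<ominus>\<^bsub>pser R\<^esub> f \<in> pord n" by (rule pord_mono) simp
  qed
  with fX show ?thesis by blast
qed

lemma pord_closed:
  assumes f: "f \<in> carrier (pser R)" and a: "\<forall>n. \<exists>g\<in>pord k. f \<ominus>\<^bsub>pser R\<^esub> g \<in> pord n"
  shows "f \<in> pord k"
proof -
  from a obtain g where g: "g \<in> pord k" "f \<ominus>\<^bsub>pser R\<^esub> g \<in> pord k" by blast
  then have "f m = g m" if "size m < k" for m
    using f that pord_carrier[OF g(1)] by (auto simp: pord_minus_iff)
  then show ?thesis using f g(1) by (auto simp: pord_def)
qed

section \<open>Comparison of substitutions\<close>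

abbreviation psub1 where "psub1 \<equiv> psub R R (\<lambda>a. a)"

lemma psub1_hom:
  assumes "\<And>v. s v \<in> pord 1"
  shows "pser_hom_over R R (\<lambda>a. a) (psub1 s)"
  using coeff_hom.psub_hom[OF id_coeff_hom assms] .

lemmas psub1D = pser_hom_overD[OF psub1_hom]

lemma psub1_var:
  assumes "\<And>v. s v \<in> pord 1"
  shows "psub1 s (pser_var R v) = s v"
  using coeff_hom.psub_var[OF id_coeff_hom assms] .

lemma pmon_diff:
  fixes s t :: "'v \<Rightarrow> 'w multiset \<Rightarrow> 'a"
  assumes s: "\<And>v. s v \<in> pord 1" and t: "\<And>v. t v \<in> pord 1"
    and d: "\<And>v. s v \<ominus>\<^bsub>pser R\<^esub> t v \<in> pord n"
  shows "pmon s k \<ominus>\<^bsub>pser R\<^esub> pmon t k \<in> pord (n + size k - 1)"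
proof (induction k)
  case empty
  interpret P: cring "pser R :: ('w multiset \<Rightarrow> 'a) ring" by (rule pser_cring)
  show ?case using pord_zero by (simp add: pmon_empty a_minus_def P.r_neg)
next
  case (add v k)
  interpret P: cring "pser R :: ('w multiset \<Rightarrow> 'a) ring" by (rule pser_cring)
  note sc = pord_carrier[OF s] and tc = pord_carrier[OF t]
  have "pmon s (add_mset v k) \<ominus>\<^bsub>pser R\<^esub> pmon t (add_mset v k) =
      (s v \<ominus>\<^bsub>pser R\<^esub> t v) \<otimes>\<^bsub>pser R\<^esub> pmon s k \<oplus>\<^bsub>pser R\<^esub> t v \<otimes>\<^bsub>pser R\<^esub> (pmon s k \<ominus>\<^bsub>pser R\<^esub> pmon t k)"
    unfolding pmon_add_mset[where s = s, OF sc] pmon_add_mset[where s = t, OF tc]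
    by (rule P.mult_diff_split[OF sc pmon_closed[OF sc] tc pmon_closed[OF tc]])
  moreover have "(s v \<ominus>\<^bsub>pser R\<^esub> t v) \<otimes>\<^bsub>pser R\<^esub> pmon s k \<in> pord (n + size k)"
    by (rule pord_mult[OF d pmon_pord[OF s]])
  moreover have "t v \<otimes>\<^bsub>pser R\<^esub> (pmon s k \<ominus>\<^bsub>pser R\<^esub> pmon t k) \<in> pord (n + size k)"
  proof (cases "k = {#}")
    case True
    then have "pmon s k \<ominus>\<^bsub>pser R\<^esub> pmon t k = \<zero>\<^bsub>pser R\<^esub>" by (simp add: pmon_empty a_minus_def P.r_neg)
    then show ?thesis using tc pord_zero by simp
  next
    case False
    then have "0 < size k" by (simp add: nonempty_has_size)
    then show ?thesis using pord_mult[OF t add, of v] by simp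
  qed
  ultimately show ?case using pord_add by simp
qed

text \<open>
  In a series of order \<open>k\<close> each monomial is a product of at least \<open>k\<close>
  factors. Replacing them one after the other leaves at least \<open>k - 1\<close> factors of
  order one besides the difference of order \<open>n\<close>.
\<close>

lemma psub1_diff:
  fixes s t :: "'v \<Rightarrow> 'w multiset \<Rightarrow> 'a"
  assumes s: "\<And>v. s v \<in> pord 1" and t: "\<And>v. t v \<in> pord 1"
    and d: "\<And>v. s v \<ominus>\<^bsub>pser R\<^esub> t v \<in> pord n" and f: "f \<in> pord k"
  shows "psub1 s f \<ominus>\<^bsub>pser R\<^esub> psub1 t f \<in> pord (n + k - 1)"
proof -
  note cs = pmon_closed[of s, OF pord_carrier[OF s]] and ct = pmon_closed[of t, OF pord_carrier[OF t]]
  note fc = pser_coeff[OF pord_carrier[OF f]]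
  have "psub1 s f m = psub1 t f m" if m: "size m < n + k - 1" for m
    unfolding psub_def
  proof (rule finsum_cong')
    fix l assume l: "l \<in> psupp R (size m) f"
    then have "k \<le> size l" using pord_coeff[OF f, of l] by (auto simp: psupp_def not_less[symmetric])
    then have "size m < n + size l - 1" using m by linarith
    then have "pmon s l m = pmon t l m"
      using pmon_diff[where s = s and t = t and k = l, OF s t d] cs ct by (simp add: pord_minus_iff)
    then show "f l \<otimes> pmon s l m = f l \<otimes> pmon t l m" by simp
  qed (use fc pser_coeff[OF ct] in auto)
  then show ?thesis
    using psub1D(4)[of s f, OF s] psub1D(4)[of t f, OF t] pord_carrier[OF f] by (simp add: pord_minus_iff)
qed

section \<open>Two-variable substitution\<close>

text \<open>
  The series \<open>F(u, v)\<close> with \<open>u\<close> and \<open>v\<close> the variables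
  \<open>0\<close> and \<open>1\<close>. The other natural numbers are variables that do not
  occur.
\<close>

definition fgl_ser :: "(nat \<Rightarrow> nat \<Rightarrow> 'a) \<Rightarrow> nat multiset \<Rightarrow> 'a" where
  "fgl_ser F m = (if set_mset m \<subseteq> {0, 1} then F (count m 0) (count m 1) else \<zero>)"

lemma mset01: "set_mset m \<subseteq> {0, 1} \<Longrightarrow> m = replicate_mset (count m 0) 0 + replicate_mset (count m 1) (1 :: nat)"
  by (rule multiset_eqI) (auto simp: Multiset.not_in_iff[symmetric])

lemma mset01_count [simp]:
  "count (replicate_mset i 0 + replicate_mset j (1 :: nat)) 0 = i"
  "count (replicate_mset i 0 + replicate_mset j (1 :: nat)) 1 = j"
  by auto

lemma mset01_set: "set_mset (replicate_mset i 0 + replicate_mset j (1 :: nat)) \<subseteq> {0, 1}" by auto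

lemma fgl_ser_closed:
  assumes F: "\<And>i j. F i j \<in> carrier R"
  shows "fgl_ser F \<in> carrier (pser R)"
proof (rule pser_carrierI)
  fix n
  have "psupp R n (fgl_ser F) \<subseteq> (\<lambda>(i, j). replicate_mset i 0 + replicate_mset j 1) ` ({..n} \<times> {..n})"
  proof
    fix m :: "nat multiset" assume m: "m \<in> psupp R n (fgl_ser F)"
    then have s: "set_mset m \<subseteq> {0, 1}" by (auto simp: psupp_def fgl_ser_def split: if_splits)
    moreover have "count m 0 \<le> n" "count m 1 \<le> n"
      using m count_le_size[of m] order_trans by (auto simp: psupp_def)+
    ultimately show "m \<in> (\<lambda>(i, j). replicate_mset i 0 + replicate_mset j 1) ` ({..n} \<times> {..n})"
      using mset01[OF s] by (intro image_eqI[where x = "(count m 0, count m 1)"]) auto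
  qed
  then show "finite (psupp R n (fgl_ser F))" by (rule finite_subset) auto
qed (simp add: fgl_ser_def F)

lemma pair_fun_pord: "f \<in> pord k \<Longrightarrow> g \<in> pord k \<Longrightarrow> pair_fun f g v \<in> pord k" by (simp add: pair_fun_def)

lemma pmon_replicate:
  fixes s :: "'v \<Rightarrow> 'w multiset \<Rightarrow> 'a"
  assumes s: "\<And>v. s v \<in> carrier (pser R)"
  shows "pmon s (replicate_mset n v) = s v [^]\<^bsub>pser R\<^esub> n"
proof (induction n)
  case 0
  interpret P: cring "pser R :: ('w multiset \<Rightarrow> 'a) ring" by (rule pser_cring)
  show ?case by (simp add: pmon_empty)
next
  case (Suc n)
  interpret P: cring "pser R :: ('w multiset \<Rightarrow> 'a) ring" by (rule pser_cring)
  show ?case using s Suc by (simp add: pmon_add_mset[where s = s, OF s] P.m_comm)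
qed

text \<open>
  The substitutions of the definition of formal group laws are instances of \<open>psub\<close>,
  and thus covered by the uniqueness of continuous homomorphisms.
\<close>

lemma subst2_psub:
  fixes f g :: "'w multiset \<Rightarrow> 'a"
  assumes F: "\<And>i j. F i j \<in> carrier R" and f: "f \<in> pord 1" and g: "g \<in> pord 1"
  shows "pser_subst2 R F f g = psub1 (pair_fun f g) (fgl_ser F)"
proof
  fix m :: "'w multiset"
  interpret H: coeff_hom R R "\<lambda>a. a" by (rule id_coeff_hom)
  let ?s = "pair_fun f g" and ?n = "size m"
  let ?I = "{(i, j). i + j \<le> ?n}"
  let ?h = "\<lambda>p. replicate_mset (fst p) 0 + replicate_mset (snd p) (1 :: nat)"
  have s: "?s v \<in> pord 1" for v using f g by (rule pair_fun_pord)
  have fI: "finite ?I" by (rule finite_subset[of _ "{..?n} \<times> {..?n}"]) auto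
  have mon: "pmon ?s (?h p) = f [^]\<^bsub>pser R\<^esub> fst p \<otimes>\<^bsub>pser R\<^esub> g [^]\<^bsub>pser R\<^esub> snd p" for p
    unfolding pmon_add[where s = ?s, OF pord_carrier[OF s]] pmon_replicate[where s = ?s, OF pord_carrier[OF s]]
    by (simp add: pair_fun_def)
  have "psub1 ?s (fgl_ser F) m = (\<Oplus>k\<in>?h ` ?I. fgl_ser F k \<otimes> pmon ?s k m)"
  proof (rule H.psub_any[OF s fgl_ser_closed[OF F]])
    show "psupp R ?n (fgl_ser F) \<subseteq> ?h ` ?I"
    proof
      fix k assume k: "k \<in> psupp R ?n (fgl_ser F)"
      then have s: "set_mset k \<subseteq> {0, 1}" by (auto simp: psupp_def fgl_ser_def split: if_splits)
      have "count k 0 + count k 1 = size k" 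
        by (subst (3) mset01[OF s]) (simp del: One_nat_def)
      then show "k \<in> ?h ` ?I"
        using mset01[OF s] k by (intro image_eqI[where x = "(count k 0, count k 1)"]) (auto simp: psupp_def)
    qed
  qed (use fI in auto)
  also have "\<dots> = (\<Oplus>p\<in>?I. F (fst p) (snd p) \<otimes> (f [^]\<^bsub>pser R\<^esub> fst p \<otimes>\<^bsub>pser R\<^esub> g [^]\<^bsub>pser R\<^esub> snd p) m)"
  proof (rule finsum_bij[symmetric, where h = ?h])
    show "bij_betw ?h ?I (?h ` ?I)"
      by (rule inj_on_imp_bij_betw, rule inj_onI) (metis mset01_count prod.collapse)
    show "fgl_ser F k \<otimes> pmon ?s k m \<in> carrier R" for k
      using pser_coeff[OF fgl_ser_closed[of F, OF F], of k] H.mon_coeff[of ?s k m, OF s] by simp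
    show "F (fst p) (snd p) \<otimes> (f [^]\<^bsub>pser R\<^esub> fst p \<otimes>\<^bsub>pser R\<^esub> g [^]\<^bsub>pser R\<^esub> snd p) m =
        fgl_ser F (?h p) \<otimes> pmon ?s (?h p) m" for p
      unfolding mon using mset01_set[of "fst p" "snd p"] by (simp add: fgl_ser_def del: One_nat_def)
  qed
  also have "\<dots> = pser_subst2 R F f g m" by (simp add: pser_subst2_def)
  finally show "pser_subst2 R F f g m = psub1 ?s (fgl_ser F) m" by simp
qed

lemma unit_mset: "m = replicate_mset (size m) ()"
  by (induction m) auto

text \<open>
  Series in one variable are indexed by multisets over the unit type, that is, by exponents.
\<close>

definition ser1 :: "(nat \<Rightarrow> 'a) \<Rightarrow> unit multiset \<Rightarrow> 'a" where "ser1 c m = c (size m)"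

lemma pser_unit_closed:
  fixes f :: "unit multiset \<Rightarrow> 'a"
  assumes "\<And>m. f m \<in> carrier R"
  shows "f \<in> carrier (pser R)"
proof (rule pser_carrierI)
  fix n
  have "psupp R n f \<subseteq> (\<lambda>k. replicate_mset k ()) ` {..n}"
  proof
    fix m assume "m \<in> psupp R n f"
    then show "m \<in> (\<lambda>k. replicate_mset k ()) ` {..n}"
      by (intro image_eqI[where x = "size m"] unit_mset) (simp add: psupp_def)
  qed
  then show "finite (psupp R n f)" by (rule finite_subset) auto
qed (rule assms)

lemma subst1_psub:
  fixes f :: "'w multiset \<Rightarrow> 'a"
  assumes c: "\<And>k. c k \<in> carrier R" and f: "f \<in> pord 1"
  shows "pser_subst1 R c f = psub1 (\<lambda>_. f) (ser1 c)"
proof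
  fix m :: "'w multiset"
  interpret H: coeff_hom R R "\<lambda>a. a" by (rule id_coeff_hom)
  let ?h = "\<lambda>k. replicate_mset k ()"
  have mon: "pmon (\<lambda>_. f) (?h k) = f [^]\<^bsub>pser R\<^esub> k" for k
    by (rule pmon_replicate[where s = "\<lambda>_. f", OF pord_carrier[OF f]])
  have "psub1 (\<lambda>_. f) (ser1 c) m = (\<Oplus>k\<in>?h ` {..size m}. ser1 c k \<otimes> pmon (\<lambda>_. f) k m)"
  proof (rule H.psub_any)
    show "psupp R (size m) (ser1 c) \<subseteq> ?h ` {..size m}"
    proof
      fix k assume "k \<in> psupp R (size m) (ser1 c)"
      then show "k \<in> ?h ` {..size m}"
        by (intro image_eqI[where x = "size k"] unit_mset) (simp add: psupp_def)
    qed
  qed (use f c in \<open>auto simp: ser1_def intro!: pser_unit_closed\<close>)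
  also have "\<dots> = (\<Oplus>k\<in>{..size m}. c k \<otimes> (f [^]\<^bsub>pser R\<^esub> k) m)"
  proof (rule finsum_bij[symmetric, where h = ?h])
    show "bij_betw ?h {..size m} (?h ` {..size m})"
      by (rule inj_on_imp_bij_betw, rule inj_onI) (metis size_replicate_mset)
    show "ser1 c k \<otimes> pmon (\<lambda>_. f) k m \<in> carrier R" for k
      using c H.mon_coeff[of "\<lambda>_::unit. f" k m] f by (simp add: ser1_def)
  qed (simp add: mon ser1_def)
  also have "\<dots> = pser_subst1 R c f m" by (simp add: pser_subst1_def)
  finally show "pser_subst1 R c f m = psub1 (\<lambda>_. f) (ser1 c) m" by simp
qed

end

context coeff_hom begin

text \<open>
  Both sides are continuous homomorphisms in \<open>f\<close> with the same value on the
  variables.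
\<close>

lemma hom_psub1:
  fixes \<phi> :: "('w multiset \<Rightarrow> 'r) \<Rightarrow> 'x multiset \<Rightarrow> 's" and s :: "'v \<Rightarrow> 'w multiset \<Rightarrow> 'r"
  assumes \<phi>: "pser_hom_over R S i \<phi>" and s: "\<And>v. s v \<in> R.pord 1" and f: "f \<in> carrier (pser R)"
  shows "\<phi> (R.psub1 s f) = psub R S i (\<lambda>v. \<phi> (s v)) f"
proof -
  have ps: "\<phi> (s v) \<in> S.pord 1" for v by (rule pser_hom_overD(3)[OF \<phi> s])
  have "pser_hom_over R S i (\<lambda>f. \<phi> (R.psub1 s f))"
    using pser_hom_over_comp[OF R.psub1_hom[of s, OF s] \<phi> id_ring_hom] .
  from pser_hom_over_eq[OF R.cring_axioms S.cring_axioms this psub_hom[of "\<lambda>v. \<phi> (s v)", OF ps] _ _ f]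
  show ?thesis using psub_var[of "\<lambda>v. \<phi> (s v)", OF ps] R.psub1_var[of s, OF s] by simp
qed

lemma psub_factor:
  fixes s :: "'v \<Rightarrow> 'w multiset \<Rightarrow> 's"
  assumes s: "\<And>v. s v \<in> S.pord 1" and f: "f \<in> carrier (pser R)"
  shows "psub R S i s f = S.psub1 s (\<lambda>m. i (f m))"
proof
  fix m :: "'w multiset"
  have "(\<lambda>m. i (f m)) \<in> carrier (pser S)"
  proof (rule pser_carrierI)
    fix n show "finite (psupp S n (\<lambda>m. i (f m)))"
      by (rule finite_subset[OF _ finite_psupp[OF f, of n]]) (auto simp: psupp_def i_zero)
  qed (use pser_coeff[OF f] in \<open>simp add: i_closed\<close>)
  then have "S.psub1 s (\<lambda>m. i (f m)) m = (\<Oplus>\<^bsub>S\<^esub>k\<in>psupp R (size m) f. i (f k) \<otimes>\<^bsub>S\<^esub> S.pmon s k m)"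
    by (rule coeff_hom.psub_any[OF S.id_coeff_hom s _ finite_psupp[OF f]]) (auto simp: psupp_def i_zero)
  then show "psub R S i s f m = S.psub1 s (\<lambda>m. i (f m)) m" by (simp add: psub_def)
qed

lemma hom_subst2:
  fixes \<phi> :: "('w multiset \<Rightarrow> 'r) \<Rightarrow> 'x multiset \<Rightarrow> 's"
  assumes \<phi>: "pser_hom_over R S i \<phi>" and F: "\<And>a b. F a b \<in> carrier R"
    and f: "f \<in> R.pord 1" and g: "g \<in> R.pord 1"
  shows "\<phi> (pser_subst2 R F f g) = pser_subst2 S (\<lambda>a b. i (F a b)) (\<phi> f) (\<phi> g)"
proof -
  have fs: "(\<lambda>m. i (R.fgl_ser F m)) = S.fgl_ser (\<lambda>a b. i (F a b))"
    by (auto simp: R.fgl_ser_def S.fgl_ser_def i_zero)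
  have pf: "(\<lambda>v. \<phi> (pair_fun f g v)) = pair_fun (\<phi> f) (\<phi> g)"
    by (auto simp: pair_fun_def)
  have p: "\<phi> f \<in> S.pord 1" "\<phi> g \<in> S.pord 1" using pser_hom_overD(3)[OF \<phi>] f g by auto
  have "\<phi> (pser_subst2 R F f g) = psub R S i (pair_fun (\<phi> f) (\<phi> g)) (R.fgl_ser F)"
    unfolding R.subst2_psub[OF F f g] pf[symmetric]
    by (rule hom_psub1[OF \<phi>]) (use f g F in \<open>auto simp: R.pair_fun_pord R.fgl_ser_closed\<close>)
  also have "\<dots> = pser_subst2 S (\<lambda>a b. i (F a b)) (\<phi> f) (\<phi> g)"
    using F p by (simp add: S.subst2_psub i_closed fs psub_factor S.pair_fun_pord R.fgl_ser_closed)
  finally show ?thesis .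
qed

end

section \<open>Formal group laws\<close>

declare One_nat_def [simp del]

lemma (in cring) affine_diff:
  assumes "d \<in> carrier R" "e \<in> carrier R" "g \<in> carrier R" "h \<in> carrier R"
  shows "d \<otimes> (\<one> \<ominus> e \<otimes> g) \<ominus> d \<otimes> (\<one> \<ominus> e \<otimes> h) = \<ominus> (d \<otimes> (e \<otimes> (g \<ominus> h)))"
proof -
  have "d \<otimes> (\<one> \<ominus> e \<otimes> g) = d \<ominus> d \<otimes> (e \<otimes> g)" "d \<otimes> (\<one> \<ominus> e \<otimes> h) = d \<ominus> d \<otimes> (e \<otimes> h)"
    using assms by (simp_all add: a_minus_def r_distr r_minus)
  moreover have "d \<ominus> d \<otimes> (e \<otimes> g) \<ominus> (d \<ominus> d \<otimes> (e \<otimes> h)) = \<ominus> (d \<otimes> (e \<otimes> (g \<ominus> h)))"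
    using assms by algebra
  ultimately show ?thesis by simp
qed

lemma (in cring) add_fixed_zero:
  assumes "x \<in> carrier R" "b \<in> carrier R" "b = x \<oplus> b"
  shows "x = \<zero>"
proof -
  have "x = (x \<oplus> b) \<ominus> b" using assms(1,2) by algebra
  also have "\<dots> = b \<ominus> b" by (simp only: assms(3)[symmetric])
  also have "\<dots> = \<zero>" using assms(2) by algebra
  finally show ?thesis .
qed

text \<open>
  With \<open>c\<close> the constant term of \<open>f\<close>, the inverse is the fixed point of
  \<open>g \<mapsto> c\<^sup>-\<^sup>1(1 - (f - c) g)\<close>, a contraction because \<open>f -
  c\<close> has order one.
\<close>

lemma (in cring) pser_unitI:
  fixes f :: "'v multiset \<Rightarrow> 'a"
  assumes f: "f \<in> carrier (pser R)" and u: "f {#} \<in> Units R"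
  shows "f \<in> Units (pser R)"
proof -
  interpret P: cring "pser R :: ('v multiset \<Rightarrow> 'a) ring" by (rule pser_cring)
  let ?c = "pser_const R (f {#}) :: 'v multiset \<Rightarrow> 'a" and ?d = "pser_const R (inv (f {#})) :: 'v multiset \<Rightarrow> 'a"
  have c: "?c \<in> carrier (pser R)" "?d \<in> carrier (pser R)" using u by (auto intro!: pser_const_closed)
  have dc: "?d \<otimes>\<^bsub>pser R\<^esub> ?c = \<one>\<^bsub>pser R\<^esub>"
    using u c by (subst pser_const_mult) (auto simp: pser_one pser_const_def fun_eq_iff)
  have e: "f \<ominus>\<^bsub>pser R\<^esub> ?c \<in> pord 1"
    using f c unfolding pser_one_pord0 by (auto simp: pser_minus_apply; simp add: pser_const_def r_neg a_minus_def pser_coeff[OF f])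
  let ?T = "\<lambda>g. ?d \<otimes>\<^bsub>pser R\<^esub> (\<one>\<^bsub>pser R\<^esub> \<ominus>\<^bsub>pser R\<^esub> (f \<ominus>\<^bsub>pser R\<^esub> ?c) \<otimes>\<^bsub>pser R\<^esub> g)"
  have "\<exists>g\<in>carrier (pser R). ?T g = g"
  proof (rule contraction_exists[where x = "\<one>\<^bsub>pser R\<^esub>"])
    fix g h :: "'v multiset \<Rightarrow> 'a" and n assume gh: "g \<in> carrier (pser R)" "h \<in> carrier (pser R)" "g \<ominus>\<^bsub>pser R\<^esub> h \<in> pord n"
    have *: "d \<otimes>\<^bsub>pser R\<^esub> (\<one>\<^bsub>pser R\<^esub> \<ominus>\<^bsub>pser R\<^esub> e \<otimes>\<^bsub>pser R\<^esub> g) \<ominus>\<^bsub>pser R\<^esub> d \<otimes>\<^bsub>pser R\<^esub> (\<one>\<^bsub>pser R\<^esub> \<ominus>\<^bsub>pser R\<^esub> e \<otimes>\<^bsub>pser R\<^esub> h)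
      = \<ominus>\<^bsub>pser R\<^esub> (d \<otimes>\<^bsub>pser R\<^esub> (e \<otimes>\<^bsub>pser R\<^esub> (g \<ominus>\<^bsub>pser R\<^esub> h)))" if "d \<in> carrier (pser R)" "e \<in> carrier (pser R)" for d e
      using that gh by (intro P.affine_diff)
    have "(f \<ominus>\<^bsub>pser R\<^esub> ?c) \<otimes>\<^bsub>pser R\<^esub> (g \<ominus>\<^bsub>pser R\<^esub> h) \<in> pord (Suc n)"
      using pord_mult[OF e gh(3)] by (simp add: plus_1_eq_Suc)
    then show "?T g \<ominus>\<^bsub>pser R\<^esub> ?T h \<in> pord (Suc n)"
      unfolding *[OF c(2) P.minus_closed[OF f c(1)]] by (intro pord_uminus pord_mult_left[OF _ c(2)])
  qed (use c f in auto)
  then obtain g where g: "g \<in> carrier (pser R)" "?T g = g" by blast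
  have *: "f \<otimes>\<^bsub>pser R\<^esub> g = \<one>\<^bsub>pser R\<^esub>"
    if "c \<in> carrier (pser R)" "d \<in> carrier (pser R)" "d \<otimes>\<^bsub>pser R\<^esub> c = \<one>\<^bsub>pser R\<^esub>"
      "d \<otimes>\<^bsub>pser R\<^esub> (\<one>\<^bsub>pser R\<^esub> \<ominus>\<^bsub>pser R\<^esub> (f \<ominus>\<^bsub>pser R\<^esub> c) \<otimes>\<^bsub>pser R\<^esub> g) = g" for c d
  proof -
    have "c \<otimes>\<^bsub>pser R\<^esub> g = c \<otimes>\<^bsub>pser R\<^esub> (d \<otimes>\<^bsub>pser R\<^esub> (\<one>\<^bsub>pser R\<^esub> \<ominus>\<^bsub>pser R\<^esub> (f \<ominus>\<^bsub>pser R\<^esub> c) \<otimes>\<^bsub>pser R\<^esub> g))"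
      by (simp only: that(4))
    also have "\<dots> = (d \<otimes>\<^bsub>pser R\<^esub> c) \<otimes>\<^bsub>pser R\<^esub> (\<one>\<^bsub>pser R\<^esub> \<ominus>\<^bsub>pser R\<^esub> (f \<ominus>\<^bsub>pser R\<^esub> c) \<otimes>\<^bsub>pser R\<^esub> g)"
      using that(1,2) f g(1) by algebra
    also have "\<dots> = \<one>\<^bsub>pser R\<^esub> \<ominus>\<^bsub>pser R\<^esub> (f \<ominus>\<^bsub>pser R\<^esub> c) \<otimes>\<^bsub>pser R\<^esub> g"
      unfolding that(3) using that(1,2) f g(1) by algebra
    also have "\<dots> = \<one>\<^bsub>pser R\<^esub> \<ominus>\<^bsub>pser R\<^esub> f \<otimes>\<^bsub>pser R\<^esub> g \<oplus>\<^bsub>pser R\<^esub> c \<otimes>\<^bsub>pser R\<^esub> g"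
      using that(1,2) f g(1) by algebra
    finally have "\<one>\<^bsub>pser R\<^esub> \<ominus>\<^bsub>pser R\<^esub> f \<otimes>\<^bsub>pser R\<^esub> g = \<zero>\<^bsub>pser R\<^esub>"
      using that(1) f g(1) by (intro P.add_fixed_zero[of _ "c \<otimes>\<^bsub>pser R\<^esub> g"]) auto
    then have "\<one>\<^bsub>pser R\<^esub> = f \<otimes>\<^bsub>pser R\<^esub> g" using f g(1) by (subst (asm) P.r_right_minus_eq) auto
    then show ?thesis by simp
  qed
  then have "f \<otimes>\<^bsub>pser R\<^esub> g = \<one>\<^bsub>pser R\<^esub>" using c dc g(2) by blast
  moreover have "g \<otimes>\<^bsub>pser R\<^esub> f = f \<otimes>\<^bsub>pser R\<^esub> g" by (rule P.m_comm[OF g(1) f])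
  ultimately show ?thesis using f g(1) by (auto simp: Units_def intro!: bexI[of _ g])
qed

lemma (in cring) pser_var_power:
  "pser_var R v [^]\<^bsub>pser R\<^esub> k = (\<lambda>m. if m = replicate_mset k v then \<one> else \<zero>)"
proof -
  have "pser_var R v [^]\<^bsub>pser R\<^esub> k = pmon (pser_var R) (replicate_mset k v)"
    by (rule pmon_replicate[symmetric, OF pser_var_closed])
  also have "\<dots> = (\<lambda>m. if m = replicate_mset k v then \<one> else \<zero>)"
    using pmon_var[of "pser_var R" "\<lambda>v. v"] by simp
  finally show ?thesis .
qed

lemma (in cring) subst2_zero_coeff:
  fixes v :: 'v
  assumes F: "\<And>i j. F i j \<in> carrier R"
  shows "pser_subst2 R F (pser_var R v) \<zero>\<^bsub>pser R\<^esub> (replicate_mset n v) = F n 0"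
    "pser_subst2 R F \<zero>\<^bsub>pser R\<^esub> (pser_var R v) (replicate_mset n v) = F 0 n"
proof -
  interpret P: cring "pser R :: ('v multiset \<Rightarrow> 'a) ring" by (rule pser_cring)
  let ?m = "replicate_mset n v"
  let ?I = "{(i, j). i + j \<le> size ?m}"
  have fI: "finite ?I" by (rule finite_subset[of _ "{..n} \<times> {..n}"]) auto
  have rep: "replicate_mset n v = replicate_mset k v \<longleftrightarrow> n = k" for k by (metis size_replicate_mset)
  let ?v = "pser_var R v" and ?z = "\<zero>\<^bsub>pser R\<^esub> :: 'v multiset \<Rightarrow> 'a"
  have vc: "?v \<in> carrier (pser R)" by (rule pser_var_closed)
  have pw: "(?v [^]\<^bsub>pser R\<^esub> a \<otimes>\<^bsub>pser R\<^esub> ?z [^]\<^bsub>pser R\<^esub> b) ?m = (if a = n \<and> b = 0 then \<one> else \<zero>)" for a b :: nat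
  proof (cases "b = 0")
    case True
    then have "?v [^]\<^bsub>pser R\<^esub> a \<otimes>\<^bsub>pser R\<^esub> ?z [^]\<^bsub>pser R\<^esub> b = ?v [^]\<^bsub>pser R\<^esub> a" using vc by simp
    then show ?thesis using True rep by (auto simp: pser_var_power)
  next
    case False
    then have "?z [^]\<^bsub>pser R\<^esub> b = ?z" by (simp add: P.nat_pow_zero)
    then have "?v [^]\<^bsub>pser R\<^esub> a \<otimes>\<^bsub>pser R\<^esub> ?z [^]\<^bsub>pser R\<^esub> b = ?z" using vc by simp
    then show ?thesis using False by (simp add: pser_zero)
  qed
  have pw': "(?z [^]\<^bsub>pser R\<^esub> a \<otimes>\<^bsub>pser R\<^esub> ?v [^]\<^bsub>pser R\<^esub> b) ?m = (if b = n \<and> a = 0 then \<one> else \<zero>)" for a b :: nat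
    using pw[of b a] vc by (simp add: P.m_comm)
  let ?f = "\<lambda>p. F (fst p) (snd p) \<otimes> (?v [^]\<^bsub>pser R\<^esub> fst p \<otimes>\<^bsub>pser R\<^esub> ?z [^]\<^bsub>pser R\<^esub> snd p) ?m"
  have "finsum R ?f ?I = ?f (n, 0)"
  proof (rule finsum_single)
    show "?f j = \<zero>" if "j \<noteq> (n, 0)" for j using that F by (cases j) (auto simp: pw)
  qed (use fI F vc pw[of n 0] in auto)
  then show "pser_subst2 R F ?v ?z ?m = F n 0"
    unfolding pser_subst2_def using F vc pw[of n 0] by simp
  let ?f = "\<lambda>p. F (fst p) (snd p) \<otimes> (?z [^]\<^bsub>pser R\<^esub> fst p \<otimes>\<^bsub>pser R\<^esub> ?v [^]\<^bsub>pser R\<^esub> snd p) ?m"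
  have "finsum R ?f ?I = ?f (0, n)"
  proof (rule finsum_single)
    show "?f j = \<zero>" if "j \<noteq> (0, n)" for j using that F by (cases j) (auto simp: pw')
  qed (use fI F vc pw'[of 0 n] in auto)
  then show "pser_subst2 R F ?z ?v ?m = F 0 n"
    unfolding pser_subst2_def using F vc pw'[of 0 n] by simp
qed

locale fgl = cring R for R :: "('r, 'm) ring_scheme" (structure) + 
  fixes F :: "nat \<Rightarrow> nat \<Rightarrow> 'r"
  assumes formal_group_law: "formal_group_law R F"
begin

lemma F_closed: "F i j \<in> carrier R"
  using formal_group_law by (simp add: formal_group_law_def)

lemma F_axioms:
  "pser_subst2 R F (pser_var R (0::nat)) \<zero>\<^bsub>pser R\<^esub> = pser_var R 0"
  "pser_subst2 R F \<zero>\<^bsub>pser R\<^esub> (pser_var R (0::nat)) = pser_var R 0"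
  "pser_subst2 R F (pser_var R (0::nat)) (pser_var R 1) = pser_subst2 R F (pser_var R 1) (pser_var R 0)"
  "pser_subst2 R F (pser_var R (0::nat)) (pser_subst2 R F (pser_var R 1) (pser_var R 2)) =
    pser_subst2 R F (pser_subst2 R F (pser_var R 0) (pser_var R 1)) (pser_var R 2)"
  using formal_group_law unfolding formal_group_law_def Let_def by blast+

lemma F_zero_right: "F n 0 = (if n = 1 then \<one> else \<zero>)"
proof -
  have "F n 0 = pser_var R (0::nat) (replicate_mset n 0)"
    using subst2_zero_coeff(1)[of F "0::nat" n, OF F_closed] unfolding F_axioms(1) by simp
  moreover have "replicate_mset n (0::nat) = {#0#} \<longleftrightarrow> n = 1"
    by (auto simp: One_nat_def dest: arg_cong[where f = size])
  ultimately show ?thesis by (simp add: pser_var_def)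
qed

lemma F_zero_left: "F 0 n = (if n = 1 then \<one> else \<zero>)"
proof -
  have "F 0 n = pser_var R (0::nat) (replicate_mset n 0)"
    using subst2_zero_coeff(2)[of F "0::nat" n, OF F_closed] unfolding F_axioms(2) by simp
  moreover have "replicate_mset n (0::nat) = {#0#} \<longleftrightarrow> n = 1"
    by (auto simp: One_nat_def dest: arg_cong[where f = size])
  ultimately show ?thesis by (simp add: pser_var_def)
qed

abbreviation fadd :: "('v multiset \<Rightarrow> 'r) \<Rightarrow> ('v multiset \<Rightarrow> 'r) \<Rightarrow> 'v multiset \<Rightarrow> 'r" where
  "fadd f g \<equiv> pser_subst2 R F f g"

lemma fgl_ser_pord: "fgl_ser F \<in> pord 1"
  using fgl_ser_closed[of F, OF F_closed] by (simp add: pser_one_pord0 fgl_ser_def F_zero_right)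

lemma fadd_psub: "f \<in> pord 1 \<Longrightarrow> g \<in> pord 1 \<Longrightarrow> fadd f g = psub1 (pair_fun f g) (fgl_ser F)"
  by (rule subst2_psub[of F, OF F_closed])

lemma fadd_pord:
  assumes "f \<in> pord 1" "g \<in> pord 1"
  shows "fadd f g \<in> pord 1"
  unfolding fadd_psub[OF assms] by (rule psub1D(3)[OF pair_fun_pord[OF assms] fgl_ser_pord])

lemma fadd_carrier: "f \<in> pord 1 \<Longrightarrow> g \<in> pord 1 \<Longrightarrow> fadd f g \<in> carrier (pser R)"
  by (rule pord_carrier[OF fadd_pord])

lemma hom_fadd:
  fixes \<phi> :: "('w multiset \<Rightarrow> 'r) \<Rightarrow> 'x multiset \<Rightarrow> 'r"
  assumes "pser_hom_over R R (\<lambda>a. a) \<phi>" "f \<in> pord 1" "g \<in> pord 1"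
  shows "\<phi> (fadd f g) = fadd (\<phi> f) (\<phi> g)"
  by (rule coeff_hom.hom_subst2[OF id_coeff_hom assms(1) F_closed assms(2,3)])

lemma psub1_zero:
  fixes s :: "'v \<Rightarrow> 'w multiset \<Rightarrow> 'r"
  assumes s: "\<And>v. s v \<in> pord 1"
  shows "psub1 s \<zero>\<^bsub>pser R\<^esub> = \<zero>\<^bsub>pser R\<^esub>"
  by (rule ring_hom_zero[OF psub1D(1)[of s, OF s] pser_ring pser_ring])

lemma fadd_zero_right:
  fixes f :: "'v multiset \<Rightarrow> 'r"
  assumes f: "f \<in> pord 1"
  shows "fadd f \<zero>\<^bsub>pser R\<^esub> = f"
proof -
  let ?s = "\<lambda>_::nat. f"
  have "psub1 ?s (fadd (pser_var R 0) \<zero>\<^bsub>pser R\<^esub>) = fadd (psub1 ?s (pser_var R 0)) (psub1 ?s \<zero>\<^bsub>pser R\<^esub>)"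
    by (rule hom_fadd[OF psub1_hom]) (auto intro: f pser_var_pord pord_zero)
  then show ?thesis using f by (simp add: F_axioms psub1_var psub1_zero)
qed

text \<open>
  The axioms of a formal group law are equations between series in variables. Applying the
  continuous homomorphism that takes the variables to \<open>f\<close>, \<open>g\<close>,
  \<open>h\<close> turns them into the laws of a group on the series without constant term.
\<close>

lemma fadd_comm:
  fixes f g :: "'v multiset \<Rightarrow> 'r"
  assumes f: "f \<in> pord 1" and g: "g \<in> pord 1"
  shows "fadd f g = fadd g f"
proof -
  let ?s = "pair_fun f g"
  have s: "?s v \<in> pord 1" for v using f g by (rule pair_fun_pord)
  have "psub1 ?s (fadd (pser_var R 0) (pser_var R 1)) = fadd (psub1 ?s (pser_var R 0)) (psub1 ?s (pser_var R 1))"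
    "psub1 ?s (fadd (pser_var R 1) (pser_var R 0)) = fadd (psub1 ?s (pser_var R 1)) (psub1 ?s (pser_var R 0))"
    by (rule hom_fadd[OF psub1_hom]; rule s pser_var_pord)+
  then show ?thesis unfolding psub1_var[of ?s, OF s] F_axioms(3)[symmetric] by (simp add: pair_fun_def)
qed

lemma fadd_assoc:
  fixes f g h :: "'v multiset \<Rightarrow> 'r"
  assumes f: "f \<in> pord 1" and g: "g \<in> pord 1" and h: "h \<in> pord 1"
  shows "fadd (fadd f g) h = fadd f (fadd g h)"
proof -
  let ?s = "\<lambda>v::nat. if v = 0 then f else if v = 1 then g else h"
  let ?v = "pser_var R :: nat \<Rightarrow> _"
  have s: "?s v \<in> pord 1" for v using f g h by simp
  note H = hom_fadd[OF psub1_hom[of ?s, OF s]]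
  have "psub1 ?s (fadd (?v 0) (fadd (?v 1) (?v 2))) = fadd (?s 0) (fadd (?s 1) (?s 2))"
    by (subst H, (intro pser_var_pord fadd_pord)+)+ (simp only: psub1_var[of ?s, OF s])
  moreover have "psub1 ?s (fadd (fadd (?v 0) (?v 1)) (?v 2)) = fadd (fadd (?s 0) (?s 1)) (?s 2)"
    by (subst H, (intro pser_var_pord fadd_pord)+)+ (simp only: psub1_var[of ?s, OF s])
  ultimately show ?thesis by (simp add: F_axioms(4))
qed

text \<open>
  The terms of \<open>F(u, v)\<close> of degree at least two. In degree two there is only \<open>F
  1 1 * u * v\<close>, because \<open>F(u, 0) = u\<close> and \<open>F(0, v) = v\<close>.
\<close>

definition fgl_rest :: "nat multiset \<Rightarrow> 'r" where
  "fgl_rest = fgl_ser F \<ominus>\<^bsub>pser R\<^esub> (pser_var R 0 \<oplus>\<^bsub>pser R\<^esub> pser_var R 1)"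

lemma size2_cases:
  fixes m :: "nat multiset"
  assumes "size m < 3"
  obtains "m = {#}" | x where "m = {#x#}" | x y where "m = {#x, y#}"
proof -
  consider "size m = 0" | "size m = Suc 0" | "size m = Suc (Suc 0)" using assms by linarith
  then show ?thesis
  proof cases
    case 1
    then show ?thesis using that by simp
  next
    case 2
    then obtain x where "m = {#x#}" by (metis One_nat_def size_1_singleton_mset)
    then show ?thesis using that by blast
  next
    case 3
    then obtain x m' where "m = add_mset x m'" by (metis size_eq_Suc_imp_eq_union)
    moreover with 3 obtain y where "m' = {#y#}" by (metis One_nat_def size_1_singleton_mset size_add_mset Suc_inject)
    ultimately show ?thesis using that by blast
  qed
qed

lemma fgl_rest_carrier: "fgl_rest \<in> carrier (pser R)"
  unfolding fgl_rest_def using fgl_ser_closed[of F, OF F_closed]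
  by (intro cring.cring_simprules(4)[OF pser_cring] pser_add_closed pser_var_closed)

lemma fgl_rest_apply:
  "fgl_rest m = fgl_ser F m \<ominus> ((if m = {#0#} then \<one> else \<zero>) \<oplus> (if m = {#1#} then \<one> else \<zero>))"
  unfolding fgl_rest_def
  by (subst pser_minus_apply[OF fgl_ser_closed[of F, OF F_closed] pser_add_closed[OF pser_var_closed pser_var_closed]])
    (simp add: pser_add pser_var_def)

lemma fgl_rest_pord: "fgl_rest \<in> pord 2"
proof -
  have "fgl_rest m = \<zero>" if "size m < 2" for m
  proof -
    have "size m < 3" using that by simp
    then show ?thesis
    proof (cases m rule: size2_cases)
      case 1
      then show ?thesis by (simp add: fgl_rest_apply fgl_ser_def F_zero_right a_minus_def)
    next
      case (2 x)
      then show ?thesis 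
        by (auto simp: fgl_rest_apply fgl_ser_def F_zero_right F_zero_left a_minus_def r_neg)
    next
      case (3 x y)
      then show ?thesis using that by simp
    qed
  qed
  then show ?thesis using fgl_rest_carrier by (simp add: pord_def)
qed

lemma fgl_rest2_pord:
  "fgl_rest \<ominus>\<^bsub>pser R\<^esub> pser_const R (F 1 1) \<otimes>\<^bsub>pser R\<^esub> (pser_var R 0 \<otimes>\<^bsub>pser R\<^esub> pser_var R 1) \<in> pord 3"
proof -
  let ?q = "pser_const R (F 1 1) \<otimes>\<^bsub>pser R\<^esub> (pser_var R 0 \<otimes>\<^bsub>pser R\<^esub> pser_var R (1 :: nat))"
  have vv: "pser_var R 0 \<otimes>\<^bsub>pser R\<^esub> pser_var R (1 :: nat) \<in> carrier (pser R)"
    by (intro pser_mult_closed pser_var_closed)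
  have q: "?q \<in> carrier (pser R)" by (intro pser_mult_closed pser_const_closed F_closed vv)
  have qm: "?q m = (if m = {#0, 1#} then F 1 1 else \<zero>)" for m
  proof -
    have "?q m = F 1 1 \<otimes> (pser_var R 0 \<otimes>\<^bsub>pser R\<^esub> pser_var R (1 :: nat)) m"
      using pser_coeff[OF vv] by (simp add: pser_const_mult F_closed)
    also have "\<dots> = (if m = {#0, 1#} then F 1 1 else \<zero>)"
      unfolding pser_var_mult[OF pser_var_closed]
      using F_closed by (auto simp: pser_var_def dest!: multi_member_split)
    finally show ?thesis .
  qed
  have "fgl_rest m = ?q m" if "size m < 3" for m
    using that
  proof (cases m rule: size2_cases)
    case 1
    then show ?thesis using pord_coeff[OF fgl_rest_pord, of m] by (simp add: qm)
  next
    case (2 x)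
    then show ?thesis using pord_coeff[OF fgl_rest_pord, of m] by (simp add: qm)
  next
    case (3 x y)
    have swap: "{#1, 0#} = {#0, 1 :: nat#}" by simp
    consider "x = 0" "y = 0" | "x = 1" "y = 1" | "x = 0" "y = 1" | "x = 1" "y = 0" | "\<not> {x, y} \<subseteq> {0, 1}" by auto
    then have "fgl_rest {#x, y#} = (if {#x, y#} = {#0, 1#} then F 1 1 else \<zero>)"
    proof cases
      case 5
      then have "{#x, y#} \<noteq> {#0, 1#}" by (metis set_mset_add_mset_insert set_mset_empty subset_refl)
      then show ?thesis using 5 by (auto simp: fgl_rest_apply fgl_ser_def a_minus_def)
    qed (use F_closed in \<open>simp_all add: fgl_rest_apply fgl_ser_def F_zero_right F_zero_left a_minus_def swap,
        simp_all add: One_nat_def\<close>)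
    then show ?thesis unfolding 3 qm .
  qed
  then show ?thesis using q fgl_rest_carrier by (simp add: pord_minus_iff)
qed

lemma fadd_expand:
  fixes f g :: "'v multiset \<Rightarrow> 'r"
  assumes f: "f \<in> pord 1" and g: "g \<in> pord 1"
  shows "fadd f g = f \<oplus>\<^bsub>pser R\<^esub> g \<oplus>\<^bsub>pser R\<^esub> psub1 (pair_fun f g) fgl_rest"
proof -
  interpret P: cring "pser R :: ('v multiset \<Rightarrow> 'r) ring" by (rule pser_cring)
  have s: "pair_fun f g v \<in> pord 1" for v using f g by (rule pair_fun_pord)
  note D = psub1D[of "pair_fun f g", OF s]
  have "psub1 (pair_fun f g) fgl_rest = fadd f g \<ominus>\<^bsub>pser R\<^esub> (f \<oplus>\<^bsub>pser R\<^esub> g)"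
    unfolding fgl_rest_def fadd_psub[OF f g]
      pser_hom_over_minus[OF cring_axioms cring_axioms psub1_hom[of "pair_fun f g", OF s] fgl_ser_closed[of F, OF F_closed]
        pser_add_closed[OF pser_var_closed pser_var_closed]]
    by (simp add: D(5) pser_var_closed psub1_var[of "pair_fun f g", OF s]) (simp add: pair_fun_def)
  moreover have "a = b \<oplus>\<^bsub>pser R\<^esub> (a \<ominus>\<^bsub>pser R\<^esub> b)" if "a \<in> carrier (pser R)" "b \<in> carrier (pser R)" 
    for a b :: "'v multiset \<Rightarrow> 'r" using that by algebra
  ultimately show ?thesis using fadd_carrier[OF f g] f g by (simp add: pord_carrier)
qed

text \<open>
  Formal addition agrees with addition to first order, also in this relative form: the terms of
  degree at least two gain one order.
\<close>

lemma fadd_diff: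
  fixes f g f' g' :: "'v multiset \<Rightarrow> 'r"
  assumes f: "f \<in> pord 1" and g: "g \<in> pord 1" and f': "f' \<in> pord 1" and g': "g' \<in> pord 1"
    and df: "f \<ominus>\<^bsub>pser R\<^esub> f' \<in> pord n" and dg: "g \<ominus>\<^bsub>pser R\<^esub> g' \<in> pord n"
  shows "(fadd f g \<ominus>\<^bsub>pser R\<^esub> fadd f' g') \<ominus>\<^bsub>pser R\<^esub> ((f \<ominus>\<^bsub>pser R\<^esub> f') \<oplus>\<^bsub>pser R\<^esub> (g \<ominus>\<^bsub>pser R\<^esub> g')) \<in> pord (Suc n)"
proof -
  interpret P: cring "pser R :: ('v multiset \<Rightarrow> 'r) ring" by (rule pser_cring)
  let ?N = "psub1 (pair_fun f g) fgl_rest" and ?N' = "psub1 (pair_fun f' g') fgl_rest"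
  have s: "pair_fun f g v \<in> pord 1" "pair_fun f' g' v \<in> pord 1" for v using f g f' g' by (auto intro: pair_fun_pord)
  have "?N \<ominus>\<^bsub>pser R\<^esub> ?N' \<in> pord (n + 2 - 1)"
    by (rule psub1_diff[OF s _ fgl_rest_pord]) (use df dg in \<open>simp add: pair_fun_def\<close>)
  moreover have N: "?N \<in> carrier (pser R)" "?N' \<in> carrier (pser R)"
    using psub1D(4)[of "pair_fun f g", OF s(1)] psub1D(4)[of "pair_fun f' g'", OF s(2)] fgl_rest_carrier by auto
  have "(f \<oplus>\<^bsub>pser R\<^esub> g \<oplus>\<^bsub>pser R\<^esub> N) \<ominus>\<^bsub>pser R\<^esub> (f' \<oplus>\<^bsub>pser R\<^esub> g' \<oplus>\<^bsub>pser R\<^esub> N') \<ominus>\<^bsub>pser R\<^esub> ((f \<ominus>\<^bsub>pser R\<^esub> f') \<oplus>\<^bsub>pser R\<^esub> (g \<ominus>\<^bsub>pser R\<^esub> g')) = N \<ominus>\<^bsub>pser R\<^esub> N'"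
    if "N \<in> carrier (pser R)" "N' \<in> carrier (pser R)" for N N'
    using that f g f' g'[THEN pord_carrier] f'[THEN pord_carrier] f[THEN pord_carrier] g[THEN pord_carrier] by algebra
  from this[OF N] have "fadd f g \<ominus>\<^bsub>pser R\<^esub> fadd f' g' \<ominus>\<^bsub>pser R\<^esub> ((f \<ominus>\<^bsub>pser R\<^esub> f') \<oplus>\<^bsub>pser R\<^esub> (g \<ominus>\<^bsub>pser R\<^esub> g')) = ?N \<ominus>\<^bsub>pser R\<^esub> ?N'"
    by (simp add: fadd_expand f g f' g')
  ultimately show ?thesis by simp
qed

text \<open>
  By \<open>fadd_diff\<close>, \<open>g \<mapsto> g - (f +\<^sub>F g)\<close> is a contraction; at
  its fixed point \<open>f +\<^sub>F g\<close> vanishes.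
\<close>

lemma fadd_inverse_exists:
  fixes f :: "'v multiset \<Rightarrow> 'r"
  assumes f: "f \<in> pord 1"
  shows "\<exists>g\<in>pord 1. fadd f g = \<zero>\<^bsub>pser R\<^esub>"
proof -
  interpret P: cring "pser R :: ('v multiset \<Rightarrow> 'r) ring" by (rule pser_cring)
  let ?T = "\<lambda>g. g \<ominus>\<^bsub>pser R\<^esub> fadd f g"
  note pc = pord_carrier
  have "\<exists>g\<in>pord 1. ?T g = g"
  proof (rule contraction_exists)
    fix g h :: "'v multiset \<Rightarrow> 'r" and n assume g: "g \<in> pord 1" and h: "h \<in> pord 1" and d: "g \<ominus>\<^bsub>pser R\<^esub> h \<in> pord n"
    have ff: "f \<ominus>\<^bsub>pser R\<^esub> f \<in> pord n" using pord_zero pc[OF f] by (simp add: a_minus_def P.r_neg)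
    have "(g \<ominus>\<^bsub>pser R\<^esub> A) \<ominus>\<^bsub>pser R\<^esub> (h \<ominus>\<^bsub>pser R\<^esub> B) = \<ominus>\<^bsub>pser R\<^esub> ((A \<ominus>\<^bsub>pser R\<^esub> B) \<ominus>\<^bsub>pser R\<^esub> ((f \<ominus>\<^bsub>pser R\<^esub> f) \<oplus>\<^bsub>pser R\<^esub> (g \<ominus>\<^bsub>pser R\<^esub> h)))"
      if "A \<in> carrier (pser R)" "B \<in> carrier (pser R)" for A B
      using that pc[OF f] pc[OF g] pc[OF h] by algebra
    from this[OF fadd_carrier[OF f g] fadd_carrier[OF f h]]
    show "?T g \<ominus>\<^bsub>pser R\<^esub> ?T h \<in> pord (Suc n)"
      using pord_uminus[OF fadd_diff[OF f g f h ff d]] by simp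
  qed (use f in \<open>auto simp: pord_zero pc fadd_pord pord_minus intro: pord_closed\<close>)
  then obtain g where g: "g \<in> pord 1" "?T g = g" by blast
  have "b = \<zero>\<^bsub>pser R\<^esub>" if "a \<in> carrier (pser R)" "b \<in> carrier (pser R)" "a \<ominus>\<^bsub>pser R\<^esub> b = a" for a b :: "'v multiset \<Rightarrow> 'r"
  proof -
    have "b = a \<ominus>\<^bsub>pser R\<^esub> (a \<ominus>\<^bsub>pser R\<^esub> b)" using that(1,2) by algebra
    also have "\<dots> = \<zero>\<^bsub>pser R\<^esub>" unfolding that(3) using that(1,2) by algebra
    finally show ?thesis .
  qed
  from this[OF pc[OF g(1)] fadd_carrier[OF f g(1)] g(2)] g(1) show ?thesis by blast
qed

text \<open>
  The series without constant term as a group under formal addition, so that multiples and finite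
  formal sums are available from the theory of commutative groups.
\<close>

definition fgrp :: "('v multiset \<Rightarrow> 'r) monoid" where
  "fgrp = \<lparr>carrier = pord 1, monoid.mult = pser_subst2 R F, one = \<zero>\<^bsub>pser R\<^esub>\<rparr>"

lemma fgrp_comm_group: "comm_group (fgrp :: ('v multiset \<Rightarrow> 'r) monoid)"
proof (rule comm_groupI)
  fix f :: "'v multiset \<Rightarrow> 'r" assume "f \<in> carrier fgrp"
  then show "\<exists>g\<in>carrier fgrp. g \<otimes>\<^bsub>fgrp\<^esub> f = \<one>\<^bsub>fgrp\<^esub>"
    using fadd_inverse_exists[of f] by (auto simp: fgrp_def fadd_comm)
next
  fix f :: "'v multiset \<Rightarrow> 'r" assume "f \<in> carrier fgrp"
  then show "\<one>\<^bsub>fgrp\<^esub> \<otimes>\<^bsub>fgrp\<^esub> f = f"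
    using fadd_comm[of "\<zero>\<^bsub>pser R\<^esub>" f] by (simp add: fgrp_def fadd_zero_right pord_zero)
qed (auto simp: fgrp_def fadd_pord pord_zero fadd_assoc intro: fadd_comm)

end

section \<open>The formal inverse and the series \<open>\<mu>\<close>\<close>

context fgl begin

abbreviation X1 :: "unit multiset \<Rightarrow> 'r" where "X1 \<equiv> pser_var R ()"

lemma fadd_cancel:
  fixes f g h :: "'v multiset \<Rightarrow> 'r"
  assumes "f \<in> pord 1" "g \<in> pord 1" "h \<in> pord 1" "fadd f g = fadd f h"
  shows "g = h"
proof -
  interpret G: comm_group "fgrp :: ('v multiset \<Rightarrow> 'r) monoid" by (rule fgrp_comm_group)
  show ?thesis using G.Units_l_cancel[of f g h, unfolded G.Units_eq] assms by (simp add: fgrp_def)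
qed

lemma fadd_interchange:
  fixes f g :: "'v multiset \<Rightarrow> 'r"
  assumes f: "f \<in> pord 1" "g \<in> pord 1" "f' \<in> pord 1" "g' \<in> pord 1"
  shows "fadd (fadd f g) (fadd f' g') = fadd (fadd f f') (fadd g g')"
proof -
  interpret G: comm_group "fgrp :: ('v multiset \<Rightarrow> 'r) monoid" by (rule fgrp_comm_group)
  have "f \<in> carrier fgrp" "g \<in> carrier fgrp" "f' \<in> carrier fgrp" "g' \<in> carrier fgrp"
    using assms by (simp_all add: fgrp_def)
  then have "(f \<otimes>\<^bsub>fgrp\<^esub> g) \<otimes>\<^bsub>fgrp\<^esub> (f' \<otimes>\<^bsub>fgrp\<^esub> g') = (f \<otimes>\<^bsub>fgrp\<^esub> f') \<otimes>\<^bsub>fgrp\<^esub> (g \<otimes>\<^bsub>fgrp\<^esub> g')"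
    by (simp add: G.m_ac)
  then show ?thesis by (simp add: fgrp_def)
qed

lemma fgl_inverse_pord: "fgl_inverse R F \<in> pord 1"
  and fgl_inverse_right: "fadd X1 (fgl_inverse R F) = \<zero>\<^bsub>pser R\<^esub>"
proof -
  let ?P = "\<lambda>g. g \<in> carrier (pser R) \<and> g {#} = \<zero> \<and> fadd X1 g = \<zero>\<^bsub>pser R\<^esub>"
  have "\<exists>!g. ?P g"
  proof (rule ex_ex1I)
    show "\<exists>g. ?P g" using fadd_inverse_exists[of X1, OF pser_var_pord] by (auto simp: pser_one_pord0)
    show "g = h" if "?P g" "?P h" for g h
      using that fadd_cancel[of X1 g h, OF pser_var_pord] unfolding pser_one_pord0 by metis
  qed
  then have "?P (fgl_inverse R F)" unfolding fgl_inverse_def by (rule theI')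
  then show "fgl_inverse R F \<in> pord 1" "fadd X1 (fgl_inverse R F) = \<zero>\<^bsub>pser R\<^esub>"
    unfolding pser_one_pord0 by blast+
qed

definition fneg :: "('v multiset \<Rightarrow> 'r) \<Rightarrow> 'v multiset \<Rightarrow> 'r" where
  "fneg f = psub1 (\<lambda>_. f) (fgl_inverse R F)"

lemma fneg_pord: "f \<in> pord 1 \<Longrightarrow> fneg f \<in> pord 1"
  unfolding fneg_def by (rule psub1D(3)[OF _ fgl_inverse_pord])

lemma fadd_fneg:
  fixes f :: "'v multiset \<Rightarrow> 'r"
  assumes f: "f \<in> pord 1"
  shows "fadd f (fneg f) = \<zero>\<^bsub>pser R\<^esub>"
proof -
  let ?s = "\<lambda>_::unit. f"
  have "psub1 ?s (fadd X1 (fgl_inverse R F)) = fadd (psub1 ?s X1) (psub1 ?s (fgl_inverse R F))"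
    by (rule hom_fadd[OF psub1_hom]) (auto intro: f pser_var_pord fgl_inverse_pord)
  then show ?thesis using f by (simp add: fgl_inverse_right psub1_zero psub1_var fneg_def)
qed

text \<open>
  Comparison of the coefficients of \<open>u + g + F 1 1 u g + \<dots> = 0\<close> in degrees one
  and two, for \<open>g\<close> the formal inverse of \<open>u\<close>.
\<close>

lemma fgl_inverse_coeff: "fgl_inverse R F {#()#} = \<ominus> \<one>" "fgl_inverse R F {#(), ()#} = F 1 1"
proof -
  let ?i = "fgl_inverse R F" and ?s = "pair_fun X1 (fgl_inverse R F)"
  let ?q = "pser_const R (F 1 1) \<otimes>\<^bsub>pser R\<^esub> (pser_var R 0 \<otimes>\<^bsub>pser R\<^esub> pser_var R (1 :: nat))"
  have s: "?s v \<in> pord 1" for v by (intro pair_fun_pord pser_var_pord fgl_inverse_pord)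
  note ic = pser_coeff[OF pord_carrier[OF fgl_inverse_pord]]
  note D = psub1D[of ?s, OF s]
  have vv: "pser_var R 0 \<otimes>\<^bsub>pser R\<^esub> pser_var R (1 :: nat) \<in> carrier (pser R)"
    by (intro pser_mult_closed pser_var_closed)
  have q: "?q \<in> carrier (pser R)" by (intro pser_mult_closed pser_const_closed F_closed vv)
  have Xi: "X1 \<otimes>\<^bsub>pser R\<^esub> ?i \<in> carrier (pser R)"
    by (intro pser_mult_closed pser_var_closed pord_carrier[OF fgl_inverse_pord])
  have "psub1 ?s ?q = pser_const R (F 1 1) \<otimes>\<^bsub>pser R\<^esub> (X1 \<otimes>\<^bsub>pser R\<^esub> ?i)"
    using vv by (simp add: D(6) pser_const_closed F_closed D(2) pser_var_closed psub1_var[of ?s, OF s])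
      (simp add: pair_fun_def)
  then have q': "psub1 ?s ?q = (\<lambda>m. F 1 1 \<otimes> (X1 \<otimes>\<^bsub>pser R\<^esub> ?i) m)"
    using pser_coeff[OF Xi] by (simp add: pser_const_mult F_closed)
  have "psub1 ?s fgl_rest \<ominus>\<^bsub>pser R\<^esub> psub1 ?s ?q \<in> pord 3"
    using D(3)[OF fgl_rest2_pord] 
    by (simp add: pser_hom_over_minus[OF cring_axioms cring_axioms psub1_hom[of ?s, OF s] fgl_rest_carrier q])
  then have N: "psub1 ?s fgl_rest m = F 1 1 \<otimes> (X1 \<otimes>\<^bsub>pser R\<^esub> ?i) m" if "size m < 3" for m
    using that D(4)[OF fgl_rest_carrier] D(4)[OF q] by (simp add: pord_minus_iff q')
  have eq: "X1 m \<oplus> ?i m \<oplus> F 1 1 \<otimes> (X1 \<otimes>\<^bsub>pser R\<^esub> ?i) m = \<zero>" if "size m < 3" for m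
    using fun_cong[OF fadd_expand[of X1 "fgl_inverse R F", OF pser_var_pord fgl_inverse_pord], of m] N[OF that]
    by (simp add: fgl_inverse_right pser_add) (simp add: pser_zero)
  note vm = pser_var_mult[OF pord_carrier[OF fgl_inverse_pord], of "()"]
  have i0: "?i {#} = \<zero>" using fgl_inverse_pord by (simp add: pser_one_pord0)
  have "\<one> \<oplus> ?i {#()#} = \<zero>" using eq[of "{#()#}"] ic[of "{#()#}"] F_closed[of 1 1]
    by (simp add: vm i0) (simp add: pser_var_def)
  then show i1: "?i {#()#} = \<ominus> \<one>" using ic by (metis minus_equality a_comm one_closed)
  have "?i {#(), ()#} \<oplus> F 1 1 \<otimes> \<ominus> \<one> = \<zero>"
    using eq[of "{#(), ()#}"] ic[of "{#(), ()#}"] by (simp add: vm i1) (simp add: pser_var_def)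
  moreover have "F 1 1 \<otimes> \<ominus> \<one> = \<ominus> F 1 1" using F_closed[of 1 1] by (simp add: r_minus)
  ultimately have "?i {#(), ()#} \<oplus> \<ominus> F 1 1 = \<zero>" by (simp only:)
  then show "?i {#(), ()#} = F 1 1" using F_closed[of 1 1] ic[of "{#(), ()#}"]
    by (metis minus_equality minus_minus a_inv_closed)
qed

text \<open>\<open>mu_tail\<close> is the series \<open>w\<close> with \<open>\<mu>(u) = 1 + u w(u)\<close>. Its constant term \<open>-F 1 1\<close> is the
  reason why \<open>\<kappa>\<close> and \<open>\<Theta>\<close> are governed by that coefficient.\<close>

definition mu_ser :: "unit multiset \<Rightarrow> 'r" where "mu_ser = ser1 (fgl_mu R F)"
definition mu_tail :: "unit multiset \<Rightarrow> 'r" where "mu_tail m = mu_ser (add_mset () m)"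

lemma mu_ser_apply: "mu_ser m = \<ominus> fgl_inverse R F (add_mset () m)"
  unfolding mu_ser_def ser1_def fgl_mu_def by (simp add: unit_mset[symmetric])

lemma mu_ser_closed: "mu_ser \<in> carrier (pser R)"
  using pser_coeff[OF pord_carrier[OF fgl_inverse_pord]] by (intro pser_unit_closed) (simp add: mu_ser_apply)

lemma mu_tail_closed: "mu_tail \<in> carrier (pser R)"
  using pser_coeff[OF mu_ser_closed] by (intro pser_unit_closed) (simp add: mu_tail_def)

lemma fgl_mu_closed: "fgl_mu R F k \<in> carrier R"
  using pser_coeff[OF pord_carrier[OF fgl_inverse_pord]] by (simp add: fgl_mu_def)

lemma mu_ser_0: "mu_ser {#} = \<one>"
  by (simp add: mu_ser_apply fgl_inverse_coeff)

lemma mu_tail_0: "mu_tail {#} = \<ominus> F 1 1"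
  by (simp add: mu_tail_def mu_ser_apply fgl_inverse_coeff)

lemma var_mult_unit:
  fixes f :: "unit multiset \<Rightarrow> 'r"
  assumes "f \<in> carrier (pser R)"
  shows "(X1 \<otimes>\<^bsub>pser R\<^esub> f) m = (if m = {#} then \<zero> else f (m - {#()#}))"
proof -
  have "() \<in># m \<longleftrightarrow> m \<noteq> {#}" by (metis (full_types) multiset_nonemptyE old.unit.exhaust empty_not_add_mset multi_member_split)
  then show ?thesis by (simp add: pser_var_mult[OF assms])
qed

lemma add_mset_unit: "m \<noteq> {#} \<Longrightarrow> add_mset () (m - {#()#}) = m"
  by (metis (full_types) multiset_nonemptyE old.unit.exhaust insert_DiffM)

lemma fgl_inverse_mu: "fgl_inverse R F = \<ominus>\<^bsub>pser R\<^esub> (X1 \<otimes>\<^bsub>pser R\<^esub> mu_ser)"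
proof
  fix m
  have c: "X1 \<otimes>\<^bsub>pser R\<^esub> mu_ser \<in> carrier (pser R)"
    by (intro pser_mult_closed pser_var_closed mu_ser_closed)
  show "fgl_inverse R F m = (\<ominus>\<^bsub>pser R\<^esub> (X1 \<otimes>\<^bsub>pser R\<^esub> mu_ser)) m"
    using fgl_inverse_pord pser_coeff[OF pord_carrier[OF fgl_inverse_pord], of m]
    by (cases "m = {#}") (simp_all add: pser_uminus_apply[OF c] var_mult_unit[OF mu_ser_closed]
        mu_ser_apply add_mset_unit pser_one_pord0)
qed

lemma mu_ser_tail: "mu_ser = \<one>\<^bsub>pser R\<^esub> \<oplus>\<^bsub>pser R\<^esub> X1 \<otimes>\<^bsub>pser R\<^esub> mu_tail"
proof
  fix m
  show "mu_ser m = (\<one>\<^bsub>pser R\<^esub> \<oplus>\<^bsub>pser R\<^esub> X1 \<otimes>\<^bsub>pser R\<^esub> mu_tail) m"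
    using pser_coeff[OF mu_ser_closed, of m]
    by (cases "m = {#}") (simp_all add: pser_add pser_one pser_const_def var_mult_unit[OF mu_tail_closed]
        mu_ser_0 mu_tail_def add_mset_unit)
qed

lemma subst1_mu: "f \<in> pord 1 \<Longrightarrow> pser_subst1 R (fgl_mu R F) f = psub1 (\<lambda>_. f) mu_ser"
  unfolding mu_ser_def by (rule subst1_psub[OF fgl_mu_closed])

end

section \<open>Formal group laws over a rational algebra are isomorphic\<close>

context cring begin

lemma diff_diff_swap:
  "a \<in> carrier R \<Longrightarrow> b \<in> carrier R \<Longrightarrow> c \<in> carrier R \<Longrightarrow> d \<in> carrier R \<Longrightarrow>
    (a \<ominus> b) \<ominus> (c \<ominus> d) = (a \<ominus> c) \<ominus> (b \<ominus> d)"
  by algebra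

definition two :: 'a where "two = \<one> \<oplus> \<one>"
lemma two_closed: "two \<in> carrier R" by (simp add: two_def)

lemma pmon_two:
  fixes k :: "'v multiset"
  shows "pmon (\<lambda>v. pser_const R two \<otimes>\<^bsub>pser R\<^esub> pser_var R v) k = (\<lambda>m. if m = k then two [^] size k else \<zero>)"
proof (induction k)
  case empty
  then show ?case by (auto simp: pmon_empty pser_one pser_const_def fun_eq_iff)
next
  case (add v k)
  let ?s = "\<lambda>v. pser_const R two \<otimes>\<^bsub>pser R\<^esub> pser_var R v :: 'v multiset \<Rightarrow> 'a"
  interpret P: cring "pser R :: ('v multiset \<Rightarrow> 'a) ring" by (rule pser_cring)
  have s: "?s v \<in> carrier (pser R)" for v by (intro pser_mult_closed pser_const_closed pser_var_closed two_closed)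
  note kc = pmon_closed[of ?s k, OF s]
  have "?s v \<otimes>\<^bsub>pser R\<^esub> pmon ?s k = pser_const R two \<otimes>\<^bsub>pser R\<^esub> (pser_var R v \<otimes>\<^bsub>pser R\<^esub> pmon ?s k)"
    by (intro P.m_assoc pser_const_closed pser_var_closed two_closed kc)
  also have "\<dots> = (\<lambda>m. two \<otimes> (pser_var R v \<otimes>\<^bsub>pser R\<^esub> pmon ?s k) m)"
    by (rule pser_const_mult[OF two_closed pser_coeff[OF pser_mult_closed[OF pser_var_closed kc]]])
  also have "\<dots> = (\<lambda>m. if m = add_mset v k then two [^] size (add_mset v k) else \<zero>)"
    unfolding pser_var_mult[OF kc]
    unfolding add using two_closed by (auto simp: fun_eq_iff m_comm dest!: multi_member_split)
  finally show ?case unfolding pmon_add_mset[where s = ?s, OF s] .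
qed

text \<open>
  Only the linear part of \<open>t\<close>, multiplication by two, matters for the lowest degree.
\<close>

lemma psub1_dilation:
  fixes t :: "'v \<Rightarrow> 'v multiset \<Rightarrow> 'a"
  assumes t: "\<And>v. t v \<in> pord 1"
    and d: "\<And>v. t v \<ominus>\<^bsub>pser R\<^esub> pser_const R two \<otimes>\<^bsub>pser R\<^esub> pser_var R v \<in> pord 2"
    and f: "f \<in> pord n" and m: "size m = n"
  shows "psub1 t f m = two [^] n \<otimes> f m"
proof -
  interpret H: coeff_hom R R "\<lambda>a. a" by (rule id_coeff_hom)
  let ?s = "\<lambda>v. pser_const R two \<otimes>\<^bsub>pser R\<^esub> pser_var R v :: 'v multiset \<Rightarrow> 'a"
  have s: "?s v \<in> pord 1" for v
    by (intro pord_mult_left pser_var_pord pser_const_closed two_closed)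
  note fc = pser_coeff[OF pord_carrier[OF f]]
  have *: "pmon t l m = (if m = l then two [^] n else \<zero>)" if "size l = n" for l
    using pmon_diff[where s = t and t = ?s and n = 2 and k = l, OF t s d]
      pmon_closed[of t l, OF pord_carrier[OF t]] pmon_closed[of ?s l, OF pord_carrier[OF s]] that m
    by (simp add: pord_minus_iff pmon_two)
  have "psub1 t f m = (\<Oplus>l\<in>insert m (psupp R n f). f l \<otimes> pmon t l m)"
    using m finite_psupp[OF pord_carrier[OF f]] by (intro H.psub_any[OF t pord_carrier[OF f]]) auto
  also have "\<dots> = f m \<otimes> pmon t m m"
  proof (rule finsum_single)
    fix l assume l: "l \<in> insert m (psupp R n f)" "l \<noteq> m"
    then have "size l = n" using pord_coeff[OF f, of l] by (force simp: psupp_def)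
    then show "f l \<otimes> pmon t l m = \<zero>" using * l fc by auto
  qed (use fc finite_psupp[OF pord_carrier[OF f]] H.mon_coeff[of t, OF t] in auto)
  also have "\<dots> = two [^] n \<otimes> f m" using *[OF m] fc two_closed by (simp add: m_comm)
  finally show ?thesis .
qed

end

text \<open>
  A substitution \<open>t\<close> whose linear part is multiplication by two, such as
  \<open>x\<^sub>v \<mapsto> x\<^sub>v +\<^bsub>F'\<^esub> x\<^sub>v\<close>. For this
  \<open>t\<close> the equation \<open>f(t) = f +\<^sub>F f\<close>, the vanishing of
  \<open>defect f\<close>, is satisfied by every homomorphism from \<open>F'\<close> to
  \<open>F\<close>.
\<close>

locale dilation = fgl R F for R :: "('r, 'm) ring_scheme" (structure) and F +
  fixes t :: "'v \<Rightarrow> 'v multiset \<Rightarrow> 'r"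
  assumes t: "\<And>v. t v \<in> pord 1"
    and td: "\<And>v. t v \<ominus>\<^bsub>pser R\<^esub> pser_const R two \<otimes>\<^bsub>pser R\<^esub> pser_var R v \<in> pord 2"
begin

definition defect :: "('v multiset \<Rightarrow> 'r) \<Rightarrow> 'v multiset \<Rightarrow> 'r" where
  "defect f = fadd f f \<ominus>\<^bsub>pser R\<^esub> psub1 t f"

lemma psub1_t_pord: "f \<in> pord n \<Longrightarrow> psub1 t f \<in> pord n" by (rule psub1D(3)[of t, OF t])

lemma defect_pord: "f \<in> pord 1 \<Longrightarrow> defect f \<in> pord 1"
  unfolding defect_def by (intro pord_minus fadd_pord psub1_t_pord)

text \<open>
  Changing \<open>f\<close> by \<open>d\<close> in degree \<open>n\<close> changes \<open>f
  +\<^sub>F f\<close> by \<open>2 d\<close> and \<open>f(t)\<close> by \<open>2\<^sup>n d\<close>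
  in that degree.
\<close>

lemma defect_diff:
  assumes f: "f \<in> pord 1" and g: "g \<in> pord 1" and d: "f \<ominus>\<^bsub>pser R\<^esub> g \<in> pord n" and m: "size m \<le> n"
  shows "defect f m \<ominus> defect g m = (two \<ominus> two [^] n) \<otimes> (f m \<ominus> g m)"
proof -
  interpret P: cring "pser R :: ('v multiset \<Rightarrow> 'r) ring" by (rule pser_cring)
  note fc = pord_carrier[OF f] and gc = pord_carrier[OF g]
  note F = fadd_carrier[OF f f] and G = fadd_carrier[OF g g]
  note tf = pord_carrier[OF psub1_t_pord[OF f]] and tg = pord_carrier[OF psub1_t_pord[OF g]]
  have A: "fadd f f \<ominus>\<^bsub>pser R\<^esub> fadd g g \<ominus>\<^bsub>pser R\<^esub> (f \<ominus>\<^bsub>pser R\<^esub> g \<oplus>\<^bsub>pser R\<^esub> (f \<ominus>\<^bsub>pser R\<^esub> g)) \<in> pord (Suc n)"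
    by (rule fadd_diff[OF f f g g d d])
  then have a: "(fadd f f \<ominus>\<^bsub>pser R\<^esub> fadd g g) m = (f \<ominus>\<^bsub>pser R\<^esub> g \<oplus>\<^bsub>pser R\<^esub> (f \<ominus>\<^bsub>pser R\<^esub> g)) m"
    using m F G fc gc by (subst (asm) pord_minus_iff) auto
  have b: "psub1 t f \<ominus>\<^bsub>pser R\<^esub> psub1 t g = psub1 t (f \<ominus>\<^bsub>pser R\<^esub> g)"
    by (rule pser_hom_over_minus[OF cring_axioms cring_axioms psub1_hom[of t, OF t] fc gc, symmetric])
  have b': "psub1 t (f \<ominus>\<^bsub>pser R\<^esub> g) m = two [^] n \<otimes> (f m \<ominus> g m)"
  proof (cases "size m = n")
    case True
    then show ?thesis using psub1_dilation[of t "f \<ominus>\<^bsub>pser R\<^esub> g" n m, OF t td d] fc gc by (simp add: pser_minus_apply)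
  next
    case False
    then have "f m \<ominus> g m = \<zero>" "psub1 t (f \<ominus>\<^bsub>pser R\<^esub> g) m = \<zero>"
      using m pord_coeff[OF d, of m] pord_coeff[OF psub1_t_pord[OF d], of m] fc gc by (auto simp: pser_minus_apply)
    then show ?thesis using two_closed by simp
  qed
  have c: "f m \<in> carrier R" "g m \<in> carrier R" using fc gc by (auto simp: pser_coeff)
  have "defect f m \<ominus> defect g m = (fadd f f m \<ominus> fadd g g m) \<ominus> (psub1 t f m \<ominus> psub1 t g m)"
    unfolding defect_def pser_minus_apply[OF F tf] pser_minus_apply[OF G tg]
    using pser_coeff[OF F, of m] pser_coeff[OF G, of m] pser_coeff[OF tf, of m] pser_coeff[OF tg, of m]
    by (intro diff_diff_swap)
  also have "fadd f f m \<ominus> fadd g g m = (f m \<ominus> g m) \<oplus> (f m \<ominus> g m)"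
    using a F G fc gc by (simp add: pser_minus_apply pser_add)
  also have "psub1 t f m \<ominus> psub1 t g m = two [^] n \<otimes> (f m \<ominus> g m)"
    using b b' tf tg by (metis pser_minus_apply)
  also have "(x \<oplus> x) \<ominus> a \<otimes> x = (two \<ominus> a) \<otimes> x" if "x \<in> carrier R" "a \<in> carrier R" for x a
  proof -
    have "x \<oplus> x = two \<otimes> x" unfolding two_def using that by (simp add: l_distr)
    then show ?thesis using that two_closed by (simp add: a_minus_def l_distr l_minus)
  qed
  from this[of "f m \<ominus> g m" "two [^] n"]
  have "(f m \<ominus> g m) \<oplus> (f m \<ominus> g m) \<ominus> two [^] n \<otimes> (f m \<ominus> g m) = (two \<ominus> two [^] n) \<otimes> (f m \<ominus> g m)"
    using c two_closed by simp
  finally show ?thesis .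
qed

text \<open>
  In degree one the factor \<open>2 - 2\<^sup>1\<close> of \<open>defect_diff\<close> vanishes;
  the linear part is free, and has to be prescribed. In higher degrees the factor is a unit, and
  \<open>f\<close> and \<open>g\<close> agree by induction on the degree.
\<close>

lemma dilation_unique:
  assumes units: "\<And>n. 2 \<le> n \<Longrightarrow> two \<ominus> two [^] (n::nat) \<in> Units R"
    and f: "f \<in> pord 1" "psub1 t f = fadd f f" and g: "g \<in> pord 1" "psub1 t g = fadd g g"
    and lin: "f \<ominus>\<^bsub>pser R\<^esub> g \<in> pord 2"
  shows "f = g"
proof (rule pser_eqI)
  interpret P: cring "pser R :: ('v multiset \<Rightarrow> 'r) ring" by (rule pser_cring)
  note fc = pord_carrier[OF f(1)] and gc = pord_carrier[OF g(1)]
  have z: "defect f m = \<zero>" "defect g m = \<zero>" for m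
    using fadd_carrier[OF f(1) f(1)] fadd_carrier[OF g(1) g(1)]
    unfolding defect_def f(2) g(2) by (simp_all add: a_minus_def P.r_neg) (simp_all add: pser_zero)
  have "f \<ominus>\<^bsub>pser R\<^esub> g \<in> pord (n + 2)" for n
  proof (induction n)
    case 0
    then show ?case using lin by (simp add: numeral_2_eq_2)
  next
    case (Suc n)
    have "f m = g m" if m: "size m < Suc n + 2" for m
    proof -
      let ?u = "two \<ominus> two [^] (n + 2)"
      have u: "?u \<in> Units R" by (rule units) simp
      have c: "f m \<ominus> g m \<in> carrier R" using fc gc by (simp add: pser_coeff)
      have "?u \<otimes> (f m \<ominus> g m) = \<zero>"
        using defect_diff[OF f(1) g(1) Suc, of m] m by (simp add: z a_minus_def)
      then have "f m \<ominus> g m = \<zero>" using u c by (metis Units_closed Units_l_cancel r_null zero_closed)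
      then show ?thesis using fc gc by (simp add: pser_coeff r_right_minus_eq)
    qed
    then show ?case using fc gc by (simp add: pord_minus_iff)
  qed
  then show "f \<ominus>\<^bsub>pser R\<^esub> g \<in> pord n" for n using pord_mono[of "f \<ominus>\<^bsub>pser R\<^esub> g" "n + 2" n] by simp
qed (use f g pord_carrier in auto)

end


context cring begin

definition rational_algebra :: bool where
  "rational_algebra \<longleftrightarrow> (\<forall>k::int. k \<noteq> 0 \<longrightarrow> [k] \<cdot> \<one> \<in> Units R)"

lemma two_power: "two [^] (n::nat) = [(2 ^ n :: nat)] \<cdot> \<one>"
proof (induction n)
  case 0 then show ?case by simp
next
  case (Suc n)
  have "two [^] Suc n = two [^] n \<otimes> two" by simp
  also have "\<dots> = two [^] n \<oplus> two [^] n" using two_closed by (simp add: two_def r_distr)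
  also have "\<dots> = [(2 ^ n + 2 ^ n :: nat)] \<cdot> \<one>" unfolding Suc by (rule add.nat_pow_mult) simp
  finally show ?case by (simp add: mult_2)
qed

lemma two_eq: "two = [(2::nat)] \<cdot> \<one>"
  using two_power[of 1] two_closed by simp

lemma rational_algebra_nat: "rational_algebra \<Longrightarrow> 0 < n \<Longrightarrow> [(n::nat)] \<cdot> \<one> \<in> Units R"
  unfolding rational_algebra_def add_pow_def
  by (metis int_pow_int add_pow_def of_nat_0_less_iff less_irrefl)

lemma Units_uminus: "a \<in> Units R \<Longrightarrow> \<ominus> a \<in> Units R"
proof -
  assume a: "a \<in> Units R"
  then have "\<ominus> a \<otimes> \<ominus> (inv a) = \<one>"
    by (simp add: l_minus r_minus Units_closed)
  moreover have "\<ominus> (inv a) \<otimes> \<ominus> a = \<one>" using a by (simp add: l_minus r_minus Units_closed)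
  moreover have "\<ominus> a \<in> carrier R" "\<ominus> (inv a) \<in> carrier R" using a by (simp_all add: Units_closed)
  ultimately show ?thesis unfolding Units_def by (blast intro: bexI[of _ "\<ominus> (inv a)"])
qed

lemma dilation_units:
  assumes "rational_algebra" "2 \<le> n"
  shows "two \<ominus> two [^] (n::nat) \<in> Units R"
proof -
  have "(2::nat) ^ 1 < 2 ^ n" using assms by (intro power_strict_increasing) auto
  then have l: "0 < 2 ^ n - (2::nat)" by simp
  let ?a = "[(2 ^ n - 2 :: nat)] \<cdot> \<one>"
  have "two \<oplus> ?a = [(2 + (2 ^ n - 2) :: nat)] \<cdot> \<one>" unfolding two_eq by (rule add.nat_pow_mult) simp
  also have "2 + (2 ^ n - 2) = (2 ^ n :: nat)" using l by simp
  also have "[(2 ^ n :: nat)] \<cdot> \<one> = two [^] n" by (rule two_power[symmetric])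
  finally have eq: "two \<oplus> ?a = two [^] n" .
  have "b \<ominus> (b \<oplus> a) = \<ominus> a" if "a \<in> carrier R" "b \<in> carrier R" for a b using that by algebra
  from this[of ?a two] have "two \<ominus> two [^] n = \<ominus> ?a" unfolding eq using two_closed by simp
  then show ?thesis using Units_uminus[OF rational_algebra_nat[OF assms(1) l]] by simp
qed

text \<open>A strict homomorphism of formal group laws from \<open>F'\<close> to \<open>F\<close>.\<close>

definition fgl_hom :: "(nat \<Rightarrow> nat \<Rightarrow> 'a) \<Rightarrow> (nat \<Rightarrow> nat \<Rightarrow> 'a) \<Rightarrow> (unit multiset \<Rightarrow> 'a) \<Rightarrow> bool" where
  "fgl_hom F' F h \<longleftrightarrow> h \<in> pord 1 \<and> h {#()#} = \<one> \<and>
    psub1 (\<lambda>_. pser_subst2 R F' (pser_var R (0::nat)) (pser_var R 1)) h =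
    pser_subst2 R F (psub1 (\<lambda>_. pser_var R (0::nat)) h) (psub1 (\<lambda>_. pser_var R 1) h)"

lemma psub1_strict:
  fixes f :: "'v multiset \<Rightarrow> 'a"
  assumes h: "h \<in> pord 1" "h {#()#} = \<one>" and f: "f \<in> pord 1"
  shows "psub1 (\<lambda>_. f) h \<ominus>\<^bsub>pser R\<^esub> f \<in> pord 2"
proof -
  let ?X = "pser_var R ()"
  have "h m = ?X m" if "size m < 2" for m
  proof -
    have "size m = 0 \<or> size m = 1" using that by linarith
    then have "m = {#} \<or> m = {#()#}" using size_1_singleton_mset[of m] by auto
    then show ?thesis using h by (auto simp: pser_one_pord0 pser_var_def)
  qed
  then have "h \<ominus>\<^bsub>pser R\<^esub> ?X \<in> pord 2" using pord_carrier[OF h(1)] pser_var_closed[of "()"] by (simp add: pord_minus_iff)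
  moreover note H = psub1_hom[of "\<lambda>_::unit. f", OF f]
  ultimately have "psub1 (\<lambda>_. f) (h \<ominus>\<^bsub>pser R\<^esub> ?X) \<in> pord 2" using pser_hom_overD(3) by blast
  then show ?thesis
    using pser_hom_over_minus[OF cring_axioms cring_axioms H pord_carrier[OF h(1)] pser_var_closed]
    by (simp add: psub1_var[of "\<lambda>_. f", OF f])
qed

end

lemma (in fgl) double_pord:
  fixes f :: "'v multiset \<Rightarrow> 'r"
  assumes f: "f \<in> pord 1"
  shows "fadd f f \<ominus>\<^bsub>pser R\<^esub> pser_const R two \<otimes>\<^bsub>pser R\<^esub> f \<in> pord 2"
proof -
  interpret P: cring "pser R :: ('v multiset \<Rightarrow> 'r) ring" by (rule pser_cring)
  have s: "pair_fun f f v \<in> pord 1" for v using f f by (rule pair_fun_pord)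
  note fc = pser_coeff[OF pord_carrier[OF f]]
  have "pser_const R two \<otimes>\<^bsub>pser R\<^esub> f = f \<oplus>\<^bsub>pser R\<^esub> f"
    using fc by (simp add: pser_const_mult two_closed pser_add two_def l_distr)
  moreover have "(a \<oplus>\<^bsub>pser R\<^esub> b) \<ominus>\<^bsub>pser R\<^esub> a = b" if "a \<in> carrier (pser R)" "b \<in> carrier (pser R)" 
    for a b :: "'v multiset \<Rightarrow> 'r" using that by algebra
  moreover have "psub1 (pair_fun f f) fgl_rest \<in> pord 2" by (rule psub1D(3)[of "pair_fun f f", OF s fgl_rest_pord])
  ultimately show ?thesis using f by (simp add: fadd_expand pord_carrier)
qed

lemma (in fgl) dilationI:
  assumes "fgl R F'"
  shows "dilation R F (\<lambda>v :: 'v. pser_subst2 R F' (pser_var R v) (pser_var R v))"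
proof -
  interpret B: fgl R F' by fact
  show ?thesis
    by unfold_locales (auto intro: B.fadd_pord pser_var_pord B.double_pord)
qed

lemma (in fgl) psub1_double:
  fixes s :: "'v \<Rightarrow> 'w multiset \<Rightarrow> 'r"
  assumes s: "\<And>v. s v \<in> pord 1" and f: "f \<in> pord 1"
  shows "psub1 s (fadd f f) = fadd (psub1 s f) (psub1 s f)"
  by (rule hom_fadd[OF psub1_hom[of s, OF s] f f])

lemma (in cring) psub1_psub1:
  fixes s :: "'v \<Rightarrow> 'w multiset \<Rightarrow> 'a" and r :: "'w \<Rightarrow> 'x multiset \<Rightarrow> 'a"
  assumes s: "\<And>v. s v \<in> pord 1" and r: "\<And>w. r w \<in> pord 1" and f: "f \<in> carrier (pser R)"
  shows "psub1 r (psub1 s f) = psub1 (\<lambda>v. psub1 r (s v)) f"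
  by (rule coeff_hom.hom_psub1[OF id_coeff_hom psub1_hom[of r, OF r] s f])

context dilation begin

text \<open>
  A solution with prescribed linear part. The hypothesis \<open>fin\<close> says that there are
  only finitely many monomials of each degree, so that a series may be given by arbitrary
  coefficients.
\<close>

lemma dilation_exists:
  assumes units: "\<And>n. 2 \<le> n \<Longrightarrow> two \<ominus> two [^] (n::nat) \<in> Units R"
    and fin: "\<And>f. (\<And>m. f m \<in> carrier R) \<Longrightarrow> (f :: 'v multiset \<Rightarrow> 'r) \<in> carrier (pser R)"
  shows "\<exists>h\<in>pord 1. psub1 t h = fadd h h \<and> (\<forall>m. size m = 1 \<longrightarrow> h m = pser_var R v m)"
proof -
  interpret P: cring "pser R :: ('v multiset \<Rightarrow> 'r) ring" by (rule pser_cring)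
  let ?c = "\<lambda>n::nat. inv (two \<ominus> two [^] n)"
  \<comment> \<open>by \<open>defect_diff\<close>, subtracting this multiple of the defect from the
    coefficients in degree \<open>n\<close> makes the defect vanish there if it vanishes in
    lower degrees\<close>
  let ?T = "\<lambda>h m. if size m < 2 then pser_var R v m else h m \<ominus> ?c (size m) \<otimes> defect h m"
  have cc: "?c n \<in> carrier R" "?c n \<otimes> (two \<ominus> two [^] n) = \<one>" if "2 \<le> n" for n
    using units[OF that] by auto
  have vc: "pser_var R v m \<in> carrier R" for m by (rule pser_coeff[OF pser_var_closed])
  note dc = pser_coeff[OF pord_carrier[OF defect_pord]]
  have Tc: "?T h m \<in> carrier R" if "h \<in> pord 1" for h m
    using cc(1)[of "size m"] dc[OF that] pser_coeff[OF pord_carrier[OF that]] vc by auto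
  have Tp: "?T h \<in> pord 1" if "h \<in> pord 1" for h
    unfolding pser_one_pord0 using fin[of "?T h", OF Tc[OF that]] by (simp add: pser_var_def)
  have "\<exists>h\<in>pord 1. ?T h = h"
  proof (rule contraction_exists)
    fix f g :: "'v multiset \<Rightarrow> 'r" and n assume f: "f \<in> pord 1" and g: "g \<in> pord 1" and d: "f \<ominus>\<^bsub>pser R\<^esub> g \<in> pord n"
    have "?T f m = ?T g m" if m: "size m < Suc n" for m
    proof (cases "size m < 2")
      case False
      let ?u = "two \<ominus> two [^] size m"
      have fg: "f m \<in> carrier R" "g m \<in> carrier R"
        using pord_carrier[OF f] pord_carrier[OF g] by (auto simp: pser_coeff)
      have u: "?u \<in> carrier R" using two_closed by simp
      have c: "?c (size m) \<in> carrier R" "?c (size m) \<otimes> ?u = \<one>" using cc[of "size m"] False by auto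
      have "defect f m \<ominus> defect g m = ?u \<otimes> (f m \<ominus> g m)"
        using m pord_mono[OF d] by (intro defect_diff[OF f g]) auto
      then have "?c (size m) \<otimes> (defect f m \<ominus> defect g m) = f m \<ominus> g m"
        using c u fg by (simp add: m_assoc[symmetric])
      then have "?c (size m) \<otimes> defect f m \<ominus> ?c (size m) \<otimes> defect g m = f m \<ominus> g m"
        using c dc[OF f, of m] dc[OF g, of m] by (simp add: a_minus_def r_distr r_minus)
      then have "f m \<ominus> ?c (size m) \<otimes> defect f m \<ominus> (g m \<ominus> ?c (size m) \<otimes> defect g m) = \<zero>"
        using c dc[OF f, of m] dc[OF g, of m] fg
        by (subst diff_diff_swap) (auto simp: r_right_minus_eq)
      then show ?thesis using False c dc[OF f, of m] dc[OF g, of m] fg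
        by (simp add: r_right_minus_eq)
    qed simp
    then show "?T f \<ominus>\<^bsub>pser R\<^esub> ?T g \<in> pord (Suc n)"
      using pord_carrier[OF Tp[OF f]] pord_carrier[OF Tp[OF g]] by (simp add: pord_minus_iff)
  qed (use Tp in \<open>auto intro: pord_carrier pord_zero pord_closed\<close>)
  then obtain h where h: "h \<in> pord 1" "?T h = h" by blast
  note hc = pser_coeff[OF pord_carrier[OF h(1)]]
  have z: "defect \<zero>\<^bsub>pser R\<^esub> = \<zero>\<^bsub>pser R\<^esub>"
    unfolding defect_def using psub1_zero[of t, OF t]
    by (simp add: fadd_zero_right pord_zero a_minus_def)
  have "defect h m = \<zero>" for m
  proof (cases "size m < 2")
    case True
    have "defect h m \<ominus> defect \<zero>\<^bsub>pser R\<^esub> m = (two \<ominus> two [^] (1::nat)) \<otimes> (h m \<ominus> (\<zero>\<^bsub>pser R\<^esub> :: 'v multiset \<Rightarrow> 'r) m)"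
      using h(1) True by (intro defect_diff) (auto simp: pord_zero intro!: pord_minus)
    then show ?thesis using hc[of m] dc[OF h(1), of m] two_closed
      unfolding z by (simp add: pser_zero a_minus_def r_neg)
  next
    case False
    then have "h m = h m \<ominus> ?c (size m) \<otimes> defect h m" using fun_cong[OF h(2), of m] by simp
    moreover have c: "?c (size m) \<in> Units R" using units[of "size m"] False by simp
    moreover have "x = \<zero>" if "a = a \<ominus> x" "a \<in> carrier R" "x \<in> carrier R" for a x
    proof -
      have "x = a \<ominus> (a \<ominus> x)" using that(2,3) by algebra
      also have "\<dots> = \<zero>" unfolding that(1)[symmetric] using that(2) by (simp add: a_minus_def r_neg)
      finally show ?thesis .
    qed
    ultimately have "?c (size m) \<otimes> defect h m = \<zero>" using hc[of m] dc[OF h(1), of m] by blast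
    then show ?thesis using c dc[OF h(1), of m] by (metis Units_closed Units_l_cancel r_null zero_closed)
  qed
  then have "fadd h h \<ominus>\<^bsub>pser R\<^esub> psub1 t h = \<zero>\<^bsub>pser R\<^esub>" by (auto simp: defect_def pser_zero fun_eq_iff)
  then have "fadd h h = psub1 t h"
    using pord_carrier[OF psub1_t_pord[OF h(1)]] fadd_carrier[OF h(1) h(1)] by (subst (asm) P.r_right_minus_eq) auto
  moreover have "h m = pser_var R v m" if "size m = 1" for m
    using fun_cong[OF h(2), of m] that by simp
  ultimately show ?thesis using h(1) by (intro bexI[of _ h]) auto
qed

end


text \<open>
  Let \<open>h\<close> be the solution of \<open>h([2]\<^bsub>F'\<^esub> u) = [2]\<^sub>F
  h(u)\<close> with \<open>h = u + \<dots>\<close>. Then \<open>h(x +\<^bsub>F'\<^esub> y)\<close>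
  and \<open>h(x) +\<^sub>F h(y)\<close> both satisfy the corresponding equation in two variables,
  for the substitution of \<open>[2]\<^bsub>F'\<^esub> x\<close> and \<open>[2]\<^bsub>F'\<^esub>
  y\<close>, and have the same linear part. By uniqueness they agree.
\<close>

lemma (in cring) fgl_hom_exists:
  assumes "fgl R F" "fgl R F'" and Q: rational_algebra
  shows "\<exists>h. fgl_hom F' F h \<and>
    psub1 (\<lambda>_. pser_subst2 R F' (pser_var R ()) (pser_var R ())) h = pser_subst2 R F h h"
proof -
  interpret A: fgl R F by fact
  interpret B: fgl R F' by fact
  let ?X = "pser_var R ()" and ?x = "pser_var R (0::nat)" and ?y = "pser_var R (1::nat)"
  let ?t1 = "\<lambda>v::unit. B.fadd (pser_var R v) (pser_var R v)"
  let ?t = "\<lambda>v::nat. B.fadd (pser_var R v) (pser_var R v)"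
  interpret D1: dilation R F ?t1 by (rule A.dilationI[OF assms(2)])
  interpret D: dilation R F ?t by (rule A.dilationI[OF assms(2)])
  note units = dilation_units[OF Q]
  obtain h where h: "h \<in> pord 1" "psub1 ?t1 h = A.fadd h h" "\<And>m. size m = 1 \<Longrightarrow> h m = ?X m"
    using D1.dilation_exists[of "()", OF units pser_unit_closed] by auto
  have h1: "h {#()#} = \<one>" using h(3)[of "{#()#}"] by (simp add: pser_var_def)
  have hc: "h \<in> carrier (pser R)" by (rule pord_carrier[OF h(1)])
  have dh: "psub1 (\<lambda>_. B.fadd ?X ?X) h = A.fadd h h" using h(2) by simp
  have xp: "?x \<in> pord 1" "?y \<in> pord 1" "?X \<in> pord 1" by (rule pser_var_pord)+
  have dX: "B.fadd ?X ?X \<in> pord 1" by (intro B.fadd_pord xp)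
  have sh: "psub1 (\<lambda>_. f) h \<in> pord 1" if "f \<in> pord 1" for f :: "nat multiset \<Rightarrow> 'a"
    using psub1D(3)[of "\<lambda>_::unit. f", OF that h(1)] .
  have double: "psub1 (\<lambda>_. B.fadd f f) h = A.fadd (psub1 (\<lambda>_. f) h) (psub1 (\<lambda>_. f) h)"
    if f: "f \<in> pord 1" for f :: "nat multiset \<Rightarrow> 'a"
  proof -
    have "psub1 (\<lambda>_. f) (psub1 (\<lambda>_. B.fadd ?X ?X) h) = psub1 (\<lambda>_. psub1 (\<lambda>_. f) (B.fadd ?X ?X)) h"
      by (rule psub1_psub1) (rule dX f hc)+
    also have "psub1 (\<lambda>_. f) (B.fadd ?X ?X) = B.fadd f f"
      unfolding B.psub1_double[of "\<lambda>_::unit. f", OF f xp(3)] psub1_var[of "\<lambda>_::unit. f", OF f] ..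
    finally show ?thesis
      unfolding dh A.psub1_double[of "\<lambda>_::unit. f", OF f h(1)] by simp
  qed
  have t: "?t v \<in> pord 1" for v by (intro B.fadd_pord pser_var_pord)
  let ?H1 = "psub1 (\<lambda>_. B.fadd ?x ?y) h" and ?H2 = "A.fadd (psub1 (\<lambda>_. ?x) h) (psub1 (\<lambda>_. ?y) h)"
  have F': "B.fadd ?x ?y \<in> pord 1" by (intro B.fadd_pord xp)
  have "?H1 = ?H2"
  proof (rule D.dilation_unique[OF units])
    show "?H1 \<in> pord 1" by (rule sh[OF F'])
    show "?H2 \<in> pord 1" by (intro A.fadd_pord sh xp)
    have tF: "psub1 ?t (B.fadd ?x ?y) = B.fadd (B.fadd ?x ?y) (B.fadd ?x ?y)"
      unfolding B.hom_fadd[OF psub1_hom[of ?t, OF t] xp(1,2)] psub1_var[of ?t, OF t]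
      by (rule B.fadd_interchange[OF xp(1) xp(1) xp(2) xp(2)])
    have "psub1 ?t ?H1 = psub1 (\<lambda>_. psub1 ?t (B.fadd ?x ?y)) h"
      by (rule psub1_psub1) (rule F' t hc)+
    then show "psub1 ?t ?H1 = A.fadd ?H1 ?H1" unfolding tF double[OF F'] .
    have hx: "psub1 ?t (psub1 (\<lambda>_. pser_var R v) h) = A.fadd (psub1 (\<lambda>_. pser_var R v) h) (psub1 (\<lambda>_. pser_var R v) h)" for v
    proof -
      have "psub1 ?t (psub1 (\<lambda>_. pser_var R v) h) = psub1 (\<lambda>_. psub1 ?t (pser_var R v)) h"
        by (rule psub1_psub1) (rule pser_var_pord t hc)+
      then show ?thesis unfolding psub1_var[of ?t, OF t] double[OF pser_var_pord] .
    qed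
    show "psub1 ?t ?H2 = A.fadd ?H2 ?H2"
      unfolding A.hom_fadd[OF psub1_hom[of ?t, OF t] sh[OF xp(1)] sh[OF xp(2)]] hx
      by (rule A.fadd_interchange) (rule sh[OF xp(1)] sh[OF xp(2)])+
    interpret P: cring "pser R :: (nat multiset \<Rightarrow> 'a) ring" by (rule pser_cring)
    have lin: "fadd f g \<ominus>\<^bsub>pser R\<^esub> (f \<oplus>\<^bsub>pser R\<^esub> g) \<in> pord 2"
      if "fadd = pser_subst2 R G" "fgl R G" "f \<in> pord 1" "g \<in> pord 1" for fadd G and f g :: "nat multiset \<Rightarrow> 'a"
    proof -
      interpret G: fgl R G by fact
      have "(a \<oplus>\<^bsub>pser R\<^esub> b) \<ominus>\<^bsub>pser R\<^esub> a = b" if "a \<in> carrier (pser R)" "b \<in> carrier (pser R)" 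
        for a b :: "nat multiset \<Rightarrow> 'a" using that by algebra
      moreover have "psub1 (pair_fun f g) G.fgl_rest \<in> pord 2"
        by (rule psub1D(3)[of "pair_fun f g", OF pair_fun_pord G.fgl_rest_pord]) (rule that)+
      ultimately show ?thesis using that(3,4) unfolding that(1) by (simp add: G.fadd_expand pord_carrier)
    qed
    let ?a = "psub1 (\<lambda>_. ?x) h" and ?b = "psub1 (\<lambda>_. ?y) h"
    have 1: "?H1 \<ominus>\<^bsub>pser R\<^esub> B.fadd ?x ?y \<in> pord 2" by (rule psub1_strict[OF h(1) h1 F'])
    have 2: "B.fadd ?x ?y \<ominus>\<^bsub>pser R\<^esub> (?x \<oplus>\<^bsub>pser R\<^esub> ?y) \<in> pord 2" by (rule lin[OF refl assms(2) xp(1,2)])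
    have 3: "?H2 \<ominus>\<^bsub>pser R\<^esub> (?a \<oplus>\<^bsub>pser R\<^esub> ?b) \<in> pord 2" by (rule lin[OF refl assms(1) sh[OF xp(1)] sh[OF xp(2)]])
    have 4: "?a \<ominus>\<^bsub>pser R\<^esub> ?x \<in> pord 2" "?b \<ominus>\<^bsub>pser R\<^esub> ?y \<in> pord 2"
      by (rule psub1_strict[OF h(1) h1 xp(1)], rule psub1_strict[OF h(1) h1 xp(2)])
    have c: "?H1 \<in> carrier (pser R)" "?H2 \<in> carrier (pser R)" "?a \<in> carrier (pser R)" "?b \<in> carrier (pser R)"
      by (intro pord_carrier[OF sh[OF F']] pord_carrier[OF A.fadd_pord[OF sh[OF xp(1)] sh[OF xp(2)]]]
          pord_carrier[OF sh[OF xp(1)]] pord_carrier[OF sh[OF xp(2)]])+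
    have "?H1 m = ?H2 m" if m: "size m < 2" for m
    proof -
      have "?H1 m = B.fadd ?x ?y m" using 1 m c F'[THEN pord_carrier] by (simp add: pord_minus_iff)
      also have "\<dots> = (?x \<oplus>\<^bsub>pser R\<^esub> ?y) m"
        using 2 m F'[THEN pord_carrier] xp[THEN pord_carrier] by (simp add: pord_minus_iff pser_add_closed)
      also have "\<dots> = ?x m \<oplus> ?y m" by (simp add: pser_add)
      also have "\<dots> = ?a m \<oplus> ?b m" using 4 m c xp[THEN pord_carrier] by (simp add: pord_minus_iff)
      also have "\<dots> = (?a \<oplus>\<^bsub>pser R\<^esub> ?b) m" by (simp add: pser_add)
      also have "\<dots> = ?H2 m" using 3 m c by (simp add: pord_minus_iff pser_add_closed)
      finally show ?thesis .
    qed
    then show "?H1 \<ominus>\<^bsub>pser R\<^esub> ?H2 \<in> pord 2" using c by (simp add: pord_minus_iff)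
  qed
  then have "fgl_hom F' F h" unfolding fgl_hom_def using h(1) h1 by blast
  with dh show ?thesis by blast
qed

text \<open>
  The composition of the homomorphisms in the two directions and the identity satisfy the same
  equation \<open>f([2] u) = [2] f(u)\<close>, and have the same linear part.
\<close>

theorem (in cring) fgl_iso_exists:
  assumes F: "fgl R F" "fgl R F'" and Q: rational_algebra
  shows "\<exists>h h'. fgl_hom F' F h \<and> fgl_hom F F' h' \<and>
    psub1 (\<lambda>_. h) h' = pser_var R () \<and> psub1 (\<lambda>_. h') h = pser_var R ()"
proof -
  let ?X = "pser_var R ()"
  have inv: "psub1 (\<lambda>_. h) h' = ?X"
    if F: "fgl R F" "fgl R F'" and h: "fgl_hom F' F h" "psub1 (\<lambda>_. pser_subst2 R F' ?X ?X) h = pser_subst2 R F h h"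
      and h': "fgl_hom F F' h'" "psub1 (\<lambda>_. pser_subst2 R F ?X ?X) h' = pser_subst2 R F' h' h'" for F F' h h'
  proof -
    interpret A: fgl R F by fact
    interpret B: fgl R F' by fact
    let ?t1 = "\<lambda>v::unit. B.fadd (pser_var R v) (pser_var R v)"
    interpret D1: dilation R F' ?t1 by (rule B.dilationI[OF F(2)])
    have hp: "h \<in> pord 1" "h {#()#} = \<one>" "h' \<in> pord 1" "h' {#()#} = \<one>" using h h' by (auto simp: fgl_hom_def)
    have Xp: "?X \<in> pord 1" by (rule pser_var_pord)
    have t: "?t1 v \<in> pord 1" for v by (intro B.fadd_pord pser_var_pord)
    show ?thesis
    proof (rule D1.dilation_unique[OF dilation_units[OF Q]])
      show "psub1 (\<lambda>_. h) h' \<in> pord 1" by (rule psub1D(3)[OF hp(1) hp(3)])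
      show "?X \<in> pord 1" by (rule Xp)
      show "psub1 ?t1 ?X = B.fadd ?X ?X" by (rule psub1_var[of ?t1, OF t])
      have "psub1 (\<lambda>_. h) (psub1 (\<lambda>_. A.fadd ?X ?X) h') = psub1 (\<lambda>_. psub1 (\<lambda>_. h) (A.fadd ?X ?X)) h'"
        by (rule psub1_psub1) (rule A.fadd_pord Xp hp pord_carrier[OF hp(3)])+
      moreover have "psub1 (\<lambda>_. h) (A.fadd ?X ?X) = A.fadd h h"
        unfolding A.psub1_double[of "\<lambda>_::unit. h", OF hp(1) Xp] psub1_var[of "\<lambda>_::unit. h", OF hp(1)] ..
      moreover have "psub1 (\<lambda>_. h) (B.fadd h' h') = B.fadd (psub1 (\<lambda>_. h) h') (psub1 (\<lambda>_. h) h')"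
        by (rule B.psub1_double) (rule hp)+
      moreover have "psub1 ?t1 (psub1 (\<lambda>_. h) h') = psub1 (\<lambda>_. psub1 ?t1 h) h'"
        by (rule psub1_psub1) (rule hp t pord_carrier[OF hp(3)])+
      moreover have "psub1 ?t1 h = A.fadd h h" using h(2) by simp
      ultimately show "psub1 ?t1 (psub1 (\<lambda>_. h) h') = B.fadd (psub1 (\<lambda>_. h) h') (psub1 (\<lambda>_. h) h')"
        using h'(2) by simp
      have 1: "psub1 (\<lambda>_. h) h' \<ominus>\<^bsub>pser R\<^esub> h \<in> pord 2" by (rule psub1_strict[OF hp(3,4) hp(1)])
      have "psub1 (\<lambda>_. ?X) h \<ominus>\<^bsub>pser R\<^esub> ?X \<in> pord 2" by (rule psub1_strict[OF hp(1,2) Xp])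
      moreover have "psub1 (\<lambda>_. ?X) h = h"
        using pser_hom_over_eq[OF cring_axioms cring_axioms psub1_hom[of "\<lambda>_::unit. ?X", OF Xp] pser_hom_over_id _ _ pord_carrier[OF hp(1)]]
          psub1_var[of "\<lambda>_::unit. ?X", OF Xp] by simp
      ultimately have 2: "h \<ominus>\<^bsub>pser R\<^esub> ?X \<in> pord 2" by simp
      have c: "psub1 (\<lambda>_. h) h' \<in> carrier (pser R)" "h \<in> carrier (pser R)" "?X \<in> carrier (pser R)"
        by (rule psub1D(4)[OF hp(1) pord_carrier[OF hp(3)]], rule pord_carrier[OF hp(1)], rule pser_var_closed)
      show "psub1 (\<lambda>_. h) h' \<ominus>\<^bsub>pser R\<^esub> ?X \<in> pord 2"
        using 1 2 c by (simp add: pord_minus_iff)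
    qed
  qed
  from fgl_hom_exists[OF F Q] fgl_hom_exists[OF F(2,1) Q] obtain h h' where
    "fgl_hom F' F h" "psub1 (\<lambda>_. pser_subst2 R F' ?X ?X) h = pser_subst2 R F h h"
    "fgl_hom F F' h'" "psub1 (\<lambda>_. pser_subst2 R F ?X ?X) h' = pser_subst2 R F' h' h'" by blast
  then show ?thesis using inv[OF F] inv[OF F(2,1)] by blast
qed

lemma ring_hom_Units:
  assumes h: "h \<in> ring_hom R S" and a: "a \<in> Units R"
  shows "h a \<in> Units S"
proof -
  from a obtain b where b: "a \<in> carrier R" "b \<in> carrier R" "b \<otimes>\<^bsub>R\<^esub> a = \<one>\<^bsub>R\<^esub>" "a \<otimes>\<^bsub>R\<^esub> b = \<one>\<^bsub>R\<^esub>"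
    unfolding Units_def by blast
  have "h b \<otimes>\<^bsub>S\<^esub> h a = \<one>\<^bsub>S\<^esub>" "h a \<otimes>\<^bsub>S\<^esub> h b = \<one>\<^bsub>S\<^esub>"
    using ring_hom_mult[OF h b(2,1)] ring_hom_mult[OF h b(1,2)] ring_hom_one[OF h] b(3,4) by simp_all
  then show ?thesis using ring_hom_closed[OF h b(1)] ring_hom_closed[OF h b(2)] unfolding Units_def by blast
qed

lemma ring_hom_inv:
  assumes R: "ring R" and S: "ring S" and h: "h \<in> ring_hom R S" and a: "a \<in> Units R"
  shows "h (inv\<^bsub>R\<^esub> a) = inv\<^bsub>S\<^esub> (h a)"
proof -
  interpret R: ring R by fact
  interpret S: ring S by fact
  have i: "inv\<^bsub>R\<^esub> a \<in> carrier R" "a \<in> carrier R" using a by auto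
  have "h (inv\<^bsub>R\<^esub> a) \<otimes>\<^bsub>S\<^esub> h a = \<one>\<^bsub>S\<^esub>"
    using ring_hom_mult[OF h i] ring_hom_one[OF h] a by simp
  then show ?thesis using ring_hom_Units[OF h a] ring_hom_closed[OF h i(1)]
    by (metis S.Units_closed S.inv_unique' S.Units_r_inv S.Units_inv_closed S.inv_unique)
qed

section \<open>Closed ideals of power series rings\<close>

context cring begin

text \<open>
  The ideals defining formal group algebras are closures, so that only closed ideals behave well
  under quotients of power series rings.
\<close>

definition closed_ideal :: "('v multiset \<Rightarrow> 'a) set \<Rightarrow> bool" where
  "closed_ideal J \<longleftrightarrow> ideal J (pser R) \<and>
    (\<forall>f\<in>carrier (pser R). (\<forall>n. \<exists>g\<in>J. f \<ominus>\<^bsub>pser R\<^esub> g \<in> pord n) \<longrightarrow> f \<in> J)"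

lemma closed_idealD:
  assumes "closed_ideal J"
  shows "ideal J (pser R)" "J \<subseteq> carrier (pser R)"
    "f \<in> carrier (pser R) \<Longrightarrow> (\<And>n. \<exists>g\<in>J. f \<ominus>\<^bsub>pser R\<^esub> g \<in> pord n) \<Longrightarrow> f \<in> J"
proof -
  show J: "ideal J (pser R)" using assms by (simp add: closed_ideal_def)
  show "J \<subseteq> carrier (pser R)" using ideal.Icarr[OF J] by (rule subsetI)
  show "f \<in> carrier (pser R) \<Longrightarrow> (\<And>n. \<exists>g\<in>J. f \<ominus>\<^bsub>pser R\<^esub> g \<in> pord n) \<Longrightarrow> f \<in> J"
    using assms unfolding closed_ideal_def by simp
qed

lemma closed_ideal_mem:
  fixes J :: "('v multiset \<Rightarrow> 'a) set"
  assumes "closed_ideal J"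
  shows "\<zero>\<^bsub>pser R\<^esub> \<in> J" "f \<in> J \<Longrightarrow> g \<in> J \<Longrightarrow> f \<oplus>\<^bsub>pser R\<^esub> g \<in> J" "f \<in> J \<Longrightarrow> \<ominus>\<^bsub>pser R\<^esub> f \<in> J"
    "f \<in> J \<Longrightarrow> g \<in> J \<Longrightarrow> f \<ominus>\<^bsub>pser R\<^esub> g \<in> J"
    "f \<in> J \<Longrightarrow> g \<in> carrier (pser R) \<Longrightarrow> f \<otimes>\<^bsub>pser R\<^esub> g \<in> J"
    "f \<in> J \<Longrightarrow> g \<in> carrier (pser R) \<Longrightarrow> g \<otimes>\<^bsub>pser R\<^esub> f \<in> J"
proof -
  interpret J: ideal J "pser R" by (rule closed_idealD(1)[OF assms])
  show "\<zero>\<^bsub>pser R\<^esub> \<in> J" "f \<in> J \<Longrightarrow> g \<in> J \<Longrightarrow> f \<oplus>\<^bsub>pser R\<^esub> g \<in> J" "f \<in> J \<Longrightarrow> \<ominus>\<^bsub>pser R\<^esub> f \<in> J"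
    "f \<in> J \<Longrightarrow> g \<in> carrier (pser R) \<Longrightarrow> f \<otimes>\<^bsub>pser R\<^esub> g \<in> J"
    "f \<in> J \<Longrightarrow> g \<in> carrier (pser R) \<Longrightarrow> g \<otimes>\<^bsub>pser R\<^esub> f \<in> J"
    by (auto simp: J.I_r_closed J.I_l_closed)
  then show "f \<in> J \<Longrightarrow> g \<in> J \<Longrightarrow> f \<ominus>\<^bsub>pser R\<^esub> g \<in> J" by (simp add: a_minus_def)
qed

lemma pser_closure_eq:
  fixes J :: "('v multiset \<Rightarrow> 'a) set"
  assumes "J \<subseteq> carrier (pser R)"
  shows "pser_closure R J = {f \<in> carrier (pser R). \<forall>n. \<exists>g\<in>J. f \<ominus>\<^bsub>pser R\<^esub> g \<in> pord n}"
proof -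
  have "(\<exists>g\<in>J. \<forall>m. size m < n \<longrightarrow> f m = g m) \<longleftrightarrow> (\<exists>g\<in>J. f \<ominus>\<^bsub>pser R\<^esub> g \<in> pord n)"
    if "f \<in> carrier (pser R)" for f n
    using assms that by (intro bex_cong) (auto simp: pord_minus_iff)
  then show ?thesis unfolding pser_closure_def by blast
qed

lemma closed_ideal_closure:
  fixes J :: "('v multiset \<Rightarrow> 'a) set"
  assumes J: "ideal J (pser R)"
  shows "closed_ideal (pser_closure R J)"
proof -
  interpret P: cring "pser R :: ('v multiset \<Rightarrow> 'a) ring" by (rule pser_cring)
  interpret J: ideal J "pser R" by fact
  note Jc = J.Icarr
  have eq: "pser_closure R J = {f \<in> carrier (pser R). \<forall>n. \<exists>g\<in>J. f \<ominus>\<^bsub>pser R\<^esub> g \<in> pord n}"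
    using Jc by (intro pser_closure_eq) blast
  let ?C = "{f \<in> carrier (pser R). \<forall>n. \<exists>g\<in>J. f \<ominus>\<^bsub>pser R\<^esub> g \<in> pord n}"
  have add: "f \<oplus>\<^bsub>pser R\<^esub> g \<in> ?C" if "f \<in> ?C" "g \<in> ?C" for f g
  proof -
    have "\<exists>h\<in>J. (f \<oplus>\<^bsub>pser R\<^esub> g) \<ominus>\<^bsub>pser R\<^esub> h \<in> pord n" for n
    proof -
      from that obtain f' g' where h: "f' \<in> J" "f \<ominus>\<^bsub>pser R\<^esub> f' \<in> pord n" "g' \<in> J" "g \<ominus>\<^bsub>pser R\<^esub> g' \<in> pord n" by blast
      have "(f \<oplus>\<^bsub>pser R\<^esub> g) \<ominus>\<^bsub>pser R\<^esub> (f' \<oplus>\<^bsub>pser R\<^esub> g') = (f \<ominus>\<^bsub>pser R\<^esub> f') \<oplus>\<^bsub>pser R\<^esub> (g \<ominus>\<^bsub>pser R\<^esub> g')"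
        using that h Jc by (intro P.add_diff_split) auto
      also have "\<dots> \<in> pord n" by (rule pord_add[OF h(2,4)])
      finally show ?thesis using h by (intro bexI[of _ "f' \<oplus>\<^bsub>pser R\<^esub> g'"]) auto
    qed
    then show ?thesis using that by auto
  qed
  have mult: "g \<otimes>\<^bsub>pser R\<^esub> f \<in> ?C" if "f \<in> ?C" "g \<in> carrier (pser R)" for f g
  proof -
    have "\<exists>h\<in>J. (g \<otimes>\<^bsub>pser R\<^esub> f) \<ominus>\<^bsub>pser R\<^esub> h \<in> pord n" for n
    proof -
      from that obtain f' where h: "f' \<in> J" "f \<ominus>\<^bsub>pser R\<^esub> f' \<in> pord n" by blast
      have "(g \<otimes>\<^bsub>pser R\<^esub> f) \<ominus>\<^bsub>pser R\<^esub> (g \<otimes>\<^bsub>pser R\<^esub> f') = g \<otimes>\<^bsub>pser R\<^esub> (f \<ominus>\<^bsub>pser R\<^esub> f')"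
        using that Jc[OF h(1)] by (simp add: a_minus_def P.r_distr P.r_minus)
      also have "\<dots> \<in> pord n" by (rule pord_mult_left[OF h(2) that(2)])
      finally show ?thesis using J.I_l_closed[OF h(1) that(2)] by blast
    qed
    then show ?thesis using that by auto
  qed
  have zero: "\<zero>\<^bsub>pser R\<^esub> \<in> ?C"
    using J.zero_closed pord_zero by (auto intro!: bexI[of _ "\<zero>\<^bsub>pser R\<^esub>"] simp: a_minus_def)
  have "ideal ?C (pser R)"
  proof (rule idealI)
    show "ring (pser R :: ('v multiset \<Rightarrow> 'a) ring)" by (rule pser_ring)
    show "subgroup ?C (add_monoid (pser R))"
    proof (rule group.subgroupI)
      show "group (add_monoid (pser R :: ('v multiset \<Rightarrow> 'a) ring))" by (rule P.a_group)
      fix f assume f: "f \<in> ?C"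
      have "\<ominus>\<^bsub>pser R\<^esub> f = \<ominus>\<^bsub>pser R\<^esub> \<one>\<^bsub>pser R\<^esub> \<otimes>\<^bsub>pser R\<^esub> f" using f by (simp add: P.l_minus)
      then have "\<ominus>\<^bsub>pser R\<^esub> f \<in> ?C" using mult[OF f, of "\<ominus>\<^bsub>pser R\<^esub> \<one>\<^bsub>pser R\<^esub>"] by simp
      then show "inv\<^bsub>add_monoid (pser R)\<^esub> f \<in> ?C" by (simp add: a_inv_def)
    qed (use zero add in auto)
    show "f \<otimes>\<^bsub>pser R\<^esub> g \<in> ?C" if "f \<in> ?C" "g \<in> carrier (pser R)" for f g
      using mult[OF that] that by (simp add: P.m_comm)
  qed (rule mult)
  moreover have "f \<in> ?C" if f: "f \<in> carrier (pser R)" "\<forall>n. \<exists>g\<in>?C. f \<ominus>\<^bsub>pser R\<^esub> g \<in> pord n" for f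
  proof -
    have "\<exists>h\<in>J. f \<ominus>\<^bsub>pser R\<^esub> h \<in> pord n" for n
    proof -
      from f obtain g where g: "g \<in> ?C" "f \<ominus>\<^bsub>pser R\<^esub> g \<in> pord n" by blast
      then obtain h where h: "h \<in> J" "g \<ominus>\<^bsub>pser R\<^esub> h \<in> pord n" by blast
      have "f \<ominus>\<^bsub>pser R\<^esub> h = (f \<ominus>\<^bsub>pser R\<^esub> g) \<oplus>\<^bsub>pser R\<^esub> (g \<ominus>\<^bsub>pser R\<^esub> h)"
        using f g Jc[OF h(1)] by (intro P.diff_trans) auto
      also have "\<dots> \<in> pord n" by (rule pord_add[OF g(2) h(2)])
      finally show ?thesis using h(1) by blast
    qed
    then show ?thesis using f by blast
  qed
  ultimately show ?thesis unfolding eq closed_ideal_def by blast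
qed

lemma closed_ideal_zero: "closed_ideal {\<zero>\<^bsub>pser R\<^esub> :: 'v multiset \<Rightarrow> 'a}"
proof -
  interpret P: cring "pser R :: ('v multiset \<Rightarrow> 'a) ring" by (rule pser_cring)
  have "f = \<zero>\<^bsub>pser R\<^esub>" if "f \<in> carrier (pser R)" "\<forall>n. f \<ominus>\<^bsub>pser R\<^esub> \<zero>\<^bsub>pser R\<^esub> \<in> pord n" for f :: "'v multiset \<Rightarrow> 'a"
    by (rule pser_eqI) (use that in auto)
  then show ?thesis using P.zeroideal by (simp add: closed_ideal_def)
qed

lemma closure_subset:
  fixes J K :: "('v multiset \<Rightarrow> 'a) set"
  assumes "J \<subseteq> K" "closed_ideal K"
  shows "pser_closure R J \<subseteq> K"
proof -
  have "J \<subseteq> carrier (pser R)" using assms closed_idealD(2) by blast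
  then show ?thesis using assms closed_idealD(3)[OF assms(2)] unfolding pser_closure_eq[OF \<open>J \<subseteq> carrier (pser R)\<close>] by blast
qed

lemma closure_superset:
  fixes J :: "('v multiset \<Rightarrow> 'a) set"
  assumes "J \<subseteq> carrier (pser R)"
  shows "J \<subseteq> pser_closure R J"
  using assms unfolding pser_closure_def by blast

end

context coeff_hom begin

text \<open>
  Together with \<open>fga_ideal_minimal\<close>, this reduces the statement that a continuous
  homomorphism maps the defining ideal of a formal group algebra into a closed ideal to its
  generators.
\<close>

lemma closed_ideal_preimage:
  fixes \<phi> :: "('v multiset \<Rightarrow> 'r) \<Rightarrow> 'w multiset \<Rightarrow> 's"
  assumes \<phi>: "pser_hom_over R S i \<phi>" and J: "S.closed_ideal J"
  shows "R.closed_ideal {f \<in> carrier (pser R). \<phi> f \<in> J}"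
proof -
  interpret PR: cring "pser R :: ('v multiset \<Rightarrow> 'r) ring" by (rule R.pser_cring)
  interpret PS: cring "pser S :: ('w multiset \<Rightarrow> 's) ring" by (rule S.pser_cring)
  interpret H: ring_hom_ring "pser R" "pser S" \<phi>
    using pser_hom_overD(1)[OF \<phi>] by (intro ring_hom_ringI2 R.pser_ring S.pser_ring)
  interpret J: ideal J "pser S" by (rule S.closed_idealD(1)[OF J])
  have "ideal {f \<in> carrier (pser R). \<phi> f \<in> J} (pser R)"
    by (rule H.ideal_vimage[OF J.ideal_axioms])
  moreover have "\<phi> f \<in> J" if f: "f \<in> carrier (pser R)"
    and a: "\<forall>n. \<exists>g\<in>{f \<in> carrier (pser R). \<phi> f \<in> J}. f \<ominus>\<^bsub>pser R\<^esub> g \<in> R.pord n" for f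
  proof (rule S.closed_idealD(3)[OF J])
    fix n
    from a obtain g where g: "g \<in> carrier (pser R)" "\<phi> g \<in> J" "f \<ominus>\<^bsub>pser R\<^esub> g \<in> R.pord n" by blast
    then have "\<phi> f \<ominus>\<^bsub>pser S\<^esub> \<phi> g \<in> S.pord n"
      using pser_hom_overD(3)[OF \<phi> g(3)] f by (simp add: pser_hom_over_minus[OF R.cring_axioms S.cring_axioms \<phi>])
    then show "\<exists>g\<in>J. \<phi> f \<ominus>\<^bsub>pser S\<^esub> g \<in> S.pord n" using g by blast
  qed (use f in simp)
  ultimately show ?thesis unfolding R.closed_ideal_def by blast
qed

text \<open>
  Substitution of congruent series gives congruent results, by induction over the topological
  generation by constants and variables. Closedness of the ideal is essential for the limits.
\<close>

lemma psub_cong_ideal: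
  fixes s t :: "'v \<Rightarrow> 'w multiset \<Rightarrow> 's"
  assumes s: "\<And>v. s v \<in> S.pord 1" and t: "\<And>v. t v \<in> S.pord 1" and J: "S.closed_ideal J"
    and d: "\<And>v. s v \<ominus>\<^bsub>pser S\<^esub> t v \<in> J" and f: "f \<in> carrier (pser R)"
  shows "psub R S i s f \<ominus>\<^bsub>pser S\<^esub> psub R S i t f \<in> J"
proof -
  interpret PS: cring "pser S :: ('w multiset \<Rightarrow> 's) ring" by (rule S.pser_cring)
  note hs = psub_hom[of s, OF s] and ht = psub_hom[of t, OF t]
  note Ds = pser_hom_overD[OF hs] and Dt = pser_hom_overD[OF ht]
  note Jm = S.closed_ideal_mem[OF J]
  show ?thesis using f
  proof (induction f rule: R.pser_closed_induct)
    case (const a)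
    have "pser_const S (i a) \<in> carrier (pser S :: ('w multiset \<Rightarrow> 's) ring)"
      using const by (intro S.pser_const_closed i_closed)
    then show ?case using Ds(2)[OF const] Dt(2)[OF const] Jm(1) by (simp add: a_minus_def PS.r_neg)
  next
    case (var v)
    then show ?case using d by (simp add: psub_var[of s, OF s] psub_var[of t, OF t])
  next
    case (add f g)
    have "psub R S i s (f \<oplus>\<^bsub>pser R\<^esub> g) \<ominus>\<^bsub>pser S\<^esub> psub R S i t (f \<oplus>\<^bsub>pser R\<^esub> g) =
      (psub R S i s f \<ominus>\<^bsub>pser S\<^esub> psub R S i t f) \<oplus>\<^bsub>pser S\<^esub> (psub R S i s g \<ominus>\<^bsub>pser S\<^esub> psub R S i t g)"
      unfolding Ds(5)[OF add(1,2)] Dt(5)[OF add(1,2)] using add(1,2) Ds(4) Dt(4) by (intro PS.add_diff_split) auto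
    then show ?case using Jm(2)[OF add(3,4)] by simp
  next
    case (mult f g)
    have "psub R S i s (f \<otimes>\<^bsub>pser R\<^esub> g) \<ominus>\<^bsub>pser S\<^esub> psub R S i t (f \<otimes>\<^bsub>pser R\<^esub> g) =
      (psub R S i s f \<ominus>\<^bsub>pser S\<^esub> psub R S i t f) \<otimes>\<^bsub>pser S\<^esub> psub R S i s g \<oplus>\<^bsub>pser S\<^esub>
      psub R S i t f \<otimes>\<^bsub>pser S\<^esub> (psub R S i s g \<ominus>\<^bsub>pser S\<^esub> psub R S i t g)"
      unfolding Ds(6)[OF mult(1,2)] Dt(6)[OF mult(1,2)] using mult(1,2) Ds(4) Dt(4) by (intro PS.mult_diff_split) auto
    then show ?case using Jm(5)[OF mult(3) Ds(4)[OF mult(2)]] Jm(6)[OF mult(4) Dt(4)[OF mult(1)]] Jm(2) by simp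
  next
    case (closed f)
    show ?case
    proof (rule S.closed_idealD(3)[OF J])
      fix n
      from closed(2)[of n] obtain g where g: "g \<in> carrier (pser R)"
        "psub R S i s g \<ominus>\<^bsub>pser S\<^esub> psub R S i t g \<in> J" "f \<ominus>\<^bsub>pser R\<^esub> g \<in> R.pord n" by blast
      have "psub R S i s f \<ominus>\<^bsub>pser S\<^esub> psub R S i t f \<ominus>\<^bsub>pser S\<^esub> (psub R S i s g \<ominus>\<^bsub>pser S\<^esub> psub R S i t g)
        = (psub R S i s f \<ominus>\<^bsub>pser S\<^esub> psub R S i s g) \<ominus>\<^bsub>pser S\<^esub> (psub R S i t f \<ominus>\<^bsub>pser S\<^esub> psub R S i t g)"
        using closed(1) g(1) Ds(4) Dt(4) by (intro PS.diff_diff_swap) auto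
      also have "\<dots> = psub R S i s (f \<ominus>\<^bsub>pser R\<^esub> g) \<ominus>\<^bsub>pser S\<^esub> psub R S i t (f \<ominus>\<^bsub>pser R\<^esub> g)"
        using closed(1) g(1) by (simp add: pser_hom_over_minus[OF R.cring_axioms S.cring_axioms hs]
            pser_hom_over_minus[OF R.cring_axioms S.cring_axioms ht])
      also have "\<dots> \<in> S.pord n" by (intro S.pord_minus Ds(3) Dt(3) g(3))
      finally show "\<exists>h\<in>J. psub R S i s f \<ominus>\<^bsub>pser S\<^esub> psub R S i t f \<ominus>\<^bsub>pser S\<^esub> h \<in> S.pord n"
        using g(2) by blast
    qed (use closed(1) Ds(4) Dt(4) in auto)
  qed
qed

end

section \<open>Formal group algebras\<close>

definition fga_gens :: "('r, 'm) ring_scheme \<Rightarrow> (nat \<Rightarrow> nat \<Rightarrow> 'r) \<Rightarrow> ('l::ab_group_add multiset \<Rightarrow> 'r) set" where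
  "fga_gens R F = insert (pser_var R 0)
    {pser_var R (l1 + l2) \<ominus>\<^bsub>pser R\<^esub> pser_subst2 R F (pser_var R l1) (pser_var R l2) | l1 l2. True}"

context fgl begin

lemma fga_gens_carrier: "fga_gens R F \<subseteq> carrier (pser R :: ('l::ab_group_add multiset \<Rightarrow> 'r) ring)"
proof -
  interpret P: cring "pser R :: ('l multiset \<Rightarrow> 'r) ring" by (rule pser_cring)
  show ?thesis unfolding fga_gens_def by (auto intro!: pser_var_closed P.minus_closed fadd_carrier pser_var_pord)
qed

lemma fga_ideal_closed: "closed_ideal (fga_ideal R F :: ('l::ab_group_add multiset \<Rightarrow> 'r) set)"
  unfolding fga_ideal_def fga_gens_def[symmetric]
  by (rule closed_ideal_closure[OF ring.genideal_ideal[OF pser_ring fga_gens_carrier]])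

lemma fga_gens_subset: "fga_gens R F \<subseteq> (fga_ideal R F :: ('l::ab_group_add multiset \<Rightarrow> 'r) set)"
proof -
  interpret P: cring "pser R :: ('l multiset \<Rightarrow> 'r) ring" by (rule pser_cring)
  have "Idl\<^bsub>pser R\<^esub> (fga_gens R F) \<subseteq> carrier (pser R :: ('l multiset \<Rightarrow> 'r) ring)"
    using ideal.Icarr[OF P.genideal_ideal[OF fga_gens_carrier]] by blast
  from closure_superset[OF this] P.genideal_self[OF fga_gens_carrier] show ?thesis
    unfolding fga_ideal_def fga_gens_def[symmetric] by blast
qed

lemma fga_ideal_minimal:
  fixes K :: "('l::ab_group_add multiset \<Rightarrow> 'r) set"
  assumes "closed_ideal K" "fga_gens R F \<subseteq> K"
  shows "fga_ideal R F \<subseteq> K"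
  unfolding fga_ideal_def fga_gens_def[symmetric]
  by (rule closure_subset[OF ring.genideal_minimal[OF pser_ring closed_idealD(1)[OF assms(1)] assms(2)] assms(1)])

lemma fga_zero_mem: "pser_var R (0 :: 'l::ab_group_add) \<in> fga_ideal R F"
  using fga_gens_subset[where 'l = 'l] by (auto simp: fga_gens_def)

lemma fga_add_mem:
  "pser_var R (l1 + l2 :: 'l::ab_group_add) \<ominus>\<^bsub>pser R\<^esub> fadd (pser_var R l1) (pser_var R l2) \<in> fga_ideal R F"
  using fga_gens_subset[where 'l = 'l] by (auto simp: fga_gens_def)

lemma fga_cring: "cring (fga R F :: ('l::ab_group_add multiset \<Rightarrow> 'r) set ring)"
  unfolding fga_def by (rule ideal.quotient_is_cring[OF closed_idealD(1)[OF fga_ideal_closed] pser_cring])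

lemma fga_class_hom: "fga_class R F \<in> ring_hom (pser R) (fga R F :: ('l::ab_group_add multiset \<Rightarrow> 'r) set ring)"
  using ideal.rcos_ring_hom[OF closed_idealD(1)[OF fga_ideal_closed[where 'l = 'l]]]
  unfolding fga_def fga_class_def[abs_def] .

lemma fga_class_ring_hom: "ring_hom_cring (pser R) (fga R F :: ('l::ab_group_add multiset \<Rightarrow> 'r) set ring) (fga_class R F)"
  by (intro ring_hom_cringI pser_cring fga_cring fga_class_hom)

lemma fga_class_eq_iff:
  fixes f g :: "'l::ab_group_add multiset \<Rightarrow> 'r"
  assumes "f \<in> carrier (pser R)" "g \<in> carrier (pser R)"
  shows "fga_class R F f = fga_class R F g \<longleftrightarrow> f \<ominus>\<^bsub>pser R\<^esub> g \<in> fga_ideal R F"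
  unfolding fga_class_def
  using ring.quotient_eq_iff_same_a_r_cos[OF pser_ring closed_idealD(1)[OF fga_ideal_closed] assms] by simp

lemma fga_carrierE:
  assumes "X \<in> carrier (fga R F :: ('l::ab_group_add multiset \<Rightarrow> 'r) set ring)"
  obtains f where "f \<in> carrier (pser R)" "X = fga_class R F f"
  using assms unfolding fga_def FactRing_def A_RCOSETS_def' fga_class_def by auto

lemma fga_class_closed:
  fixes f :: "'l::ab_group_add multiset \<Rightarrow> 'r"
  shows "f \<in> carrier (pser R) \<Longrightarrow> fga_class R F f \<in> carrier (fga R F)"
  by (rule ring_hom_closed[OF fga_class_hom])

lemma fga_class_mem:
  fixes f g :: "'l::ab_group_add multiset \<Rightarrow> 'r"
  assumes "f \<in> carrier (pser R)" "g \<in> fga_class R F f"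
  shows "g \<in> carrier (pser R)" "fga_class R F g = fga_class R F f"
proof -
  interpret P: cring "pser R :: ('l multiset \<Rightarrow> 'r) ring" by (rule pser_cring)
  from assms(2) obtain h where h: "h \<in> fga_ideal R F" "g = h \<oplus>\<^bsub>pser R\<^esub> f"
    unfolding fga_class_def a_r_coset_def' by auto
  have hc: "h \<in> carrier (pser R)" using h(1) closed_idealD(2)[OF fga_ideal_closed] by blast
  show g: "g \<in> carrier (pser R)" using h(2) hc assms(1) by simp
  have "(a \<oplus>\<^bsub>pser R\<^esub> b) \<ominus>\<^bsub>pser R\<^esub> b = a" if "a \<in> carrier (pser R)" "b \<in> carrier (pser R)" 
    for a b :: "'l multiset \<Rightarrow> 'r" using that by algebra
  then show "fga_class R F g = fga_class R F f"
    using h hc assms(1) g by (subst fga_class_eq_iff) auto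
qed

lemma fga_class_self:
  fixes f :: "'l::ab_group_add multiset \<Rightarrow> 'r"
  assumes "f \<in> carrier (pser R)"
  shows "f \<in> fga_class R F f"
proof -
  interpret P: cring "pser R :: ('l multiset \<Rightarrow> 'r) ring" by (rule pser_cring)
  have "f = \<zero>\<^bsub>pser R\<^esub> \<oplus>\<^bsub>pser R\<^esub> f" using assms by simp
  then show ?thesis unfolding fga_class_def a_r_coset_def' using closed_ideal_mem(1)[OF fga_ideal_closed] by auto
qed

lemma fga_x_closed: "fga_x R F l \<in> carrier (fga R F)"
  unfolding fga_x_def by (rule fga_class_closed[OF pser_var_closed])

lemma fga_const_closed: "a \<in> carrier R \<Longrightarrow> fga_const R F a \<in> carrier (fga R F :: ('l::ab_group_add multiset \<Rightarrow> 'r) set ring)"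
  unfolding fga_const_def by (rule fga_class_closed[OF pser_const_closed])

lemma fga_unitI:
  fixes f :: "'l::ab_group_add multiset \<Rightarrow> 'r"
  assumes f: "f \<in> carrier (pser R)" "f {#} \<in> Units R"
  shows "fga_class R F f \<in> Units (fga R F)"
  by (rule ring_hom_Units[OF fga_class_hom pser_unitI[OF f]])

end

lemma (in cring) pser_const_hom: "pser_const R \<in> ring_hom R (pser R :: ('v multiset \<Rightarrow> 'a) ring)"
proof (rule ring_hom_memI)
  fix x y assume xy: "x \<in> carrier R" "y \<in> carrier R"
  have "pser_const R x \<otimes>\<^bsub>pser R\<^esub> pser_const R y = (\<lambda>m :: 'v multiset. x \<otimes> pser_const R y m)"
    using xy by (intro pser_const_mult pser_coeff[OF pser_const_closed])
  also have "\<dots> = pser_const R (x \<otimes> y)" using xy by (auto simp: pser_const_def)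
  finally show "pser_const R (x \<otimes> y) = pser_const R x \<otimes>\<^bsub>pser R\<^esub> (pser_const R y :: 'v multiset \<Rightarrow> 'a)" by simp
qed (simp_all add: pser_const_closed pser_one, auto simp: pser_add pser_const_def)

lemma (in fgl) fga_const_hom: "fga_const R F \<in> ring_hom R (fga R F :: ('l::ab_group_add multiset \<Rightarrow> 'r) set ring)"
  using ring_hom_trans[OF pser_const_hom fga_class_hom[where 'l = 'l]]
  unfolding fga_const_def[abs_def] by (simp add: comp_def)

text \<open>The induced map on cosets; by \<open>map_class\<close> the choice of the representative is
  immaterial for the substitutions considered in \<open>fga_hom\<close>.\<close>

definition fga_map where
  "fga_map R S G i s X = fga_class S G (psub R S i s (SOME f. f \<in> X))"

text \<open>
  The conditions say that \<open>l \<mapsto> s l\<close> is, modulo the defining ideal, a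
  homomorphism from the lattice to the formal group. This is what a continuous homomorphism of
  formal group algebras amounts to.
\<close>

locale fga_hom = coeff_hom R S i + A: fgl R F + B: fgl S G
  for R :: "('r, 'm) ring_scheme" (structure) and S :: "('s, 'n) ring_scheme" (structure) and i F G +
  fixes s :: "'l::ab_group_add \<Rightarrow> 'k::ab_group_add multiset \<Rightarrow> 's"
  assumes s: "\<And>l. s l \<in> S.pord 1"
    and s_zero: "s 0 \<in> fga_ideal S G"
    and s_add: "\<And>l1 l2. s (l1 + l2) \<ominus>\<^bsub>pser S\<^esub> pser_subst2 S (\<lambda>a b. i (F a b)) (s l1) (s l2) \<in> fga_ideal S G"
begin

abbreviation "\<Psi> \<equiv> fga_map R S G i s"

lemmas hom_s = psub_hom[of s, OF s]

lemma psub_ideal: 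
  assumes "f \<in> fga_ideal R F"
  shows "psub R S i s f \<in> fga_ideal S G"
proof -
  have "fga_gens R F \<subseteq> {f \<in> carrier (pser R). psub R S i s f \<in> fga_ideal S G}"
  proof
    fix g :: "'l multiset \<Rightarrow> 'r" assume g: "g \<in> fga_gens R F"
    then have gc: "g \<in> carrier (pser R)" using A.fga_gens_carrier by blast
    consider "g = pser_var R 0" | l1 l2 where "g = pser_var R (l1 + l2) \<ominus>\<^bsub>pser R\<^esub> A.fadd (pser_var R l1) (pser_var R l2)"
      using g by (auto simp: fga_gens_def)
    then have "psub R S i s g \<in> fga_ideal S G"
    proof cases
      case 1
      then show ?thesis using s_zero by (simp add: psub_var[of s, OF s])
    next
      case 2
      then have "psub R S i s g = s (l1 + l2) \<ominus>\<^bsub>pser S\<^esub> pser_subst2 S (\<lambda>a b. i (F a b)) (s l1) (s l2)"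
        by (simp add: pser_hom_over_minus[OF R.cring_axioms S.cring_axioms hom_s] R.pser_var_closed
            A.fadd_carrier R.pser_var_pord hom_subst2[OF hom_s A.F_closed] psub_var[of s, OF s])
      then show ?thesis using s_add by simp
    qed
    then show "g \<in> {f \<in> carrier (pser R). psub R S i s f \<in> fga_ideal S G}" using gc by simp
  qed
  from A.fga_ideal_minimal[OF closed_ideal_preimage[OF hom_s B.fga_ideal_closed] this] assms show ?thesis by blast
qed

lemma map_class:
  assumes f: "f \<in> carrier (pser R)"
  shows "\<Psi> (fga_class R F f) = fga_class S G (psub R S i s f)"
proof -
  let ?g = "SOME g. g \<in> fga_class R F f"
  have g: "?g \<in> fga_class R F f" by (rule someI[where P = "\<lambda>g. g \<in> fga_class R F f", OF A.fga_class_self[OF f]])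
  note gm = A.fga_class_mem[OF f g]
  have "?g \<ominus>\<^bsub>pser R\<^esub> f \<in> fga_ideal R F" using gm f by (subst A.fga_class_eq_iff[symmetric]) auto
  from psub_ideal[OF this] have "psub R S i s ?g \<ominus>\<^bsub>pser S\<^esub> psub R S i s f \<in> fga_ideal S G"
    using gm f by (simp add: pser_hom_over_minus[OF R.cring_axioms S.cring_axioms hom_s])
  then show ?thesis unfolding fga_map_def using gm(1) f
    by (subst B.fga_class_eq_iff) (auto simp: pser_hom_overD(4)[OF hom_s])
qed

lemma map_hom: "\<Psi> \<in> ring_hom (fga R F) (fga S G)"
proof -
  interpret AH: ring_hom_cring "pser R" "fga R F :: ('l multiset \<Rightarrow> 'r) set ring" "fga_class R F" by (rule A.fga_class_ring_hom)
  interpret BH: ring_hom_cring "pser S" "fga S G :: ('k multiset \<Rightarrow> 's) set ring" "fga_class S G" by (rule B.fga_class_ring_hom)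
  note D = pser_hom_overD[OF hom_s]
  show ?thesis
  proof (rule ring_hom_memI)
    fix X assume "X \<in> carrier (fga R F :: ('l multiset \<Rightarrow> 'r) set ring)"
    then obtain f where f: "f \<in> carrier (pser R)" "X = fga_class R F f" by (rule A.fga_carrierE)
    then show "\<Psi> X \<in> carrier (fga S G)" by (simp add: map_class D(4))
    fix Y assume "Y \<in> carrier (fga R F :: ('l multiset \<Rightarrow> 'r) set ring)"
    then obtain g where g: "g \<in> carrier (pser R)" "Y = fga_class R F g" by (rule A.fga_carrierE)
    show "\<Psi> (X \<otimes>\<^bsub>fga R F\<^esub> Y) = \<Psi> X \<otimes>\<^bsub>fga S G\<^esub> \<Psi> Y"
      unfolding f(2) g(2) AH.hom_mult[OF f(1) g(1), symmetric] map_class[OF f(1)] map_class[OF g(1)]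
        map_class[OF R.pser_mult_closed[OF f(1) g(1)]] D(6)[OF f(1) g(1)]
      by (rule BH.hom_mult[OF D(4)[OF f(1)] D(4)[OF g(1)]])
    show "\<Psi> (X \<oplus>\<^bsub>fga R F\<^esub> Y) = \<Psi> X \<oplus>\<^bsub>fga S G\<^esub> \<Psi> Y"
      unfolding f(2) g(2) AH.hom_add[OF f(1) g(1), symmetric] map_class[OF f(1)] map_class[OF g(1)]
        map_class[OF R.pser_add_closed[OF f(1) g(1)]] D(5)[OF f(1) g(1)]
      by (rule BH.hom_add[OF D(4)[OF f(1)] D(4)[OF g(1)]])
  next
    have "\<Psi> (fga_class R F \<one>\<^bsub>pser R\<^esub>) = fga_class S G (psub R S i s \<one>\<^bsub>pser R\<^esub>)"
      by (rule map_class) (rule AH.R.one_closed)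
    then show "\<Psi> \<one>\<^bsub>fga R F\<^esub> = \<one>\<^bsub>fga S G\<^esub>"
      unfolding ring_hom_one[OF D(1)] AH.hom_one BH.hom_one .
  qed
qed

lemma map_x: "\<Psi> (fga_x R F l) = fga_class S G (s l)"
  unfolding fga_x_def map_class[OF R.pser_var_closed] psub_var[of s, OF s] ..

lemma map_const: "a \<in> carrier R \<Longrightarrow> \<Psi> (fga_const R F a) = fga_const S G (i a)"
  unfolding fga_const_def by (simp add: map_class R.pser_const_closed pser_hom_overD(2)[OF hom_s])

end

section \<open>Regularity of the generators\<close>

text \<open>
  Order monomials by degree, and then by the exponent of \<open>b\<close>. If \<open>m\<close> is
  the monomial of \<open>f\<close> of smallest degree with the highest exponent of
  \<open>b\<close>, then the coefficient of \<open>g f\<close> at \<open>b m\<close> is the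
  product of the coefficients of \<open>g\<close> at \<open>b\<close> and of \<open>f\<close> at
  \<open>m\<close>.
\<close>

lemma (in cring) regular_series:
  fixes g f :: "'v multiset \<Rightarrow> 'a"
  assumes g: "g \<in> pord 1" and reg: "\<And>a. a \<in> carrier R \<Longrightarrow> g {#b#} \<otimes> a = \<zero> \<Longrightarrow> a = \<zero>"
    and f: "f \<in> carrier (pser R)" and z: "g \<otimes>\<^bsub>pser R\<^esub> f = \<zero>\<^bsub>pser R\<^esub>"
  shows "f = \<zero>\<^bsub>pser R\<^esub>"
proof (rule ccontr)
  assume "f \<noteq> \<zero>\<^bsub>pser R\<^esub>"
  then obtain m0 where m0: "f m0 \<noteq> \<zero>" by (auto simp: pser_zero fun_eq_iff)
  define n where "n = (LEAST n. \<exists>m. size m = n \<and> f m \<noteq> \<zero>)"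
  have ex: "\<exists>m. size m = n \<and> f m \<noteq> \<zero>" unfolding n_def by (rule LeastI[where k = "size m0"]) (use m0 in blast)
  have low: "f m = \<zero>" if "size m < n" for m
    using not_less_Least[of "size m" "\<lambda>n. \<exists>m. size m = n \<and> f m \<noteq> \<zero>"] that unfolding n_def by blast
  define k where "k = (GREATEST k. \<exists>m. size m = n \<and> f m \<noteq> \<zero> \<and> count m b = k)"
  have bound: "k \<le> n" if "\<exists>m. size m = n \<and> f m \<noteq> \<zero> \<and> count m b = k" for k
    using that count_le_size by auto
  obtain m where m: "size m = n" "f m \<noteq> \<zero>" "count m b = k"
    using GreatestI_ex_nat[of "\<lambda>k. \<exists>m. size m = n \<and> f m \<noteq> \<zero> \<and> count m b = k" n] ex bound unfolding k_def by blast
  have high: "f m = \<zero>" if "size m = n" "count m b > k" for m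
    using Greatest_le_nat[of "\<lambda>k. \<exists>m. size m = n \<and> f m \<noteq> \<zero> \<and> count m b = k" "count m b" n] that bound
    unfolding k_def by force
  have gc: "g m \<in> carrier R" and fc: "f m \<in> carrier R" for m
    using g f by (auto intro: pser_coeff pord_carrier)
  let ?M = "add_mset b m"
  let ?F = "\<lambda>p. g (fst p) \<otimes> f (snd p)"
  have "(g \<otimes>\<^bsub>pser R\<^esub> f) ?M = finsum R ?F (splits ?M)" using gc fc by (intro pser_mult) auto
  also have "\<dots> = ?F ({#b#}, m)"
  proof (rule finsum_single)
    fix p assume p: "p \<in> splits ?M" "p \<noteq> ({#b#}, m)"
    obtain a q where pq: "p = (a, q)" by (cases p)
    with p have s: "a + q = ?M" "size a + size q = Suc n" using splits_size[of a q ?M] m(1) by (auto simp: splits_def)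
    consider "size q < n" | "size q > n" | "size q = n" by linarith
    then show "?F p = \<zero>"
    proof cases
      case 1 then show ?thesis using gc by (simp add: pq low)
    next
      case 2 then have "size a = 0" using s(2) by linarith
      then have "a = {#}" by simp
      then show ?thesis using g fc by (simp add: pq pser_one_pord0)
    next
      case 3
      then have "size a = 1" using s by simp
      then obtain v where v: "a = {#v#}" by (metis size_1_singleton_mset)
      have "v \<noteq> b" using s(1) p(2) by (auto simp: v pq)
      then have "count q b > k" using arg_cong[OF s(1), of "\<lambda>x. count x b"] m(3) by (simp add: v)
      then show ?thesis using high 3 gc by (simp add: pq)
    qed
  qed (use gc fc finite_splits[of ?M] in \<open>auto simp: splits_def\<close>)
  finally have "g {#b#} \<otimes> f m = \<zero>" using z by (simp add: pser_zero)
  then show False using reg fc m(2) by blast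
qed

lemma (in fgl) fadd_cong_ideal:
  fixes f g f' g' :: "'v multiset \<Rightarrow> 'r"
  assumes J: "closed_ideal J" and c: "f \<in> pord 1" "g \<in> pord 1" "f' \<in> pord 1" "g' \<in> pord 1"
    and d: "f \<ominus>\<^bsub>pser R\<^esub> f' \<in> J" "g \<ominus>\<^bsub>pser R\<^esub> g' \<in> J"
  shows "fadd f g \<ominus>\<^bsub>pser R\<^esub> fadd f' g' \<in> J"
proof -
  interpret H: coeff_hom R R "\<lambda>a. a" by (rule id_coeff_hom)
  show ?thesis
    unfolding fadd_psub[OF c(1,2)] fadd_psub[OF c(3,4)]
    by (rule H.psub_cong_ideal[OF _ _ J]) (use c d in \<open>auto simp: pair_fun_def fgl_ser_closed[of F, OF F_closed]\<close>)
qed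

lemma (in cring) psub1_pser_var:
  assumes "f \<in> carrier (pser R)"
  shows "psub1 (pser_var R) f = f"
  by (rule pser_hom_over_eq[OF cring_axioms cring_axioms psub1_hom[of "pser_var R", OF pser_var_pord]
      pser_hom_over_id refl psub1_var[of "pser_var R", OF pser_var_pord] assms])

locale fgl_lattice = fgl R F + Modules.module scale
  for R :: "('r, 'm) ring_scheme" (structure) and F and scale :: "int \<Rightarrow> 'l::ab_group_add \<Rightarrow> 'l" +
  fixes B :: "'l set"
  assumes finite_basis: "finite B" and independent_basis: "independent B" and span_basis: "span B = UNIV"
begin

text \<open>The homomorphism from the lattice to the formal group with \<open>\<chi>(b) = x\<^sub>b\<close> for basis elements
  \<open>b\<close>. Substituting \<open>\<chi>(l)\<close> for \<open>x\<^sub>l\<close> kills the defining ideal of the formal group algebra, and does not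
  change classes. So it embeds the formal group algebra into the power series, and the regularity
  of \<open>x\<^sub>l\<close> can be read off from the series \<open>\<chi>(l)\<close>.\<close>

definition chi :: "'l \<Rightarrow> 'l multiset \<Rightarrow> 'r" where
  "chi l = finprod fgrp (\<lambda>b. pser_var R b [^]\<^bsub>fgrp\<^esub> (representation B l b)) B"

lemma fgrp_simps: "carrier fgrp = pord 1" "\<one>\<^bsub>fgrp\<^esub> = \<zero>\<^bsub>pser R\<^esub>" "f \<otimes>\<^bsub>fgrp\<^esub> g = fadd f g"
  by (simp_all add: fgrp_def)

lemma chi_pord: "chi l \<in> pord 1"
proof -
  interpret G: comm_group "fgrp :: ('l multiset \<Rightarrow> 'r) monoid" by (rule fgrp_comm_group)
  have v: "pser_var R b \<in> carrier fgrp" for b :: 'l by (simp add: fgrp_simps pser_var_pord)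
  have "chi l \<in> carrier fgrp" unfolding chi_def
    by (rule G.finprod_closed) (auto intro!: G.int_pow_closed v)
  then show ?thesis by (simp add: fgrp_simps)
qed

lemma chi_add: "chi (l1 + l2) = fadd (chi l1) (chi l2)"
proof -
  interpret G: comm_group "fgrp :: ('l multiset \<Rightarrow> 'r) monoid" by (rule fgrp_comm_group)
  have v: "pser_var R b \<in> carrier fgrp" for b :: 'l by (simp add: fgrp_simps pser_var_pord)
  have "chi (l1 + l2) = finprod fgrp (\<lambda>b. pser_var R b [^]\<^bsub>fgrp\<^esub> (representation B l1 b) \<otimes>\<^bsub>fgrp\<^esub> 
      pser_var R b [^]\<^bsub>fgrp\<^esub> (representation B l2 b)) B"
    unfolding chi_def using v
    by (intro G.finprod_cong') (auto simp: representation_add[OF independent_basis] span_basis G.int_pow_mult intro!: G.int_pow_closed)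
  also have "\<dots> = chi l1 \<otimes>\<^bsub>fgrp\<^esub> chi l2"
    unfolding chi_def using v by (intro G.finprod_multf) (auto intro!: G.int_pow_closed)
  finally show ?thesis by (simp add: fgrp_simps)
qed

lemma chi_basis: "b \<in> B \<Longrightarrow> chi b = pser_var R b"
proof -
  interpret G: comm_group "fgrp :: ('l multiset \<Rightarrow> 'r) monoid" by (rule fgrp_comm_group)
  assume b: "b \<in> B"
  have v: "pser_var R b \<in> carrier fgrp" for b :: 'l by (simp add: fgrp_simps pser_var_pord)
  have "chi b = finprod fgrp (\<lambda>c. if b = c then pser_var R c else \<one>\<^bsub>fgrp\<^esub>) B"
    unfolding chi_def using v
    by (intro G.finprod_cong') (auto simp: representation_basis[OF independent_basis b] G.int_pow_1)
  also have "\<dots> = pser_var R b" using b finite_basis v by (intro G.finprod_singleton) auto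
  finally show ?thesis .
qed

lemma chi_zero: "chi 0 = \<zero>\<^bsub>pser R\<^esub>"
proof -
  interpret G: comm_group "fgrp :: ('l multiset \<Rightarrow> 'r) monoid" by (rule fgrp_comm_group)
  have "chi 0 = \<one>\<^bsub>fgrp\<^esub>" unfolding chi_def by (intro G.finprod_one_eqI) (simp add: representation_zero)
  then show ?thesis by (simp add: fgrp_simps)
qed

text \<open>Taking the coefficient at a variable is a homomorphism from the formal group to the additive
  group of the coefficients.\<close>

lemma chi_linear:
  assumes b: "b \<in> B"
  shows "chi l {#b#} = [representation B l b] \<cdot> \<one>"
proof -
  interpret G: comm_group "fgrp :: ('l multiset \<Rightarrow> 'r) monoid" by (rule fgrp_comm_group)
  let ?e = "\<lambda>f :: 'l multiset \<Rightarrow> 'r. f {#b#}"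
  have v: "pser_var R b \<in> carrier fgrp" for b :: 'l by (simp add: fgrp_simps pser_var_pord)
  have eadd: "?e (fadd f g) = ?e f \<oplus> ?e g" if "f \<in> pord 1" "g \<in> pord 1" for f g
  proof -
    have "psub1 (pair_fun f g) fgl_rest \<in> pord 2"
      by (rule psub1D(3)[of "pair_fun f g", OF pair_fun_pord fgl_rest_pord]) (rule that)+
    then show ?thesis using that[THEN pord_carrier]
      by (simp add: fadd_expand[OF that] pser_add pord_coeff pser_coeff)
  qed
  interpret E: group_hom fgrp "add_monoid R" ?e
    using G.group_axioms a_group
    by (intro group_hom.intro group_hom_axioms.intro)
       (auto simp: hom_def fgrp_simps eadd intro: pser_coeff pord_carrier)
  have epow: "?e (pser_var R c [^]\<^bsub>fgrp\<^esub> (n::int)) = [n] \<cdot> ?e (pser_var R c)" for c n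
    using E.hom_int_pow[OF v, of c n] by (simp add: add_pow_def)
  have epow': "?e (pser_var R c [^]\<^bsub>fgrp\<^esub> (n::int)) = (if c = b then [n] \<cdot> \<one> else \<zero>)" for c n
  proof (cases "c = b")
    case True
    then show ?thesis by (simp only: epow) (simp add: pser_var_def)
  next
    case False
    have "[n] \<cdot> \<zero> = \<zero>" unfolding add_pow_def using group.int_pow_one[OF a_group, of n] by simp
    with False show ?thesis by (simp only: epow) (simp add: pser_var_def)
  qed
  have "?e (finprod fgrp f A) = finsum R (\<lambda>a. ?e (f a)) A" if "finite A" "\<And>a. a \<in> A \<Longrightarrow> f a \<in> pord 1" for f and A :: "'l set"
    using that
  proof (induction A rule: finite_induct)
    case empty
    then show ?case by (simp add: fgrp_simps pser_zero)
  next
    case (insert a A)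
    have p: "finprod fgrp f A \<in> pord 1" using insert.prems G.finprod_closed[of f A] by (auto simp: fgrp_simps)
    have "finprod fgrp f (insert a A) = fadd (f a) (finprod fgrp f A)"
      using insert.hyps insert.prems by (subst G.finprod_insert) (auto simp: fgrp_simps)
    then show ?case using insert p pser_coeff[OF pord_carrier[OF insert.prems]]
      by (subst finsum_insert) (auto simp: eadd)
  qed
  then have "chi l {#b#} = finsum R (\<lambda>c. ?e (pser_var R c [^]\<^bsub>fgrp\<^esub> (representation B l c))) B"
    unfolding chi_def using finite_basis G.int_pow_closed[OF v] by (simp add: fgrp_simps)
  also have "\<dots> = ?e (pser_var R b [^]\<^bsub>fgrp\<^esub> (representation B l b))"
    by (rule finsum_single[OF finite_basis b]) (auto simp: epow')
  also have "\<dots> = [representation B l b] \<cdot> \<one>" by (simp add: epow')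
  finally show ?thesis .
qed

lemma chi_kills_ideal:
  assumes "f \<in> fga_ideal R F"
  shows "psub1 chi f = \<zero>\<^bsub>pser R\<^esub>"
proof -
  interpret P: cring "pser R :: ('l multiset \<Rightarrow> 'r) ring" by (rule pser_cring)
  note h = psub1_hom[of chi, OF chi_pord] and pv = psub1_var[of chi, OF chi_pord]
  let ?K = "{f \<in> carrier (pser R). psub1 chi f \<in> {\<zero>\<^bsub>pser R\<^esub>}}"
  have "fga_gens R F \<subseteq> ?K"
  proof
    fix g :: "'l multiset \<Rightarrow> 'r" assume g: "g \<in> fga_gens R F"
    then have gc: "g \<in> carrier (pser R)" using fga_gens_carrier by blast
    consider "g = pser_var R 0" | l1 l2 where "g = pser_var R (l1 + l2) \<ominus>\<^bsub>pser R\<^esub> fadd (pser_var R l1) (pser_var R l2)"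
      using g by (auto simp: fga_gens_def)
    then have "psub1 chi g = \<zero>\<^bsub>pser R\<^esub>"
    proof cases
      case 1
      then show ?thesis by (simp add: pv chi_zero)
    next
      case 2
      have "psub1 chi g = chi (l1 + l2) \<ominus>\<^bsub>pser R\<^esub> fadd (chi l1) (chi l2)"
        unfolding 2 by (simp add: pser_hom_over_minus[OF cring_axioms cring_axioms h] pser_var_closed
            fadd_carrier pser_var_pord hom_fadd[OF h] pv)
      then show ?thesis using chi_pord[of "l1 + l2", THEN pord_carrier] by (simp add: chi_add a_minus_def P.r_neg)
    qed
    then show "g \<in> ?K" using gc by simp
  qed
  from fga_ideal_minimal[OF coeff_hom.closed_ideal_preimage[OF id_coeff_hom h closed_ideal_zero] this] assms
  show ?thesis by blast
qed

text \<open>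
  Both \<open>\<chi>\<close> and \<open>l \<mapsto> x\<^sub>l\<close> are additive modulo the
  ideal, and they agree on the basis. The induction runs over multiples of basis elements, and
  needs both directions of each step for negative multiples.
\<close>

lemma chi_cong: "chi l \<ominus>\<^bsub>pser R\<^esub> pser_var R l \<in> fga_ideal R F"
proof -
  interpret P: cring "pser R :: ('l multiset \<Rightarrow> 'r) ring" by (rule pser_cring)
  let ?I = "fga_ideal R F :: ('l multiset \<Rightarrow> 'r) set"
  let ?P = "\<lambda>l. chi l \<ominus>\<^bsub>pser R\<^esub> pser_var R l \<in> ?I"
  note J = fga_ideal_closed[where 'l = 'l]
  note Jm = closed_ideal_mem[OF J]
  note pc = pord_carrier and vp = pser_var_pord and vc = pser_var_closed
  have sym: "b \<ominus>\<^bsub>pser R\<^esub> a \<in> ?I" if "a \<ominus>\<^bsub>pser R\<^esub> b \<in> ?I" "a \<in> carrier (pser R)" "b \<in> carrier (pser R)" for a b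
  proof -
    have "b \<ominus>\<^bsub>pser R\<^esub> a = \<ominus>\<^bsub>pser R\<^esub> (a \<ominus>\<^bsub>pser R\<^esub> b)" using that(2,3) by algebra
    then show ?thesis using Jm(3)[OF that(1)] by simp
  qed
  have trans: "a \<ominus>\<^bsub>pser R\<^esub> c \<in> ?I" if "a \<ominus>\<^bsub>pser R\<^esub> b \<in> ?I" "b \<ominus>\<^bsub>pser R\<^esub> c \<in> ?I"
    "a \<in> carrier (pser R)" "b \<in> carrier (pser R)" "c \<in> carrier (pser R)" for a b c
    unfolding P.diff_trans[OF that(3-5)] by (rule Jm(2)[OF that(1,2)])
  have refl: "a \<ominus>\<^bsub>pser R\<^esub> a \<in> ?I" if "a \<in> carrier (pser R)" for a
    using that Jm(1) by (simp add: a_minus_def P.r_neg)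
  have step: "?P (l + b) \<longleftrightarrow> ?P l" if b: "b \<in> B" for l b
  proof
    assume l: "?P l"
    have "fadd (chi l) (pser_var R b) \<ominus>\<^bsub>pser R\<^esub> fadd (pser_var R l) (pser_var R b) \<in> ?I"
      by (rule fadd_cong_ideal[OF J chi_pord vp vp vp l refl[OF vc]])
    then show "?P (l + b)"
      unfolding chi_add chi_basis[OF b]
      by (rule trans[OF _ sym[OF fga_add_mem vc fadd_carrier[OF vp vp]] fadd_carrier[OF chi_pord vp] fadd_carrier[OF vp vp] vc])
  next
    assume "?P (l + b)"
    then have "fadd (chi l) (pser_var R b) \<ominus>\<^bsub>pser R\<^esub> fadd (pser_var R l) (pser_var R b) \<in> ?I"
      unfolding chi_add chi_basis[OF b]
      by (rule trans[OF _ fga_add_mem fadd_carrier[OF chi_pord vp] vc fadd_carrier[OF vp vp]])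
    then have "fadd (fadd (chi l) (pser_var R b)) (fneg (pser_var R b)) \<ominus>\<^bsub>pser R\<^esub>
        fadd (fadd (pser_var R l) (pser_var R b)) (fneg (pser_var R b)) \<in> ?I"
      by (rule fadd_cong_ideal[OF J fadd_pord[OF chi_pord vp] fneg_pord[OF vp] fadd_pord[OF vp vp] fneg_pord[OF vp] _ refl[OF pc[OF fneg_pord[OF vp]]]])
    then show "?P l"
      by (simp add: fadd_assoc chi_pord vp fneg_pord fadd_fneg fadd_zero_right)
  qed
  have scale: "?P (l + scale n b) \<longleftrightarrow> ?P l" if b: "b \<in> B" for l b n
  proof (induction n rule: int_induct[where k = 0])
    case base
    then show ?case by simp
  next
    case (step1 i)
    have "l + scale (i + 1) b = (l + scale i b) + b" by (simp add: scale_left_distrib)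
    then show ?case using step1 step[OF b, of "l + scale i b"] by (simp only:)
  next
    case (step2 i)
    have "l + scale i b = (l + scale (i - 1) b) + b" by (simp add: scale_left_diff_distrib)
    then show ?case using step2 step[OF b, of "l + scale (i - 1) b"] by (simp only:)
  qed
  have "l \<in> span B" by (simp add: span_basis)
  then show ?thesis
  proof (induction rule: span_induct_alt)
    case base
    show ?case unfolding chi_zero
      by (rule sym[OF _ vc P.zero_closed]) (use fga_zero_mem[where 'l = 'l] vc[of "0 :: 'l"] in \<open>simp_all add: a_minus_def\<close>)
  next
    case (step c x y)
    then show ?case using scale[OF step(1), of y c] by (simp add: add.commute)
  qed
qed

text \<open>
  If \<open>x\<^sub>l f\<close> lies in the ideal, then \<open>\<chi>(l) f(\<chi>) = 0\<close>,
  hence \<open>f(\<chi>) = 0\<close> by \<open>regular_series\<close>. As \<open>f\<close> is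
  congruent to \<open>f(\<chi>)\<close>, it lies in the ideal.
\<close>

theorem fga_x_regular:
  assumes b: "b \<in> B" and reg: "\<And>a. a \<in> carrier R \<Longrightarrow> [representation B l b] \<cdot> \<one> \<otimes> a = \<zero> \<Longrightarrow> a = \<zero>"
  shows "fga_x R F l \<in> regular_elements (fga R F)"
  unfolding regular_elements_def
proof (intro CollectI conjI ballI impI)
  show "fga_x R F l \<in> carrier (fga R F)" by (rule fga_x_closed)
  interpret P: cring "pser R :: ('l multiset \<Rightarrow> 'r) ring" by (rule pser_cring)
  interpret H: ring_hom_cring "pser R" "fga R F :: ('l multiset \<Rightarrow> 'r) set ring" "fga_class R F" by (rule fga_class_ring_hom)
  note h = psub1_hom[of chi, OF chi_pord]
  note D = pser_hom_overD[OF h]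
  note Jm = closed_ideal_mem[OF fga_ideal_closed[where 'l = 'l]]
  fix X assume "X \<in> carrier (fga R F :: ('l multiset \<Rightarrow> 'r) set ring)" and z: "fga_x R F l \<otimes>\<^bsub>fga R F\<^esub> X = \<zero>\<^bsub>fga R F\<^esub>"
  then obtain f where f: "f \<in> carrier (pser R)" "X = fga_class R F f" by (elim fga_carrierE)
  note vc = pser_var_closed[of l]
  have "fga_class R F (pser_var R l \<otimes>\<^bsub>pser R\<^esub> f) = fga_class R F \<zero>\<^bsub>pser R\<^esub>"
    using z f vc unfolding fga_x_def by simp
  then have "(pser_var R l \<otimes>\<^bsub>pser R\<^esub> f) \<ominus>\<^bsub>pser R\<^esub> \<zero>\<^bsub>pser R\<^esub> \<in> fga_ideal R F"
    by (subst (asm) fga_class_eq_iff) (use f vc in auto)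
  then have "pser_var R l \<otimes>\<^bsub>pser R\<^esub> f \<in> fga_ideal R F" using f vc by (simp add: a_minus_def)
  from chi_kills_ideal[OF this] have "chi l \<otimes>\<^bsub>pser R\<^esub> psub1 chi f = \<zero>\<^bsub>pser R\<^esub>"
    by (simp add: D(6)[OF vc f(1)] psub1_var[of chi, OF chi_pord])
  from regular_series[OF chi_pord _ D(4)[OF f(1)] this, of b] reg
  have 0: "psub1 chi f = \<zero>\<^bsub>pser R\<^esub>" by (simp add: chi_linear[OF b])
  have "psub1 chi f \<ominus>\<^bsub>pser R\<^esub> psub1 (pser_var R) f \<in> fga_ideal R F"
    by (rule coeff_hom.psub_cong_ideal[OF id_coeff_hom chi_pord pser_var_pord fga_ideal_closed chi_cong f(1)])
  then have "\<ominus>\<^bsub>pser R\<^esub> f \<in> fga_ideal R F" using f(1) by (simp add: 0 psub1_pser_var a_minus_def)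
  from Jm(3)[OF this] have "f \<in> fga_ideal R F" using f(1) by simp
  then have "fga_class R F f = fga_class R F \<zero>\<^bsub>pser R\<^esub>"
    by (subst fga_class_eq_iff) (use f(1) in \<open>auto simp: a_minus_def\<close>)
  then show "X = \<zero>\<^bsub>fga R F\<^esub>" using f by simp
qed

end

section \<open>Rings of fractions\<close>

lemma (in cring) Units_right_inverseI:
  assumes "a \<in> carrier R" "b \<in> carrier R" "a \<otimes> b = \<one>"
  shows "a \<in> Units R"
proof -
  have "b \<otimes> a = \<one>" using assms m_comm by simp
  then show ?thesis using assms unfolding Units_def by blast
qed

locale fractions = cring A for A :: "('a, 'm) ring_scheme" (structure) +
  fixes S :: "'a set"
  assumes S_subset: "S \<subseteq> carrier A" and S_one: "\<one> \<in> S" 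
    and S_mult: "\<And>s t. s \<in> S \<Longrightarrow> t \<in> S \<Longrightarrow> s \<otimes> t \<in> S"
begin

abbreviation "L \<equiv> localization A S"
abbreviation "fr \<equiv> frac_of A S"

lemma S_carrier: "s \<in> S \<Longrightarrow> s \<in> carrier A" using S_subset by blast

lemma frac_rel_iff:
  "((a, s), (b, t)) \<in> frac_rel A S \<longleftrightarrow> a \<in> carrier A \<and> s \<in> S \<and> b \<in> carrier A \<and> t \<in> S \<and>
      (\<exists>u\<in>S. u \<otimes> (a \<otimes> t) = u \<otimes> (b \<otimes> s))"
  by (simp add: frac_rel_def)

lemma frac_rel_equiv: "equiv (carrier A \<times> S) (frac_rel A S)"
proof (rule equivI)
  show "frac_rel A S \<subseteq> (carrier A \<times> S) \<times> (carrier A \<times> S)" by (auto simp: frac_rel_def)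
  show "refl_on (carrier A \<times> S) (frac_rel A S)"
    using S_one by (auto simp: refl_on_def frac_rel_def)
  show "sym (frac_rel A S)" unfolding sym_def by (auto simp: frac_rel_def) metis
  show "trans (frac_rel A S)"
  proof (rule transI, clarsimp simp: frac_rel_iff)
    fix a s b t c r u v
    assume c: "a \<in> carrier A" "b \<in> carrier A" "c \<in> carrier A" "s \<in> S" "t \<in> S" "r \<in> S" "u \<in> S" "v \<in> S"
      and uv: "u \<otimes> (a \<otimes> t) = u \<otimes> (b \<otimes> s)" "v \<otimes> (b \<otimes> r) = v \<otimes> (c \<otimes> t)"
    note cc = c S_carrier[OF c(4)] S_carrier[OF c(5)] S_carrier[OF c(6)] S_carrier[OF c(7)] S_carrier[OF c(8)]
    have "(u \<otimes> v \<otimes> t) \<otimes> (a \<otimes> r) = (v \<otimes> r) \<otimes> (u \<otimes> (a \<otimes> t))" using cc by (simp add: m_ac)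
    also have "\<dots> = (u \<otimes> s) \<otimes> (v \<otimes> (b \<otimes> r))" unfolding uv(1) using cc by (simp add: m_ac)
    also have "\<dots> = (u \<otimes> v \<otimes> t) \<otimes> (c \<otimes> s)" unfolding uv(2) using cc by (simp add: m_ac)
    finally show "\<exists>w\<in>S. w \<otimes> (a \<otimes> r) = w \<otimes> (c \<otimes> s)" using c S_mult by blast
  qed
qed

lemma fr_eq_iff:
  assumes "a \<in> carrier A" "s \<in> S" "b \<in> carrier A" "t \<in> S"
  shows "fr a s = fr b t \<longleftrightarrow> (\<exists>u\<in>S. u \<otimes> (a \<otimes> t) = u \<otimes> (b \<otimes> s))"
  unfolding frac_of_def
  using eq_equiv_class_iff[OF frac_rel_equiv, of "(a, s)" "(b, t)"] assms by (simp add: frac_rel_iff)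

lemma fr_eqI:
  assumes "a \<in> carrier A" "s \<in> S" "b \<in> carrier A" "t \<in> S" "a \<otimes> t = b \<otimes> s"
  shows "fr a s = fr b t"
  using assms S_one by (subst fr_eq_iff) auto

lemma fr_mem: "(b, t) \<in> fr a s \<Longrightarrow> a \<in> carrier A \<and> s \<in> S \<and> b \<in> carrier A \<and> t \<in> S \<and> fr b t = fr a s"
  unfolding frac_of_def 
  using equiv_class_eq_iff[OF frac_rel_equiv, of "(a, s)" "(b, t)"] by (auto simp: frac_rel_iff)

lemma fr_self: "a \<in> carrier A \<Longrightarrow> s \<in> S \<Longrightarrow> (a, s) \<in> fr a s"
  unfolding frac_of_def using S_one by (auto simp: frac_rel_iff)

lemma carrier_L: "carrier L = {fr a s | a s. a \<in> carrier A \<and> s \<in> S}"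
  by (auto simp: localization_def quotient_def frac_of_def)

lemma L_E:
  assumes "X \<in> carrier L"
  obtains a s where "a \<in> carrier A" "s \<in> S" "X = fr a s"
  using assms by (auto simp: carrier_L)

lemma fr_closed: "a \<in> carrier A \<Longrightarrow> s \<in> S \<Longrightarrow> fr a s \<in> carrier L"
  by (auto simp: carrier_L)

lemma fr_UN:
  assumes "a \<in> carrier A" "s \<in> S" "\<And>b t. b \<in> carrier A \<Longrightarrow> t \<in> S \<Longrightarrow> fr b t = fr a s \<Longrightarrow> f b t = c"
  shows "(\<Union>(b, t)\<in>fr a s. f b t) = c"
proof -
  have "f b t = c" if "(b, t) \<in> fr a s" for b t using fr_mem[OF that] assms(3) by blast
  moreover have "(a, s) \<in> fr a s" using fr_self assms by blast
  ultimately show ?thesis by fast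
qed

lemma fr_mult:
  assumes a: "a \<in> carrier A" "s \<in> S" and b: "b \<in> carrier A" "t \<in> S"
  shows "fr a s \<otimes>\<^bsub>L\<^esub> fr b t = fr (a \<otimes> b) (s \<otimes> t)"
proof -
  have "fr (a' \<otimes> b') (s' \<otimes> t') = fr (a \<otimes> b) (s \<otimes> t)"
    if "a' \<in> carrier A" "s' \<in> S" "fr a' s' = fr a s" "b' \<in> carrier A" "t' \<in> S" "fr b' t' = fr b t" for a' s' b' t'
  proof -
    note th = that
    obtain u v where uv: "u \<in> S" "u \<otimes> (a' \<otimes> s) = u \<otimes> (a \<otimes> s')" "v \<in> S" "v \<otimes> (b' \<otimes> t) = v \<otimes> (b \<otimes> t')"
      using iffD1[OF fr_eq_iff[OF th(1,2) a] th(3)] iffD1[OF fr_eq_iff[OF th(4,5) b] th(6)] by blast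
    note c = a b that(1,2,4,5) uv(1,3)
    note cc = c S_carrier[OF c(2)] S_carrier[OF c(4)] S_carrier[OF c(6)] S_carrier[OF c(8)] S_carrier[OF c(9)] S_carrier[OF c(10)]
    have "(u \<otimes> v) \<otimes> ((a' \<otimes> b') \<otimes> (s \<otimes> t)) = (u \<otimes> (a' \<otimes> s)) \<otimes> (v \<otimes> (b' \<otimes> t))" using cc by (simp add: m_ac)
    also have "\<dots> = (u \<otimes> v) \<otimes> ((a \<otimes> b) \<otimes> (s' \<otimes> t'))" unfolding uv(2,4) using cc by (simp add: m_ac)
    finally show ?thesis using c S_mult by (subst fr_eq_iff) blast+
  qed
  note eq = this
  have "fr a s \<otimes>\<^bsub>L\<^esub> fr b t = (\<Union>(a', s')\<in>fr a s. \<Union>(b', t')\<in>fr b t. fr (a' \<otimes> b') (s' \<otimes> t'))"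
    by (simp add: localization_def)
  also have "\<dots> = fr (a \<otimes> b) (s \<otimes> t)"
    by (rule fr_UN[OF a], rule fr_UN[OF b], rule eq)
  finally show ?thesis .
qed

lemma fr_add:
  assumes a: "a \<in> carrier A" "s \<in> S" and b: "b \<in> carrier A" "t \<in> S"
  shows "fr a s \<oplus>\<^bsub>L\<^esub> fr b t = fr (a \<otimes> t \<oplus> b \<otimes> s) (s \<otimes> t)"
proof -
  have "fr (a' \<otimes> t' \<oplus> b' \<otimes> s') (s' \<otimes> t') = fr (a \<otimes> t \<oplus> b \<otimes> s) (s \<otimes> t)"
    if "a' \<in> carrier A" "s' \<in> S" "fr a' s' = fr a s" "b' \<in> carrier A" "t' \<in> S" "fr b' t' = fr b t" for a' s' b' t'
  proof -
    note th = that
    obtain u v where uv: "u \<in> S" "u \<otimes> (a' \<otimes> s) = u \<otimes> (a \<otimes> s')" "v \<in> S" "v \<otimes> (b' \<otimes> t) = v \<otimes> (b \<otimes> t')"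
      using iffD1[OF fr_eq_iff[OF th(1,2) a] th(3)] iffD1[OF fr_eq_iff[OF th(4,5) b] th(6)] by blast
    note c = a b that(1,2,4,5) uv(1,3)
    note cc = c S_carrier[OF c(2)] S_carrier[OF c(4)] S_carrier[OF c(6)] S_carrier[OF c(8)] S_carrier[OF c(9)] S_carrier[OF c(10)]
    have "(u \<otimes> v) \<otimes> ((a' \<otimes> t' \<oplus> b' \<otimes> s') \<otimes> (s \<otimes> t)) =
        (v \<otimes> t' \<otimes> t) \<otimes> (u \<otimes> (a' \<otimes> s)) \<oplus> (u \<otimes> s' \<otimes> s) \<otimes> (v \<otimes> (b' \<otimes> t))"
      using cc by (simp add: m_ac l_distr r_distr)
    also have "\<dots> = (u \<otimes> v) \<otimes> ((a \<otimes> t \<oplus> b \<otimes> s) \<otimes> (s' \<otimes> t'))"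
      unfolding uv(2,4) using cc by (simp add: m_ac l_distr r_distr)
    finally show ?thesis using c cc(11-) S_mult by (subst fr_eq_iff) (blast intro: m_closed add.m_closed)+
  qed
  note eq = this
  have "fr a s \<oplus>\<^bsub>L\<^esub> fr b t = (\<Union>(a', s')\<in>fr a s. \<Union>(b', t')\<in>fr b t. fr (a' \<otimes> t' \<oplus> b' \<otimes> s') (s' \<otimes> t'))"
    by (simp add: localization_def)
  also have "\<dots> = fr (a \<otimes> t \<oplus> b \<otimes> s) (s \<otimes> t)"
    by (rule fr_UN[OF a], rule fr_UN[OF b], rule eq)
  finally show ?thesis .
qed

lemma L_one: "\<one>\<^bsub>L\<^esub> = fr \<one> \<one>" and L_zero: "\<zero>\<^bsub>L\<^esub> = fr \<zero> \<one>"
  by (simp_all add: localization_def)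

lemma fr_zero: "s \<in> S \<Longrightarrow> fr \<zero> s = \<zero>\<^bsub>L\<^esub>"
  unfolding L_zero using S_one by (intro fr_eqI) (auto dest: S_carrier)

lemma L_cring: "cring L"
proof (rule cringI)
  show "abelian_group L"
  proof (rule abelian_groupI)
    fix X Y assume X: "X \<in> carrier L" and Y: "Y \<in> carrier L"
    obtain a s where a: "a \<in> carrier A" "s \<in> S" "X = fr a s" using X by (rule L_E)
    obtain b t where b: "b \<in> carrier A" "t \<in> S" "Y = fr b t" using Y by (rule L_E)
    note c = a(1) b(1) S_carrier[OF a(2)] S_carrier[OF b(2)]
    show "X \<oplus>\<^bsub>L\<^esub> Y \<in> carrier L" using a b c by (simp add: fr_add fr_closed S_mult)
    show "X \<oplus>\<^bsub>L\<^esub> Y = Y \<oplus>\<^bsub>L\<^esub> X" using a b c by (simp add: fr_add a_comm m_comm)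
    fix Z assume Z: "Z \<in> carrier L"
    obtain d r where d: "d \<in> carrier A" "r \<in> S" "Z = fr d r" using Z by (rule L_E)
    show "X \<oplus>\<^bsub>L\<^esub> Y \<oplus>\<^bsub>L\<^esub> Z = X \<oplus>\<^bsub>L\<^esub> (Y \<oplus>\<^bsub>L\<^esub> Z)"
      using a b d c S_carrier[OF d(2)] by (simp add: fr_add S_mult l_distr r_distr m_ac a_ac)
  next
    show "\<zero>\<^bsub>L\<^esub> \<in> carrier L" using S_one by (simp add: L_zero fr_closed)
    fix X assume X: "X \<in> carrier L"
    obtain a s where a: "a \<in> carrier A" "s \<in> S" "X = fr a s" using X by (rule L_E)
    note c = a(1) S_carrier[OF a(2)]
    show "\<zero>\<^bsub>L\<^esub> \<oplus>\<^bsub>L\<^esub> X = X" using a c S_one by (simp add: L_zero fr_add)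
    have "fr (\<ominus> a) s \<oplus>\<^bsub>L\<^esub> X = fr (\<ominus> a \<otimes> s \<oplus> a \<otimes> s) (s \<otimes> s)" using a by (simp add: fr_add)
    also have "\<ominus> a \<otimes> s \<oplus> a \<otimes> s = \<zero>" using c by (simp add: l_minus l_neg)
    finally show "\<exists>Y\<in>carrier L. Y \<oplus>\<^bsub>L\<^esub> X = \<zero>\<^bsub>L\<^esub>"
      using a S_mult by (intro bexI[of _ "fr (\<ominus> a) s"]) (auto simp: fr_zero fr_closed)
  qed
  show "Group.comm_monoid L"
  proof (rule comm_monoidI)
    show "\<one>\<^bsub>L\<^esub> \<in> carrier L" using S_one by (simp add: L_one fr_closed)
    fix X Y assume X: "X \<in> carrier L" and Y: "Y \<in> carrier L"
    obtain a s where a: "a \<in> carrier A" "s \<in> S" "X = fr a s" using X by (rule L_E)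
    obtain b t where b: "b \<in> carrier A" "t \<in> S" "Y = fr b t" using Y by (rule L_E)
    note c = a(1) b(1) S_carrier[OF a(2)] S_carrier[OF b(2)]
    show "X \<otimes>\<^bsub>L\<^esub> Y \<in> carrier L" using a b c by (simp add: fr_mult fr_closed S_mult)
    show "X \<otimes>\<^bsub>L\<^esub> Y = Y \<otimes>\<^bsub>L\<^esub> X" using a b c by (simp add: fr_mult m_comm)
    fix Z assume Z: "Z \<in> carrier L"
    obtain d r where d: "d \<in> carrier A" "r \<in> S" "Z = fr d r" using Z by (rule L_E)
    show "X \<otimes>\<^bsub>L\<^esub> Y \<otimes>\<^bsub>L\<^esub> Z = X \<otimes>\<^bsub>L\<^esub> (Y \<otimes>\<^bsub>L\<^esub> Z)"
      using a b d c S_carrier[OF d(2)] by (simp add: fr_mult S_mult m_ac)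
  next
    fix X assume X: "X \<in> carrier L"
    obtain a s where a: "a \<in> carrier A" "s \<in> S" "X = fr a s" using X by (rule L_E)
    show "\<one>\<^bsub>L\<^esub> \<otimes>\<^bsub>L\<^esub> X = X" using a S_carrier[OF a(2)] S_one by (simp add: L_one fr_mult)
  qed
  fix X Y Z assume X: "X \<in> carrier L" and Y: "Y \<in> carrier L" and Z: "Z \<in> carrier L"
  obtain a s where a: "a \<in> carrier A" "s \<in> S" "X = fr a s" using X by (rule L_E)
  obtain b t where b: "b \<in> carrier A" "t \<in> S" "Y = fr b t" using Y by (rule L_E)
  obtain d r where d: "d \<in> carrier A" "r \<in> S" "Z = fr d r" using Z by (rule L_E)
  note c = a(1) b(1) d(1) S_carrier[OF a(2)] S_carrier[OF b(2)] S_carrier[OF d(2)]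
  have "fr ((a \<otimes> t \<oplus> b \<otimes> s) \<otimes> d) (s \<otimes> t \<otimes> r) = fr (a \<otimes> d \<otimes> (t \<otimes> r) \<oplus> b \<otimes> d \<otimes> (s \<otimes> r)) (s \<otimes> r \<otimes> (t \<otimes> r))"
    by (rule fr_eqI) (use a b d c in \<open>simp_all add: S_mult l_distr r_distr m_ac\<close>)
  then show "(X \<oplus>\<^bsub>L\<^esub> Y) \<otimes>\<^bsub>L\<^esub> Z = X \<otimes>\<^bsub>L\<^esub> Z \<oplus>\<^bsub>L\<^esub> Y \<otimes>\<^bsub>L\<^esub> Z"
    using a b d c by (simp add: fr_add fr_mult S_mult)
qed

abbreviation "emb \<equiv> loc_emb A S"

lemma emb_hom: "emb \<in> ring_hom A L"
  by (rule ring_hom_memI) (use S_one in \<open>auto simp: loc_emb_def fr_closed fr_mult fr_add L_one\<close>)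

lemma emb_closed: "a \<in> carrier A \<Longrightarrow> emb a \<in> carrier L"
  by (rule ring_hom_closed[OF emb_hom])

lemma emb_eq_iff: "a \<in> carrier A \<Longrightarrow> b \<in> carrier A \<Longrightarrow> emb a = emb b \<longleftrightarrow> (\<exists>u\<in>S. u \<otimes> a = u \<otimes> b)"
  unfolding loc_emb_def using S_one by (subst fr_eq_iff) auto

lemma emb_fr: "s \<in> S \<Longrightarrow> a \<in> carrier A \<Longrightarrow> emb s \<otimes>\<^bsub>L\<^esub> fr a s = emb a"
proof -
  assume s: "s \<in> S" and a: "a \<in> carrier A"
  note sc = S_carrier[OF s]
  have "fr s \<one> \<otimes>\<^bsub>L\<^esub> fr a s = fr (s \<otimes> a) (\<one> \<otimes> s)" by (rule fr_mult[OF sc S_one a s])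
  also have "\<dots> = fr a \<one>" by (rule fr_eqI) (use s a sc S_one in \<open>simp_all add: m_ac\<close>)
  finally show ?thesis unfolding loc_emb_def .
qed

lemma emb_unit:
  assumes s: "s \<in> S"
  shows "emb s \<in> Units L"
proof -
  interpret L: cring L by (rule L_cring)
  have "emb s \<otimes>\<^bsub>L\<^esub> fr \<one> s = \<one>\<^bsub>L\<^esub>"
    using emb_fr[OF s] ring_hom_one[OF emb_hom] by simp
  moreover have "fr \<one> s \<in> carrier L" "emb s \<in> carrier L" using s S_carrier by (auto intro: fr_closed emb_closed)
  ultimately show ?thesis using L.Units_right_inverseI by blast
qed

lemma fr_eq: 
  assumes "a \<in> carrier A" "s \<in> S"
  shows "fr a s = emb a \<otimes>\<^bsub>L\<^esub> inv\<^bsub>L\<^esub> emb s"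
proof -
  interpret L: cring L by (rule L_cring)
  have u: "emb s \<in> Units L" by (rule emb_unit[OF assms(2)])
  have f: "fr a s \<in> carrier L" by (rule fr_closed[OF assms])
  have "emb a \<otimes>\<^bsub>L\<^esub> inv\<^bsub>L\<^esub> emb s = emb s \<otimes>\<^bsub>L\<^esub> fr a s \<otimes>\<^bsub>L\<^esub> inv\<^bsub>L\<^esub> emb s"
    by (simp add: emb_fr assms)
  also have "\<dots> = (emb s \<otimes>\<^bsub>L\<^esub> inv\<^bsub>L\<^esub> emb s) \<otimes>\<^bsub>L\<^esub> fr a s"
    using L.Units_closed[OF u] L.Units_inv_closed[OF u] f by (simp add: L.m_ac del: L.Units_r_inv)
  also have "\<dots> = fr a s" using u f by simp
  finally show ?thesis by simp
qed

text \<open>The extension of a homomorphism that takes the denominators to units. That it does not depend on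
  the representation of a fraction is \<open>ext_fr\<close>.\<close>

definition ext :: "('b, 'n) ring_scheme \<Rightarrow> ('a \<Rightarrow> 'b) \<Rightarrow> ('a \<times> 'a) set \<Rightarrow> 'b" where
  "ext B \<phi> X = (THE y. \<exists>a\<in>carrier A. \<exists>s\<in>S. X = fr a s \<and> y = \<phi> a \<otimes>\<^bsub>B\<^esub> inv\<^bsub>B\<^esub> \<phi> s)"

context
  fixes B :: "('b, 'n) ring_scheme" and \<phi>
  assumes B: "cring B" and \<phi>: "\<phi> \<in> ring_hom A B" and units: "\<And>s. s \<in> S \<Longrightarrow> \<phi> s \<in> Units B"
begin

interpretation B: cring B by (rule B)

lemma ext_fr:
  assumes a: "a \<in> carrier A" "s \<in> S"
  shows "ext B \<phi> (fr a s) = \<phi> a \<otimes>\<^bsub>B\<^esub> inv\<^bsub>B\<^esub> \<phi> s"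
  unfolding ext_def
proof (rule the_equality)
  show "\<exists>a'\<in>carrier A. \<exists>s'\<in>S. fr a s = fr a' s' \<and> \<phi> a \<otimes>\<^bsub>B\<^esub> inv\<^bsub>B\<^esub> \<phi> s = \<phi> a' \<otimes>\<^bsub>B\<^esub> inv\<^bsub>B\<^esub> \<phi> s'"
    using a by blast
  fix y assume "\<exists>a'\<in>carrier A. \<exists>s'\<in>S. fr a s = fr a' s' \<and> y = \<phi> a' \<otimes>\<^bsub>B\<^esub> inv\<^bsub>B\<^esub> \<phi> s'"
  then obtain b t where b: "b \<in> carrier A" "t \<in> S" "fr a s = fr b t" "y = \<phi> b \<otimes>\<^bsub>B\<^esub> inv\<^bsub>B\<^esub> \<phi> t" by blast
  then obtain u where u: "u \<in> S" "u \<otimes> (a \<otimes> t) = u \<otimes> (b \<otimes> s)" using a by (auto simp: fr_eq_iff)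
  note sc = S_carrier[OF a(2)] S_carrier[OF b(2)] S_carrier[OF u(1)]
  note pc = ring_hom_closed[OF \<phi>]
  have "\<phi> u \<otimes>\<^bsub>B\<^esub> (\<phi> a \<otimes>\<^bsub>B\<^esub> \<phi> t) = \<phi> u \<otimes>\<^bsub>B\<^esub> (\<phi> b \<otimes>\<^bsub>B\<^esub> \<phi> s)"
    using arg_cong[OF u(2), of \<phi>] a b sc by (simp add: ring_hom_mult[OF \<phi>])
  then have e: "\<phi> a \<otimes>\<^bsub>B\<^esub> \<phi> t = \<phi> b \<otimes>\<^bsub>B\<^esub> \<phi> s"
    using units[OF u(1)] a b sc pc by (subst (asm) B.Units_l_cancel) auto
  have us: "\<phi> s \<in> Units B" "\<phi> t \<in> Units B" using units a b by auto
  have "\<phi> a \<otimes>\<^bsub>B\<^esub> inv\<^bsub>B\<^esub> \<phi> s = (\<phi> a \<otimes>\<^bsub>B\<^esub> \<phi> t) \<otimes>\<^bsub>B\<^esub> (inv\<^bsub>B\<^esub> \<phi> s \<otimes>\<^bsub>B\<^esub> inv\<^bsub>B\<^esub> \<phi> t)"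
  proof -
    have "(\<phi> a \<otimes>\<^bsub>B\<^esub> \<phi> t) \<otimes>\<^bsub>B\<^esub> (inv\<^bsub>B\<^esub> \<phi> s \<otimes>\<^bsub>B\<^esub> inv\<^bsub>B\<^esub> \<phi> t) = (\<phi> a \<otimes>\<^bsub>B\<^esub> inv\<^bsub>B\<^esub> \<phi> s) \<otimes>\<^bsub>B\<^esub> (\<phi> t \<otimes>\<^bsub>B\<^esub> inv\<^bsub>B\<^esub> \<phi> t)"
      using us pc[OF a(1)] pc[OF sc(2)] by (simp add: B.m_ac del: B.Units_r_inv)
    then show ?thesis using us pc[OF a(1)] by simp
  qed
  also have "\<dots> = (\<phi> b \<otimes>\<^bsub>B\<^esub> inv\<^bsub>B\<^esub> \<phi> t) \<otimes>\<^bsub>B\<^esub> (\<phi> s \<otimes>\<^bsub>B\<^esub> inv\<^bsub>B\<^esub> \<phi> s)"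
    unfolding e using us pc[OF b(1)] pc[OF sc(1)] by (simp add: B.m_ac del: B.Units_r_inv)
  finally show "y = \<phi> a \<otimes>\<^bsub>B\<^esub> inv\<^bsub>B\<^esub> \<phi> s" using b us pc by simp
qed

lemma ext_emb:
  assumes a: "a \<in> carrier A"
  shows "ext B \<phi> (emb a) = \<phi> a"
  unfolding loc_emb_def ext_fr[OF a S_one] ring_hom_one[OF \<phi>] using ring_hom_closed[OF \<phi> a] by simp

lemma ext_hom: "ext B \<phi> \<in> ring_hom L B"
proof (rule ring_hom_memI)
  note pc = ring_hom_closed[OF \<phi>]
  fix X assume X: "X \<in> carrier L"
  obtain a s where a: "a \<in> carrier A" "s \<in> S" "X = fr a s" using X by (rule L_E)
  show "ext B \<phi> X \<in> carrier B" using a pc units by (simp add: ext_fr)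
  fix Y assume Y: "Y \<in> carrier L"
  obtain b t where b: "b \<in> carrier A" "t \<in> S" "Y = fr b t" using Y by (rule L_E)
  note sc = S_carrier[OF a(2)] S_carrier[OF b(2)]
  have us: "\<phi> s \<in> Units B" "\<phi> t \<in> Units B" using units a b by auto
  have c: "\<phi> a \<in> carrier B" "\<phi> b \<in> carrier B" "\<phi> s \<in> carrier B" "\<phi> t \<in> carrier B" 
    "inv\<^bsub>B\<^esub> \<phi> s \<in> carrier B" "inv\<^bsub>B\<^esub> \<phi> t \<in> carrier B" using a b sc pc us by auto
  have i: "inv\<^bsub>B\<^esub> (\<phi> s \<otimes>\<^bsub>B\<^esub> \<phi> t) = inv\<^bsub>B\<^esub> \<phi> s \<otimes>\<^bsub>B\<^esub> inv\<^bsub>B\<^esub> \<phi> t"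
  proof (rule B.inv_unique'[symmetric])
    have "(\<phi> s \<otimes>\<^bsub>B\<^esub> \<phi> t) \<otimes>\<^bsub>B\<^esub> (inv\<^bsub>B\<^esub> \<phi> s \<otimes>\<^bsub>B\<^esub> inv\<^bsub>B\<^esub> \<phi> t) = (\<phi> s \<otimes>\<^bsub>B\<^esub> inv\<^bsub>B\<^esub> \<phi> s) \<otimes>\<^bsub>B\<^esub> (\<phi> t \<otimes>\<^bsub>B\<^esub> inv\<^bsub>B\<^esub> \<phi> t)"
      using c by (simp add: B.m_ac del: B.Units_r_inv)
    also have "\<dots> = \<one>\<^bsub>B\<^esub>" using us by simp
    finally show "(\<phi> s \<otimes>\<^bsub>B\<^esub> \<phi> t) \<otimes>\<^bsub>B\<^esub> (inv\<^bsub>B\<^esub> \<phi> s \<otimes>\<^bsub>B\<^esub> inv\<^bsub>B\<^esub> \<phi> t) = \<one>\<^bsub>B\<^esub>" .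
    then show "(inv\<^bsub>B\<^esub> \<phi> s \<otimes>\<^bsub>B\<^esub> inv\<^bsub>B\<^esub> \<phi> t) \<otimes>\<^bsub>B\<^esub> (\<phi> s \<otimes>\<^bsub>B\<^esub> \<phi> t) = \<one>\<^bsub>B\<^esub>"
      using c by (simp add: B.m_comm)
  qed (use c in auto)
  have "ext B \<phi> (X \<otimes>\<^bsub>L\<^esub> Y) = (\<phi> a \<otimes>\<^bsub>B\<^esub> \<phi> b) \<otimes>\<^bsub>B\<^esub> (inv\<^bsub>B\<^esub> \<phi> s \<otimes>\<^bsub>B\<^esub> inv\<^bsub>B\<^esub> \<phi> t)"
    using a b sc by (simp add: fr_mult ext_fr S_mult ring_hom_mult[OF \<phi>] i)
  then show "ext B \<phi> (X \<otimes>\<^bsub>L\<^esub> Y) = ext B \<phi> X \<otimes>\<^bsub>B\<^esub> ext B \<phi> Y"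
    using a b c by (simp add: ext_fr B.m_ac)
  have "ext B \<phi> (X \<oplus>\<^bsub>L\<^esub> Y) = (\<phi> a \<otimes>\<^bsub>B\<^esub> \<phi> t \<oplus>\<^bsub>B\<^esub> \<phi> b \<otimes>\<^bsub>B\<^esub> \<phi> s) \<otimes>\<^bsub>B\<^esub> (inv\<^bsub>B\<^esub> \<phi> s \<otimes>\<^bsub>B\<^esub> inv\<^bsub>B\<^esub> \<phi> t)"
    using a b sc by (simp add: fr_add ext_fr S_mult ring_hom_mult[OF \<phi>] ring_hom_add[OF \<phi>] i)
  also have "\<dots> = (\<phi> a \<otimes>\<^bsub>B\<^esub> inv\<^bsub>B\<^esub> \<phi> s) \<otimes>\<^bsub>B\<^esub> (\<phi> t \<otimes>\<^bsub>B\<^esub> inv\<^bsub>B\<^esub> \<phi> t) \<oplus>\<^bsub>B\<^esub> (\<phi> b \<otimes>\<^bsub>B\<^esub> inv\<^bsub>B\<^esub> \<phi> t) \<otimes>\<^bsub>B\<^esub> (\<phi> s \<otimes>\<^bsub>B\<^esub> inv\<^bsub>B\<^esub> \<phi> s)"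
    using c by (simp add: B.l_distr B.r_distr B.m_ac del: B.Units_r_inv)
  finally show "ext B \<phi> (X \<oplus>\<^bsub>L\<^esub> Y) = ext B \<phi> X \<oplus>\<^bsub>B\<^esub> ext B \<phi> Y"
    using a b c us by (simp add: ext_fr)
next
  show "ext B \<phi> \<one>\<^bsub>L\<^esub> = \<one>\<^bsub>B\<^esub>"
    using ext_emb[of \<one>] ring_hom_one[OF emb_hom] ring_hom_one[OF \<phi>] by simp
qed

end

text \<open>
  All homomorphisms between the rings below are compared in this way, on numerators only.
\<close>

lemma hom_unique:
  assumes B: "cring B" and f: "f \<in> ring_hom L B" and g: "g \<in> ring_hom L B"
    and eq: "\<And>a. a \<in> carrier A \<Longrightarrow> f (emb a) = g (emb a)" and X: "X \<in> carrier L"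
  shows "f X = g X"
proof -
  interpret B: cring B by fact
  obtain a s where a: "a \<in> carrier A" "s \<in> S" "X = fr a s" using X by (rule L_E)
  have r: "ring L" "ring B" using L_cring B by (auto simp: cring.axioms)
  have u: "emb s \<in> Units L" by (rule emb_unit[OF a(2)])
  have c: "emb a \<in> carrier L" "inv\<^bsub>L\<^esub> emb s \<in> carrier L"
    using a u by (auto simp: emb_closed intro: monoid.Units_inv_closed[OF ring.is_monoid[OF r(1)]])
  show ?thesis
    unfolding a(3) fr_eq[OF a(1,2)] ring_hom_mult[OF f c] ring_hom_mult[OF g c]
      ring_hom_inv[OF r f u] ring_hom_inv[OF r g u] eq[OF a(1)] eq[OF S_carrier[OF a(2)]] ..
qed

end

lemma (in cring) regular_elements_fractions: "fractions R (regular_elements R)"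
proof
  show "regular_elements R \<subseteq> carrier R" "\<one> \<in> regular_elements R" by (auto simp: regular_elements_def)
  show "s \<otimes> t \<in> regular_elements R" if "s \<in> regular_elements R" "t \<in> regular_elements R" for s t
  proof -
    have c: "s \<in> carrier R" "t \<in> carrier R" using that by (auto simp: regular_elements_def)
    have "a = \<zero>" if a: "a \<in> carrier R" "s \<otimes> t \<otimes> a = \<zero>" for a
    proof -
      have "s \<otimes> (t \<otimes> a) = \<zero>" using a c by (simp add: m_assoc)
      then have "t \<otimes> a = \<zero>" using \<open>s \<in> regular_elements R\<close> a c unfolding regular_elements_def by simp
      then show ?thesis using \<open>t \<in> regular_elements R\<close> a unfolding regular_elements_def by simp
    qed
    then show ?thesis using c unfolding regular_elements_def by simp
  qed
qed

lemma (in cring) tfrac_emb_inj: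
  assumes "a \<in> carrier R" "b \<in> carrier R" "tfrac_emb R a = tfrac_emb R b"
  shows "a = b"
proof -
  interpret Q: fractions R "regular_elements R" by (rule regular_elements_fractions)
  from assms obtain u where u: "u \<in> regular_elements R" "u \<otimes> a = u \<otimes> b"
    unfolding tfrac_emb_def by (auto simp: Q.emb_eq_iff)
  then have uc: "u \<in> carrier R" by (simp add: regular_elements_def)
  have "u \<otimes> (a \<ominus> b) = \<zero>" using u(2) uc assms(1,2) by (simp add: a_minus_def r_distr r_minus r_neg)
  then have "a \<ominus> b = \<zero>" using u(1) assms(1,2) unfolding regular_elements_def by simp
  then show ?thesis using assms(1,2) by (simp add: r_right_minus_eq)
qed

section \<open>The Weyl group and its action\<close>

text \<open>
  The property of Weyl group elements which makes them act on formal group algebras.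
\<close>

definition lattice_aut :: "('l::ab_group_add \<Rightarrow> 'l) \<Rightarrow> bool" where
  "lattice_aut w \<longleftrightarrow> bij w \<and> (\<forall>a b. w (a + b) = w a + w b)"

lemma lattice_aut_id: "lattice_aut id" by (simp add: lattice_aut_def)

lemma lattice_aut_comp: "lattice_aut v \<Longrightarrow> lattice_aut w \<Longrightarrow> lattice_aut (v \<circ> w)"
  by (simp add: lattice_aut_def bij_comp)

lemma lattice_aut_inv: "lattice_aut w \<Longrightarrow> lattice_aut (inv_into UNIV w)"
  unfolding lattice_aut_def
proof (intro conjI allI)
  assume w: "bij w \<and> (\<forall>a b. w (a + b) = w a + w b)"
  then show "bij (inv_into UNIV w)" by (simp add: bij_imp_bij_inv)
  fix a b
  have "w (inv_into UNIV w a + inv_into UNIV w b) = a + b"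
    using w by (simp add: bij_is_surj surj_f_inv_f)
  then show "inv_into UNIV w (a + b) = inv_into UNIV w a + inv_into UNIV w b"
    using w by (metis bij_is_inj inv_f_f)
qed

lemma lattice_aut_zero: "lattice_aut w \<Longrightarrow> w 0 = 0"
  unfolding lattice_aut_def by (metis add.right_neutral add_left_cancel)

lemma lattice_aut_zero_iff: "lattice_aut w \<Longrightarrow> w l = 0 \<longleftrightarrow> l = 0"
  by (metis lattice_aut_zero lattice_aut_def bij_is_inj inj_eq)

lemma lattice_aut_minus: "lattice_aut w \<Longrightarrow> w (- l) = - w l"
  by (metis lattice_aut_zero lattice_aut_def add.right_inverse add_eq_0_iff)

context root_datum begin

lemma coroot_add: "\<alpha> \<in> \<Phi> \<Longrightarrow> coroot \<alpha> (a + b) = coroot \<alpha> a + coroot \<alpha> b"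
  using coroot_hom module_hom.add by blast

lemma coroot_scale: "\<alpha> \<in> \<Phi> \<Longrightarrow> coroot \<alpha> (scale c a) = c * coroot \<alpha> a"
  using coroot_hom module_hom.scale by blast

lemma coroot_diff: "\<alpha> \<in> \<Phi> \<Longrightarrow> coroot \<alpha> (a - b) = coroot \<alpha> a - coroot \<alpha> b"
  using coroot_add[of \<alpha> "a - b" b] by simp

lemma reflection_root: "\<alpha> \<in> \<Phi> \<Longrightarrow> reflection scale coroot \<alpha> \<alpha> = - \<alpha>"
proof -
  assume "\<alpha> \<in> \<Phi>"
  moreover have "scale 2 \<alpha> = \<alpha> + \<alpha>" using scale_left_distrib[of 1 1 \<alpha>] by simp
  ultimately show ?thesis by (simp add: reflection_def coroot_root)
qed

lemma reflection_reflection: "\<alpha> \<in> \<Phi> \<Longrightarrow> reflection scale coroot \<alpha> (reflection scale coroot \<alpha> l) = l"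
  by (simp add: reflection_def coroot_diff coroot_scale coroot_root algebra_simps)

lemma reflection_aut: "\<alpha> \<in> \<Phi> \<Longrightarrow> lattice_aut (reflection scale coroot \<alpha>)"
  unfolding lattice_aut_def
  by (auto intro!: involuntory_imp_bij simp: reflection_reflection)
    (simp add: reflection_def coroot_add scale_left_distrib)

abbreviation "W \<equiv> weyl_group scale \<Phi> coroot"

lemma reflection_weyl: "\<alpha> \<in> \<Phi> \<Longrightarrow> reflection scale coroot \<alpha> \<in> W"
  unfolding weyl_group_def by (intro generate.incl) auto

lemma BijGroup_UNIV:
  "v \<in> carrier (BijGroup UNIV) \<longleftrightarrow> bij v" "\<one>\<^bsub>BijGroup UNIV\<^esub> = id"
  "bij v \<Longrightarrow> bij w \<Longrightarrow> v \<otimes>\<^bsub>BijGroup UNIV\<^esub> w = v \<circ> w"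
  "bij v \<Longrightarrow> inv\<^bsub>BijGroup UNIV\<^esub> v = inv_into UNIV v"
  using inv_BijGroup[of v UNIV]
  by (auto simp: BijGroup_def Bij_def compose_def fun_eq_iff)

lemma weyl_aut: "w \<in> W \<Longrightarrow> lattice_aut w"
  unfolding weyl_group_def
proof (induction w rule: generate.induct)
  case one
  then show ?case using lattice_aut_id by (simp add: BijGroup_UNIV id_def)
next
  case (incl h)
  then show ?case by (auto intro: reflection_aut)
next
  case (inv h)
  then have "lattice_aut h" by (auto intro: reflection_aut)
  then show ?case by (simp add: BijGroup_UNIV lattice_aut_inv lattice_aut_def[of h])
next
  case (eng v w)
  then have "bij v" "bij w" by (simp_all add: lattice_aut_def)
  then show ?case using lattice_aut_comp[OF eng.IH] by (simp only: BijGroup_UNIV(3))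
qed

lemma weyl_bij: "w \<in> W \<Longrightarrow> bij w" using weyl_aut lattice_aut_def by blast

lemma weyl_id: "id \<in> W"
  using generate.one[of "BijGroup UNIV" "reflection scale coroot ` \<Phi>"] by (simp add: weyl_group_def BijGroup_UNIV)

lemma weyl_comp: "v \<in> W \<Longrightarrow> w \<in> W \<Longrightarrow> v \<circ> w \<in> W"
  using generate.eng[of v "BijGroup UNIV" "reflection scale coroot ` \<Phi>" w] weyl_bij[of v] weyl_bij[of w]
  by (simp add: weyl_group_def BijGroup_UNIV)

lemma weyl_inv: "w \<in> W \<Longrightarrow> inv_into UNIV w \<in> W"
proof -
  assume w: "w \<in> W"
  have "group (BijGroup (UNIV :: 'a set))" by (rule group_BijGroup)
  moreover have "reflection scale coroot ` \<Phi> \<subseteq> carrier (BijGroup UNIV)"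
    using reflection_aut by (auto simp: BijGroup_UNIV lattice_aut_def)
  ultimately show ?thesis
    using group.generate_m_inv_closed[of "BijGroup UNIV" "reflection scale coroot ` \<Phi>" w] w weyl_bij[OF w]
    by (simp add: weyl_group_def BijGroup_UNIV)
qed

end

context fgl begin

lemma pser_act_psub:
  fixes f :: "'l multiset \<Rightarrow> 'r"
  assumes w: "bij w" and f: "f \<in> carrier (pser R)"
  shows "pser_act w f = psub1 (\<lambda>l. pser_var R (w l)) f"
proof
  fix m :: "'l multiset"
  interpret H: coeff_hom R R "\<lambda>a. a" by (rule id_coeff_hom)
  let ?s = "\<lambda>l. pser_var R (w l)" and ?k = "image_mset (inv_into UNIV w) m"
  note fc = pser_coeff[OF f]
  have mon: "pmon ?s k m = (if k = ?k then \<one> else \<zero>)" for k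
  proof -
    have "m = image_mset w k \<longleftrightarrow> k = ?k"
      using w by (auto simp: multiset.map_comp comp_def bij_is_surj surj_f_inv_f bij_is_inj inv_f_f)
    then show ?thesis using fun_cong[OF pmon_var[of ?s w k], of m] by simp
  qed
  have "psub1 ?s f m = (\<Oplus>k\<in>insert ?k (psupp R (size m) f). f k \<otimes> pmon ?s k m)"
    using finite_psupp[OF f] by (intro H.psub_any[OF pser_var_pord f]) auto
  also have "\<dots> = f ?k \<otimes> pmon ?s ?k m"
    by (rule finsum_single) (use fc finite_psupp[OF f] in \<open>auto simp: mon\<close>)
  finally show "pser_act w f m = psub1 ?s f m" using fc by (simp add: mon pser_act_def)
qed

lemma fga_hom_act:
  assumes "lattice_aut (w :: 'l::ab_group_add \<Rightarrow> 'l)"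
  shows "fga_hom R R (\<lambda>a. a) F F (\<lambda>l. pser_var R (w l))"
proof -
  interpret H: coeff_hom R R "\<lambda>a. a" by (rule id_coeff_hom)
  show ?thesis
    using assms fga_add_mem[of "w _" "w _"] fga_zero_mem[where 'l = 'l]
    by unfold_locales (auto simp: pser_var_pord lattice_aut_zero, simp add: lattice_aut_def)
qed

lemma fga_class_iff:
  fixes f :: "'l::ab_group_add multiset \<Rightarrow> 'r"
  assumes "f \<in> carrier (pser R)"
  shows "g \<in> fga_class R F f \<longleftrightarrow> g \<in> carrier (pser R) \<and> fga_class R F g = fga_class R F f"
  using fga_class_mem[OF assms] fga_class_self[of g] by blast

text \<open>
  The action of the definition takes images of cosets, whereas homomorphisms of formal group
  algebras are given by representatives. The image of a coset is a full coset since the inverse of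
  \<open>w\<close> acts, too.
\<close>

lemma fga_act_eq:
  assumes w: "lattice_aut (w :: 'l::ab_group_add \<Rightarrow> 'l)" and X: "X \<in> carrier (fga R F)"
  shows "fga_act w X = fga_map R R F (\<lambda>a. a) (\<lambda>l. pser_var R (w l)) X"
proof -
  let ?v = "inv_into UNIV w"
  have v: "lattice_aut ?v" by (rule lattice_aut_inv[OF w])
  have bw: "bij w" and bv: "bij ?v" using w v by (auto simp: lattice_aut_def)
  interpret W: fga_hom R R "\<lambda>a. a" F F "\<lambda>l. pser_var R (w l)" by (rule fga_hom_act[OF w])
  interpret V: fga_hom R R "\<lambda>a. a" F F "\<lambda>l. pser_var R (?v l)" by (rule fga_hom_act[OF v])
  have wv: "pser_act w (pser_act ?v g) = g" and vw: "pser_act ?v (pser_act w g) = g" for g :: "'l multiset \<Rightarrow> 'r"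
    using bw by (auto simp: pser_act_def multiset.map_comp comp_def inv_inv_eq bij_is_surj surj_f_inv_f bij_is_inj inv_f_f)
  have wc: "pser_act w g \<in> carrier (pser R)" and vc: "pser_act ?v g \<in> carrier (pser R)" if "g \<in> carrier (pser R)" for g
    using that pser_hom_overD(4)[OF W.hom_s] pser_hom_overD(4)[OF V.hom_s] by (simp_all add: pser_act_psub bw bv)
  have cw: "W.\<Psi> (fga_class R F g) = fga_class R F (pser_act w g)"
    and cv: "V.\<Psi> (fga_class R F g) = fga_class R F (pser_act ?v g)" if "g \<in> carrier (pser R)" for g
    using that by (simp_all add: W.map_class V.map_class pser_act_psub bw bv)
  from X obtain f where f: "f \<in> carrier (pser R)" "X = fga_class R F f" by (rule fga_carrierE)
  have "pser_act w ` fga_class R F f = fga_class R F (pser_act w f)"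
  proof (intro equalityI subsetI)
    fix g assume "g \<in> pser_act w ` fga_class R F f"
    then obtain h where h: "h \<in> carrier (pser R)" "fga_class R F h = fga_class R F f" "g = pser_act w h"
      using f by (auto simp: fga_class_iff)
    then show "g \<in> fga_class R F (pser_act w f)"
      using f wc cw[OF h(1)] cw[OF f(1)] by (simp add: fga_class_iff)
  next
    fix g assume "g \<in> fga_class R F (pser_act w f)"
    then have g: "g \<in> carrier (pser R)" "fga_class R F g = fga_class R F (pser_act w f)"
      using wc[OF f(1)] by (auto simp: fga_class_iff)
    then have "fga_class R F (pser_act ?v g) = fga_class R F f"
      using cv[OF g(1)] cv[OF wc[OF f(1)]] by (simp add: vw)
    then have "pser_act ?v g \<in> fga_class R F f" using f(1) vc[OF g(1)] by (simp add: fga_class_iff)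
    then show "g \<in> pser_act w ` fga_class R F f" by (intro image_eqI[where x = "pser_act ?v g"] wv[symmetric])
  qed
  then show ?thesis using f cw by (simp add: fga_act_def)
qed

lemma fga_act_hom:
  assumes w: "lattice_aut (w :: 'l::ab_group_add \<Rightarrow> 'l)"
  shows "fga_act w \<in> ring_hom (fga R F) (fga R F)"
proof -
  interpret W: fga_hom R R "\<lambda>a. a" F F "\<lambda>l. pser_var R (w l)" by (rule fga_hom_act[OF w])
  interpret A: cring "fga R F :: ('l multiset \<Rightarrow> 'r) set ring" by (rule fga_cring)
  show ?thesis using W.map_hom
    unfolding ring_hom_def using fga_act_eq[OF w] by (auto simp: Pi_def)
qed

lemma fga_act_x: "lattice_aut w \<Longrightarrow> fga_act w (fga_x R F l) = fga_x R F (w l)"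
  using fga_hom.map_x[OF fga_hom_act] by (simp add: fga_act_eq fga_x_closed) (simp add: fga_x_def)

lemma fga_act_const:
  assumes w: "lattice_aut (w :: 'l::ab_group_add \<Rightarrow> 'l)" and "a \<in> carrier R"
  shows "fga_act w (fga_const R F a) = fga_const R F a"
  using fga_hom.map_const[OF fga_hom_act[OF w]] assms by (simp add: fga_act_eq fga_const_closed)

lemma fga_act_id:
  assumes "X \<in> carrier (fga R F :: ('l::ab_group_add multiset \<Rightarrow> 'r) set ring)"
  shows "fga_act id X = X"
  unfolding fga_act_def pser_act_def by (simp add: inv_id[unfolded id_def] id_def)

lemma fga_act_comp:
  fixes X :: "('l::ab_group_add multiset \<Rightarrow> 'r) set"
  assumes v: "lattice_aut v" and w: "lattice_aut (w :: 'l::ab_group_add \<Rightarrow> 'l)"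
  shows "fga_act v (fga_act w X) = fga_act (v \<circ> w) X"
proof -
  have "pser_act v (pser_act w f) = pser_act (v \<circ> w) f" for f :: "'l multiset \<Rightarrow> 'r"
    using v w by (simp add: pser_act_def multiset.map_comp o_inv_distrib lattice_aut_def)
  then show ?thesis by (simp add: fga_act_def image_image)
qed

lemma fga_act_regular:
  assumes w: "lattice_aut (w :: 'l::ab_group_add \<Rightarrow> 'l)" and X: "X \<in> regular_elements (fga R F)"
  shows "fga_act w X \<in> regular_elements (fga R F)"
  unfolding regular_elements_def
proof (intro CollectI conjI ballI impI)
  interpret A: cring "fga R F :: ('l multiset \<Rightarrow> 'r) set ring" by (rule fga_cring)
  let ?v = "inv_into UNIV w"
  have v: "lattice_aut ?v" by (rule lattice_aut_inv[OF w])
  have b: "bij w" using w by (simp add: lattice_aut_def)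
  have vw: "?v \<circ> w = id" "w \<circ> ?v = id" using b by (auto simp: fun_eq_iff bij_is_surj surj_f_inv_f bij_is_inj inv_f_f)
  note h = fga_act_hom[OF w] and hv = fga_act_hom[OF v]
  have Xc: "X \<in> carrier (fga R F)" using X by (simp add: regular_elements_def)
  show "fga_act w X \<in> carrier (fga R F)" by (rule ring_hom_closed[OF h Xc])
  fix Y assume Y: "Y \<in> carrier (fga R F)" and z: "fga_act w X \<otimes>\<^bsub>fga R F\<^esub> Y = \<zero>\<^bsub>fga R F\<^esub>"
  have vY: "fga_act ?v Y \<in> carrier (fga R F)" by (rule ring_hom_closed[OF hv Y])
  have "fga_act ?v (fga_act w X \<otimes>\<^bsub>fga R F\<^esub> Y) = X \<otimes>\<^bsub>fga R F\<^esub> fga_act ?v Y"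
    using ring_hom_mult[OF hv ring_hom_closed[OF h Xc] Y] Xc by (simp add: fga_act_comp[OF v w] vw fga_act_id)
  then have "X \<otimes>\<^bsub>fga R F\<^esub> fga_act ?v Y = \<zero>\<^bsub>fga R F\<^esub>"
    using z ring_hom_zero[OF hv A.ring_axioms A.ring_axioms] by simp
  then have "fga_act ?v Y = \<zero>\<^bsub>fga R F\<^esub>" using X vY by (simp add: regular_elements_def)
  then have "fga_act w (fga_act ?v Y) = \<zero>\<^bsub>fga R F\<^esub>" using ring_hom_zero[OF h A.ring_axioms A.ring_axioms] by simp
  then show "Y = \<zero>\<^bsub>fga R F\<^esub>" using Y by (simp add: fga_act_comp[OF w v] vw fga_act_id)
qed

end

section \<open>Maps of total rings of fractions\<close>

lemma (in fractions) frac_map_ext: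
  assumes h: "h \<in> ring_hom A A" and S: "\<And>s. s \<in> S \<Longrightarrow> h s \<in> S" and X: "X \<in> carrier L"
  shows "(\<Union>(a, s)\<in>X. fr (h a) (h s)) = ext L (\<lambda>a. emb (h a)) X"
proof -
  have h': "(\<lambda>a. emb (h a)) \<in> ring_hom A L"
    using ring_hom_trans[OF h emb_hom] by (simp add: comp_def)
  have E: "ext L (\<lambda>a. emb (h a)) (fr a s) = fr (h a) (h s)" if "a \<in> carrier A" "s \<in> S" for a s
    using that ext_fr[OF L_cring h' emb_unit[OF S] that] ring_hom_closed[OF h] S by (simp add: fr_eq)
  obtain a s where a: "a \<in> carrier A" "s \<in> S" "X = fr a s" using X by (rule L_E)
  have "(\<Union>(a, s)\<in>fr a s. fr (h a) (h s)) = fr (h a) (h s)"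
    by (rule fr_UN[OF a(1,2)]) (metis E a(1,2))
  then show ?thesis using a E by simp
qed

lemma (in cring) tfrac_map_hom:
  assumes h: "h \<in> ring_hom R R" and S: "\<And>s. s \<in> regular_elements R \<Longrightarrow> h s \<in> regular_elements R"
  shows "tfrac_map R h \<in> ring_hom (tfrac R) (tfrac R)"
    "a \<in> carrier R \<Longrightarrow> tfrac_map R h (tfrac_emb R a) = tfrac_emb R (h a)"
proof -
  interpret Q: fractions R "regular_elements R" by (rule regular_elements_fractions)
  have h': "(\<lambda>a. Q.emb (h a)) \<in> ring_hom R Q.L"
    using ring_hom_trans[OF h Q.emb_hom] by (simp add: comp_def)
  have eq: "tfrac_map R h X = Q.ext Q.L (\<lambda>a. Q.emb (h a)) X" if "X \<in> carrier Q.L" for X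
    using Q.frac_map_ext[OF h S that] by (simp add: tfrac_map_def)
  interpret QL: cring Q.L by (rule Q.L_cring)
  have "Q.ext Q.L (\<lambda>a. Q.emb (h a)) \<in> ring_hom Q.L Q.L"
    by (rule Q.ext_hom[OF Q.L_cring h' Q.emb_unit[OF S]])
  then show "tfrac_map R h \<in> ring_hom (tfrac R) (tfrac R)"
    unfolding tfrac_def ring_hom_def using eq by (auto simp: Pi_def)
  show "a \<in> carrier R \<Longrightarrow> tfrac_map R h (tfrac_emb R a) = tfrac_emb R (h a)"
    using eq[OF Q.emb_closed] Q.ext_emb[OF Q.L_cring h' Q.emb_unit[OF S]] by (simp add: tfrac_emb_def)
qed

lemma (in cring) tfrac_hom_unique:
  assumes B: "cring B" and f: "f \<in> ring_hom (tfrac R) B" and g: "g \<in> ring_hom (tfrac R) B"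
    and eq: "\<And>a. a \<in> carrier R \<Longrightarrow> f (tfrac_emb R a) = g (tfrac_emb R a)" and X: "X \<in> carrier (tfrac R)"
  shows "f X = g X"
proof -
  interpret Q: fractions R "regular_elements R" by (rule regular_elements_fractions)
  show ?thesis using Q.hom_unique[OF B] f g eq X unfolding tfrac_def tfrac_emb_def by blast
qed

lemma (in cring) tfrac_cring: "cring (tfrac R)"
  unfolding tfrac_def using fractions.L_cring[OF regular_elements_fractions] .

lemma (in cring) tfrac_emb_hom: "tfrac_emb R \<in> ring_hom R (tfrac R)"
  unfolding tfrac_def tfrac_emb_def using fractions.emb_hom[OF regular_elements_fractions] .

lemma (in cring) tfrac_emb_unit: "s \<in> regular_elements R \<Longrightarrow> tfrac_emb R s \<in> Units (tfrac R)"
  unfolding tfrac_def tfrac_emb_def using fractions.emb_unit[OF regular_elements_fractions] .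

text \<open>An isomorphism preserves regular elements. A mere homomorphism does not, hence the
  inverse \<open>g\<close>.\<close>

lemma tfrac_iso_extend:
  assumes A: "cring A" and B: "cring B" and f: "f \<in> ring_hom A B" and g: "g \<in> ring_hom B A"
    and gf: "\<And>a. a \<in> carrier A \<Longrightarrow> g (f a) = a" and fg: "\<And>b. b \<in> carrier B \<Longrightarrow> f (g b) = b"
  shows "\<exists>\<tau>\<in>ring_hom (tfrac A) (tfrac B). \<forall>a\<in>carrier A. \<tau> (tfrac_emb A a) = tfrac_emb B (f a)"
proof -
  interpret A: cring A by fact
  interpret B: cring B by fact
  interpret Q: fractions A "regular_elements A" by (rule A.regular_elements_fractions)
  have reg: "f s \<in> regular_elements B" if s: "s \<in> regular_elements A" for s
    unfolding regular_elements_def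
  proof (intro CollectI conjI ballI impI)
    have sc: "s \<in> carrier A" using s by (simp add: regular_elements_def)
    show "f s \<in> carrier B" by (rule ring_hom_closed[OF f sc])
    fix b assume b: "b \<in> carrier B" and z: "f s \<otimes>\<^bsub>B\<^esub> b = \<zero>\<^bsub>B\<^esub>"
    have gb: "g b \<in> carrier A" by (rule ring_hom_closed[OF g b])
    have "g (f s \<otimes>\<^bsub>B\<^esub> b) = s \<otimes>\<^bsub>A\<^esub> g b" using ring_hom_mult[OF g ring_hom_closed[OF f sc] b] sc by (simp add: gf)
    then have "s \<otimes>\<^bsub>A\<^esub> g b = \<zero>\<^bsub>A\<^esub>" using z ring_hom_zero[OF g B.ring_axioms A.ring_axioms] by simp
    then have "g b = \<zero>\<^bsub>A\<^esub>" using s gb by (simp add: regular_elements_def)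
    then have "f (g b) = \<zero>\<^bsub>B\<^esub>" using ring_hom_zero[OF f A.ring_axioms B.ring_axioms] by simp
    then show "b = \<zero>\<^bsub>B\<^esub>" using b fg by simp
  qed
  have h: "(\<lambda>a. tfrac_emb B (f a)) \<in> ring_hom A (tfrac B)"
    using ring_hom_trans[OF f B.tfrac_emb_hom] by (simp add: comp_def)
  have u: "tfrac_emb B (f s) \<in> Units (tfrac B)" if "s \<in> regular_elements A" for s
    by (rule B.tfrac_emb_unit[OF reg[OF that]])
  show ?thesis
    using Q.ext_hom[OF B.tfrac_cring h u] Q.ext_emb[OF B.tfrac_cring h u]
    unfolding tfrac_def[of A] tfrac_emb_def[of A] by blast
qed

section \<open>Twisted group rings\<close>

lemma generate_ring_mono':
  assumes "S \<subseteq> generate_ring R S'"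
  shows "generate_ring R S \<subseteq> generate_ring R S'"
proof
  fix x assume "x \<in> generate_ring R S"
  then show "x \<in> generate_ring R S'"
    by (induction rule: generate_ring.induct) (use assms in \<open>auto intro: generate_ring.intros\<close>)
qed

locale twisted = cring P for P :: "('p, 'm) ring_scheme" (structure) +
  fixes W :: "('l \<Rightarrow> 'l) set" and act :: "('l \<Rightarrow> 'l) \<Rightarrow> 'p \<Rightarrow> 'p"
  assumes W_id: "id \<in> W" and W_comp: "\<And>v w. v \<in> W \<Longrightarrow> w \<in> W \<Longrightarrow> v \<circ> w \<in> W"
    and W_inv: "\<And>w. w \<in> W \<Longrightarrow> inv_into UNIV w \<in> W" and W_bij: "\<And>w. w \<in> W \<Longrightarrow> bij w"
    and act_hom: "\<And>w. w \<in> W \<Longrightarrow> act w \<in> ring_hom P P"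
    and act_id: "\<And>a. a \<in> carrier P \<Longrightarrow> act id a = a"
begin

abbreviation "T \<equiv> twisted_group_ring P W act"
abbreviation "tm \<equiv> twisted_monom P W"

lemmas act_closed = ring_hom_closed[OF act_hom]
lemmas act_mult = ring_hom_mult[OF act_hom]
lemmas act_add = ring_hom_add[OF act_hom]
lemmas act_one = ring_hom_one[OF act_hom]
lemma act_zero: "w \<in> W \<Longrightarrow> act w \<zero> = \<zero>" by (rule ring_hom_zero[OF act_hom ring_axioms ring_axioms])
lemma act_uminus: "w \<in> W \<Longrightarrow> a \<in> carrier P \<Longrightarrow> act w (\<ominus> a) = \<ominus> act w a"
  using ring_hom_cring.hom_a_inv[of P P "act w" a] act_hom[of w] cring_axioms by (simp add: ring_hom_cring_def ring_hom_cring_axioms_def)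

lemma T_carrier: "f \<in> carrier T \<longleftrightarrow> f \<in> W \<rightarrow>\<^sub>E carrier P \<and> finite {w \<in> W. f w \<noteq> \<zero>}"
  by (simp only: twisted_group_ring_def partial_object.simps mem_Collect_eq)

lemma T_apply: "f \<in> carrier T \<Longrightarrow> w \<in> W \<Longrightarrow> f w \<in> carrier P"
  by (auto simp: T_carrier)

lemma T_finite: "f \<in> carrier T \<Longrightarrow> finite {w \<in> W. f w \<noteq> \<zero>}"
  by (simp only: T_carrier)

lemma T_ext: "f \<in> extensional W \<Longrightarrow> g \<in> extensional W \<Longrightarrow> (\<And>w. w \<in> W \<Longrightarrow> f w = g w) \<Longrightarrow> f = g"
  by (rule extensionalityI[where A = W])

lemma T_extensional: "f \<in> carrier T \<Longrightarrow> f \<in> extensional W"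
  by (auto simp: T_carrier PiE_def)

lemma T_carrierI:
  assumes "f \<in> extensional W" "\<And>w. w \<in> W \<Longrightarrow> f w \<in> carrier P" "finite B" "\<And>w. w \<in> W \<Longrightarrow> w \<notin> B \<Longrightarrow> f w = \<zero>"
  shows "f \<in> carrier T"
proof -
  have "{w \<in> W. f w \<noteq> \<zero>} \<subseteq> B" using assms(4) by blast
  then have "finite {w \<in> W. f w \<noteq> \<zero>}" using assms(3) finite_subset by blast
  then show ?thesis using assms(1,2) by (simp add: T_carrier PiE_def Pi_def)
qed

lemma T_add: "f \<oplus>\<^bsub>T\<^esub> g = (\<lambda>w\<in>W. f w \<oplus> g w)" by (simp add: twisted_group_ring_def)
lemma T_zero: "\<zero>\<^bsub>T\<^esub> = (\<lambda>w\<in>W. \<zero>)" by (simp add: twisted_group_ring_def)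
lemma T_one: "\<one>\<^bsub>T\<^esub> = tm id \<one>" by (simp add: twisted_group_ring_def twisted_monom_def)

lemma T_mult: "v \<in> W \<Longrightarrow> (f \<otimes>\<^bsub>T\<^esub> g) v = 
    (\<Oplus>w\<in>{w \<in> W. g w \<noteq> \<zero>}. act (inv_into UNIV w) (f (v \<circ> inv_into UNIV w)) \<otimes> g w)"
  by (simp add: twisted_group_ring_def)

lemma T_mult_extensional: "f \<otimes>\<^bsub>T\<^esub> g \<in> extensional W"
  by (simp add: twisted_group_ring_def)

lemma T_term_closed:
  assumes "f \<in> carrier T" "g \<in> carrier T" "v \<in> W" "w \<in> W"
  shows "act (inv_into UNIV w) (f (v \<circ> inv_into UNIV w)) \<otimes> g w \<in> carrier P"
  by (rule m_closed[OF act_closed[OF W_inv[OF assms(4)] T_apply[OF assms(1) W_comp[OF assms(3) W_inv[OF assms(4)]]]]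
      T_apply[OF assms(2,4)]])

lemma T_mult_closed:
  assumes f: "f \<in> carrier T" and g: "g \<in> carrier T"
  shows "f \<otimes>\<^bsub>T\<^esub> g \<in> carrier T"
proof (rule T_carrierI[OF T_mult_extensional])
  let ?F = "{w \<in> W. f w \<noteq> \<zero>}" and ?G = "{w \<in> W. g w \<noteq> \<zero>}"
  show "(f \<otimes>\<^bsub>T\<^esub> g) v \<in> carrier P" if v: "v \<in> W" for v
    unfolding T_mult[OF v] by (intro finsum_closed) (auto intro!: T_term_closed f g v)
  show "finite ((\<lambda>p. fst p \<circ> snd p) ` (?F \<times> ?G))" using T_finite f g by blast
  fix v assume v: "v \<in> W" "v \<notin> (\<lambda>p. fst p \<circ> snd p) ` (?F \<times> ?G)"
  show "(f \<otimes>\<^bsub>T\<^esub> g) v = \<zero>"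
    unfolding T_mult[OF v(1)]
  proof (rule finsum_zero_eqI)
    fix w assume w: "w \<in> ?G"
    have i: "v \<circ> inv_into UNIV w \<in> W" "inv_into UNIV w \<in> W" using v w W_inv W_comp by auto
    have "v = (v \<circ> inv_into UNIV w) \<circ> w" using W_bij[of w] w by (auto simp: fun_eq_iff bij_is_inj)
    then have "v \<in> (\<lambda>p. fst p \<circ> snd p) ` (?F \<times> ?G)" if "f (v \<circ> inv_into UNIV w) \<noteq> \<zero>"
      using that w i by (intro image_eqI[where x = "(v \<circ> inv_into UNIV w, w)"]) auto
    then have "f (v \<circ> inv_into UNIV w) = \<zero>" using v(2) by blast
    then show "act (inv_into UNIV w) (f (v \<circ> inv_into UNIV w)) \<otimes> g w = \<zero>"
      using w i T_apply[OF g, of w] by (simp add: act_zero)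
  qed
qed

lemma T_add_closed:
  assumes f: "f \<in> carrier T" and g: "g \<in> carrier T"
  shows "f \<oplus>\<^bsub>T\<^esub> g \<in> carrier T"
  by (rule T_carrierI[where B = "{w \<in> W. f w \<noteq> \<zero>} \<union> {w \<in> W. g w \<noteq> \<zero>}"])
    (use T_finite[OF f] T_finite[OF g] T_apply[OF f] T_apply[OF g] in \<open>auto simp: T_add\<close>)

lemma T_zero_closed: "\<zero>\<^bsub>T\<^esub> \<in> carrier T"
  by (rule T_carrierI[where B = "{}"]) (auto simp: T_zero)

lemma mon_closed: "c \<in> carrier P \<Longrightarrow> tm w c \<in> carrier T"
  by (rule T_carrierI[where B = "{w}"]) (auto simp: twisted_monom_def)

lemma mon_apply: "v \<in> W \<Longrightarrow> tm w c v = (if v = w then c else \<zero>)"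
  by (simp add: twisted_monom_def)

lemma T_abelian_group: "abelian_group T"
proof (rule abelian_groupI)
  fix f assume f: "f \<in> carrier T"
  show "\<zero>\<^bsub>T\<^esub> \<oplus>\<^bsub>T\<^esub> f = f"
    using T_apply[OF f] T_extensional[OF f] by (auto intro!: T_ext simp: T_add T_zero)
  have "(\<lambda>w\<in>W. \<ominus> f w) \<in> carrier T"
    by (rule T_carrierI[OF _ _ T_finite[OF f]]) (use T_apply[OF f] in auto)
  moreover have "(\<lambda>w\<in>W. \<ominus> f w) \<oplus>\<^bsub>T\<^esub> f = \<zero>\<^bsub>T\<^esub>"
    using T_apply[OF f] by (auto intro!: T_ext simp: T_add T_zero l_neg)
  ultimately show "\<exists>g\<in>carrier T. g \<oplus>\<^bsub>T\<^esub> f = \<zero>\<^bsub>T\<^esub>" by blast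
  fix g assume g: "g \<in> carrier T"
  show "f \<oplus>\<^bsub>T\<^esub> g = g \<oplus>\<^bsub>T\<^esub> f"
    using T_apply[OF f] T_apply[OF g] by (auto intro!: T_ext simp: T_add a_comm)
  fix h assume h: "h \<in> carrier T"
  show "f \<oplus>\<^bsub>T\<^esub> g \<oplus>\<^bsub>T\<^esub> h = f \<oplus>\<^bsub>T\<^esub> (g \<oplus>\<^bsub>T\<^esub> h)"
    using T_apply[OF f] T_apply[OF g] T_apply[OF h] by (auto intro!: T_ext simp: T_add a_assoc)
qed (simp_all add: T_add_closed T_zero_closed)

lemma T_uminus_closed: "f \<in> carrier T \<Longrightarrow> \<ominus>\<^bsub>T\<^esub> f \<in> carrier T"
  by (rule abelian_group.a_inv_closed[OF T_abelian_group])

lemma T_uminus_apply: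
  assumes f: "f \<in> carrier T" and w: "w \<in> W"
  shows "(\<ominus>\<^bsub>T\<^esub> f) w = \<ominus> f w"
proof -
  have "(\<ominus>\<^bsub>T\<^esub> f \<oplus>\<^bsub>T\<^esub> f) w = \<zero>"
    using abelian_group.l_neg[OF T_abelian_group f] w by (simp add: T_zero)
  then have "(\<ominus>\<^bsub>T\<^esub> f) w \<oplus> f w = \<zero>" using w by (simp add: T_add)
  then show ?thesis using minus_equality T_apply[OF f w] T_apply[OF T_uminus_closed[OF f] w] by simp
qed

lemma T_minus_apply: "f \<in> carrier T \<Longrightarrow> g \<in> carrier T \<Longrightarrow> w \<in> W \<Longrightarrow> (f \<ominus>\<^bsub>T\<^esub> g) w = f w \<ominus> g w"
  by (simp add: a_minus_def T_add T_uminus_apply)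

lemma generate_T:
  assumes S: "S \<subseteq> carrier T"
  shows "generate_ring T S \<subseteq> carrier T"
proof
  fix x assume "x \<in> generate_ring T S"
  then show "x \<in> carrier T"
    by (induction rule: generate_ring.induct)
      (use S in \<open>auto simp: T_one mon_closed T_uminus_closed T_add_closed T_mult_closed\<close>)
qed

text \<open>Multiplication by coefficients from the left and from the right. All products that occur
  below reduce to these.\<close>

lemma mon_mult_left:
  assumes c: "c \<in> carrier P" and f: "f \<in> carrier T" and v: "v \<in> W"
  shows "(tm id c \<otimes>\<^bsub>T\<^esub> f) v = act (inv_into UNIV v) c \<otimes> f v"
proof -
  let ?t = "\<lambda>w. act (inv_into UNIV w) (tm id c (v \<circ> inv_into UNIV w)) \<otimes> f w"
  have z: "?t w = \<zero>" if w: "w \<in> W" "w \<noteq> v" for w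
  proof -
    have "v \<circ> inv_into UNIV w \<noteq> id"
    proof
      assume "v \<circ> inv_into UNIV w = id"
      then have "v \<circ> inv_into UNIV w \<circ> w = w" by simp
      then show False using W_bij[OF w(1)] w(2) by (simp add: comp_assoc bij_is_inj)
    qed
    then show ?thesis using w v f W_inv W_comp by (simp add: mon_apply act_zero T_apply)
  qed
  have vv: "v \<circ> inv_into UNIV v = id" using W_bij[OF v] by (auto simp: fun_eq_iff bij_is_surj surj_f_inv_f)
  have tv: "?t v = act (inv_into UNIV v) c \<otimes> f v" by (simp add: vv mon_apply W_id)
  have tc: "act (inv_into UNIV v) c \<otimes> f v \<in> carrier P" using c f v W_inv by (simp add: act_closed T_apply)
  show ?thesis
  proof (cases "f v = \<zero>")
    case True
    then have "(tm id c \<otimes>\<^bsub>T\<^esub> f) v = \<zero>"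
      unfolding T_mult[OF v] using z by (intro finsum_zero_eqI) auto
    then show ?thesis using True c v W_inv by (simp add: act_closed)
  next
    case False
    have "finsum P ?t {w \<in> W. f w \<noteq> \<zero>} = ?t v"
      by (rule finsum_single[OF T_finite[OF f]]) (use False v z tv tc in auto)
    then show ?thesis using T_mult[OF v, of "tm id c" f] tv by simp
  qed
qed

lemma mon_mult_right:
  assumes c: "c \<in> carrier P" and f: "f \<in> carrier T" and v: "v \<in> W"
  shows "(f \<otimes>\<^bsub>T\<^esub> tm id c) v = f v \<otimes> c"
proof (cases "c = \<zero>")
  case True
  then have e: "{w \<in> W. tm id c w \<noteq> \<zero>} = {}" by (auto simp: mon_apply)
  have "(f \<otimes>\<^bsub>T\<^esub> tm id c) v = \<zero>" unfolding T_mult[OF v] e by (rule finsum_empty)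
  then show ?thesis using True T_apply[OF f v] by simp
next
  case False
  then have "{w \<in> W. tm id c w \<noteq> \<zero>} = {id}" using W_id by (auto simp: mon_apply split: if_splits)
  then show ?thesis unfolding T_mult[OF v] using f v c W_id
    by (simp add: T_apply mon_apply finsum_insert inv_id act_id)
qed

text \<open>For \<open>y = x\<^sub>\<alpha>\<^sup>-\<^sup>1\<close> and \<open>s = s\<^sub>\<alpha>\<close> this is the formal Demazure element \<open>X\<^sub>\<alpha>\<close>.\<close>

definition dem :: "('l \<Rightarrow> 'l) \<Rightarrow> 'p \<Rightarrow> ('l \<Rightarrow> 'l) \<Rightarrow> 'p" where
  "dem s y = tm id y \<otimes>\<^bsub>T\<^esub> (\<one>\<^bsub>T\<^esub> \<ominus>\<^bsub>T\<^esub> tm s \<one>)"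

lemma dem_factor_closed: "\<one>\<^bsub>T\<^esub> \<ominus>\<^bsub>T\<^esub> tm s \<one> \<in> carrier T"
  unfolding T_one by (intro abelian_group.minus_closed[OF T_abelian_group] mon_closed) simp_all

lemma dem_closed: "y \<in> carrier P \<Longrightarrow> dem s y \<in> carrier T"
  unfolding dem_def by (intro T_mult_closed mon_closed dem_factor_closed)

lemma dem_apply:
  assumes "y \<in> carrier P" "v \<in> W"
  shows "dem s y v = act (inv_into UNIV v) y \<otimes> ((if v = id then \<one> else \<zero>) \<ominus> (if v = s then \<one> else \<zero>))"
  unfolding dem_def mon_mult_left[OF assms(1) dem_factor_closed assms(2)]
  using assms(2) by (simp add: T_one T_minus_apply mon_closed mon_apply)

lemma dem_scale:
  assumes c: "c \<in> carrier P" and y: "y \<in> carrier P"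
  shows "tm id c \<otimes>\<^bsub>T\<^esub> dem s y = dem s (c \<otimes> y)"
proof (rule T_ext[OF T_mult_extensional T_extensional[OF dem_closed]])
  fix v assume v: "v \<in> W"
  then show "(tm id c \<otimes>\<^bsub>T\<^esub> dem s y) v = dem s (c \<otimes> y) v"
    using c y W_inv[OF v] by (simp add: mon_mult_left dem_closed dem_apply act_mult act_closed m_assoc)
qed (use c y in simp)

text \<open>With \<open>X = y(1 - \<delta>)\<close> and \<open>x y = 1\<close> one has \<open>\<delta> = 1 - x X\<close>. As \<open>\<psi>\<close> and \<open>\<mu>\<close> are fixed by \<open>s\<close>, they
  commute with \<open>X\<close> and \<open>\<delta>\<close>, whence \<open>X \<psi> + \<delta> \<mu> = \<psi> X + \<mu> (1 - x X)\<close>. The calculation is done for the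
  coefficients at \<open>id\<close>, at \<open>s\<close>, and elsewhere.\<close>

lemma dem_lusztig:
  assumes s: "s \<in> W" "s \<noteq> id" "inv_into UNIV s = s" and x: "x \<in> carrier P" and y: "y \<in> carrier P" and xy: "x \<otimes> y = \<one>"
    and \<psi>: "\<psi> \<in> carrier P" "act s \<psi> = \<psi>" and \<mu>: "\<mu> \<in> carrier P" "act s \<mu> = \<mu>"
  shows "dem s y \<otimes>\<^bsub>T\<^esub> tm id \<psi> \<oplus>\<^bsub>T\<^esub> tm s \<one> \<otimes>\<^bsub>T\<^esub> tm id \<mu> =
    tm id (\<psi> \<ominus> \<mu> \<otimes> x) \<otimes>\<^bsub>T\<^esub> dem s y \<oplus>\<^bsub>T\<^esub> tm id \<mu>"
proof (rule T_ext)
  fix v assume v: "v \<in> W"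
  let ?c = "\<psi> \<ominus> \<mu> \<otimes> x"
  have c: "?c \<in> carrier P" using \<psi> \<mu> x by simp
  have L: "(dem s y \<otimes>\<^bsub>T\<^esub> tm id \<psi> \<oplus>\<^bsub>T\<^esub> tm s \<one> \<otimes>\<^bsub>T\<^esub> tm id \<mu>) v =
      dem s y v \<otimes> \<psi> \<oplus> (if v = s then \<one> else \<zero>) \<otimes> \<mu>"
    using v \<psi> \<mu> y by (simp add: T_add mon_mult_right dem_closed mon_closed mon_apply)
  have R: "(tm id ?c \<otimes>\<^bsub>T\<^esub> dem s y \<oplus>\<^bsub>T\<^esub> tm id \<mu>) v =
      act (inv_into UNIV v) ?c \<otimes> dem s y v \<oplus> (if v = id then \<mu> else \<zero>)"
    using v c y by (simp add: T_add mon_mult_left dem_closed mon_apply)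
  have iid: "inv_into UNIV (id :: 'l \<Rightarrow> 'l) = id" by (rule inv_id)
  consider "v = id" | "v = s" | "v \<noteq> id" "v \<noteq> s" by blast
  then show "(dem s y \<otimes>\<^bsub>T\<^esub> tm id \<psi> \<oplus>\<^bsub>T\<^esub> tm s \<one> \<otimes>\<^bsub>T\<^esub> tm id \<mu>) v =
      (tm id ?c \<otimes>\<^bsub>T\<^esub> dem s y \<oplus>\<^bsub>T\<^esub> tm id \<mu>) v"
    unfolding L R
  proof cases
    case 1
    have d: "dem s y v = y" using y v s(2) by (simp add: dem_apply 1 iid act_id a_minus_def)
    have a: "act (inv_into UNIV v) ?c = ?c" using c by (simp add: 1 iid act_id)
    have "\<psi> \<otimes> y \<ominus> \<mu> \<otimes> (x \<otimes> y) \<oplus> \<mu> = \<psi> \<otimes> y"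
      using \<psi> \<mu> y by (simp add: xy a_minus_def a_assoc l_neg)
    then have "y \<otimes> \<psi> = ?c \<otimes> y \<oplus> \<mu>" using \<psi> \<mu> x y by (simp add: a_minus_def l_distr l_minus m_assoc m_comm[of y])
    then show "dem s y v \<otimes> \<psi> \<oplus> (if v = s then \<one> else \<zero>) \<otimes> \<mu> =
        act (inv_into UNIV v) ?c \<otimes> dem s y v \<oplus> (if v = id then \<mu> else \<zero>)"
      unfolding d a using 1 s(2) x y \<psi> \<mu> by auto
  next
    case 2
    let ?y = "act s y" and ?x = "act s x"
    have yc: "?y \<in> carrier P" "?x \<in> carrier P" using y x s by (auto intro: act_closed)
    have xy': "?x \<otimes> ?y = \<one>" using act_mult[OF s(1) x y] act_one[OF s(1)] by (simp add: xy)
    have d: "dem s y v = \<ominus> ?y" using y v s yc by (simp add: dem_apply 2 a_minus_def r_minus)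
    have a: "act (inv_into UNIV v) ?c = \<psi> \<ominus> \<mu> \<otimes> ?x"
      using \<psi> \<mu> x s yc by (simp add: 2 a_minus_def act_add act_uminus act_mult)
    have e: "(\<psi> \<ominus> \<mu> \<otimes> X) \<otimes> \<ominus> Y = \<ominus> (Y \<otimes> \<psi>) \<oplus> \<mu> \<otimes> (X \<otimes> Y)" if "X \<in> carrier P" "Y \<in> carrier P" for X Y
      using that \<psi>(1) \<mu>(1) by algebra
    show "dem s y v \<otimes> \<psi> \<oplus> (if v = s then \<one> else \<zero>) \<otimes> \<mu> =
        act (inv_into UNIV v) ?c \<otimes> dem s y v \<oplus> (if v = id then \<mu> else \<zero>)"
      unfolding d a e[OF yc(2,1)] xy' using 2 s(2) yc \<psi> \<mu> by (simp add: l_minus)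
  next
    case 3
    then have d: "dem s y v = \<zero>" using y v W_inv by (simp add: dem_apply a_minus_def act_closed)
    show "dem s y v \<otimes> \<psi> \<oplus> (if v = s then \<one> else \<zero>) \<otimes> \<mu> =
        act (inv_into UNIV v) ?c \<otimes> dem s y v \<oplus> (if v = id then \<mu> else \<zero>)"
      unfolding d using 3 \<psi> \<mu> c act_closed[OF W_inv[OF v] c] by simp
  qed
qed (simp_all add: T_add)

text \<open>
  The element \<open>T\<^sub>\<alpha>\<close> in the case \<open>\<kappa> = 0\<close> has the form
  treated in \<open>dem_lusztig\<close>, with \<open>\<psi> = 2 c\<close> and \<open>\<mu> =
  1\<close>.
\<close>

lemma dem_double:
  assumes s: "s \<in> W" and y: "y \<in> carrier P" and c: "c \<in> carrier P"
  shows "[(2::nat)] \<cdot>\<^bsub>T\<^esub> (dem s y \<otimes>\<^bsub>T\<^esub> tm id c) \<oplus>\<^bsub>T\<^esub> tm s \<one> =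
    dem s y \<otimes>\<^bsub>T\<^esub> tm id (c \<oplus> c) \<oplus>\<^bsub>T\<^esub> tm s \<one> \<otimes>\<^bsub>T\<^esub> tm id \<one>"
proof -
  interpret TG: abelian_group T by (rule T_abelian_group)
  let ?z = "dem s y \<otimes>\<^bsub>T\<^esub> tm id c"
  have z: "?z \<in> carrier T" by (intro T_mult_closed dem_closed mon_closed y c)
  have "[(2::nat)] \<cdot>\<^bsub>T\<^esub> ?z = ?z \<oplus>\<^bsub>T\<^esub> ?z"
    using z by (simp add: add_pow_def numeral_2_eq_2)
  then show ?thesis
    by (simp only:, intro T_ext) (use y c dem_closed[OF y, of s] in \<open>auto simp: T_add mon_mult_right dem_closed mon_closed mon_apply r_distr T_apply\<close>)
qed

text \<open>
  Generators may be replaced by affine functions of them whose leading coefficients are units of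
  the coefficient ring.
\<close>

lemma generate_affine:
  assumes E: "E \<subseteq> carrier P" and X: "\<And>\<alpha>. \<alpha> \<in> D \<Longrightarrow> X \<alpha> \<in> carrier T"
    and u: "\<And>\<alpha>. \<alpha> \<in> D \<Longrightarrow> u \<alpha> \<in> E" "\<And>\<alpha>. \<alpha> \<in> D \<Longrightarrow> u' \<alpha> \<in> E" "\<And>\<alpha>. \<alpha> \<in> D \<Longrightarrow> m \<alpha> \<in> E"
    and uu: "\<And>\<alpha>. \<alpha> \<in> D \<Longrightarrow> u' \<alpha> \<otimes> u \<alpha> = \<one>"
    and Y: "\<And>\<alpha>. \<alpha> \<in> D \<Longrightarrow> Y \<alpha> = tm id (u \<alpha>) \<otimes>\<^bsub>T\<^esub> X \<alpha> \<oplus>\<^bsub>T\<^esub> tm id (m \<alpha>)"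
  shows "generate_ring T (tm id ` E \<union> Y ` D) = generate_ring T (tm id ` E \<union> X ` D)"
proof (rule equalityI; rule generate_ring_mono'; rule Un_least)
  show "tm id ` E \<subseteq> generate_ring T (tm id ` E \<union> X ` D)" "tm id ` E \<subseteq> generate_ring T (tm id ` E \<union> Y ` D)"
    by (auto intro: generate_ring.incl)
  show "Y ` D \<subseteq> generate_ring T (tm id ` E \<union> X ` D)"
    using u by (auto simp: Y intro!: generate_ring.eng_add generate_ring.eng_mult intro: generate_ring.incl)
  show "X ` D \<subseteq> generate_ring T (tm id ` E \<union> Y ` D)"
  proof
    fix z assume "z \<in> X ` D"
    then obtain \<alpha> where \<alpha>: "\<alpha> \<in> D" "z = X \<alpha>" by blast
    have c: "u \<alpha> \<in> carrier P" "u' \<alpha> \<in> carrier P" "m \<alpha> \<in> carrier P" using u[OF \<alpha>(1)] E by auto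
    note Xc = X[OF \<alpha>(1)]
    have Yc: "Y \<alpha> \<in> carrier T" unfolding Y[OF \<alpha>(1)] by (intro T_add_closed T_mult_closed mon_closed c Xc)
    have YC: "Y \<alpha> \<oplus>\<^bsub>T\<^esub> \<ominus>\<^bsub>T\<^esub> tm id (m \<alpha>) \<in> carrier T"
      by (intro T_add_closed T_uminus_closed mon_closed c Yc)
    have "X \<alpha> = tm id (u' \<alpha>) \<otimes>\<^bsub>T\<^esub> (Y \<alpha> \<oplus>\<^bsub>T\<^esub> \<ominus>\<^bsub>T\<^esub> tm id (m \<alpha>))"
    proof (rule T_ext[OF T_extensional[OF Xc] T_mult_extensional])
      fix v assume v: "v \<in> W"
      note iv = W_inv[OF v]
      note Xv = T_apply[OF Xc v]
      let ?m = "if v = id then m \<alpha> else \<zero>" and ?a = "act (inv_into UNIV v)"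
      have mc: "?m \<in> carrier P" using c by simp
      have ac: "?a (u \<alpha>) \<in> carrier P" "?a (u' \<alpha>) \<in> carrier P" using iv c by (auto intro: act_closed)
      have "(Y \<alpha> \<oplus>\<^bsub>T\<^esub> \<ominus>\<^bsub>T\<^esub> tm id (m \<alpha>)) v = (?a (u \<alpha>) \<otimes> X \<alpha> v \<oplus> ?m) \<oplus> \<ominus> ?m"
        using v c Xc by (simp add: T_add T_uminus_apply mon_closed mon_apply Y[OF \<alpha>(1)] mon_mult_left)
      also have "\<dots> = ?a (u \<alpha>) \<otimes> X \<alpha> v" using ac Xv mc by (simp add: a_assoc r_neg del: if_split)
      finally have "(tm id (u' \<alpha>) \<otimes>\<^bsub>T\<^esub> (Y \<alpha> \<oplus>\<^bsub>T\<^esub> \<ominus>\<^bsub>T\<^esub> tm id (m \<alpha>))) v = ?a (u' \<alpha>) \<otimes> (?a (u \<alpha>) \<otimes> X \<alpha> v)"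
        by (simp add: mon_mult_left[OF c(2) YC v])
      also have "\<dots> = ?a (u' \<alpha> \<otimes> u \<alpha>) \<otimes> X \<alpha> v" using ac Xv c iv by (simp add: act_mult m_assoc)
      also have "\<dots> = X \<alpha> v" using Xv act_one[OF iv] by (simp add: uu[OF \<alpha>(1)])
      finally show "X \<alpha> v = (tm id (u' \<alpha>) \<otimes>\<^bsub>T\<^esub> (Y \<alpha> \<oplus>\<^bsub>T\<^esub> \<ominus>\<^bsub>T\<^esub> tm id (m \<alpha>))) v" by simp
    qed
    then show "z \<in> generate_ring T (tm id ` E \<union> Y ` D)"
      unfolding \<alpha>(2) using \<alpha>(1) u[OF \<alpha>(1)]
      by (auto intro!: generate_ring.eng_add generate_ring.eng_mult generate_ring.a_inv intro: generate_ring.incl)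
  qed
qed

end

text \<open>
  Injectivity is needed because the product of the twisted group ring sums over the support of its
  second factor.
\<close>

locale twisted_hom = A: twisted P W act + B: twisted P' W act'
  for P :: "('p, 'm) ring_scheme" and W :: "('l \<Rightarrow> 'l) set" and act and P' :: "('q, 'n) ring_scheme" and act' +
  fixes \<tau> :: "'p \<Rightarrow> 'q"
  assumes \<tau>: "\<tau> \<in> ring_hom P P'" and \<tau>_inj: "inj_on \<tau> (carrier P)"
    and \<tau>_act: "\<And>w a. w \<in> W \<Longrightarrow> a \<in> carrier P \<Longrightarrow> \<tau> (act w a) = act' w (\<tau> a)"
begin

definition \<phi> :: "(('l \<Rightarrow> 'l) \<Rightarrow> 'p) \<Rightarrow> ('l \<Rightarrow> 'l) \<Rightarrow> 'q" where "\<phi> f = (\<lambda>w\<in>W. \<tau> (f w))"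

lemma \<tau>_zero: "\<tau> \<zero>\<^bsub>P\<^esub> = \<zero>\<^bsub>P'\<^esub>" by (rule ring_hom_zero[OF \<tau> A.ring_axioms B.ring_axioms])

lemma \<tau>_zero_iff: "a \<in> carrier P \<Longrightarrow> \<tau> a = \<zero>\<^bsub>P'\<^esub> \<longleftrightarrow> a = \<zero>\<^bsub>P\<^esub>"
  using \<tau>_inj \<tau>_zero by (metis A.zero_closed inj_onD)

lemma \<phi>_closed:
  assumes f: "f \<in> carrier A.T"
  shows "\<phi> f \<in> carrier B.T"
proof (rule B.T_carrierI[OF _ _ A.T_finite[OF f]])
  show "\<phi> f w \<in> carrier P'" if "w \<in> W" for w
    using ring_hom_closed[OF \<tau> A.T_apply[OF f that]] that by (simp add: \<phi>_def)
qed (auto simp: \<phi>_def \<tau>_zero)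

lemma \<phi>_extensional: "\<phi> f \<in> extensional W" by (simp add: \<phi>_def)

lemma \<phi>_add:
  assumes "f \<in> carrier A.T" "g \<in> carrier A.T"
  shows "\<phi> (f \<oplus>\<^bsub>A.T\<^esub> g) = \<phi> f \<oplus>\<^bsub>B.T\<^esub> \<phi> g"
  by (rule B.T_ext) (use assms in \<open>auto simp: \<phi>_def A.T_add B.T_add A.T_apply ring_hom_add[OF \<tau>]\<close>)

lemma \<phi>_mon: "\<phi> (A.tm w c) = B.tm w (\<tau> c)"
  by (rule B.T_ext) (auto simp: \<phi>_def A.mon_apply B.mon_apply \<tau>_zero, simp add: twisted_monom_def)

lemma \<phi>_one: "\<phi> \<one>\<^bsub>A.T\<^esub> = \<one>\<^bsub>B.T\<^esub>"
  by (simp add: A.T_one B.T_one \<phi>_mon ring_hom_one[OF \<tau>])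

lemma \<phi>_mult:
  assumes f: "f \<in> carrier A.T" and g: "g \<in> carrier A.T"
  shows "\<phi> (f \<otimes>\<^bsub>A.T\<^esub> g) = \<phi> f \<otimes>\<^bsub>B.T\<^esub> \<phi> g"
proof (rule B.T_ext[OF \<phi>_extensional B.T_mult_extensional])
  fix v assume v: "v \<in> W"
  let ?S = "{w \<in> W. g w \<noteq> \<zero>\<^bsub>P\<^esub>}"
  have S: "{w \<in> W. \<phi> g w \<noteq> \<zero>\<^bsub>P'\<^esub>} = ?S" using A.T_apply[OF g] by (auto simp: \<phi>_def \<tau>_zero_iff)
  let ?t = "\<lambda>w. act (inv_into UNIV w) (f (v \<circ> inv_into UNIV w)) \<otimes>\<^bsub>P\<^esub> g w"
  have "\<phi> (f \<otimes>\<^bsub>A.T\<^esub> g) v = \<tau> (finsum P ?t ?S)" using v by (simp add: \<phi>_def A.T_mult)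
  also have "\<dots> = finsum P' (\<lambda>w. \<tau> (?t w)) ?S"
    using A.T_finite[OF g] A.T_term_closed[OF f g v]
    by (intro hom_finsum[OF A.abelian_monoid_axioms B.abelian_monoid_axioms])
      (auto simp: \<tau>_zero ring_hom_add[OF \<tau>] ring_hom_closed[OF \<tau>])
  also have "\<dots> = finsum P' (\<lambda>w. act' (inv_into UNIV w) (\<phi> f (v \<circ> inv_into UNIV w)) \<otimes>\<^bsub>P'\<^esub> \<phi> g w) ?S"
  proof (rule B.finsum_cong')
    fix w assume "w \<in> ?S"
    then have w: "w \<in> W" by simp
    have i: "inv_into UNIV w \<in> W" "v \<circ> inv_into UNIV w \<in> W" using A.W_inv A.W_comp w v by auto
    show "\<tau> (?t w) = act' (inv_into UNIV w) (\<phi> f (v \<circ> inv_into UNIV w)) \<otimes>\<^bsub>P'\<^esub> \<phi> g w"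
      using w i A.T_apply[OF f i(2)] A.T_apply[OF g w] 
      by (simp add: \<phi>_def ring_hom_mult[OF \<tau>] A.act_closed \<tau>_act)
  qed (use B.T_term_closed[OF \<phi>_closed[OF f] \<phi>_closed[OF g] v] in auto)
  also have "\<dots> = (\<phi> f \<otimes>\<^bsub>B.T\<^esub> \<phi> g) v" unfolding B.T_mult[OF v] S ..
  finally show "\<phi> (f \<otimes>\<^bsub>A.T\<^esub> g) v = (\<phi> f \<otimes>\<^bsub>B.T\<^esub> \<phi> g) v" .
qed

lemma \<phi>_uminus:
  assumes f: "f \<in> carrier A.T"
  shows "\<phi> (\<ominus>\<^bsub>A.T\<^esub> f) = \<ominus>\<^bsub>B.T\<^esub> \<phi> f"
proof (rule B.T_ext[OF \<phi>_extensional B.T_extensional[OF B.T_uminus_closed[OF \<phi>_closed[OF f]]]])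
  fix v assume v: "v \<in> W"
  interpret H: ring_hom_cring P P' \<tau> by (intro ring_hom_cringI A.cring_axioms B.cring_axioms \<tau>)
  show "\<phi> (\<ominus>\<^bsub>A.T\<^esub> f) v = (\<ominus>\<^bsub>B.T\<^esub> \<phi> f) v"
    unfolding B.T_uminus_apply[OF \<phi>_closed[OF f] v] using v A.T_apply[OF f v]
    by (simp add: \<phi>_def A.T_uminus_apply[OF f])
qed

lemma \<phi>_generate:
  assumes S: "S \<subseteq> carrier A.T" and S': "\<phi> ` S \<subseteq> generate_ring B.T S'"
  shows "\<phi> ` generate_ring A.T S \<subseteq> generate_ring B.T S'"
proof
  fix y assume "y \<in> \<phi> ` generate_ring A.T S"
  then obtain x where x: "x \<in> generate_ring A.T S" "y = \<phi> x" by blast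
  note c = subsetD[OF A.generate_T[OF S]]
  have "\<phi> x \<in> generate_ring B.T S'" using x(1)
    by (induction rule: generate_ring.induct)
      (use S' in \<open>auto simp: \<phi>_one \<phi>_uminus \<phi>_add \<phi>_mult c intro: generate_ring.intros\<close>)
  then show "y \<in> generate_ring B.T S'" using x by simp
qed

lemma \<phi>_dem:
  assumes "y \<in> carrier P"
  shows "\<phi> (A.dem s y) = B.dem s (\<tau> y)"
  unfolding A.dem_def B.dem_def
  using assms A.dem_factor_closed
  by (simp add: \<phi>_mult A.mon_closed \<phi>_mon)
    (simp add: a_minus_def A.T_one B.T_one \<phi>_add \<phi>_uminus A.mon_closed A.T_uminus_closed \<phi>_mon ring_hom_one[OF \<tau>])

end

lemma twisted_iso:
  assumes 1: "twisted_hom P W act P' act' \<tau>" and 2: "twisted_hom P' W act' P act \<sigma>"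
    and st: "\<And>a. a \<in> carrier P \<Longrightarrow> \<sigma> (\<tau> a) = a" and ts: "\<And>b. b \<in> carrier P' \<Longrightarrow> \<tau> (\<sigma> b) = b"
    and S: "S \<subseteq> carrier (twisted_group_ring P W act)" and S': "S' \<subseteq> carrier (twisted_group_ring P' W act')"
    and im: "(\<lambda>f. \<lambda>w\<in>W. \<tau> (f w)) ` S \<subseteq> generate_ring (twisted_group_ring P' W act') S'"
    and im': "(\<lambda>f. \<lambda>w\<in>W. \<sigma> (f w)) ` S' \<subseteq> generate_ring (twisted_group_ring P W act) S"
  shows "(\<lambda>f. \<lambda>w\<in>W. \<tau> (f w)) \<in> ring_iso
    ((twisted_group_ring P W act)\<lparr>carrier := generate_ring (twisted_group_ring P W act) S\<rparr>)
    ((twisted_group_ring P' W act')\<lparr>carrier := generate_ring (twisted_group_ring P' W act') S'\<rparr>)"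
proof -
  interpret F: twisted_hom P W act P' act' \<tau> by (rule 1)
  interpret G: twisted_hom P' W act' P act \<sigma> by (rule 2)
  let ?H = "generate_ring F.A.T S" and ?H' = "generate_ring F.B.T S'"
  have Fd: "(\<lambda>f. \<lambda>w\<in>W. \<tau> (f w)) = F.\<phi>" and Gd: "(\<lambda>f. \<lambda>w\<in>W. \<sigma> (f w)) = G.\<phi>"
    by (auto simp: F.\<phi>_def G.\<phi>_def fun_eq_iff)
  have FH: "F.\<phi> f \<in> ?H'" if "f \<in> ?H" for f using F.\<phi>_generate[OF S im[unfolded Fd]] that by blast
  have GH: "G.\<phi> f \<in> ?H" if "f \<in> ?H'" for f using G.\<phi>_generate[OF S' im'[unfolded Gd]] that by blast
  have HT: "f \<in> carrier F.A.T" if "f \<in> ?H" for f using F.A.generate_T[OF S] that by blast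
  have HT': "f \<in> carrier F.B.T" if "f \<in> ?H'" for f using F.B.generate_T[OF S'] that by blast
  have GF: "G.\<phi> (F.\<phi> f) = f" if "f \<in> ?H" for f
    using F.A.T_extensional[OF HT[OF that]] F.A.T_apply[OF HT[OF that]]
    by (intro F.A.T_ext) (auto simp: F.\<phi>_def G.\<phi>_def st)
  have FG: "F.\<phi> (G.\<phi> f) = f" if "f \<in> ?H'" for f
    using F.B.T_extensional[OF HT'[OF that]] F.B.T_apply[OF HT'[OF that]]
    by (intro F.B.T_ext) (auto simp: F.\<phi>_def G.\<phi>_def ts)
  have "bij_betw F.\<phi> ?H ?H'"
    by (rule bij_betwI[where g = G.\<phi>]) (auto simp: FH GH GF FG)
  then show ?thesis
    unfolding Fd ring_iso_def ring_hom_def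
    by (auto simp: FH F.\<phi>_mult F.\<phi>_add F.\<phi>_one HT)
qed

section \<open>Opposite generators and the series \<open>\<mu>\<close>\<close>

context fgl begin

lemma psub1_coeff_0:
  fixes s :: "'v \<Rightarrow> 'w multiset \<Rightarrow> 'r"
  assumes s: "\<And>v. s v \<in> pord 1" and f: "f \<in> carrier (pser R)"
  shows "psub1 s f {#} = f {#}"
proof -
  interpret H: coeff_hom R R "\<lambda>a. a" by (rule id_coeff_hom)
  have e: "insert {#} (psupp R (size ({#} :: 'w multiset)) f) = {{#}}" by (auto simp: psupp_def)
  have "psub1 s f {#} = (\<Oplus>k\<in>{{#}}. f k \<otimes> pmon s k {#})"
    by (rule H.psub_any[OF s f]) (auto simp: psupp_def)
  then show ?thesis using pser_coeff[OF f] H.mon_coeff[of s, OF s]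
    by (simp add: finsum_insert pmon_empty pser_one pser_const_def)
qed

text \<open>Evaluation at \<open>x\<^sub>l\<close>, a homomorphism which takes series with invertible constant term to units.\<close>

definition eval_x :: "'l::ab_group_add \<Rightarrow> (unit multiset \<Rightarrow> 'r) \<Rightarrow> ('l multiset \<Rightarrow> 'r) set" where
  "eval_x l f = fga_class R F (psub1 (\<lambda>_. pser_var R l) f)"

lemma eval_x_hom: "eval_x (l :: 'l::ab_group_add) \<in> ring_hom (pser R) (fga R F)"
proof -
  have "psub1 (\<lambda>_. pser_var R l) \<in> ring_hom (pser R :: (unit multiset \<Rightarrow> 'r) ring) (pser R)"
    by (rule psub1D(1)[OF pser_var_pord])
  from ring_hom_trans[OF this fga_class_hom] show ?thesis by (simp add: comp_def eval_x_def[abs_def])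
qed

lemma eval_x_ring_hom: "ring_hom_cring (pser R) (fga R F :: ('l::ab_group_add multiset \<Rightarrow> 'r) set ring) (eval_x l)"
  by (intro ring_hom_cringI pser_cring fga_cring eval_x_hom)

lemma eval_x_var: "eval_x l X1 = fga_x R F l"
  unfolding eval_x_def fga_x_def psub1_var[of "\<lambda>_. pser_var R l", OF pser_var_pord] ..

lemma eval_x_unit:
  assumes f: "f \<in> carrier (pser R)" "f {#} \<in> Units R"
  shows "eval_x (l :: 'l::ab_group_add) f \<in> Units (fga R F)"
  by (rule ring_hom_Units[OF eval_x_hom pser_unitI[OF f]])

lemma fga_mu_eval: "fga_mu R F l = eval_x l mu_ser"
  unfolding fga_mu_def eval_x_def subst1_mu[OF pser_var_pord] ..

lemma mu_unit: "eval_x (l :: 'l::ab_group_add) mu_ser \<in> Units (fga R F)"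
  by (rule eval_x_unit[OF mu_ser_closed]) (simp add: mu_ser_0)

lemma mu_eval: "eval_x (l :: 'l::ab_group_add) mu_ser = \<one>\<^bsub>fga R F\<^esub> \<oplus>\<^bsub>fga R F\<^esub> fga_x R F l \<otimes>\<^bsub>fga R F\<^esub> eval_x l mu_tail"
proof -
  interpret H: ring_hom_cring "pser R" "fga R F :: ('l multiset \<Rightarrow> 'r) set ring" "eval_x l" by (rule eval_x_ring_hom)
  have "eval_x l (\<one>\<^bsub>pser R\<^esub> \<oplus>\<^bsub>pser R\<^esub> X1 \<otimes>\<^bsub>pser R\<^esub> mu_tail) =
      \<one>\<^bsub>fga R F\<^esub> \<oplus>\<^bsub>fga R F\<^esub> fga_x R F l \<otimes>\<^bsub>fga R F\<^esub> eval_x l mu_tail"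
    using mu_tail_closed pser_var_closed[of "()"] by (simp add: eval_x_var)
  then show ?thesis by (simp only: mu_ser_tail[symmetric])
qed

text \<open>
  \<open>x\<^sub>l +\<^sub>F x\<^bsub>-l\<^esub>\<close> is congruent to \<open>x\<^sub>0\<close>,
  that is, to zero. So \<open>x\<^bsub>-l\<^esub>\<close> is congruent to the formal inverse of
  \<open>x\<^sub>l\<close>, which is \<open>-x\<^sub>l \<mu>(x\<^sub>l)\<close>.
\<close>

lemma fga_x_minus: "fga_x R F (- l :: 'l::ab_group_add) = \<ominus>\<^bsub>fga R F\<^esub> (fga_x R F l \<otimes>\<^bsub>fga R F\<^esub> eval_x l mu_ser)"
proof -
  interpret P: cring "pser R :: ('l multiset \<Rightarrow> 'r) ring" by (rule pser_cring)
  interpret H: ring_hom_cring "pser R" "fga R F :: ('l multiset \<Rightarrow> 'r) set ring" "eval_x l" by (rule eval_x_ring_hom)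
  let ?v = "pser_var R l" and ?v' = "pser_var R (- l)" and ?I = "fga_ideal R F :: ('l multiset \<Rightarrow> 'r) set"
  note J = fga_ideal_closed[where 'l = 'l]
  note vp = pser_var_pord[of l] and vp' = pser_var_pord[of "- l"]
  note np = fneg_pord[OF vp]
  have vc: "pser_var R k \<in> carrier (pser R)" for k :: 'l by (rule pser_var_closed)
  note ac = fadd_carrier[OF vp vp']
  have "fga_class R F (fadd ?v ?v') = fga_class R F (pser_var R (l + (- l)))"
    using fga_add_mem[of l "- l"] by (intro fga_class_eq_iff[THEN iffD2, symmetric] vc ac)
  also have "\<dots> = fga_class R F \<zero>\<^bsub>pser R\<^esub>"
    using fga_zero_mem[where 'l = 'l] vc by (intro fga_class_eq_iff[THEN iffD2]) (auto simp: a_minus_def)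
  finally have z: "fadd ?v ?v' \<ominus>\<^bsub>pser R\<^esub> \<zero>\<^bsub>pser R\<^esub> \<in> ?I"
    using ac by (subst (asm) fga_class_eq_iff) auto
  have nn: "fneg ?v \<ominus>\<^bsub>pser R\<^esub> fneg ?v \<in> ?I"
    using pord_carrier[OF np] closed_ideal_mem(1)[OF J] by (simp add: a_minus_def P.r_neg)
  have "fadd (fneg ?v) (fadd ?v ?v') \<ominus>\<^bsub>pser R\<^esub> fadd (fneg ?v) \<zero>\<^bsub>pser R\<^esub> \<in> ?I"
    by (rule fadd_cong_ideal[OF J np fadd_pord[OF vp vp'] np pord_zero nn z])
  moreover have "fadd (fneg ?v) (fadd ?v ?v') = ?v'"
  proof -
    have "fadd (fneg ?v) (fadd ?v ?v') = fadd (fadd (fneg ?v) ?v) ?v'" by (rule fadd_assoc[OF np vp vp', symmetric])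
    also have "fadd (fneg ?v) ?v = \<zero>\<^bsub>pser R\<^esub>" using fadd_comm[OF np vp] fadd_fneg[OF vp] by simp
    also have "fadd \<zero>\<^bsub>pser R\<^esub> ?v' = ?v'" using fadd_comm[OF pord_zero vp'] fadd_zero_right[OF vp'] by simp
    finally show ?thesis .
  qed
  ultimately have "?v' \<ominus>\<^bsub>pser R\<^esub> fneg ?v \<in> ?I" using fadd_zero_right[OF np] by simp
  then have "fga_x R F (- l) = fga_class R F (fneg ?v)"
    unfolding fga_x_def by (intro fga_class_eq_iff[THEN iffD2] vc pord_carrier[OF np])
  also have "\<dots> = eval_x l (fgl_inverse R F)" by (simp add: eval_x_def fneg_def)
  also have "\<dots> = \<ominus>\<^bsub>fga R F\<^esub> (fga_x R F l \<otimes>\<^bsub>fga R F\<^esub> eval_x l mu_ser)"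
    unfolding fgl_inverse_mu using mu_ser_closed pser_var_closed[of "()"] by (simp add: eval_x_var)
  finally show ?thesis .
qed

text \<open>
  A unit minus a multiple of the topologically nilpotent \<open>x\<^sub>l\<close>.
\<close>

lemma fga_affine_unit:
  assumes a: "a \<in> Units (fga R F :: ('l::ab_group_add multiset \<Rightarrow> 'r) set ring)" and b: "b \<in> carrier (fga R F)"
  shows "a \<ominus>\<^bsub>fga R F\<^esub> b \<otimes>\<^bsub>fga R F\<^esub> fga_x R F l \<in> Units (fga R F)"
proof -
  interpret A: cring "fga R F :: ('l multiset \<Rightarrow> 'r) set ring" by (rule fga_cring)
  interpret P: cring "pser R :: ('l multiset \<Rightarrow> 'r) ring" by (rule pser_cring)
  interpret H: ring_hom_cring "pser R" "fga R F :: ('l multiset \<Rightarrow> 'r) set ring" "fga_class R F" by (rule fga_class_ring_hom)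
  let ?x = "fga_x R F l" and ?c = "inv\<^bsub>fga R F\<^esub> a \<otimes>\<^bsub>fga R F\<^esub> b"
  have x: "?x \<in> carrier (fga R F)" by (rule fga_x_closed)
  have c: "?c \<in> carrier (fga R F)" using a b by simp
  then obtain f where f: "f \<in> carrier (pser R)" "?c = fga_class R F f" by (rule fga_carrierE)
  note vc = pser_var_closed[of l]
  let ?g = "\<one>\<^bsub>pser R\<^esub> \<ominus>\<^bsub>pser R\<^esub> f \<otimes>\<^bsub>pser R\<^esub> pser_var R l"
  have "f \<otimes>\<^bsub>pser R\<^esub> pser_var R l \<in> pord 1" by (rule pord_mult_left[OF pser_var_pord f(1)])
  then have "?g {#} = \<one>" using f vc by (simp add: pser_minus_apply pser_one_pord0) (simp add: pser_one pser_const_def a_minus_def)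
  then have "fga_class R F ?g \<in> Units (fga R F)" using f vc by (intro fga_unitI) auto
  moreover have "fga_class R F ?g = \<one>\<^bsub>fga R F\<^esub> \<ominus>\<^bsub>fga R F\<^esub> ?c \<otimes>\<^bsub>fga R F\<^esub> ?x"
    using f vc by (simp add: a_minus_def fga_x_def)
  ultimately have u: "\<one>\<^bsub>fga R F\<^esub> \<ominus>\<^bsub>fga R F\<^esub> ?c \<otimes>\<^bsub>fga R F\<^esub> ?x \<in> Units (fga R F)" by simp
  have "a \<otimes>\<^bsub>fga R F\<^esub> (\<one>\<^bsub>fga R F\<^esub> \<ominus>\<^bsub>fga R F\<^esub> ?c \<otimes>\<^bsub>fga R F\<^esub> ?x) = a \<ominus>\<^bsub>fga R F\<^esub> (a \<otimes>\<^bsub>fga R F\<^esub> inv\<^bsub>fga R F\<^esub> a) \<otimes>\<^bsub>fga R F\<^esub> b \<otimes>\<^bsub>fga R F\<^esub> ?x"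
    using A.Units_closed[OF a] A.Units_inv_closed[OF a] b x
    by (simp add: a_minus_def A.r_distr A.r_minus A.m_assoc del: A.Units_r_inv)
  also have "\<dots> = a \<ominus>\<^bsub>fga R F\<^esub> b \<otimes>\<^bsub>fga R F\<^esub> ?x" using a b by simp
  finally show ?thesis using A.Units_m_closed[OF a u] by simp
qed

text \<open>
  With \<open>\<mu>(x) = 1 + x w(x)\<close> and \<open>x\<^bsub>-l\<^esub> = -x \<mu>(x)\<close>
  for \<open>x = x\<^sub>l\<close>, the difference is \<open>x (w(x\<^sub>l) + \<mu>(x\<^sub>l)
  w(x\<^bsub>-l\<^esub>))\<close>, where the second factor has constant term \<open>-2 F 1
  1\<close>.
\<close>

lemma Theta_factor:
  assumes a: "F 1 1 \<in> Units R" and two: "two \<in> Units R"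
  shows "\<exists>u\<in>Units (fga R F). fga_mu R F (l :: 'l::ab_group_add) \<ominus>\<^bsub>fga R F\<^esub> fga_mu R F (- l) = fga_x R F l \<otimes>\<^bsub>fga R F\<^esub> u"
proof -
  interpret A: cring "fga R F :: ('l multiset \<Rightarrow> 'r) set ring" by (rule fga_cring)
  interpret H: ring_hom_cring "pser R" "fga R F :: ('l multiset \<Rightarrow> 'r) set ring" "fga_class R F" by (rule fga_class_ring_hom)
  let ?A = "fga R F :: ('l multiset \<Rightarrow> 'r) set ring"
  let ?x = "fga_x R F l" and ?w1 = "eval_x l mu_tail" and ?w2 = "eval_x (- l) mu_tail" and ?m = "eval_x l mu_ser"
  have c: "?x \<in> carrier ?A" "?w1 \<in> carrier ?A" "?w2 \<in> carrier ?A" "?m \<in> carrier ?A"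
    using fga_x_closed ring_hom_closed[OF eval_x_hom] mu_tail_closed mu_ser_closed by auto
  let ?s = "\<lambda>k::'l. psub1 (\<lambda>_. pser_var R k) mu_tail" and ?t = "psub1 (\<lambda>_. pser_var R l) mu_ser"
  have sc: "?s k \<in> carrier (pser R)" "?t \<in> carrier (pser R)" for k
    by (rule psub1D(4)[OF pser_var_pord]; rule mu_tail_closed mu_ser_closed)+
  have s0: "?s k {#} = \<ominus> F 1 1" "?t {#} = \<one>" for k
    using psub1_coeff_0[of "\<lambda>_. pser_var R k" mu_tail] psub1_coeff_0[of "\<lambda>_. pser_var R l" mu_ser]
    by (simp_all add: pser_var_pord mu_tail_closed mu_ser_closed mu_tail_0 mu_ser_0)
  let ?g = "?s l \<oplus>\<^bsub>pser R\<^esub> ?t \<otimes>\<^bsub>pser R\<^esub> ?s (- l)"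
  have gc: "?g \<in> carrier (pser R)" using sc by (intro pser_add_closed pser_mult_closed)
  have sp: "splits ({#} :: 'l multiset) = {({#}, {#})}" by (auto simp: splits_def)
  have "(?t \<otimes>\<^bsub>pser R\<^esub> ?s (- l)) {#} = \<ominus> F 1 1"
    using pser_coeff[OF sc(1)] pser_coeff[OF sc(2)] F_closed[of 1 1]
    by (subst pser_mult) (auto simp: sp finsum_insert s0)
  then have "?g {#} = \<ominus> (two \<otimes> F 1 1)"
    using F_closed[of 1 1] by (simp add: pser_add s0 two_def l_distr minus_add)
  then have "fga_class R F ?g \<in> Units ?A" using a two gc by (intro fga_unitI) (auto intro: Units_uminus)
  moreover have "fga_class R F ?g = ?w1 \<oplus>\<^bsub>?A\<^esub> ?m \<otimes>\<^bsub>?A\<^esub> ?w2" using sc by (simp add: eval_x_def)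
  moreover have "fga_mu R F l \<ominus>\<^bsub>?A\<^esub> fga_mu R F (- l) = ?x \<otimes>\<^bsub>?A\<^esub> (?w1 \<oplus>\<^bsub>?A\<^esub> ?m \<otimes>\<^bsub>?A\<^esub> ?w2)"
  proof -
    have *: "(\<one>\<^bsub>?A\<^esub> \<oplus>\<^bsub>?A\<^esub> x \<otimes>\<^bsub>?A\<^esub> w) \<ominus>\<^bsub>?A\<^esub> (\<one>\<^bsub>?A\<^esub> \<oplus>\<^bsub>?A\<^esub> (\<ominus>\<^bsub>?A\<^esub> (x \<otimes>\<^bsub>?A\<^esub> m)) \<otimes>\<^bsub>?A\<^esub> w') = x \<otimes>\<^bsub>?A\<^esub> (w \<oplus>\<^bsub>?A\<^esub> m \<otimes>\<^bsub>?A\<^esub> w')"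
      if "x \<in> carrier ?A" "w \<in> carrier ?A" "m \<in> carrier ?A" "w' \<in> carrier ?A" for x w m w'
    proof -
      have e: "(\<one>\<^bsub>?A\<^esub> \<oplus>\<^bsub>?A\<^esub> a) \<ominus>\<^bsub>?A\<^esub> (\<one>\<^bsub>?A\<^esub> \<oplus>\<^bsub>?A\<^esub> \<ominus>\<^bsub>?A\<^esub> b) = a \<oplus>\<^bsub>?A\<^esub> b" if "a \<in> carrier ?A" "b \<in> carrier ?A" for a b
      proof -
        have "(z \<oplus>\<^bsub>?A\<^esub> a) \<ominus>\<^bsub>?A\<^esub> (z \<oplus>\<^bsub>?A\<^esub> \<ominus>\<^bsub>?A\<^esub> b) = a \<oplus>\<^bsub>?A\<^esub> b" if "z \<in> carrier ?A" for z
          using that \<open>a \<in> carrier ?A\<close> \<open>b \<in> carrier ?A\<close> by algebra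
        then show ?thesis by simp
      qed
      show ?thesis using e[of "x \<otimes>\<^bsub>?A\<^esub> w" "x \<otimes>\<^bsub>?A\<^esub> m \<otimes>\<^bsub>?A\<^esub> w'"] that by (simp add: A.l_minus A.r_distr A.m_assoc)
    qed
    show ?thesis unfolding fga_mu_eval mu_eval[of l] mu_eval[of "- l"] fga_x_minus 
      using *[OF c(1,2,4,3)] by (simp add: mu_eval[of l, symmetric])
  qed
  ultimately show ?thesis by (intro bexI[of _ "fga_class R F ?g"]) simp_all
qed

end

section \<open>Change of coefficients\<close>

text \<open>
  The axioms are transported by the homomorphism of power series rings induced by
  \<open>i\<close>.
\<close>

lemma (in coeff_hom) fgl_image:
  assumes "fgl R F"
  shows "fgl S (\<lambda>a b. i (F a b))"
proof -
  interpret A: fgl R F by fact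
  let ?s = "pser_var S :: nat \<Rightarrow> nat multiset \<Rightarrow> 's"
  note sp = S.pser_var_pord
  have h: "pser_hom_over R S i (psub R S i ?s)" by (rule psub_hom[OF sp])
  have v: "psub R S i ?s (pser_var R k) = pser_var S k" for k by (rule psub_var[OF sp])
  have z: "psub R S i ?s \<zero>\<^bsub>pser R\<^esub> = \<zero>\<^bsub>pser S\<^esub>"
    by (rule ring_hom_zero[OF pser_hom_overD(1)[OF h] R.pser_ring S.pser_ring])
  note H = hom_subst2[where F = F, OF h A.F_closed]
  let ?F = "pser_subst2 S (\<lambda>a b. i (F a b))"
  have "?F (pser_var S (0::nat)) \<zero>\<^bsub>pser S\<^esub> = pser_var S 0"
    using H[OF R.pser_var_pord[of "0::nat"] R.pord_zero] by (simp add: A.F_axioms v z)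
  moreover have "?F \<zero>\<^bsub>pser S\<^esub> (pser_var S (0::nat)) = pser_var S 0"
    using H[OF R.pord_zero R.pser_var_pord[of "0::nat"]] by (simp add: A.F_axioms v z)
  moreover have "?F (pser_var S (0::nat)) (pser_var S 1) = ?F (pser_var S 1) (pser_var S 0)"
    using H[OF R.pser_var_pord[of 0] R.pser_var_pord[of 1]] H[OF R.pser_var_pord[of 1] R.pser_var_pord[of 0]]
    by (simp add: A.F_axioms(3) v)
  moreover have "?F (pser_var S (0::nat)) (?F (pser_var S 1) (pser_var S 2)) = ?F (?F (pser_var S 0) (pser_var S 1)) (pser_var S 2)"
    using H[OF R.pser_var_pord[of 0] A.fadd_pord[OF R.pser_var_pord[of 1] R.pser_var_pord[of 2]]]
      H[OF A.fadd_pord[OF R.pser_var_pord[of 0] R.pser_var_pord[of 1]] R.pser_var_pord[of 2]]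
      H[OF R.pser_var_pord[of 1] R.pser_var_pord[of 2]] H[OF R.pser_var_pord[of 0] R.pser_var_pord[of 1]]
    by (simp add: A.F_axioms(4) v)
  ultimately have "formal_group_law S (\<lambda>a b. i (F a b))"
    unfolding formal_group_law_def Let_def using i_closed A.F_closed by blast
  then show ?thesis by unfold_locales
qed

lemma (in coeff_hom) i_add_pow: "i ([(k::int)] \<cdot>\<^bsub>R\<^esub> \<one>\<^bsub>R\<^esub>) = [k] \<cdot>\<^bsub>S\<^esub> \<one>\<^bsub>S\<^esub>"
proof -
  interpret E: group_hom "add_monoid R" "add_monoid S" i
    using R.a_group S.a_group by (intro group_hom.intro group_hom_axioms.intro) (auto simp: hom_def i_closed i_add)
  show ?thesis using E.hom_int_pow[of "\<one>\<^bsub>R\<^esub>" k] by (simp add: add_pow_def i_one)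
qed

lemma (in coeff_hom) rational_algebra_image: "R.rational_algebra \<Longrightarrow> S.rational_algebra"
  unfolding R.rational_algebra_def S.rational_algebra_def
  using ring_hom_Units[OF i] by (simp add: i_add_pow[symmetric])

lemma (in cring) two_unit: "rational_algebra \<Longrightarrow> two \<in> Units R"
  using rational_algebra_nat[of 2] by (simp add: two_eq)

lemma fga_hom_coeff:
  assumes "cring S" "fgl R F" and i: "i \<in> ring_hom R S"
  shows "fga_hom R S i F (\<lambda>a b. i (F a b)) (pser_var S :: 'l::ab_group_add \<Rightarrow> _)"
proof -
  interpret A: fgl R F by fact
  interpret S: cring S by fact
  interpret H: coeff_hom R S i by unfold_locales (rule i)
  interpret B: fgl S "\<lambda>a b. i (F a b)" by (rule H.fgl_image) fact
  show ?thesis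
    by unfold_locales (auto intro: S.pser_var_pord B.fga_zero_mem B.fga_add_mem)
qed

text \<open>
  \<open>l \<mapsto> h(x\<^sub>l)\<close> is additive for \<open>F\<close>, since \<open>h\<close>
  is a homomorphism from \<open>F'\<close> to \<open>F\<close> and \<open>l \<mapsto>
  x\<^sub>l\<close> is additive for \<open>F'\<close>. The coefficients \<open>C\<close> and
  \<open>C'\<close> over the base ring \<open>K\<close> may differ: they will be
  \<open>R'\<^sub>F\<close> and \<open>R'\<^bsub>F'\<^esub>\<close>.
\<close>

lemma fga_hom_iso:
  assumes K: "fgl K F" "fgl K F'" and h: "cring.fgl_hom K F' F h"
    and C: "cring C" "cring C'" and i: "i \<in> ring_hom K C" "i' \<in> ring_hom K C'" and \<theta>: "\<theta> \<in> ring_hom C C'"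
    and \<theta>i: "\<And>a. a \<in> carrier K \<Longrightarrow> \<theta> (i a) = i' a"
  shows "fga_hom C C' \<theta> (\<lambda>a b. i (F a b)) (\<lambda>a b. i' (F' a b)) (\<lambda>l :: 'l::ab_group_add. psub K C' i' (\<lambda>_. pser_var C' l) h)"
proof -
  interpret A: fgl K F by (rule K)
  interpret A': fgl K F' by (rule K)
  interpret C: cring C by (rule C)
  interpret C': cring C' by (rule C)
  interpret I: coeff_hom K C i by unfold_locales (rule i)
  interpret I': coeff_hom K C' i' by unfold_locales (rule i)
  interpret T: coeff_hom C C' \<theta> by unfold_locales (rule \<theta>)
  interpret G: fgl C "\<lambda>a b. i (F a b)" by (rule I.fgl_image[OF K(1)])
  interpret G': fgl C' "\<lambda>a b. i' (F' a b)" by (rule I'.fgl_image[OF K(2)])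
  have h1: "h \<in> A.pord 1" "A.psub1 (\<lambda>_. A'.fadd (pser_var K (0::nat)) (pser_var K 1)) h =
      A.fadd (A.psub1 (\<lambda>_. pser_var K (0::nat)) h) (A.psub1 (\<lambda>_. pser_var K 1) h)"
    using h by (auto simp: A.fgl_hom_def)
  note hc = A.pord_carrier[OF h1(1)]
  let ?s = "\<lambda>f :: 'l multiset \<Rightarrow> 'e. psub K C' i' (\<lambda>_. f) h"
  have sp: "?s f \<in> C'.pord 1" if "f \<in> C'.pord 1" for f
    by (rule I'.psub_pord[OF that h1(1)])
  have vp: "pser_var C' l \<in> C'.pord 1" for l :: 'l by (rule C'.pser_var_pord)
  have FF: "(\<lambda>a b. \<theta> (i (F a b))) = (\<lambda>a b. i' (F a b))" by (simp add: \<theta>i A.F_closed)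
  \<comment> \<open>the functional equation of \<open>h\<close>, an identity in two variables over \<open>K\<close>, is evaluated at \<open>f\<close> and \<open>g\<close>\<close>
  have fe: "?s (pser_subst2 C' (\<lambda>a b. i' (F' a b)) f g) = pser_subst2 C' (\<lambda>a b. i' (F a b)) (?s f) (?s g)"
    if f: "f \<in> C'.pord 1" and g: "g \<in> C'.pord 1" for f g
  proof -
    let ?p = "pair_fun f g" and ?v = "pser_var K :: nat \<Rightarrow> _"
    have p: "?p v \<in> C'.pord 1" for v by (rule C'.pair_fun_pord[OF f g])
    let ?\<phi> = "psub K C' i' ?p"
    have \<phi>: "pser_hom_over K C' i' ?\<phi>" by (rule I'.psub_hom[OF p])
    have \<phi>v: "?\<phi> (?v 0) = f" "?\<phi> (?v 1) = g" using I'.psub_var[of ?p, OF p] by (simp_all add: pair_fun_def)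
    have \<phi>h: "?\<phi> (A.psub1 (\<lambda>_. k) h) = psub K C' i' (\<lambda>_. ?\<phi> k) h" if "k \<in> A.pord 1" for k
      by (rule I'.hom_psub1[OF \<phi> that hc])
    have "?\<phi> (A.psub1 (\<lambda>_. A'.fadd (?v 0) (?v 1)) h) = psub K C' i' (\<lambda>_. ?\<phi> (A'.fadd (?v 0) (?v 1))) h"
      by (rule \<phi>h) (intro A'.fadd_pord A.pser_var_pord)
    also have "?\<phi> (A'.fadd (?v 0) (?v 1)) = pser_subst2 C' (\<lambda>a b. i' (F' a b)) f g"
      using I'.hom_subst2[where F = F', OF \<phi> A'.F_closed A.pser_var_pord A.pser_var_pord] by (simp only: \<phi>v)
    finally have L: "?\<phi> (A.psub1 (\<lambda>_. A'.fadd (?v 0) (?v 1)) h) = ?s (pser_subst2 C' (\<lambda>a b. i' (F' a b)) f g)" .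
    have kp: "A.psub1 (\<lambda>_. ?v k) h \<in> A.pord 1" for k by (rule A.psub1D(3)[OF A.pser_var_pord h1(1)])
    have "?\<phi> (A.fadd (A.psub1 (\<lambda>_. ?v 0) h) (A.psub1 (\<lambda>_. ?v 1) h)) =
        pser_subst2 C' (\<lambda>a b. i' (F a b)) (?s f) (?s g)"
      using I'.hom_subst2[where F = F, OF \<phi> A.F_closed kp kp] by (simp only: \<phi>h[OF A.pser_var_pord] \<phi>v)
    then show ?thesis using L h1(2) by simp
  qed
  have cong: "?s f \<ominus>\<^bsub>pser C'\<^esub> ?s g \<in> fga_ideal C' (\<lambda>a b. i' (F' a b))"
    if "f \<in> C'.pord 1" "g \<in> C'.pord 1" "f \<ominus>\<^bsub>pser C'\<^esub> g \<in> fga_ideal C' (\<lambda>a b. i' (F' a b))" for f g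
    by (rule I'.psub_cong_ideal[OF that(1,2) G'.fga_ideal_closed that(3) hc])
  interpret P': cring "pser C' :: ('l multiset \<Rightarrow> 'e) ring" by (rule C'.pser_cring)
  have s0: "?s \<zero>\<^bsub>pser C'\<^esub> = \<zero>\<^bsub>pser C'\<^esub>"
  proof -
    have hX: "h = pser_var K () \<otimes>\<^bsub>pser K\<^esub> (\<lambda>m. h (add_mset () m))"
    proof
      fix m
      have "(\<lambda>m. h (add_mset () m)) \<in> carrier (pser K)" using pser_coeff[OF hc] by (intro A.pser_unit_closed) simp
      then show "h m = (pser_var K () \<otimes>\<^bsub>pser K\<^esub> (\<lambda>m. h (add_mset () m))) m"
        using h1(1) by (simp add: A.var_mult_unit A.add_mset_unit A.pser_one_pord0)
    qed
    have hc': "(\<lambda>m. h (add_mset () m)) \<in> carrier (pser K)" using pser_coeff[OF hc] by (intro A.pser_unit_closed) simp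
    have zp: "\<zero>\<^bsub>pser C'\<^esub> \<in> C'.pord 1" for v :: unit by (rule C'.pord_zero)
    note D = pser_hom_overD[OF I'.psub_hom[of "\<lambda>_::unit. \<zero>\<^bsub>pser C'\<^esub> :: 'l multiset \<Rightarrow> 'e", OF zp]]
    show ?thesis
      using arg_cong[OF hX, of "psub K C' i' (\<lambda>_::unit. \<zero>\<^bsub>pser C'\<^esub> :: 'l multiset \<Rightarrow> 'e)"] D(6)[OF A.pser_var_closed hc'] D(4)[OF hc'] I'.psub_var[of "\<lambda>_::unit. \<zero>\<^bsub>pser C'\<^esub> :: 'l multiset \<Rightarrow> 'e", OF zp]
      by simp
  qed
  have sc: "?s f \<in> carrier (pser C')" if "f \<in> C'.pord 1" for f by (rule C'.pord_carrier[OF sp[OF that]])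
  show ?thesis
  proof (unfold_locales)
    fix l l1 l2 :: 'l
    show "?s (pser_var C' l) \<in> C'.pord 1" by (rule sp[OF vp])
    have "pser_var C' (0 :: 'l) \<ominus>\<^bsub>pser C'\<^esub> \<zero>\<^bsub>pser C'\<^esub> \<in> fga_ideal C' (\<lambda>a b. i' (F' a b))"
      using G'.fga_zero_mem[where 'l = 'l] C'.pser_var_closed[of "0 :: 'l"] by (simp add: a_minus_def)
    from cong[OF vp C'.pord_zero this] show "?s (pser_var C' 0) \<in> fga_ideal C' (\<lambda>a b. i' (F' a b))"
      using sc[OF vp[of 0]] by (simp add: s0 a_minus_def)
    have "?s (pser_var C' (l1 + l2)) \<ominus>\<^bsub>pser C'\<^esub> ?s (pser_subst2 C' (\<lambda>a b. i' (F' a b)) (pser_var C' l1) (pser_var C' l2))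
        \<in> fga_ideal C' (\<lambda>a b. i' (F' a b))"
      by (rule cong[OF vp G'.fadd_pord[OF vp vp] G'.fga_add_mem])
    then show "?s (pser_var C' (l1 + l2)) \<ominus>\<^bsub>pser C'\<^esub> pser_subst2 C' (\<lambda>a b. \<theta> (i (F a b))) (?s (pser_var C' l1)) (?s (pser_var C' l2))
        \<in> fga_ideal C' (\<lambda>a b. i' (F' a b))"
      unfolding FF fe[OF vp vp] .
  qed
qed

section \<open>The Hecke algebra is generated by Demazure elements\<close>

lemma (in cring) inv_eqI: "a \<in> carrier R \<Longrightarrow> b \<in> carrier R \<Longrightarrow> a \<otimes> b = \<one> \<Longrightarrow> inv a = b"
  using m_comm by (metis inv_unique')

context root_datum begin

lemma neg_root: "\<alpha> \<in> \<Phi> \<Longrightarrow> - \<alpha> \<in> \<Phi>"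
  using refl_root[of \<alpha> \<alpha>] reflection_root[of \<alpha>] by (simp add: reflection_def)

lemma root_nonzero: "\<alpha> \<in> \<Phi> \<Longrightarrow> \<alpha> \<noteq> 0"
  using coroot_root[of \<alpha>] coroot_add[of \<alpha> 0 0] by auto

text \<open>
  Some coordinate of a non-zero lattice element does not vanish.
\<close>

lemma fga_x_regular_of_nonzero:
  fixes l :: 'l
  assumes "fgl C G" and reg: "\<And>k a. k \<noteq> 0 \<Longrightarrow> a \<in> carrier C \<Longrightarrow> [(k::int)] \<cdot>\<^bsub>C\<^esub> \<one>\<^bsub>C\<^esub> \<otimes>\<^bsub>C\<^esub> a = \<zero>\<^bsub>C\<^esub> \<Longrightarrow> a = \<zero>\<^bsub>C\<^esub>"
    and l: "l \<noteq> 0"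
  shows "fga_x C G l \<in> regular_elements (fga C G)"
proof -
  obtain B where B: "finite B" "independent B" "span B = UNIV" using free by blast
  interpret CG: fgl C G by fact
  interpret L: fgl_lattice C G scale B
    by unfold_locales (use B in auto)
  have "\<exists>b\<in>B. representation B l b \<noteq> 0"
  proof (rule ccontr)
    assume "\<not> ?thesis"
    then have "representation B l b = 0" for b using representation_ne_zero[of B l b] by blast
    then have "l = 0" using sum_nonzero_representation_eq[OF B(2), of l] B(3) by simp
    then show False using l by simp
  qed
  then obtain b where b: "b \<in> B" "representation B l b \<noteq> 0" by blast
  show ?thesis by (rule L.fga_x_regular[OF b(1) reg[OF b(2)]])
qed

end

text \<open>
  The situation after the extension of coefficients: \<open>C\<close> is an algebra over
  \<open>K\<^sub>F\<close> in which \<open>x\<^sub>\<gamma>\<close> is invertible, and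
  \<open>K\<close> contains \<open>\<rat>\<close>. The map \<open>em\<close> embeds the formal
  group algebra \<open>A\<close> into its total ring of fractions \<open>Q\<close>.
\<close>

locale hecke = based_root_datum scale \<Phi> coroot \<Delta> + K: fgl K F + C: cring C
  for scale :: "int \<Rightarrow> 'l::ab_group_add \<Rightarrow> 'l" and \<Phi> coroot \<Delta> and K :: "('k, 'm) ring_scheme" and F and C :: "('c, 'n) ring_scheme" +
  fixes j :: "(int multiset \<Rightarrow> 'k) set \<Rightarrow> 'c"
  assumes j: "j \<in> ring_hom (fga K F) C"
    and rational: "K.rational_algebra"
    and gamma_unit: "j (fga_x K F 1) \<in> Units C"
    and kappa_cases: "kappa_zero C (coeff_fgl K F j) \<Phi> \<or> F 1 1 \<in> Units K"
begin

abbreviation "G \<equiv> coeff_fgl K F j"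
abbreviation A :: "('l multiset \<Rightarrow> 'c) set ring" where "A \<equiv> fga C G"
abbreviation "Q \<equiv> tfrac A"
abbreviation "em \<equiv> tfrac_emb A"
abbreviation "x \<equiv> fga_x C G :: 'l \<Rightarrow> _"

lemma i_hom: "(\<lambda>a. j (fga_const K F a)) \<in> ring_hom K C"
  using ring_hom_trans[OF K.fga_const_hom j] by (simp add: comp_def)

sublocale I: coeff_hom K C "\<lambda>a. j (fga_const K F a)"
  by unfold_locales (rule i_hom)

sublocale CG: fgl C G
  using I.fgl_image[OF K.fgl_axioms] by (simp add: coeff_fgl_def)

sublocale A: cring A by (rule CG.fga_cring)
sublocale Q: cring Q by (rule A.tfrac_cring)

lemma C_rational: "C.rational_algebra" by (rule I.rational_algebra_image[OF rational])

lemma em_hom: "em \<in> ring_hom A Q" by (rule A.tfrac_emb_hom)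
lemmas em_closed = ring_hom_closed[OF em_hom]
lemmas em_mult = ring_hom_mult[OF em_hom]
lemmas em_add = ring_hom_add[OF em_hom]
lemmas em_one = ring_hom_one[OF em_hom]
lemma em_uminus: "a \<in> carrier A \<Longrightarrow> em (\<ominus>\<^bsub>A\<^esub> a) = \<ominus>\<^bsub>Q\<^esub> em a"
  using ring_hom_cring.hom_a_inv[OF ring_hom_cringI[OF A.cring_axioms Q.cring_axioms em_hom]] .
lemma em_minus: "a \<in> carrier A \<Longrightarrow> b \<in> carrier A \<Longrightarrow> em (a \<ominus>\<^bsub>A\<^esub> b) = em a \<ominus>\<^bsub>Q\<^esub> em b"
  by (simp add: a_minus_def em_add em_uminus)
lemma em_inv: "a \<in> Units A \<Longrightarrow> em (inv\<^bsub>A\<^esub> a) = inv\<^bsub>Q\<^esub> em a"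
  by (rule ring_hom_inv[OF A.ring_axioms Q.ring_axioms em_hom])
lemma em_Units: "a \<in> Units A \<Longrightarrow> em a \<in> Units Q" by (rule ring_hom_Units[OF em_hom])

lemma x_closed: "x l \<in> carrier A" by (rule CG.fga_x_closed)

lemma x_regular: "l \<noteq> 0 \<Longrightarrow> x l \<in> regular_elements A"
proof (rule fga_x_regular_of_nonzero[OF CG.fgl_axioms])
  fix k :: int and a assume k: "k \<noteq> 0" and a: "a \<in> carrier C" "[k] \<cdot>\<^bsub>C\<^esub> \<one>\<^bsub>C\<^esub> \<otimes>\<^bsub>C\<^esub> a = \<zero>\<^bsub>C\<^esub>"
  have u: "[k] \<cdot>\<^bsub>C\<^esub> \<one>\<^bsub>C\<^esub> \<in> Units C" using C_rational k by (simp add: C.rational_algebra_def)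
  show "a = \<zero>\<^bsub>C\<^esub>" using C.Units_l_cancel[OF u a(1), of "\<zero>\<^bsub>C\<^esub>"] u a by (simp add: C.Units_closed)
qed

lemma x_unit: "l \<noteq> 0 \<Longrightarrow> em (x l) \<in> Units Q"
  by (rule A.tfrac_emb_unit[OF x_regular])

text \<open>
  The element \<open>w(x\<^sub>\<alpha>) \<mu>(x\<^sub>\<alpha>)\<^sup>-\<^sup>1\<close> of the
  formal group algebra which represents \<open>\<kappa>\<^sub>\<alpha>\<close>, for
  \<open>\<mu>(u) = 1 + u w(u)\<close>.
\<close>

definition kap :: "'l \<Rightarrow> ('l multiset \<Rightarrow> 'c) set" where
  "kap \<alpha> = CG.eval_x \<alpha> CG.mu_tail \<otimes>\<^bsub>A\<^esub> inv\<^bsub>A\<^esub> CG.eval_x \<alpha> CG.mu_ser"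

text \<open>
  \<open>x\<^bsub>-\<alpha>\<^esub> = -x\<^sub>\<alpha> \<mu>(x\<^sub>\<alpha>)\<close> gives
  \<open>\<kappa>\<^sub>\<alpha> \<mu>(x\<^sub>\<alpha>) x\<^sub>\<alpha> =
  \<mu>(x\<^sub>\<alpha>) - 1 = x\<^sub>\<alpha> w(x\<^sub>\<alpha>)\<close>.
\<close>

lemma kappa_eq:
  assumes \<alpha>: "\<alpha> \<in> \<Phi>"
  shows "kappa C G \<alpha> = em (kap \<alpha>)"
proof -
  let ?X = "em (x \<alpha>)" and ?Y = "em (x (- \<alpha>))"
  let ?m = "CG.eval_x \<alpha> CG.mu_ser" and ?w = "CG.eval_x \<alpha> CG.mu_tail"
  have mu: "?m \<in> Units A" by (rule CG.mu_unit)
  have wc: "?w \<in> carrier A" by (rule ring_hom_closed[OF CG.eval_x_hom CG.mu_tail_closed])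
  have mc: "?m \<in> carrier A" using mu by (rule A.Units_closed)
  let ?M = "em ?m" and ?W = "em ?w"
  have X: "?X \<in> Units Q" and Y: "?Y \<in> Units Q" using \<alpha> root_nonzero neg_root by (auto intro: x_unit)
  have M: "?M \<in> Units Q" by (rule em_Units[OF mu])
  note c = Q.Units_closed[OF X] Q.Units_closed[OF Y] Q.Units_closed[OF M] em_closed[OF wc]
    Q.Units_inv_closed[OF X] Q.Units_inv_closed[OF Y] Q.Units_inv_closed[OF M]
  have YX: "?Y = \<ominus>\<^bsub>Q\<^esub> (?X \<otimes>\<^bsub>Q\<^esub> ?M)"
    unfolding CG.fga_x_minus using x_closed mc by (simp add: em_uminus em_mult)
  have MW: "?M = \<one>\<^bsub>Q\<^esub> \<oplus>\<^bsub>Q\<^esub> ?X \<otimes>\<^bsub>Q\<^esub> ?W"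
    using arg_cong[OF CG.mu_eval[of \<alpha>], of em] x_closed wc by (simp add: em_add em_mult em_one)
  let ?k = "inv\<^bsub>Q\<^esub> ?X \<oplus>\<^bsub>Q\<^esub> inv\<^bsub>Q\<^esub> ?Y"
  have kc: "?k \<in> carrier Q" using c by simp
  have "?X \<otimes>\<^bsub>Q\<^esub> (?k \<otimes>\<^bsub>Q\<^esub> ?M) = (?X \<otimes>\<^bsub>Q\<^esub> inv\<^bsub>Q\<^esub> ?X) \<otimes>\<^bsub>Q\<^esub> ?M \<oplus>\<^bsub>Q\<^esub> (?X \<otimes>\<^bsub>Q\<^esub> ?M) \<otimes>\<^bsub>Q\<^esub> inv\<^bsub>Q\<^esub> ?Y"
    using c by (simp add: Q.l_distr Q.r_distr Q.m_ac del: Q.Units_r_inv)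
  also have "(?X \<otimes>\<^bsub>Q\<^esub> ?M) = \<ominus>\<^bsub>Q\<^esub> ?Y" unfolding YX using c by simp
  also have "(?X \<otimes>\<^bsub>Q\<^esub> inv\<^bsub>Q\<^esub> ?X) \<otimes>\<^bsub>Q\<^esub> ?M \<oplus>\<^bsub>Q\<^esub> \<ominus>\<^bsub>Q\<^esub> ?Y \<otimes>\<^bsub>Q\<^esub> inv\<^bsub>Q\<^esub> ?Y = ?M \<oplus>\<^bsub>Q\<^esub> \<ominus>\<^bsub>Q\<^esub> \<one>\<^bsub>Q\<^esub>"
    using c X Y by (simp add: Q.l_minus)
  also have "\<dots> = ?X \<otimes>\<^bsub>Q\<^esub> ?W"
  proof -
    have "(\<one>\<^bsub>Q\<^esub> \<oplus>\<^bsub>Q\<^esub> a) \<oplus>\<^bsub>Q\<^esub> \<ominus>\<^bsub>Q\<^esub> \<one>\<^bsub>Q\<^esub> = a" if "a \<in> carrier Q" for a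
      using that by (simp add: Q.a_ac Q.r_neg)
    then show ?thesis unfolding MW using c by simp
  qed
  finally have "?X \<otimes>\<^bsub>Q\<^esub> (?k \<otimes>\<^bsub>Q\<^esub> ?M) = ?X \<otimes>\<^bsub>Q\<^esub> ?W" .
  then have kM: "?k \<otimes>\<^bsub>Q\<^esub> ?M = ?W" using X c kc by (simp del: Q.r_distr)
  have "em (kap \<alpha>) = ?W \<otimes>\<^bsub>Q\<^esub> inv\<^bsub>Q\<^esub> ?M" unfolding kap_def using mu wc by (simp add: em_mult em_inv)
  also have "\<dots> = ?k \<otimes>\<^bsub>Q\<^esub> (?M \<otimes>\<^bsub>Q\<^esub> inv\<^bsub>Q\<^esub> ?M)"
    unfolding kM[symmetric] using kc c by (simp add: Q.m_assoc del: Q.Units_r_inv)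
  also have "\<dots> = ?k" using M kc by simp
  finally show ?thesis by (simp add: kappa_def Let_def)
qed

lemma a11_unit: "F 1 1 \<in> Units K \<Longrightarrow> G 1 1 \<in> Units C"
  unfolding coeff_fgl_def by (rule ring_hom_Units[OF i_hom])

lemma kap_closed: "kap \<alpha> \<in> carrier A"
  unfolding kap_def
  using A.Units_inv_closed[OF CG.mu_unit[of \<alpha>]] ring_hom_closed[OF CG.eval_x_hom[of \<alpha>] CG.mu_tail_closed] by simp

lemma kap_unit: "F 1 1 \<in> Units K \<Longrightarrow> kap \<alpha> \<in> Units A"
  unfolding kap_def using a11_unit CG.mu_unit
  by (intro A.Units_m_closed CG.eval_x_unit[OF CG.mu_tail_closed] A.Units_inv_Units)
    (auto simp: CG.mu_tail_0 intro: C.Units_uminus)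

text \<open>
  A non-zero \<open>\<kappa>\<^sub>\<alpha>\<close> excludes \<open>\<kappa> = 0\<close>. Then the
  coefficient \<open>F 1 1\<close> is a unit, and \<open>\<kappa>\<^sub>\<alpha>\<close> is
  already invertible in the formal group algebra.
\<close>

lemma kappa_inverses_subset: "kappa_inverses C G \<Phi> \<subseteq> em ` carrier A"
proof
  fix y assume "y \<in> kappa_inverses C G \<Phi>"
  then obtain \<alpha> where y: "y \<in> carrier Q" "\<alpha> \<in> \<Phi>" "kappa C G \<alpha> \<noteq> \<zero>\<^bsub>Q\<^esub>" "kappa C G \<alpha> \<otimes>\<^bsub>Q\<^esub> y = \<one>\<^bsub>Q\<^esub>"
    by (auto simp: kappa_inverses_def Let_def)
  then have "\<not> kappa_zero C G \<Phi>" by (auto simp: kappa_zero_def)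
  then have u: "kap \<alpha> \<in> Units A" using kappa_cases kap_unit by blast
  have "y = inv\<^bsub>Q\<^esub> em (kap \<alpha>)"
    using y kap_closed[of \<alpha>] Q.inv_eqI[OF em_closed y(1)] by (simp add: kappa_eq)
  then show "y \<in> em ` carrier A" using em_inv[OF u] A.Units_inv_closed[OF u] by (metis image_eqI)
qed

lemma fga_kappa_eq: "fga_kappa C G \<Phi> = em ` carrier A"
proof (cases "kappa_zero C G \<Phi>")
  case True
  then show ?thesis by (simp add: fga_kappa_def Let_def)
next
  case False
  have "generate_ring Q (em ` carrier A \<union> kappa_inverses C G \<Phi>) = em ` carrier A"
  proof (rule equalityI)
    show "generate_ring Q (em ` carrier A \<union> kappa_inverses C G \<Phi>) \<subseteq> em ` carrier A"
    proof
      fix z assume "z \<in> generate_ring Q (em ` carrier A \<union> kappa_inverses C G \<Phi>)"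
      then show "z \<in> em ` carrier A"
      proof (induction rule: generate_ring.induct)
        case one
        then show ?case using em_one by (metis A.one_closed image_eqI)
      next
        case (incl h)
        then show ?case using kappa_inverses_subset by blast
      next
        case (a_inv h)
        then obtain a where "h = em a" "a \<in> carrier A" by blast
        then show ?case by (intro image_eqI[where x = "\<ominus>\<^bsub>A\<^esub> a"]) (simp_all add: em_uminus)
      next
        case (eng_add h1 h2)
        then obtain a b where "h1 = em a" "a \<in> carrier A" "h2 = em b" "b \<in> carrier A" by blast
        then show ?case by (intro image_eqI[where x = "a \<oplus>\<^bsub>A\<^esub> b"]) (simp_all add: em_add)
      next
        case (eng_mult h1 h2)
        then obtain a b where "h1 = em a" "a \<in> carrier A" "h2 = em b" "b \<in> carrier A" by blast
        then show ?case by (intro image_eqI[where x = "a \<otimes>\<^bsub>A\<^esub> b"]) (simp_all add: em_mult)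
      qed
    qed
  qed (auto intro: generate_ring.incl)
  then show ?thesis using False by (simp add: fga_kappa_def Let_def)
qed

definition Pgens where
  "Pgens = em ` carrier A \<union> {y \<in> carrier Q. \<exists>l. l \<noteq> 0 \<and> em (x l) \<otimes>\<^bsub>Q\<^esub> y = \<one>\<^bsub>Q\<^esub>} \<union> kappa_inverses C G \<Phi>"

definition P where "P = Q\<lparr>carrier := generate_ring Q Pgens\<rparr>"

lemma P_eq: "Q_prime C G \<Phi> = P"
  by (simp add: Q_prime_def P_def Pgens_def Let_def)

lemma Pgens_carrier: "Pgens \<subseteq> carrier Q"
  using em_closed kappa_inverses_subset by (auto simp: Pgens_def)

lemma P_subcring: "subcring (generate_ring Q Pgens) Q"
  by (rule Q.subcringI'[OF Q.generate_ring_is_subring[OF Pgens_carrier]])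

sublocale P: cring P
  unfolding P_def using Q.subcring_iff[OF Q.generate_ring_incl[OF Pgens_carrier]] P_subcring by simp

lemma P_simps: "a \<otimes>\<^bsub>P\<^esub> b = a \<otimes>\<^bsub>Q\<^esub> b" "a \<oplus>\<^bsub>P\<^esub> b = a \<oplus>\<^bsub>Q\<^esub> b" "\<one>\<^bsub>P\<^esub> = \<one>\<^bsub>Q\<^esub>" "\<zero>\<^bsub>P\<^esub> = \<zero>\<^bsub>Q\<^esub>"
  "carrier P = generate_ring Q Pgens"
  by (simp_all add: P_def)

lemma P_Q: "a \<in> carrier P \<Longrightarrow> a \<in> carrier Q"
  using Q.generate_ring_incl[OF Pgens_carrier] by (auto simp: P_simps)

lemma em_P: "a \<in> carrier A \<Longrightarrow> em a \<in> carrier P"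
  unfolding P_simps by (rule generate_ring.incl) (simp add: Pgens_def)

lemma inv_x_P: "l \<noteq> 0 \<Longrightarrow> inv\<^bsub>Q\<^esub> em (x l) \<in> carrier P"
  unfolding P_simps using x_unit[of l] by (intro generate_ring.incl) (auto simp: Pgens_def)

lemma inv_P:
  assumes "a \<in> carrier P" "inv\<^bsub>Q\<^esub> a \<in> carrier P" "a \<in> Units Q"
  shows "inv\<^bsub>P\<^esub> a = inv\<^bsub>Q\<^esub> a"
  by (rule P.inv_eqI) (use assms in \<open>auto simp: P_simps(1,3)\<close>)

lemma P_uminus: "a \<in> carrier P \<Longrightarrow> \<ominus>\<^bsub>P\<^esub> a = \<ominus>\<^bsub>Q\<^esub> a"
proof -
  assume a: "a \<in> carrier P"
  have "\<ominus>\<^bsub>P\<^esub> a \<oplus>\<^bsub>Q\<^esub> a = \<zero>\<^bsub>Q\<^esub>" using P.l_neg[OF a] by (simp add: P_simps)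
  then show ?thesis using Q.minus_equality[of "\<ominus>\<^bsub>P\<^esub> a" a] P_Q a by simp
qed

lemma P_minus: "a \<in> carrier P \<Longrightarrow> b \<in> carrier P \<Longrightarrow> a \<ominus>\<^bsub>P\<^esub> b = a \<ominus>\<^bsub>Q\<^esub> b"
  by (simp add: a_minus_def P_simps(2) P_uminus)

abbreviation "act \<equiv> \<lambda>w. tfrac_map A (fga_act w)"

lemma act_hom_Q:
  assumes "w \<in> W"
  shows "act w \<in> ring_hom Q Q" "a \<in> carrier A \<Longrightarrow> act w (em a) = em (fga_act w a)"
  using A.tfrac_map_hom[OF CG.fga_act_hom[OF weyl_aut[OF assms]] CG.fga_act_regular[OF weyl_aut[OF assms]]] by auto

lemma act_em_x: "w \<in> W \<Longrightarrow> act w (em (x l)) = em (x (w l))"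
  by (simp add: act_hom_Q(2) x_closed CG.fga_act_x weyl_aut)

lemma act_P:
  assumes w: "w \<in> W" and a: "a \<in> carrier P"
  shows "act w a \<in> carrier P"
proof -
  note h = act_hom_Q(1)[OF w]
  note aut = weyl_aut[OF w]
  interpret H: ring_hom_cring Q Q "act w" by (intro ring_hom_cringI Q.cring_axioms h)
  have g: "act w y \<in> generate_ring Q Pgens" if y: "y \<in> Pgens" for y
  proof -
    have 1: "act w (em b) \<in> generate_ring Q Pgens" if "b \<in> carrier A" for b
      using em_P[of "fga_act w b"] ring_hom_closed[OF CG.fga_act_hom[OF aut] that] act_hom_Q(2)[OF w that]
      by (simp add: P_simps)
    have 2: "act w z \<in> generate_ring Q Pgens" if z: "z \<in> carrier Q" "l \<noteq> 0" "em (x l) \<otimes>\<^bsub>Q\<^esub> z = \<one>\<^bsub>Q\<^esub>" for z l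
    proof -
      have "em (x (w l)) \<otimes>\<^bsub>Q\<^esub> act w z = \<one>\<^bsub>Q\<^esub>"
        using ring_hom_mult[OF h em_closed[OF x_closed] z(1), of l] ring_hom_one[OF h]
        by (simp add: z(3) act_em_x[OF w])
      moreover have "w l \<noteq> 0" using z(2) lattice_aut_zero_iff[OF aut] by simp
      moreover have "act w z \<in> carrier Q" using z(1) by (rule H.hom_closed)
      ultimately show ?thesis by (intro generate_ring.incl) (auto simp: Pgens_def)
    qed
    show ?thesis using y kappa_inverses_subset 1 2 unfolding Pgens_def by blast
  qed
  have "a \<in> generate_ring Q Pgens" using a by (simp add: P_simps)
  then have "act w a \<in> generate_ring Q Pgens"
  proof (induction rule: generate_ring.induct)
    case one then show ?case by (simp add: generate_ring.one)
  next
    case (incl y) then show ?case by (rule g)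
  next
    case (a_inv y)
    then show ?case using P_Q by (simp add: P_simps generate_ring.a_inv)
  next
    case (eng_add y z)
    then show ?case using P_Q by (simp add: P_simps generate_ring.eng_add)
  next
    case (eng_mult y z)
    then show ?case using P_Q by (simp add: P_simps generate_ring.eng_mult)
  qed
  then show ?thesis by (simp add: P_simps)
qed

lemma act_id_Q: "a \<in> carrier Q \<Longrightarrow> act id a = a"
  using A.tfrac_hom_unique[OF Q.cring_axioms act_hom_Q(1)[OF weyl_id] id_ring_hom]
  by (simp add: act_hom_Q(2)[OF weyl_id] CG.fga_act_id)

sublocale TW: twisted P W act
proof
  show "act w \<in> ring_hom P P" if "w \<in> W" for w
    using act_hom_Q(1)[OF that] act_P[OF that] P_Q unfolding ring_hom_def by (auto simp: P_simps(1-4))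
  show "act id a = a" if "a \<in> carrier P" for a using act_id_Q P_Q that by blast
qed (auto intro: weyl_id weyl_comp weyl_inv weyl_bij)

lemma T_eq: "twisted_fga C G scale \<Phi> coroot = TW.T"
  by (simp add: twisted_fga_def P_eq)

abbreviation "rfl \<equiv> reflection scale coroot"
abbreviation "\<Theta> \<equiv> fga_mu K F (1::int) \<ominus>\<^bsub>fga K F\<^esub> fga_mu K F (- 1)"

definition demazure where "demazure \<alpha> = TW.dem (rfl \<alpha>) (inv\<^bsub>Q\<^esub> em (x \<alpha>))"

lemma refl_facts:
  assumes "\<alpha> \<in> \<Phi>"
  shows "rfl \<alpha> \<in> W" "rfl \<alpha> \<noteq> id" "inv_into UNIV (rfl \<alpha>) = rfl \<alpha>"
proof -
  show "rfl \<alpha> \<in> W" by (rule reflection_weyl[OF assms])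
  show "rfl \<alpha> \<noteq> id"
  proof
    assume "rfl \<alpha> = id"
    then have "\<alpha> + \<alpha> = 0" using reflection_root[OF assms] by (metis id_apply add.right_inverse)
    then show False using coroot_add[OF assms, of \<alpha> \<alpha>] coroot_root[OF assms] coroot_add[OF assms, of 0 0] by simp
  qed
  show "inv_into UNIV (rfl \<alpha>) = rfl \<alpha>"
    by (rule inv_unique_comp) (auto simp: fun_eq_iff reflection_reflection[OF assms])
qed

lemma const_closed: "c \<in> carrier C \<Longrightarrow> fga_const C G c \<in> carrier A" by (rule CG.fga_const_closed)

lemma act_const: "w \<in> W \<Longrightarrow> c \<in> carrier C \<Longrightarrow> act w (em (fga_const C G c)) = em (fga_const C G c)"
  by (simp add: act_hom_Q(2) const_closed CG.fga_act_const weyl_aut)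

lemma mu_closed: "fga_mu K F k \<in> carrier (fga K F :: (int multiset \<Rightarrow> 'k) set ring)"
  unfolding K.fga_mu_eval by (rule ring_hom_closed[OF K.eval_x_hom K.mu_ser_closed])

lemma Theta_closed: "\<Theta> \<in> carrier (fga K F)"
proof -
  interpret KF: cring "fga K F :: (int multiset \<Rightarrow> 'k) set ring" by (rule K.fga_cring)
  show ?thesis using mu_closed by simp
qed

lemma Theta_unit: "F 1 1 \<in> Units K \<Longrightarrow> j \<Theta> \<in> Units C"
proof -
  assume a: "F 1 1 \<in> Units K"
  interpret KF: cring "fga K F :: (int multiset \<Rightarrow> 'k) set ring" by (rule K.fga_cring)
  obtain u where u: "u \<in> Units (fga K F :: (int multiset \<Rightarrow> 'k) set ring)" "\<Theta> = fga_x K F 1 \<otimes>\<^bsub>fga K F\<^esub> u"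
    using K.Theta_factor[OF a K.two_unit[OF rational], of 1] by blast
  show ?thesis
    unfolding u(2) ring_hom_mult[OF j K.fga_x_closed KF.Units_closed[OF u(1)]]
    by (intro C.Units_m_closed gamma_unit ring_hom_Units[OF j u(1)])
qed

lemma jc: "r \<in> carrier (fga K F) \<Longrightarrow> j r \<in> carrier C" by (rule ring_hom_closed[OF j])

text \<open>
  The factor \<open>\<psi>\<close> of \<open>dem_lusztig\<close> is \<open>2
  x\<^sub>\<gamma>\<close> or \<open>\<Theta> / \<kappa>\<^sub>\<alpha>\<close>, a unit in both
  cases, and \<open>\<mu>\<close> is \<open>1\<close> or \<open>\<mu>(x\<^sub>\<gamma>)\<close>.
  They are fixed by the reflection.
\<close>

lemma lusztig:
  assumes \<alpha>: "\<alpha> \<in> \<Delta>"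
  obtains u m where "u \<in> Units A" "m \<in> carrier A"
    "demazure_lusztig K F C j scale \<Phi> coroot \<alpha> = TW.tm id (em u) \<otimes>\<^bsub>TW.T\<^esub> demazure \<alpha> \<oplus>\<^bsub>TW.T\<^esub> TW.tm id (em m)"
proof -
  have \<alpha>\<Phi>: "\<alpha> \<in> \<Phi>" using \<alpha> simple_subset by blast
  note s = refl_facts[OF \<alpha>\<Phi>]
  let ?y = "inv\<^bsub>Q\<^esub> em (x \<alpha>)"
  have X: "em (x \<alpha>) \<in> Units Q" by (rule x_unit[OF root_nonzero[OF \<alpha>\<Phi>]])
  have yP: "?y \<in> carrier P" by (rule inv_x_P[OF root_nonzero[OF \<alpha>\<Phi>]])
  have xP: "em (x \<alpha>) \<in> carrier P" by (rule em_P[OF x_closed])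
  have invy: "inv\<^bsub>P\<^esub> em (x \<alpha>) = ?y" by (rule inv_P[OF xP yP X])
  have xy: "em (x \<alpha>) \<otimes>\<^bsub>P\<^esub> ?y = \<one>\<^bsub>P\<^esub>" using X by (simp add: P_simps(1,3))
  have dl: "TW.tm id (inv\<^bsub>P\<^esub> em (x \<alpha>)) \<otimes>\<^bsub>TW.T\<^esub> (\<one>\<^bsub>TW.T\<^esub> \<ominus>\<^bsub>TW.T\<^esub> TW.tm (rfl \<alpha>) \<one>\<^bsub>P\<^esub>) = demazure \<alpha>"
    unfolding demazure_def TW.dem_def invy ..
  show ?thesis
  proof (cases "kappa_zero C G \<Phi>")
    case True
    let ?g = "j (fga_x K F 1)"
    let ?c = "fga_const C G ?g :: ('l multiset \<Rightarrow> 'c) set"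
    have gc: "?g \<in> carrier C" by (rule jc[OF K.fga_x_closed])
    have cA: "?c \<in> carrier A" by (rule const_closed[OF gc])
    let ?u = "(?c \<oplus>\<^bsub>A\<^esub> ?c) \<ominus>\<^bsub>A\<^esub> \<one>\<^bsub>A\<^esub> \<otimes>\<^bsub>A\<^esub> x \<alpha>"
    have "?g \<oplus>\<^bsub>C\<^esub> ?g = C.two \<otimes>\<^bsub>C\<^esub> ?g" using gc by (simp add: C.two_def C.l_distr)
    then have "?g \<oplus>\<^bsub>C\<^esub> ?g \<in> Units C" using C.two_unit[OF C_rational] gamma_unit by simp
    from ring_hom_Units[OF CG.fga_const_hom this] have "?c \<oplus>\<^bsub>A\<^esub> ?c \<in> Units A"
      by (simp add: ring_hom_add[OF CG.fga_const_hom gc gc])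
    then have u: "?u \<in> Units A" by (rule CG.fga_affine_unit) simp
    have dm: "demazure_lusztig K F C j scale \<Phi> coroot \<alpha> =
        [(2::nat)] \<cdot>\<^bsub>TW.T\<^esub> (demazure \<alpha> \<otimes>\<^bsub>TW.T\<^esub> TW.tm id (em ?c)) \<oplus>\<^bsub>TW.T\<^esub> TW.tm (rfl \<alpha>) \<one>\<^bsub>P\<^esub>"
      unfolding demazure_lusztig_def Let_def P_eq T_eq dl using True by simp
    also have "\<dots> = demazure \<alpha> \<otimes>\<^bsub>TW.T\<^esub> TW.tm id (em ?c \<oplus>\<^bsub>P\<^esub> em ?c) \<oplus>\<^bsub>TW.T\<^esub> TW.tm (rfl \<alpha>) \<one>\<^bsub>P\<^esub> \<otimes>\<^bsub>TW.T\<^esub> TW.tm id \<one>\<^bsub>P\<^esub>"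
      unfolding demazure_def by (rule TW.dem_double[OF s(1) yP em_P[OF cA]])
    also have "\<dots> = TW.tm id ((em ?c \<oplus>\<^bsub>P\<^esub> em ?c) \<ominus>\<^bsub>P\<^esub> \<one>\<^bsub>P\<^esub> \<otimes>\<^bsub>P\<^esub> em (x \<alpha>)) \<otimes>\<^bsub>TW.T\<^esub> demazure \<alpha> \<oplus>\<^bsub>TW.T\<^esub> TW.tm id \<one>\<^bsub>P\<^esub>"
      unfolding demazure_def
    proof (rule TW.dem_lusztig[OF s xP yP xy])
      show "em ?c \<oplus>\<^bsub>P\<^esub> em ?c \<in> carrier P" using em_P[OF cA] by simp
      show "act (rfl \<alpha>) (em ?c \<oplus>\<^bsub>P\<^esub> em ?c) = em ?c \<oplus>\<^bsub>P\<^esub> em ?c"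
        using TW.act_add[OF s(1) em_P[OF cA] em_P[OF cA]] by (simp add: act_const[OF s(1) gc])
      show "act (rfl \<alpha>) \<one>\<^bsub>P\<^esub> = \<one>\<^bsub>P\<^esub>" by (rule TW.act_one[OF s(1)])
    qed simp
    also have "(em ?c \<oplus>\<^bsub>P\<^esub> em ?c) \<ominus>\<^bsub>P\<^esub> \<one>\<^bsub>P\<^esub> \<otimes>\<^bsub>P\<^esub> em (x \<alpha>) = em ?u"
    proof -
      have "(em ?c \<oplus>\<^bsub>P\<^esub> em ?c) \<ominus>\<^bsub>P\<^esub> \<one>\<^bsub>P\<^esub> \<otimes>\<^bsub>P\<^esub> em (x \<alpha>) = (em ?c \<oplus>\<^bsub>P\<^esub> em ?c) \<ominus>\<^bsub>Q\<^esub> \<one>\<^bsub>P\<^esub> \<otimes>\<^bsub>P\<^esub> em (x \<alpha>)"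
        using em_P[OF cA] xP by (intro P_minus) auto
      also have "\<dots> = em ?u" using cA x_closed by (simp add: P_simps(1-3) em_closed em_minus em_add em_mult em_one)
      finally show ?thesis .
    qed
    finally have fin: "demazure_lusztig K F C j scale \<Phi> coroot \<alpha> =
        TW.tm id (em ?u) \<otimes>\<^bsub>TW.T\<^esub> demazure \<alpha> \<oplus>\<^bsub>TW.T\<^esub> TW.tm id \<one>\<^bsub>P\<^esub>" .
    have one: "\<one>\<^bsub>P\<^esub> = em \<one>\<^bsub>A\<^esub>" by (simp add: P_simps(3) em_one)
    show ?thesis by (rule that[OF u A.one_closed fin[unfolded one]])
  next
    case False
    then have a11: "F 1 1 \<in> Units K" using kappa_cases by blast
    let ?t = "fga_const C G (j \<Theta>) :: ('l multiset \<Rightarrow> 'c) set" and ?m = "fga_const C G (j (fga_mu K F 1)) :: ('l multiset \<Rightarrow> 'c) set"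
    have tc: "j \<Theta> \<in> carrier C" "j (fga_mu K F 1) \<in> carrier C" by (rule jc[OF Theta_closed], rule jc[OF mu_closed])
    have tU: "?t \<in> Units A" by (rule ring_hom_Units[OF CG.fga_const_hom Theta_unit[OF a11]])
    have tA: "?t \<in> carrier A" and mA: "?m \<in> carrier A" using tc by (auto intro: const_closed)
    have kU: "kap \<alpha> \<in> Units A" by (rule kap_unit[OF a11])
    have kU': "em (kap \<alpha>) \<in> Units Q" by (rule em_Units[OF kU])
    have kP: "em (kap \<alpha>) \<in> carrier P" "em (inv\<^bsub>A\<^esub> kap \<alpha>) \<in> carrier P"
      using kU by (auto intro: em_P)
    have invk: "inv\<^bsub>P\<^esub> kappa C G \<alpha> = em (inv\<^bsub>A\<^esub> kap \<alpha>)"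
      unfolding kappa_eq[OF \<alpha>\<Phi>] em_inv[OF kU] by (rule inv_P) (use kP kU' in \<open>auto simp: em_inv[OF kU]\<close>)
    let ?\<psi> = "em ?t \<otimes>\<^bsub>P\<^esub> em (inv\<^bsub>A\<^esub> kap \<alpha>)"
    let ?u = "(?t \<otimes>\<^bsub>A\<^esub> inv\<^bsub>A\<^esub> kap \<alpha>) \<ominus>\<^bsub>A\<^esub> ?m \<otimes>\<^bsub>A\<^esub> x \<alpha>"
    have u: "?u \<in> Units A" by (rule CG.fga_affine_unit) (use tU kU mA in auto)
    have \<psi>P: "?\<psi> \<in> carrier P" using em_P[OF tA] kP by simp
    \<comment> \<open>the reflection exchanges the two summands of \<open>\<kappa>\<close>\<close>
    have actk: "act (rfl \<alpha>) (em (kap \<alpha>)) = em (kap \<alpha>)"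
    proof -
      note h = act_hom_Q(1)[OF s(1)]
      have X': "em (x (- \<alpha>)) \<in> Units Q" by (rule x_unit[OF root_nonzero[OF neg_root[OF \<alpha>\<Phi>]]])
      have "rfl \<alpha> (- \<alpha>) = \<alpha>" using lattice_aut_minus[OF weyl_aut[OF s(1)]] reflection_root[OF \<alpha>\<Phi>] by simp
      then have "act (rfl \<alpha>) (inv\<^bsub>Q\<^esub> em (x \<alpha>) \<oplus>\<^bsub>Q\<^esub> inv\<^bsub>Q\<^esub> em (x (- \<alpha>))) = inv\<^bsub>Q\<^esub> em (x (- \<alpha>)) \<oplus>\<^bsub>Q\<^esub> inv\<^bsub>Q\<^esub> em (x \<alpha>)"
        using ring_hom_add[OF h Q.Units_inv_closed[OF X] Q.Units_inv_closed[OF X']]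
          ring_hom_inv[OF Q.ring_axioms Q.ring_axioms h X] ring_hom_inv[OF Q.ring_axioms Q.ring_axioms h X']
        by (simp add: act_em_x[OF s(1)] reflection_root[OF \<alpha>\<Phi>])
      also have "\<dots> = inv\<^bsub>Q\<^esub> em (x \<alpha>) \<oplus>\<^bsub>Q\<^esub> inv\<^bsub>Q\<^esub> em (x (- \<alpha>))"
        using X X' by (simp add: Q.a_comm)
      finally show ?thesis unfolding kappa_eq[OF \<alpha>\<Phi>, symmetric] kappa_def Let_def .
    qed
    then have acti: "act (rfl \<alpha>) (em (inv\<^bsub>A\<^esub> kap \<alpha>)) = em (inv\<^bsub>A\<^esub> kap \<alpha>)"
      unfolding em_inv[OF kU] using ring_hom_inv[OF Q.ring_axioms Q.ring_axioms act_hom_Q(1)[OF s(1)] kU'] by simp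
    have "demazure_lusztig K F C j scale \<Phi> coroot \<alpha> =
        demazure \<alpha> \<otimes>\<^bsub>TW.T\<^esub> TW.tm id ?\<psi> \<oplus>\<^bsub>TW.T\<^esub> TW.tm (rfl \<alpha>) \<one>\<^bsub>P\<^esub> \<otimes>\<^bsub>TW.T\<^esub> TW.tm id (em ?m)"
      unfolding demazure_lusztig_def Let_def P_eq T_eq dl invk using False by simp
    also have "\<dots> = TW.tm id (?\<psi> \<ominus>\<^bsub>P\<^esub> em ?m \<otimes>\<^bsub>P\<^esub> em (x \<alpha>)) \<otimes>\<^bsub>TW.T\<^esub> demazure \<alpha> \<oplus>\<^bsub>TW.T\<^esub> TW.tm id (em ?m)"
      unfolding demazure_def
    proof (rule TW.dem_lusztig[OF s xP yP xy \<psi>P _ em_P[OF mA] act_const[OF s(1) tc(2)]])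
      show "act (rfl \<alpha>) ?\<psi> = ?\<psi>"
        using TW.act_mult[OF s(1) em_P[OF tA] kP(2)] by (simp add: act_const[OF s(1) tc(1)] acti)
    qed
    also have "?\<psi> \<ominus>\<^bsub>P\<^esub> em ?m \<otimes>\<^bsub>P\<^esub> em (x \<alpha>) = em ?u"
    proof -
      have "?\<psi> \<ominus>\<^bsub>P\<^esub> em ?m \<otimes>\<^bsub>P\<^esub> em (x \<alpha>) = ?\<psi> \<ominus>\<^bsub>Q\<^esub> em ?m \<otimes>\<^bsub>P\<^esub> em (x \<alpha>)"
        using \<psi>P em_P[OF mA] xP by (intro P_minus) auto
      then show ?thesis using tA mA kU x_closed by (simp add: P_simps(1) em_minus em_mult)
    qed
    finally show ?thesis by (rule that[OF u mA])
  qed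
qed

lemma demazure_closed: "\<alpha> \<in> \<Delta> \<Longrightarrow> demazure \<alpha> \<in> carrier TW.T"
  unfolding demazure_def using simple_subset root_nonzero by (intro TW.dem_closed inv_x_P) auto

theorem affine_hecke_eq:
  "affine_hecke K F C j scale \<Phi> coroot \<Delta> =
    TW.T\<lparr>carrier := generate_ring TW.T (TW.tm id ` em ` carrier A \<union> demazure ` \<Delta>)\<rparr>"
proof -
  let ?Y = "demazure_lusztig K F C j scale \<Phi> coroot"
  have "\<forall>\<alpha>\<in>\<Delta>. \<exists>u m. u \<in> Units A \<and> m \<in> carrier A \<and> ?Y \<alpha> = TW.tm id (em u) \<otimes>\<^bsub>TW.T\<^esub> demazure \<alpha> \<oplus>\<^bsub>TW.T\<^esub> TW.tm id (em m)"
    using lusztig by metis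
  then obtain u m where um: "\<And>\<alpha>. \<alpha> \<in> \<Delta> \<Longrightarrow> u \<alpha> \<in> Units A" "\<And>\<alpha>. \<alpha> \<in> \<Delta> \<Longrightarrow> m \<alpha> \<in> carrier A"
    "\<And>\<alpha>. \<alpha> \<in> \<Delta> \<Longrightarrow> ?Y \<alpha> = TW.tm id (em (u \<alpha>)) \<otimes>\<^bsub>TW.T\<^esub> demazure \<alpha> \<oplus>\<^bsub>TW.T\<^esub> TW.tm id (em (m \<alpha>))"
    by metis
  have "generate_ring TW.T (TW.tm id ` em ` carrier A \<union> ?Y ` \<Delta>) =
      generate_ring TW.T (TW.tm id ` em ` carrier A \<union> demazure ` \<Delta>)"
  proof (rule TW.generate_affine[where u = "\<lambda>\<alpha>. em (u \<alpha>)" and u' = "\<lambda>\<alpha>. em (inv\<^bsub>A\<^esub> u \<alpha>)" and m = "\<lambda>\<alpha>. em (m \<alpha>)"])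
    show "em ` carrier A \<subseteq> carrier P" using em_P by blast
    show "em (inv\<^bsub>A\<^esub> u \<alpha>) \<otimes>\<^bsub>P\<^esub> em (u \<alpha>) = \<one>\<^bsub>P\<^esub>" if "\<alpha> \<in> \<Delta>" for \<alpha>
      using um(1)[OF that] em_mult[OF A.Units_inv_closed[OF um(1)[OF that]] A.Units_closed[OF um(1)[OF that]]]
      by (simp add: P_simps(1,3) em_one)
  qed (use um demazure_closed in auto)
  then show ?thesis
    unfolding affine_hecke_def Let_def P_eq T_eq fga_kappa_eq by simp
qed

end

section \<open>Transport along an isomorphism of formal group laws\<close>

lemma (in fgl) strict_series_factor:
  assumes h: "h \<in> pord 1" "h {#()#} = \<one>"
  shows "\<exists>g\<in>Units (pser R). h = pser_var R () \<otimes>\<^bsub>pser R\<^esub> g"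
proof
  let ?g = "\<lambda>m. h (add_mset () m)"
  have gc: "?g \<in> carrier (pser R)" using pser_coeff[OF pord_carrier[OF h(1)]] by (intro pser_unit_closed) simp
  then show "?g \<in> Units (pser R)" using h(2) by (intro pser_unitI) auto
  show "h = pser_var R () \<otimes>\<^bsub>pser R\<^esub> ?g"
  proof
    fix m show "h m = (pser_var R () \<otimes>\<^bsub>pser R\<^esub> ?g) m"
      using h(1) gc by (simp add: var_mult_unit add_mset_unit pser_one_pord0)
  qed
qed

text \<open>
  Both sides are continuous homomorphisms in \<open>f\<close> which take the variable to
  \<open>\<phi> k\<close>.
\<close>

lemma pser_hom_over_psub:
  fixes k :: "'w multiset \<Rightarrow> 's"
  assumes R: "cring R" and S: "cring S" and T: "cring T"
    and i: "i \<in> ring_hom R S" and \<theta>: "\<theta> \<in> ring_hom S T"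
    and \<phi>: "pser_hom_over S T \<theta> \<phi>" and k: "k \<in> cring.pord S 1" and f: "f \<in> carrier (pser R)"
  shows "\<phi> (psub R S i (\<lambda>_::unit. k) f) = psub R T (\<lambda>a. \<theta> (i a)) (\<lambda>_. \<phi> k) f"
proof -
  interpret S: cring S by fact
  interpret T: cring T by fact
  interpret I: coeff_hom R S i using R S i by (intro coeff_hom.intro coeff_hom_axioms.intro)
  have "(\<lambda>a. \<theta> (i a)) \<in> ring_hom R T" using ring_hom_trans[OF i \<theta>] by (simp add: comp_def)
  then interpret J: coeff_hom R T "\<lambda>a. \<theta> (i a)" using R T by (intro coeff_hom.intro coeff_hom_axioms.intro)
  have kT: "\<phi> k \<in> T.pord 1" by (rule pser_hom_overD(3)[OF \<phi> k])
  show ?thesis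
  proof (rule pser_hom_over_eq[OF R T pser_hom_over_comp[OF I.psub_hom \<phi> i] J.psub_hom _ _ f])
    show "\<phi> (psub R S i (\<lambda>_::unit. k) (pser_var R v)) = psub R T (\<lambda>a. \<theta> (i a)) (\<lambda>_. \<phi> k) (pser_var R v)" for v
      using I.psub_var[of "\<lambda>_::unit. k", OF k] J.psub_var[of "\<lambda>_::unit. \<phi> k", OF kT] by simp
  qed (use k kT in auto)
qed

text \<open>
  The direction is contravariant: a homomorphism \<open>h\<close> from \<open>F'\<close> to
  \<open>F\<close> induces a homomorphism from the formal group algebra of \<open>F\<close> to
  that of \<open>F'\<close>. The coefficients are changed along \<open>\<theta>\<close>, which is
  given in advance. For the formal group algebra over \<open>\<Lambda>\<close> it is itself
  induced by transport for \<open>\<Gamma>\<close>.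
\<close>

locale fgl_transport = fgl K F + A': fgl K F' + C: cring C + C': cring C'
  for K :: "('k, 'm) ring_scheme" (structure) and F F' and C :: "('c, 'n) ring_scheme" and C' :: "('d, 'o) ring_scheme" +
  fixes i i' \<theta> h
  assumes h: "fgl_hom F' F h" and i: "i \<in> ring_hom K C" and i': "i' \<in> ring_hom K C'"
    and \<theta>: "\<theta> \<in> ring_hom C C'" and \<theta>i: "\<And>a. a \<in> carrier K \<Longrightarrow> \<theta> (i a) = i' a"
begin

abbreviation "Fi \<equiv> \<lambda>a b. i (F a b)"
abbreviation "Fi' \<equiv> \<lambda>a b. i' (F' a b)"

definition shift :: "'l::ab_group_add \<Rightarrow> 'l multiset \<Rightarrow> 'd" where
  "shift l = psub K C' i' (\<lambda>_. pser_var C' l) h"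

definition transport :: "('l::ab_group_add multiset \<Rightarrow> 'c) set \<Rightarrow> ('l multiset \<Rightarrow> 'd) set" where
  "transport = fga_map C C' Fi' \<theta> shift"

lemma coeff_hom_i: "coeff_hom K C i" "coeff_hom K C' i'" "coeff_hom C C' \<theta>"
  using i i' \<theta> by unfold_locales

lemma h_pord: "h \<in> pord 1" "h {#()#} = \<one>" "h \<in> carrier (pser K)"
  using h pord_carrier by (auto simp: fgl_hom_def)

lemma shift_hom: "fga_hom C C' \<theta> Fi Fi' (shift :: 'l::ab_group_add \<Rightarrow> _)"
  unfolding shift_def[abs_def]
  by (rule fga_hom_iso[OF fgl_axioms A'.fgl_axioms h C.cring_axioms C'.cring_axioms i i' \<theta> \<theta>i])

lemmas transport_hom = fga_hom.map_hom[OF shift_hom, folded transport_def]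
lemmas transport_const = fga_hom.map_const[OF shift_hom, folded transport_def]
lemmas transport_class = fga_hom.map_class[OF shift_hom, folded transport_def]
lemmas transport_shift = fga_hom.map_x[OF shift_hom, folded transport_def]
lemmas shift_pord = fga_hom.s[OF shift_hom]

text \<open>
  Since \<open>h = u + \<dots>\<close>, the quotient \<open>h(u) / u\<close> is a series with
  constant term one.
\<close>

lemma transport_x:
  "\<exists>u\<in>Units (fga C' Fi'). transport (fga_x C Fi l) = fga_x C' Fi' (l :: 'l::ab_group_add) \<otimes>\<^bsub>fga C' Fi'\<^esub> u"
proof -
  interpret I': coeff_hom K C' i' by (rule coeff_hom_i)
  interpret G': fgl C' Fi' by (rule I'.fgl_image) (rule A'.fgl_axioms)
  obtain g where g: "g \<in> Units (pser K)" "h = pser_var K () \<otimes>\<^bsub>pser K\<^esub> g" using strict_series_factor[OF h_pord(1,2)] by blast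
  interpret P: cring "pser K :: (unit multiset \<Rightarrow> 'k) ring" by (rule pser_cring)
  have vp: "pser_var C' l \<in> C'.pord 1" for v :: unit by (rule C'.pser_var_pord)
  let ?\<phi> = "psub K C' i' (\<lambda>_::unit. pser_var C' l)"
  have \<phi>: "?\<phi> \<in> ring_hom (pser K) (pser C')"
    by (rule pser_hom_overD(1)[OF I'.psub_hom[of "\<lambda>_::unit. pser_var C' l", OF vp]])
  have gc: "?\<phi> g \<in> carrier (pser C')" by (rule ring_hom_closed[OF \<phi> P.Units_closed[OF g(1)]])
  have "transport (fga_x C Fi l) = fga_class C' Fi' (?\<phi> h)" unfolding transport_shift shift_def ..
  also have "?\<phi> h = pser_var C' l \<otimes>\<^bsub>pser C'\<^esub> ?\<phi> g"
    unfolding g(2) ring_hom_mult[OF \<phi> pser_var_closed P.Units_closed[OF g(1)]]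
      I'.psub_var[of "\<lambda>_::unit. pser_var C' l", OF vp] ..
  also have "fga_class C' Fi' \<dots> = fga_x C' Fi' l \<otimes>\<^bsub>fga C' Fi'\<^esub> fga_class C' Fi' (?\<phi> g)"
    unfolding fga_x_def by (rule ring_hom_mult[OF G'.fga_class_hom C'.pser_var_closed gc])
  finally show ?thesis using ring_hom_Units[OF G'.fga_class_hom ring_hom_Units[OF \<phi> g(1)]] by blast
qed

lemma transport_act:
  fixes X :: "('l::ab_group_add multiset \<Rightarrow> 'c) set"
  assumes w: "lattice_aut w" and X: "X \<in> carrier (fga C Fi)"
  shows "transport (fga_act w X) = fga_act w (transport X)"
proof -
  interpret I: coeff_hom K C i by (rule coeff_hom_i)
  interpret I': coeff_hom K C' i' by (rule coeff_hom_i)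
  interpret T: coeff_hom C C' \<theta> by (rule coeff_hom_i)
  interpret G: fgl C Fi by (rule I.fgl_image) (rule fgl_axioms)
  interpret G': fgl C' Fi' by (rule I'.fgl_image) (rule A'.fgl_axioms)
  obtain f where f: "f \<in> carrier (pser C)" "X = fga_class C Fi f" using X by (rule G.fga_carrierE)
  let ?v = "\<lambda>l. pser_var C (w l)" and ?v' = "\<lambda>l. pser_var C' (w l)"
  note a = fga_hom.map_class[OF G.fga_hom_act[OF w]] and a' = fga_hom.map_class[OF G'.fga_hom_act[OF w]]
  note hs = T.psub_hom[of shift, OF shift_pord]
  note hv = C.psub1_hom[of ?v, OF C.pser_var_pord] and hv' = C'.psub1_hom[of ?v', OF C'.pser_var_pord]
  have Xc: "fga_class C Fi f \<in> carrier (fga C Fi)" using X f by simp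
  have sc: "psub C C' \<theta> shift f \<in> carrier (pser C')" by (rule pser_hom_overD(4)[OF hs f(1)])
  have vc: "C.psub1 ?v f \<in> carrier (pser C)" by (rule pser_hom_overD(4)[OF hv f(1)])
  have "transport (fga_act w X) = fga_class C' Fi' (psub C C' \<theta> shift (C.psub1 ?v f))"
    unfolding f(2) G.fga_act_eq[OF w Xc] a[OF f(1)] by (rule transport_class[OF vc])
  also have "psub C C' \<theta> shift (C.psub1 ?v f) = C'.psub1 ?v' (psub C C' \<theta> shift f)"
  proof (rule pser_hom_over_eq[OF C.cring_axioms C'.cring_axioms pser_hom_over_comp[OF hv hs id_ring_hom]
        pser_hom_over_comp[OF hs hv' \<theta>] _ _ f(1)])
    fix l
    have "C'.psub1 ?v' (shift l) = psub K C' (\<lambda>a. (i' a)) (\<lambda>_. C'.psub1 ?v' (pser_var C' l)) h"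
      unfolding shift_def
      by (rule pser_hom_over_psub[OF cring_axioms C'.cring_axioms C'.cring_axioms i' id_ring_hom hv' C'.pser_var_pord h_pord(3)])
    then have "C'.psub1 ?v' (shift l) = shift (w l)"
      unfolding C'.psub1_var[of ?v', OF C'.pser_var_pord] by (simp add: shift_def)
    then show "psub C C' \<theta> shift (C.psub1 ?v (pser_var C l)) = C'.psub1 ?v' (psub C C' \<theta> shift (pser_var C l))"
      unfolding C.psub1_var[of ?v, OF C.pser_var_pord] T.psub_var[of shift, OF shift_pord] by simp
  qed simp
  also have "fga_class C' Fi' \<dots> = fga_act w (transport X)"
    unfolding f(2) transport_class[OF f(1)] a'[OF sc, symmetric]
    by (rule G'.fga_act_eq[OF w, symmetric]) (rule G'.fga_class_closed[OF sc])
  finally show ?thesis .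
qed

text \<open>
  The composition takes \<open>x\<^sub>l\<close> to \<open>h(h'(x\<^sub>l))\<close>, with
  \<open>h\<close> the outer series.
\<close>

lemma transport_inverse:
  fixes X :: "('l::ab_group_add multiset \<Rightarrow> 'c) set"
  assumes T': "fgl_transport K F' F C' C i' i \<theta>' h'"
    and \<theta>\<theta>: "\<And>c. c \<in> carrier C \<Longrightarrow> \<theta>' (\<theta> c) = c" and hh: "psub1 (\<lambda>_. h') h = pser_var K ()"
    and X: "X \<in> carrier (fga C Fi)"
  shows "fgl_transport.transport K F C' C i \<theta>' h' (transport X) = X"
proof -
  interpret B: fgl_transport K F' F C' C i' i \<theta>' h' by (rule T')
  interpret I: coeff_hom K C i by (rule coeff_hom_i)
  interpret T: coeff_hom C C' \<theta> by (rule coeff_hom_i)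
  interpret T': coeff_hom C' C \<theta>' by (rule B.coeff_hom_i)
  interpret G: fgl C Fi by (rule I.fgl_image) (rule fgl_axioms)
  obtain f where f: "f \<in> carrier (pser C)" "X = fga_class C Fi f" using X by (rule G.fga_carrierE)
  note hs = T.psub_hom[of shift, OF shift_pord]
  note hs' = T'.psub_hom[of B.shift, OF B.shift_pord]
  have sc: "psub C C' \<theta> shift f \<in> carrier (pser C')" by (rule pser_hom_overD(4)[OF hs f(1)])
  have "B.transport (transport X) = fga_class C Fi (psub C' C \<theta>' B.shift (psub C C' \<theta> shift f))"
    unfolding f(2) transport_class[OF f(1)] by (rule B.transport_class[OF sc])
  also have "psub C' C \<theta>' B.shift (psub C C' \<theta> shift f) = f"
  proof (rule pser_hom_over_eq[OF C.cring_axioms C.cring_axioms pser_hom_over_comp[OF hs hs' \<theta>] pser_hom_over_id \<theta>\<theta> _ f(1)])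
    fix l :: 'l
    have vp: "pser_var C l \<in> C.pord 1" for v :: unit by (rule C.pser_var_pord)
    have "psub C' C \<theta>' B.shift (shift l) = psub K C (\<lambda>a. \<theta>' (i' a)) (\<lambda>_. psub C' C \<theta>' B.shift (pser_var C' l)) h"
      unfolding shift_def
      by (rule pser_hom_over_psub[OF cring_axioms C'.cring_axioms C.cring_axioms i' B.\<theta> hs' C'.pser_var_pord h_pord(3)])
    also have "psub C' C \<theta>' B.shift (pser_var C' l) = B.shift l" by (rule T'.psub_var[of B.shift, OF B.shift_pord])
    also have "psub K C (\<lambda>a. \<theta>' (i' a)) (\<lambda>_. B.shift l) h = psub K C i (\<lambda>_. B.shift l) h"
      unfolding psub_def using pser_coeff[OF h_pord(3)] by (simp add: B.\<theta>i)
    also have "\<dots> = psub K C i (\<lambda>_. pser_var C l) (psub1 (\<lambda>_. h') h)"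
      unfolding B.shift_def
      by (rule I.hom_psub1[OF I.psub_hom[of "\<lambda>_::unit. pser_var C l", OF vp] B.h_pord(1) h_pord(3), symmetric])
    also have "\<dots> = pser_var C l" unfolding hh by (rule I.psub_var[of "\<lambda>_::unit. pser_var C l", OF vp])
    finally show "psub C' C \<theta>' B.shift (psub C C' \<theta> shift (pser_var C l)) = pser_var C l"
      unfolding T.psub_var[of shift, OF shift_pord] .
  qed
  finally show ?thesis using f by simp
qed

end

section \<open>Transport of Hecke algebras\<close>

text \<open>
  \<open>\<tau>\<close> is the extension of the transport of formal group algebras to total rings
  of fractions.
\<close>

locale hecke_transport = H: hecke scale \<Phi> coroot \<Delta> K F C j + H': hecke scale \<Phi> coroot \<Delta> K F' C' j' +
    X: fgl_transport K F F' C C' "\<lambda>a. j (fga_const K F a)" "\<lambda>a. j' (fga_const K F' a)" \<theta> h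
  for scale :: "int \<Rightarrow> 'l::ab_group_add \<Rightarrow> 'l" and \<Phi> coroot \<Delta>
    and K :: "('k, 'm) ring_scheme" and F F' and C :: "('c, 'n) ring_scheme" and j
    and C' :: "('d, 'o) ring_scheme" and j' \<theta> h +
  fixes \<tau> :: "(('l multiset \<Rightarrow> 'c) set \<times> ('l multiset \<Rightarrow> 'c) set) set \<Rightarrow> (('l multiset \<Rightarrow> 'd) set \<times> ('l multiset \<Rightarrow> 'd) set) set"
  assumes \<tau>_hom: "\<tau> \<in> ring_hom H.Q H'.Q" and \<tau>_inj: "inj_on \<tau> (carrier H.Q)"
    and \<tau>_em: "\<And>a. a \<in> carrier H.A \<Longrightarrow> \<tau> (H.em a) = H'.em (X.transport a)"
begin

lemmas coeff_eq = coeff_fgl_def[of K F j, symmetric] coeff_fgl_def[of K F' j', symmetric]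

lemma transport_closed: "a \<in> carrier H.A \<Longrightarrow> X.transport a \<in> carrier H'.A"
  using ring_hom_closed[OF X.transport_hom[unfolded coeff_eq]] .

lemma transport_x': "\<exists>u\<in>Units H'.A. X.transport (H.x l) = H'.x l \<otimes>\<^bsub>H'.A\<^esub> u"
  using X.transport_x[of l, unfolded coeff_eq] .

lemma transport_act': "w \<in> H.W \<Longrightarrow> a \<in> carrier H.A \<Longrightarrow> X.transport (fga_act w a) = fga_act w (X.transport a)"
  using X.transport_act[of w a, unfolded coeff_eq] H.weyl_aut by blast

lemma transport_const':
  "c \<in> carrier C \<Longrightarrow> X.transport (fga_const C H.G c :: ('l multiset \<Rightarrow> 'c) set) = fga_const C' H'.G (\<theta> c)"
  by (rule X.transport_const[unfolded coeff_eq])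

text \<open>
  Transport changes \<open>x\<^sub>l\<close> by a unit of the formal group algebra. This is why it
  preserves \<open>Q'\<close> and why it takes Demazure elements to multiples of Demazure
  elements.
\<close>

lemma \<tau>_inv_x:
  assumes l: "l \<noteq> 0"
  shows "\<exists>u\<in>carrier H'.A. \<tau> (inv\<^bsub>H.Q\<^esub> H.em (H.x l)) = H'.em u \<otimes>\<^bsub>H'.Q\<^esub> inv\<^bsub>H'.Q\<^esub> H'.em (H'.x l)"
proof -
  obtain u where u: "u \<in> Units H'.A" "X.transport (H.x l) = H'.x l \<otimes>\<^bsub>H'.A\<^esub> u" using transport_x' by blast
  let ?X = "H'.em (H'.x l)" and ?U = "H'.em u" and ?V = "H'.em (inv\<^bsub>H'.A\<^esub> u)"
  have X: "?X \<in> Units H'.Q" by (rule H'.x_unit[OF l])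
  have uc: "u \<in> carrier H'.A" "inv\<^bsub>H'.A\<^esub> u \<in> carrier H'.A" using u(1) by auto
  have c: "?X \<in> carrier H'.Q" "?U \<in> carrier H'.Q" "?V \<in> carrier H'.Q" "inv\<^bsub>H'.Q\<^esub> ?X \<in> carrier H'.Q"
    using X uc by (auto intro: H'.em_closed)
  have UV: "?U \<otimes>\<^bsub>H'.Q\<^esub> ?V = \<one>\<^bsub>H'.Q\<^esub>"
    unfolding H'.em_mult[OF uc, symmetric] H'.A.Units_r_inv[OF u(1)] by (rule H'.em_one)
  have "\<tau> (inv\<^bsub>H.Q\<^esub> H.em (H.x l)) = inv\<^bsub>H'.Q\<^esub> (\<tau> (H.em (H.x l)))"
    by (rule ring_hom_inv[OF H.Q.ring_axioms H'.Q.ring_axioms \<tau>_hom H.x_unit[OF l]])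
  also have "\<tau> (H.em (H.x l)) = ?X \<otimes>\<^bsub>H'.Q\<^esub> ?U"
    unfolding \<tau>_em[OF H.x_closed] u(2) by (rule H'.em_mult[OF H'.x_closed uc(1)])
  also have "inv\<^bsub>H'.Q\<^esub> (?X \<otimes>\<^bsub>H'.Q\<^esub> ?U) = ?V \<otimes>\<^bsub>H'.Q\<^esub> inv\<^bsub>H'.Q\<^esub> ?X"
  proof (rule H'.Q.inv_eqI)
    have "?X \<otimes>\<^bsub>H'.Q\<^esub> ?U \<otimes>\<^bsub>H'.Q\<^esub> (?V \<otimes>\<^bsub>H'.Q\<^esub> inv\<^bsub>H'.Q\<^esub> ?X) = (?X \<otimes>\<^bsub>H'.Q\<^esub> inv\<^bsub>H'.Q\<^esub> ?X) \<otimes>\<^bsub>H'.Q\<^esub> (?U \<otimes>\<^bsub>H'.Q\<^esub> ?V)"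
      using c by (simp add: H'.Q.m_ac del: H'.Q.Units_r_inv)
    then show "?X \<otimes>\<^bsub>H'.Q\<^esub> ?U \<otimes>\<^bsub>H'.Q\<^esub> (?V \<otimes>\<^bsub>H'.Q\<^esub> inv\<^bsub>H'.Q\<^esub> ?X) = \<one>\<^bsub>H'.Q\<^esub>"
      unfolding UV H'.Q.Units_r_inv[OF X] by simp
  qed (use c in auto)
  finally show ?thesis using uc by blast
qed

lemma \<tau>_inv_x_P:
  assumes l: "l \<noteq> 0"
  shows "\<tau> (inv\<^bsub>H.Q\<^esub> H.em (H.x l)) \<in> carrier H'.P"
proof -
  obtain u where u: "u \<in> carrier H'.A"
    "\<tau> (inv\<^bsub>H.Q\<^esub> H.em (H.x l)) = H'.em u \<otimes>\<^bsub>H'.Q\<^esub> inv\<^bsub>H'.Q\<^esub> H'.em (H'.x l)" using \<tau>_inv_x[OF l] by blast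
  show ?thesis unfolding u(2)
    using H'.P.m_closed[OF H'.em_P[OF u(1)] H'.inv_x_P[OF l]] by (simp add: H'.P_simps(1))
qed

lemma \<tau>_P: 
  assumes "a \<in> carrier H.P"
  shows "\<tau> a \<in> carrier H'.P"
proof -
  interpret T: ring_hom_cring H.Q H'.Q \<tau> by (intro ring_hom_cringI H.Q.cring_axioms H'.Q.cring_axioms \<tau>_hom)
  have em: "\<tau> (H.em b) \<in> carrier H'.P" if "b \<in> carrier H.A" for b
    unfolding \<tau>_em[OF that] by (rule H'.em_P[OF transport_closed[OF that]])
  have gens: "\<tau> y \<in> carrier H'.P" if "y \<in> H.Pgens" for y
  proof -
    have A: "\<tau> y \<in> carrier H'.P" if "y \<in> H.em ` carrier H.A" using that em by (elim imageE) simp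
    show ?thesis using that unfolding H.Pgens_def
    proof (elim UnE CollectE conjE exE)
      assume "y \<in> kappa_inverses C H.G \<Phi>"
      then show ?thesis by (rule A[OF subsetD[OF H.kappa_inverses_subset]])
    next
      fix l assume y: "y \<in> carrier H.Q" "l \<noteq> 0" "H.em (H.x l) \<otimes>\<^bsub>H.Q\<^esub> y = \<one>\<^bsub>H.Q\<^esub>"
      then have "y = inv\<^bsub>H.Q\<^esub> H.em (H.x l)" using H.Q.inv_eqI[OF H.em_closed[OF H.x_closed]] by simp
      then show ?thesis using \<tau>_inv_x_P[OF y(2)] by simp
    qed (rule A)
  qed
  have "a \<in> generate_ring H.Q H.Pgens" using assms by (simp only: H.P_simps(5))
  then show ?thesis
  proof (induction rule: generate_ring.induct)
    case one
    then show ?case using H'.P.one_closed by (simp add: H'.P_simps(3))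
  next
    case (incl y)
    then show ?case by (rule gens)
  next
    case (a_inv y)
    then have "y \<in> carrier H.Q" using H.P_Q by (simp add: H.P_simps(5))
    then show ?case using H'.P.a_inv_closed[OF a_inv.IH] H'.P_uminus[OF a_inv.IH] by simp
  next
    case (eng_add y z)
    then have "y \<in> carrier H.Q" "z \<in> carrier H.Q" using H.P_Q by (simp_all add: H.P_simps(5))
    then show ?case using H'.P.a_closed[OF eng_add.IH] by (simp add: H'.P_simps(2))
  next
    case (eng_mult y z)
    then have "y \<in> carrier H.Q" "z \<in> carrier H.Q" using H.P_Q by (simp_all add: H.P_simps(5))
    then show ?case using H'.P.m_closed[OF eng_mult.IH] by (simp add: H'.P_simps(1))
  qed
qed

lemma \<tau>_act:
  assumes w: "w \<in> H.W" and a: "a \<in> carrier H.Q"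
  shows "\<tau> (H.act w a) = H'.act w (\<tau> a)"
proof -
  have f: "(\<lambda>a. \<tau> (H.act w a)) \<in> ring_hom H.Q H'.Q"
    using ring_hom_trans[OF H.act_hom_Q(1)[OF w] \<tau>_hom] by (simp add: comp_def)
  have g: "(\<lambda>a. H'.act w (\<tau> a)) \<in> ring_hom H.Q H'.Q"
    using ring_hom_trans[OF \<tau>_hom H'.act_hom_Q(1)[OF w]] by (simp add: comp_def)
  show ?thesis
  proof (rule H.A.tfrac_hom_unique[OF H'.Q.cring_axioms f g _ a])
    fix b assume b: "b \<in> carrier H.A"
    have wb: "fga_act w b \<in> carrier H.A" by (rule ring_hom_closed[OF H.CG.fga_act_hom[OF H.weyl_aut[OF w]] b])
    show "\<tau> (H.act w (H.em b)) = H'.act w (\<tau> (H.em b))"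
      unfolding H.act_hom_Q(2)[OF w b] \<tau>_em[OF wb] \<tau>_em[OF b] H'.act_hom_Q(2)[OF w transport_closed[OF b]]
        transport_act'[OF w b] ..
  qed
qed

sublocale TH: twisted_hom H.P H.W H.act H'.P H'.act \<tau>
proof
  show "\<tau> \<in> ring_hom H.P H'.P"
    by (rule ring_hom_memI)
      (use \<tau>_P H.P_Q \<tau>_hom in \<open>auto simp: H.P_simps(1-3) H'.P_simps(1-3) ring_hom_mult ring_hom_add ring_hom_one\<close>)
  show "inj_on \<tau> (carrier H.P)" using \<tau>_inj H.P_Q by (meson inj_on_subset subsetI)
  show "\<tau> (H.act w a) = H'.act w (\<tau> a)" if "w \<in> H.W" "a \<in> carrier H.P" for w a
    by (rule \<tau>_act[OF that(1) H.P_Q[OF that(2)]])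
qed

text \<open>
  The generators of one side go to elements generated on the other side. They do not correspond to
  each other exactly, so that the statement is needed for both directions.
\<close>

lemma \<phi>_gens:
  "TH.\<phi> ` (H.TW.tm id ` H.em ` carrier H.A \<union> H.demazure ` \<Delta>) \<subseteq>
    generate_ring H'.TW.T (H'.TW.tm id ` H'.em ` carrier H'.A \<union> H'.demazure ` \<Delta>)"
proof -
  let ?G = "generate_ring H'.TW.T (H'.TW.tm id ` H'.em ` carrier H'.A \<union> H'.demazure ` \<Delta>)"
  have tm: "H'.TW.tm id (H'.em a) \<in> ?G" if "a \<in> carrier H'.A" for a
    using that by (intro generate_ring.incl) blast
  have "TH.\<phi> (H.TW.tm id (H.em a)) \<in> ?G" if "a \<in> carrier H.A" for a
    unfolding TH.\<phi>_mon \<tau>_em[OF that] by (rule tm[OF transport_closed[OF that]])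
  moreover have "TH.\<phi> (H.demazure \<alpha>) \<in> ?G" if "\<alpha> \<in> \<Delta>" for \<alpha>
  proof -
    have l: "\<alpha> \<noteq> 0" using H.simple_subset H.root_nonzero that by blast
    obtain u where u: "u \<in> carrier H'.A"
      "\<tau> (inv\<^bsub>H.Q\<^esub> H.em (H.x \<alpha>)) = H'.em u \<otimes>\<^bsub>H'.Q\<^esub> inv\<^bsub>H'.Q\<^esub> H'.em (H'.x \<alpha>)" using \<tau>_inv_x[OF l] by blast
    have "TH.\<phi> (H.demazure \<alpha>) = H'.TW.tm id (H'.em u) \<otimes>\<^bsub>H'.TW.T\<^esub> H'.demazure \<alpha>"
      unfolding H.demazure_def H'.demazure_def TH.\<phi>_dem[OF H.inv_x_P[OF l]] u(2)
        H'.TW.dem_scale[OF H'.em_P[OF u(1)] H'.inv_x_P[OF l]] H'.P_simps(1) ..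
    moreover have "H'.demazure \<alpha> \<in> ?G" using that by (intro generate_ring.incl) blast
    ultimately show ?thesis using tm[OF u(1)] by (simp add: generate_ring.eng_mult)
  qed
  ultimately show ?thesis by blast
qed

lemma \<phi>_const:
  assumes a: "a \<in> carrier K"
  shows "TH.\<phi> (affine_hecke_const K F C j scale \<Phi> coroot a) = affine_hecke_const K F' C' j' scale \<Phi> coroot a"
proof -
  have c: "j (fga_const K F a) \<in> carrier C" by (rule ring_hom_closed[OF H.i_hom a])
  show ?thesis
    unfolding affine_hecke_const_def Let_def H.P_eq H'.P_eq TH.\<phi>_mon \<tau>_em[OF H.const_closed[OF c]]
      transport_const'[OF c] X.\<theta>i[OF a] ..
qed

end

text \<open>
  The restriction of an isomorphism of twisted group rings to subrings which it and its inverse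
  map into each other.
\<close>

lemma hecke_transport_iso:
  assumes 1: "hecke_transport scale \<Phi> coroot \<Delta> K F F' C j C' j' \<theta> h \<tau>"
    and 2: "hecke_transport scale \<Phi> coroot \<Delta> K F' F C' j' C j \<theta>' h' \<tau>'"
    and st: "\<And>a. a \<in> carrier (tfrac (fga C (coeff_fgl K F j))) \<Longrightarrow> \<tau>' (\<tau> a) = a"
    and ts: "\<And>a. a \<in> carrier (tfrac (fga C' (coeff_fgl K F' j'))) \<Longrightarrow> \<tau> (\<tau>' a) = a"
  shows "\<exists>\<phi>\<in>ring_iso (affine_hecke K F C j scale \<Phi> coroot \<Delta>) (affine_hecke K F' C' j' scale \<Phi> coroot \<Delta>).
    \<forall>a\<in>carrier K. \<phi> (affine_hecke_const K F C j scale \<Phi> coroot a) = affine_hecke_const K F' C' j' scale \<Phi> coroot a"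
proof -
  interpret A: hecke_transport scale \<Phi> coroot \<Delta> K F F' C j C' j' \<theta> h \<tau> by (rule 1)
  interpret B: hecke_transport scale \<Phi> coroot \<Delta> K F' F C' j' C j \<theta>' h' \<tau>' by (rule 2)
  have Fd: "(\<lambda>f. \<lambda>w\<in>A.H.W. \<tau> (f w)) = A.TH.\<phi>" and Gd: "(\<lambda>f. \<lambda>w\<in>A.H.W. \<tau>' (f w)) = B.TH.\<phi>"
    by (auto simp: A.TH.\<phi>_def B.TH.\<phi>_def fun_eq_iff)
  have "A.TH.\<phi> \<in> ring_iso (affine_hecke K F C j scale \<Phi> coroot \<Delta>) (affine_hecke K F' C' j' scale \<Phi> coroot \<Delta>)"
    unfolding A.H.affine_hecke_eq A.H'.affine_hecke_eq Fd[symmetric]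
  proof (rule twisted_iso[OF A.TH.twisted_hom_axioms B.TH.twisted_hom_axioms])
    show "\<tau>' (\<tau> a) = a" if "a \<in> carrier A.H.P" for a by (rule st[OF A.H.P_Q[OF that]])
    show "\<tau> (\<tau>' a) = a" if "a \<in> carrier A.H'.P" for a by (rule ts[OF A.H'.P_Q[OF that]])
    show "A.H.TW.tm id ` A.H.em ` carrier A.H.A \<union> A.H.demazure ` \<Delta> \<subseteq> carrier A.H.TW.T"
      using A.H.demazure_closed A.H.TW.mon_closed[OF A.H.em_P] by blast
    show "A.H'.TW.tm id ` A.H'.em ` carrier A.H'.A \<union> A.H'.demazure ` \<Delta> \<subseteq> carrier A.H'.TW.T"
      using A.H'.demazure_closed A.H'.TW.mon_closed[OF A.H'.em_P] by blast
  qed (unfold Fd Gd, rule A.\<phi>_gens, rule B.\<phi>_gens)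
  then show ?thesis using A.\<phi>_const by blast
qed

section \<open>Rationalization\<close>

context cring begin

lemma int_multiple_mult: "([(k::int)] \<cdot> \<one>) \<otimes> ([(l::int)] \<cdot> \<one>) = [(k * l)] \<cdot> \<one>"
proof -
  have "([k] \<cdot> \<one>) \<otimes> ([l] \<cdot> \<one>) = [k] \<cdot> ([l] \<cdot> \<one>)" by (simp add: add_pow_ldistr_int)
  also have "\<dots> = [(k * l)] \<cdot> \<one>" using add.int_pow_pow[of \<one> k l] by (simp add: mult.commute)
  finally show ?thesis .
qed

lemma integer_denoms_fractions: "fractions R (integer_denoms R)"
proof
  show "integer_denoms R \<subseteq> carrier R" by (auto simp: integer_denoms_def)
  show "\<one> \<in> integer_denoms R" unfolding integer_denoms_def
    by (intro CollectI exI[of _ 1]) (simp add: add.int_pow_1)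
  show "s \<otimes> t \<in> integer_denoms R" if st: "s \<in> integer_denoms R" "t \<in> integer_denoms R" for s t
  proof -
    obtain k l where "s = [(k::int)] \<cdot> \<one>" "t = [(l::int)] \<cdot> \<one>" "k \<noteq> 0" "l \<noteq> 0"
      using st unfolding integer_denoms_def by blast
    then have "s \<otimes> t = [(k * l)] \<cdot> \<one>" "k * l \<noteq> 0" by (simp_all add: int_multiple_mult)
    then show ?thesis unfolding integer_denoms_def by blast
  qed
qed

abbreviation "rat_emb \<equiv> loc_emb R (integer_denoms R)"

lemma rationalization_cring: "cring (rationalization R)"
  unfolding rationalization_def by (rule fractions.L_cring[OF integer_denoms_fractions])

lemma rat_emb_hom: "rat_emb \<in> ring_hom R (rationalization R)"
  unfolding rationalization_def by (rule fractions.emb_hom[OF integer_denoms_fractions])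

lemma rat_emb_coeff_hom: "coeff_hom R (rationalization R) rat_emb"
  by (intro coeff_hom.intro coeff_hom_axioms.intro cring_axioms rationalization_cring rat_emb_hom)

lemma rationalization_rational: "cring.rational_algebra (rationalization R)"
proof -
  interpret K: cring "rationalization R" by (rule rationalization_cring)
  interpret E: coeff_hom R "rationalization R" rat_emb by (rule rat_emb_coeff_hom)
  show ?thesis unfolding K.rational_algebra_def
  proof (intro allI impI)
    fix k :: int assume "k \<noteq> 0"
    then have "[k] \<cdot> \<one> \<in> integer_denoms R" by (auto simp: integer_denoms_def)
    then have "rat_emb ([k] \<cdot> \<one>) \<in> Units (rationalization R)"
      unfolding rationalization_def by (rule fractions.emb_unit[OF integer_denoms_fractions])
    then show "[k] \<cdot>\<^bsub>rationalization R\<^esub> \<one>\<^bsub>rationalization R\<^esub> \<in> Units (rationalization R)"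
      by (simp add: E.i_add_pow)
  qed
qed

text \<open>
  If a non-zero integer vanishes in \<open>R\<close>, then zero is a denominator.
\<close>

lemma rationalization_trivial:
  assumes k: "k \<noteq> (0::int)" "[k] \<cdot> \<one> = \<zero>" and a: "a \<in> carrier (rationalization R)"
  shows "a \<in> Units (rationalization R)"
proof -
  interpret K: cring "rationalization R" by (rule rationalization_cring)
  interpret E: coeff_hom R "rationalization R" rat_emb by (rule rat_emb_coeff_hom)
  have "[k] \<cdot>\<^bsub>rationalization R\<^esub> \<one>\<^bsub>rationalization R\<^esub> = \<zero>\<^bsub>rationalization R\<^esub>"
    unfolding E.i_add_pow[symmetric] k(2) by (rule E.i_zero)
  then have u: "\<zero>\<^bsub>rationalization R\<^esub> \<in> Units (rationalization R)"
    using rationalization_rational k(1) unfolding K.rational_algebra_def by metis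
  have "\<zero>\<^bsub>rationalization R\<^esub> = \<one>\<^bsub>rationalization R\<^esub>"
    using K.Units_r_inv[OF u] unfolding K.l_null[OF K.Units_inv_closed[OF u]] .
  then have "a = \<one>\<^bsub>rationalization R\<^esub>" using K.l_one[OF a] K.l_null[OF a] by simp
  then show ?thesis by simp
qed

end

lemma (in fgl) rat_fgl: "fgl (rationalization R) (rat_fgl R F)"
  unfolding rat_fgl_def by (rule coeff_hom.fgl_image[OF rat_emb_coeff_hom]) (rule fgl_axioms)

section \<open>Vanishing of \<open>\<kappa>\<close> under change of coefficients\<close>

lemma (in cring) inverses_sum_zero_iff:
  assumes "X \<in> Units R" "Y \<in> Units R"
  shows "inv X \<oplus> inv Y = \<zero> \<longleftrightarrow> X \<oplus> Y = \<zero>"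
proof -
  have c: "X \<in> carrier R" "Y \<in> carrier R" "inv X \<in> carrier R" "inv Y \<in> carrier R" using assms by auto
  have e: "(X \<otimes> Y) \<otimes> (inv X \<oplus> inv Y) = X \<oplus> Y"
  proof -
    have "(X \<otimes> Y) \<otimes> (inv X \<oplus> inv Y) = (X \<otimes> inv X) \<otimes> Y \<oplus> (Y \<otimes> inv Y) \<otimes> X"
      using c by (simp add: r_distr m_ac del: Units_r_inv)
    then show ?thesis using assms c by (simp add: a_comm)
  qed
  have "X \<otimes> Y \<in> Units R" using assms by simp
  then have "(X \<otimes> Y) \<otimes> (inv X \<oplus> inv Y) = (X \<otimes> Y) \<otimes> \<zero> \<longleftrightarrow> inv X \<oplus> inv Y = \<zero>"
    using c by (intro Units_l_cancel) auto
  then show ?thesis unfolding e using c by simp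
qed

text \<open>
  The right-hand side is preserved by changes of coefficients, unlike total rings of fractions.
\<close>

lemma (in fgl) kappa_zero_iff:
  assumes "fga_x R F \<alpha> \<in> regular_elements (fga R F)" "fga_x R F (- \<alpha>) \<in> regular_elements (fga R F)"
  shows "kappa R F \<alpha> = \<zero>\<^bsub>tfrac (fga R F)\<^esub> \<longleftrightarrow>
    fga_x R F \<alpha> \<oplus>\<^bsub>fga R F\<^esub> fga_x R F (- \<alpha>) = \<zero>\<^bsub>fga R F :: ('l::ab_group_add multiset \<Rightarrow> 'r) set ring\<^esub>"
proof -
  interpret A: cring "fga R F :: ('l multiset \<Rightarrow> 'r) set ring" by (rule fga_cring)
  interpret Q: cring "tfrac (fga R F :: ('l multiset \<Rightarrow> 'r) set ring)" by (rule A.tfrac_cring)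
  let ?em = "tfrac_emb (fga R F :: ('l multiset \<Rightarrow> 'r) set ring)"
  note hom = A.tfrac_emb_hom
  have "kappa R F \<alpha> = \<zero>\<^bsub>tfrac (fga R F)\<^esub> \<longleftrightarrow>
      ?em (fga_x R F \<alpha>) \<oplus>\<^bsub>tfrac (fga R F)\<^esub> ?em (fga_x R F (- \<alpha>)) = \<zero>\<^bsub>tfrac (fga R F)\<^esub>"
    unfolding kappa_def Let_def by (intro Q.inverses_sum_zero_iff A.tfrac_emb_unit assms)
  also have "\<dots> \<longleftrightarrow> ?em (fga_x R F \<alpha> \<oplus>\<^bsub>fga R F\<^esub> fga_x R F (- \<alpha>)) = ?em \<zero>\<^bsub>fga R F\<^esub>"
    unfolding ring_hom_add[OF hom fga_x_closed fga_x_closed] ring_hom_zero[OF hom A.ring_axioms Q.ring_axioms] ..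
  also have "\<dots> \<longleftrightarrow> fga_x R F \<alpha> \<oplus>\<^bsub>fga R F\<^esub> fga_x R F (- \<alpha>) = \<zero>\<^bsub>fga R F\<^esub>"
    using A.tfrac_emb_inj[OF A.a_closed[OF fga_x_closed fga_x_closed] A.zero_closed] by auto
  finally show ?thesis .
qed

lemma (in root_datum) kappa_zero_coeff:
  assumes "fgl R F" "cring C" and i: "i \<in> ring_hom R C"
    and reg: "\<And>k a. k \<noteq> 0 \<Longrightarrow> a \<in> carrier R \<Longrightarrow> [(k::int)] \<cdot>\<^bsub>R\<^esub> \<one>\<^bsub>R\<^esub> \<otimes>\<^bsub>R\<^esub> a = \<zero>\<^bsub>R\<^esub> \<Longrightarrow> a = \<zero>\<^bsub>R\<^esub>"
    and reg': "\<And>k a. k \<noteq> 0 \<Longrightarrow> a \<in> carrier C \<Longrightarrow> [(k::int)] \<cdot>\<^bsub>C\<^esub> \<one>\<^bsub>C\<^esub> \<otimes>\<^bsub>C\<^esub> a = \<zero>\<^bsub>C\<^esub> \<Longrightarrow> a = \<zero>\<^bsub>C\<^esub>"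
    and z: "kappa_zero R F \<Phi>"
  shows "kappa_zero C (\<lambda>a b. i (F a b)) \<Phi>"
  unfolding kappa_zero_def
proof
  fix \<alpha> assume \<alpha>: "\<alpha> \<in> \<Phi>"
  let ?G = "\<lambda>a b. i (F a b)"
  interpret M: fga_hom R C i F ?G "pser_var C :: 'l \<Rightarrow> _" by (rule fga_hom_coeff[OF assms(2,1) i])
  interpret A: cring "fga R F :: ('l multiset \<Rightarrow> _) set ring" by (rule M.A.fga_cring)
  interpret B: cring "fga C ?G :: ('l multiset \<Rightarrow> _) set ring" by (rule M.B.fga_cring)
  have nz: "\<alpha> \<noteq> 0" "- \<alpha> \<noteq> 0" using root_nonzero[OF \<alpha>] by auto
  have r: "fga_x R F l \<in> regular_elements (fga R F)" if "l \<noteq> 0" for l :: 'l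
    by (rule fga_x_regular_of_nonzero[OF assms(1) _ that]) (rule reg)
  have r': "fga_x C ?G l \<in> regular_elements (fga C ?G)" if "l \<noteq> 0" for l :: 'l
    by (rule fga_x_regular_of_nonzero[OF M.B.fgl_axioms _ that]) (rule reg')
  have "kappa R F \<alpha> = \<zero>\<^bsub>tfrac (fga R F)\<^esub>" using z \<alpha> by (simp add: kappa_zero_def)
  then have "fga_x R F \<alpha> \<oplus>\<^bsub>fga R F\<^esub> fga_x R F (- \<alpha>) = \<zero>\<^bsub>fga R F\<^esub>"
    by (rule M.A.kappa_zero_iff[OF r[OF nz(1)] r[OF nz(2)], THEN iffD1])
  from arg_cong[OF this, of M.\<Psi>] have "fga_x C ?G \<alpha> \<oplus>\<^bsub>fga C ?G\<^esub> fga_x C ?G (- \<alpha>) = \<zero>\<^bsub>fga C ?G\<^esub>"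
    unfolding ring_hom_add[OF M.map_hom M.A.fga_x_closed M.A.fga_x_closed]
      ring_hom_zero[OF M.map_hom A.ring_axioms B.ring_axioms] M.map_x by (simp only: fga_x_def)
  then show "kappa C ?G \<alpha> = \<zero>\<^bsub>tfrac (fga C ?G)\<^esub>"
    by (rule M.B.kappa_zero_iff[OF r'[OF nz(1)] r'[OF nz(2)], THEN iffD2])
qed

section \<open>Adjoining the inverse of \<open>x\<^sub>\<gamma>\<close>\<close>

abbreviation "gamma_loc K F \<equiv> localization (gamma_ring K F) (gamma_powers K F)"
abbreviation "gamma_emb K F \<equiv> loc_emb (gamma_ring K F) (gamma_powers K F)"

lemma (in fgl) gamma_fractions: "fractions (gamma_ring R F) (gamma_powers R F)"
proof -
  interpret A: cring "gamma_ring R F" by (rule fga_cring)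
  have x: "fga_x R F 1 \<in> carrier (gamma_ring R F)" by (rule fga_x_closed)
  show ?thesis
  proof
    show "gamma_powers R F \<subseteq> carrier (gamma_ring R F)" using x by (auto simp: gamma_powers_def)
    show "\<one>\<^bsub>gamma_ring R F\<^esub> \<in> gamma_powers R F"
      unfolding gamma_powers_def by (intro CollectI exI[of _ 0]) simp
    show "s \<otimes>\<^bsub>gamma_ring R F\<^esub> t \<in> gamma_powers R F" if "s \<in> gamma_powers R F" "t \<in> gamma_powers R F" for s t
      using that A.nat_pow_mult[OF x] unfolding gamma_powers_def by fastforce
  qed
qed

lemma (in fgl) gamma_unit: "gamma_emb R F (fga_x R F 1) \<in> Units (gamma_loc R F)"
proof (rule fractions.emb_unit[OF gamma_fractions])
  interpret A: cring "gamma_ring R F" by (rule fga_cring)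
  show "fga_x R F 1 \<in> gamma_powers R F"
    unfolding gamma_powers_def using fga_x_closed[of "1::int"] by (intro CollectI exI[of _ "1::nat"]) simp
qed

text \<open>
  The transport for the lattice \<open>\<Gamma>\<close> takes \<open>x\<^sub>\<gamma>\<close> to
  \<open>x\<^sub>\<gamma>\<close> times a unit, and hence extends to the rings with
  \<open>x\<^sub>\<gamma>\<^sup>-\<^sup>1\<close> adjoined.
\<close>

lemma gamma_transport_exists:
  assumes K: "fgl K F" "fgl K F'" and h: "cring.fgl_hom K F' F h"
  shows "\<exists>\<theta>\<in>ring_hom (gamma_loc K F) (gamma_loc K F'). \<forall>X\<in>carrier (gamma_ring K F).
    \<theta> (gamma_emb K F X) = gamma_emb K F' (fgl_transport.transport K F' K K (\<lambda>a. a) (\<lambda>a. a) h X)"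
proof -
  interpret A: fgl K F by (rule K)
  interpret A': fgl K F' by (rule K)
  interpret X: fgl_transport K F F' K K "\<lambda>a. a" "\<lambda>a. a" "\<lambda>a. a" h
    by unfold_locales (auto intro: h id_ring_hom)
  interpret L: fractions "gamma_ring K F" "gamma_powers K F" by (rule A.gamma_fractions)
  interpret L': fractions "gamma_ring K F'" "gamma_powers K F'" by (rule A'.gamma_fractions)
  interpret C': cring "gamma_loc K F'" by (rule L'.L_cring)
  let ?f = "\<lambda>X. gamma_emb K F' (X.transport X)"
  have t: "X.transport \<in> ring_hom (gamma_ring K F) (gamma_ring K F')" by (rule X.transport_hom)
  have f: "?f \<in> ring_hom (gamma_ring K F) (gamma_loc K F')"
    using ring_hom_trans[OF t L'.emb_hom] by (simp add: comp_def)
  have x: "?f (fga_x K F 1) \<in> Units (gamma_loc K F')"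
  proof -
    obtain u where u: "u \<in> Units (gamma_ring K F')" "X.transport (fga_x K F 1) = fga_x K F' 1 \<otimes>\<^bsub>gamma_ring K F'\<^esub> u"
      using X.transport_x[of "1::int"] by blast
    have uc: "u \<in> carrier (gamma_ring K F')" using u(1) by (rule L'.Units_closed)
    show ?thesis unfolding u(2) ring_hom_mult[OF L'.emb_hom A'.fga_x_closed uc]
      by (intro C'.Units_m_closed A'.gamma_unit ring_hom_Units[OF L'.emb_hom u(1)])
  qed
  have units: "?f s \<in> Units (gamma_loc K F')" if sS: "s \<in> gamma_powers K F" for s
  proof -
    obtain n :: nat where s: "s = fga_x K F 1 [^]\<^bsub>gamma_ring K F\<^esub> n" using sS unfolding gamma_powers_def by blast
    have "?f (fga_x K F 1 [^]\<^bsub>gamma_ring K F\<^esub> n) \<in> Units (gamma_loc K F')"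
    proof (induction n)
      case 0
      show ?case unfolding L.nat_pow_0 ring_hom_one[OF f] by simp
    next
      case (Suc n)
      have c: "fga_x K F 1 [^]\<^bsub>gamma_ring K F\<^esub> n \<in> carrier (gamma_ring K F)" by (rule L.nat_pow_closed[OF A.fga_x_closed])
      show ?case
        unfolding L.nat_pow_Suc ring_hom_mult[OF f c A.fga_x_closed] by (rule C'.Units_m_closed[OF Suc x])
    qed
    then show ?thesis unfolding s .
  qed
  show ?thesis
    using L.ext_hom[OF C'.cring_axioms f units] L.ext_emb[OF C'.cring_axioms f units] by blast
qed

section \<open>The comparison of the two Hecke algebras\<close>

text \<open>
  The homomorphism \<open>h\<close> is used twice, for the coefficient rings over
  \<open>\<Gamma>\<close> and then, along the resulting \<open>\<theta>\<close>, for the formal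
  group algebras of \<open>\<Lambda>\<close>.
\<close>

theorem hecke_localized_iso:
  assumes H: "hecke scale \<Phi> coroot \<Delta> K F (gamma_loc K F) (gamma_emb K F)"
    and H': "hecke scale \<Phi> coroot \<Delta> K F' (gamma_loc K F') (gamma_emb K F')"
  shows "\<exists>\<phi>\<in>ring_iso (affine_hecke K F (gamma_loc K F) (gamma_emb K F) scale \<Phi> coroot \<Delta>)
      (affine_hecke K F' (gamma_loc K F') (gamma_emb K F') scale \<Phi> coroot \<Delta>).
    \<forall>a\<in>carrier K. \<phi> (affine_hecke_const K F (gamma_loc K F) (gamma_emb K F) scale \<Phi> coroot a) =
      affine_hecke_const K F' (gamma_loc K F') (gamma_emb K F') scale \<Phi> coroot a"
proof -
  interpret H: hecke scale \<Phi> coroot \<Delta> K F "gamma_loc K F" "gamma_emb K F" by (rule H)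
  interpret H': hecke scale \<Phi> coroot \<Delta> K F' "gamma_loc K F'" "gamma_emb K F'" by (rule H')
  let ?C = "gamma_loc K F" and ?C' = "gamma_loc K F'" and ?j = "gamma_emb K F" and ?j' = "gamma_emb K F'"
  note K = H.K.fgl_axioms and K' = H'.K.fgl_axioms
  obtain h h' where h: "H.K.fgl_hom F' F h" "H.K.fgl_hom F F' h'"
    "H.K.psub1 (\<lambda>_. h) h' = pser_var K ()" "H.K.psub1 (\<lambda>_. h') h = pser_var K ()"
    using H.K.fgl_iso_exists[OF K K' H.rational] by blast
  interpret g: fgl_transport K F F' K K "\<lambda>a. a" "\<lambda>a. a" "\<lambda>a. a" h
    by unfold_locales (auto intro: h id_ring_hom)
  interpret g': fgl_transport K F' F K K "\<lambda>a. a" "\<lambda>a. a" "\<lambda>a. a" h'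
    by unfold_locales (auto intro: h id_ring_hom)
  have gg: "g'.transport (g.transport X) = X" if "X \<in> carrier (gamma_ring K F)" for X
    by (rule g.transport_inverse[OF g'.fgl_transport_axioms refl h(4) that])
  have gg': "g.transport (g'.transport X) = X" if "X \<in> carrier (gamma_ring K F')" for X
    by (rule g'.transport_inverse[OF g.fgl_transport_axioms refl h(3) that])
  obtain \<theta> where \<theta>: "\<theta> \<in> ring_hom ?C ?C'"
    "\<And>X. X \<in> carrier (gamma_ring K F) \<Longrightarrow> \<theta> (?j X) = ?j' (g.transport X)"
    using gamma_transport_exists[OF K K' h(1)] by blast
  obtain \<theta>' where \<theta>': "\<theta>' \<in> ring_hom ?C' ?C"
    "\<And>X. X \<in> carrier (gamma_ring K F') \<Longrightarrow> \<theta>' (?j' X) = ?j (g'.transport X)"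
    using gamma_transport_exists[OF K' K h(2)] by blast
  note tc = ring_hom_closed[OF g.transport_hom] and tc' = ring_hom_closed[OF g'.transport_hom]
  have \<theta>\<theta>: "\<theta>' (\<theta> c) = c" if "c \<in> carrier ?C" for c
    using fractions.hom_unique[OF H.K.gamma_fractions H.C.cring_axioms
        ring_hom_trans[OF \<theta>(1) \<theta>'(1), unfolded comp_def] id_ring_hom _ that]
    by (simp add: \<theta>(2) \<theta>'(2) tc gg)
  have \<theta>\<theta>': "\<theta> (\<theta>' c) = c" if "c \<in> carrier ?C'" for c
    using fractions.hom_unique[OF H'.K.gamma_fractions H'.C.cring_axioms
        ring_hom_trans[OF \<theta>'(1) \<theta>(1), unfolded comp_def] id_ring_hom _ that]
    by (simp add: \<theta>(2) \<theta>'(2) tc' gg')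
  interpret X: fgl_transport K F F' ?C ?C' "\<lambda>a. ?j (fga_const K F a)" "\<lambda>a. ?j' (fga_const K F' a)" \<theta> h
  proof
    show "\<theta> (?j (fga_const K F a)) = ?j' (fga_const K F' a)" if "a \<in> carrier K" for a
      unfolding \<theta>(2)[OF H.K.fga_const_closed[OF that]] g.transport_const[OF that] ..
  qed (rule h H.i_hom H'.i_hom \<theta>)+
  interpret X': fgl_transport K F' F ?C' ?C "\<lambda>a. ?j' (fga_const K F' a)" "\<lambda>a. ?j (fga_const K F a)" \<theta>' h'
  proof
    show "\<theta>' (?j' (fga_const K F' a)) = ?j (fga_const K F a)" if "a \<in> carrier K" for a
      unfolding \<theta>'(2)[OF H'.K.fga_const_closed[OF that]] g'.transport_const[OF that] ..
  qed (rule h H.i_hom H'.i_hom \<theta>')+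
  note ce = coeff_fgl_def[of K F ?j, symmetric] coeff_fgl_def[of K F' ?j', symmetric]
  have t: "X.transport \<in> ring_hom H.A H'.A" by (rule X.transport_hom[unfolded ce])
  have t': "X'.transport \<in> ring_hom H'.A H.A" by (rule X'.transport_hom[unfolded ce])
  have tt: "X'.transport (X.transport a) = a" if "a \<in> carrier H.A" for a
    using X.transport_inverse[OF X'.fgl_transport_axioms \<theta>\<theta> h(4), unfolded ce, OF _ that] by simp
  have tt': "X.transport (X'.transport a) = a" if "a \<in> carrier H'.A" for a
    using X'.transport_inverse[OF X.fgl_transport_axioms \<theta>\<theta>' h(3), unfolded ce, OF _ that] by simp
  obtain \<tau> where \<tau>: "\<tau> \<in> ring_hom H.Q H'.Q" "\<And>a. a \<in> carrier H.A \<Longrightarrow> \<tau> (H.em a) = H'.em (X.transport a)"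
    using tfrac_iso_extend[OF H.A.cring_axioms H'.A.cring_axioms t t' tt tt'] by blast
  obtain \<tau>' where \<tau>': "\<tau>' \<in> ring_hom H'.Q H.Q" "\<And>a. a \<in> carrier H'.A \<Longrightarrow> \<tau>' (H'.em a) = H.em (X'.transport a)"
    using tfrac_iso_extend[OF H'.A.cring_axioms H.A.cring_axioms t' t tt' tt] by blast
  have st: "\<tau>' (\<tau> a) = a" if "a \<in> carrier H.Q" for a
    using H.A.tfrac_hom_unique[OF H.Q.cring_axioms ring_hom_trans[OF \<tau>(1) \<tau>'(1), unfolded comp_def] id_ring_hom _ that]
    by (simp add: \<tau>(2) \<tau>'(2) ring_hom_closed[OF t] tt)
  have ts: "\<tau> (\<tau>' a) = a" if "a \<in> carrier H'.Q" for a
    using H'.A.tfrac_hom_unique[OF H'.Q.cring_axioms ring_hom_trans[OF \<tau>'(1) \<tau>(1), unfolded comp_def] id_ring_hom _ that]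
    by (simp add: \<tau>(2) \<tau>'(2) ring_hom_closed[OF t'] tt')
  show ?thesis
  proof (rule hecke_transport_iso[OF _ _ st ts])
    show "hecke_transport scale \<Phi> coroot \<Delta> K F F' ?C ?j ?C' ?j' \<theta> h \<tau>"
      by (intro hecke_transport.intro H H' X.fgl_transport_axioms hecke_transport_axioms.intro \<tau> inj_on_inverseI[of _ \<tau>'] st)
    show "hecke_transport scale \<Phi> coroot \<Delta> K F' F ?C' ?j' ?C ?j \<theta>' h' \<tau>'"
      by (intro hecke_transport.intro H H' X'.fgl_transport_axioms hecke_transport_axioms.intro \<tau>' inj_on_inverseI[of _ \<tau>] ts)
  qed
qed

text \<open>
  If \<open>F 1 1\<close> is not a unit of \<open>R\<close>, then \<open>\<kappa> = 0\<close> over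
  \<open>R\<close>. In characteristic zero this persists over the extended coefficients, because
  non-zero integers are regular in the domain \<open>R\<close> and units in
  \<open>R'\<^sub>F\<close>. In positive characteristic \<open>R \<otimes> \<rat>\<close> is the
  zero ring, where \<open>F 1 1\<close> is a unit.
\<close>

lemma extended_hecke:
  assumes "domain R" and "based_root_datum scale \<Phi> coroot \<Delta>" and "formal_group_law R F"
    and cases: "kappa_zero R F \<Phi> \<or> F 1 1 \<in> Units R"
  shows "hecke scale \<Phi> coroot \<Delta> (rationalization R) (rat_fgl R F) (R_prime R F) (R_prime_map R F)"
proof -
  interpret D: based_root_datum scale \<Phi> coroot \<Delta> by fact
  interpret R: domain R by fact
  interpret A: fgl R F by unfold_locales fact
  let ?K = "rationalization R" and ?F = "rat_fgl R F"
  interpret K: fgl ?K ?F by (rule A.rat_fgl)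
  let ?C = "gamma_loc ?K ?F" and ?j = "gamma_emb ?K ?F"
  interpret L: fractions "gamma_ring ?K ?F" "gamma_powers ?K ?F" by (rule K.gamma_fractions)
  interpret C: cring ?C by (rule L.L_cring)
  have i: "(\<lambda>a. ?j (fga_const ?K ?F a)) \<in> ring_hom ?K ?C"
    using ring_hom_trans[OF K.fga_const_hom L.emb_hom] by (simp add: comp_def)
  interpret I: coeff_hom ?K ?C "\<lambda>a. ?j (fga_const ?K ?F a)" by unfold_locales (rule i)
  note Q = R.rationalization_rational
  have CQ: "C.rational_algebra" by (rule I.rational_algebra_image[OF Q])
  have "kappa_zero ?C (coeff_fgl ?K ?F ?j) \<Phi> \<or> ?F 1 1 \<in> Units ?K"
  proof (cases "F 1 1 \<in> Units R")
    case True
    then show ?thesis using ring_hom_Units[OF R.rat_emb_hom] by (simp add: rat_fgl_def)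
  next
    case False
    then have z: "kappa_zero R F \<Phi>" using cases by blast
    show ?thesis
    proof (cases "\<exists>k::int. k \<noteq> 0 \<and> [k] \<cdot>\<^bsub>R\<^esub> \<one>\<^bsub>R\<^esub> = \<zero>\<^bsub>R\<^esub>")
      case True
      then show ?thesis using R.rationalization_trivial K.F_closed by blast
    next
      case char0: False
      have "kappa_zero ?C (\<lambda>a b. ?j (fga_const ?K ?F (loc_emb R (integer_denoms R) (F a b)))) \<Phi>"
      proof (rule D.kappa_zero_coeff[OF A.fgl_axioms C.cring_axioms _ _ _ z])
        show "(\<lambda>a. ?j (fga_const ?K ?F (loc_emb R (integer_denoms R) a))) \<in> ring_hom R ?C"
          using ring_hom_trans[OF R.rat_emb_hom i] by (simp add: comp_def)
        show "a = \<zero>\<^bsub>R\<^esub>" if "k \<noteq> 0" "a \<in> carrier R" "[k] \<cdot>\<^bsub>R\<^esub> \<one>\<^bsub>R\<^esub> \<otimes>\<^bsub>R\<^esub> a = \<zero>\<^bsub>R\<^esub>" for k :: int and a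
          using char0 that R.integral[OF that(3)] R.add.int_pow_closed[OF R.one_closed] by blast
        show "a = \<zero>\<^bsub>?C\<^esub>" if "k \<noteq> 0" "a \<in> carrier ?C" "[k] \<cdot>\<^bsub>?C\<^esub> \<one>\<^bsub>?C\<^esub> \<otimes>\<^bsub>?C\<^esub> a = \<zero>\<^bsub>?C\<^esub>" for k :: int and a
        proof -
          have u: "[k] \<cdot>\<^bsub>?C\<^esub> \<one>\<^bsub>?C\<^esub> \<in> Units ?C" using CQ that(1) by (simp add: C.rational_algebra_def)
          show ?thesis using C.Units_l_cancel[OF u that(2), of "\<zero>\<^bsub>?C\<^esub>"] u that by (simp add: C.Units_closed)
        qed
      qed
      then show ?thesis by (simp add: coeff_fgl_def rat_fgl_def)
    qed
  qed
  then have "hecke scale \<Phi> coroot \<Delta> ?K ?F ?C ?j"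
    by (intro hecke.intro hecke_axioms.intro D.based_root_datum_axioms K.fgl_axioms C.cring_axioms L.emb_hom Q K.gamma_unit)
  then show ?thesis by (simp add: R_prime_def R_prime_map_def Let_def)
qed

theorem theorem9p7:
  fixes R :: "('r, 'm) ring_scheme"
    and F F' :: "nat \<Rightarrow> nat \<Rightarrow> 'r"
    and scale :: "int \<Rightarrow> 'l::ab_group_add \<Rightarrow> 'l"
    and \<Phi> :: "'l set"
    and coroot :: "'l \<Rightarrow> 'l \<Rightarrow> int"
    and \<Delta> :: "'l set"
  assumes "domain R"
    and "based_root_datum scale \<Phi> coroot \<Delta>"
    and "formal_group_law R F"
    and "formal_group_law R F'"
    and "kappa_zero R F \<Phi> \<or> F 1 1 \<in> Units R"
    and "kappa_zero R F' \<Phi> \<or> F' 1 1 \<in> Units R"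
  shows "\<exists>\<phi> \<in> ring_iso (extended_affine_hecke R F scale \<Phi> coroot \<Delta>)
                       (extended_affine_hecke R F' scale \<Phi> coroot \<Delta>).
    \<forall>a \<in> carrier (rationalization R).
      \<phi> (extended_affine_hecke_const R F scale \<Phi> coroot a) =
      extended_affine_hecke_const R F' scale \<Phi> coroot a"
proof -
  note H = extended_hecke[OF assms(1,2,3,5), unfolded R_prime_def R_prime_map_def Let_def]
  note H' = extended_hecke[OF assms(1,2,4,6), unfolded R_prime_def R_prime_map_def Let_def]
  show ?thesis
    using hecke_localized_iso[OF H H']
    unfolding extended_affine_hecke_def extended_affine_hecke_const_def R_prime_def R_prime_map_def Let_def .
qed

end
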